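(* For every $\beta>-2$, there is a random variable $W_\beta(\infty)$ such that $$W_\beta(t)\longrightarrow W_\beta(\infty)\quad\text{as }t\to\infty,\ \text{almost surely and in }L^1,$$ where $W_\beta(\infty)>0$ almost surely and $\mathsf E W_\beta(\infty)=1$. Moreover, as $n\to\infty$, $$\frac{D_n^*}{\log n}\longrightarrow\frac2{r_\beta}\qquad\text{in probability},$$ and, for every $x\in\mathbb R$, $$\mathsf P\bigl(r_\beta D_n^*-2\log n\le x\bigr)\longrightarrow\mathsf E\Bigl[\exp\Bigl(-\tfrac12e^{-x}W_\beta(\infty)\Bigr)\Bigr].$$
   Context: For $\beta>-2$ put $\phi_\beta(z)=\int_0^1(1-s^z)s^{\beta+1}(1-s)^\beta\,ds$ and $r_\beta=\phi_\beta(1)=B(\beta+2,\beta+2)$, where $B$ is the beta function. Let $\Pi=(\Pi(t))_{t\ge0}$ be the homogeneous exchangeable fragmentation of $\mathbb N$ (càdlàg Markov process on partitions of $\mathbb N$, exchangeable, started from the one-block partition, different blocks evolving independently with the same law) without erosion, conservative and binary, with dislocation measure $\nu_\beta(dx)=x^\beta(1-x)^\beta\,dx$ on $[1/2,1)$, where $x$ is the larger relative mass: at a dislocation $(x,1-x)$ the labels of a block are assigned independently to the two daughters with probabilities $x$ and $1-x$. Its restriction $\Pi_n$ to $[n]=\{1,\dots,n\}$ is the continuous-time beta-splitting tree on $n$ leaves: different blocks evolve independently, and a block with $m\ge2$ labels splits into ordered daughter blocks of sizes $i$ and $m-i$ at rate $\frac12\binom mi B(i+\beta+1,m-i+\beta+1)$,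 $1\le i\le m-1$ (total rate $\phi_\beta(m-1)$), with the labels of the first block uniform given its size. $D_{n,i}$ is the continuous-time height of leaf $i$, i.e. the first time at which $\{i\}$ is a block of $\Pi_n$, and $D_n^*=\max_{1\le i\le n}D_{n,i}$. $(P_i(t))_{i\ge1}$ are the ranked asymptotic frequencies of the blocks of $\Pi(t)$, and $$W_\beta(t)=e^{r_\beta t}\sum_{i\ge1}P_i(t)^2.$$ *)

theory Defs
  imports "HOL-Probability.Probability"
begin

section \<open>Partitions of the positive integers\<close>

abbreviation positive_nats :: "nat set"
  where "positive_nats \<equiv> {1..}"

definition restrict_partition :: "nat set set \<Rightarrow> nat set \<Rightarrow> nat set set"
  where "restrict_partition P S = (\<lambda>B. B \<inter> S) ` P - {{}}"

text \<open>The sigma-algebra generated by the restrictions to the sets \<open>{1..n}\<close>; it is the Borel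
  sigma-algebra of the usual metric on partitions.\<close>

definition partition_algebra :: "nat set set measure"
  where "partition_algebra =
    sigma {P. partition_on positive_nats P}
      {{P. partition_on positive_nats P \<and> restrict_partition P {1..n} = \<eta>} | n \<eta>. True}"

definition permute_partition :: "(nat \<Rightarrow> nat) \<Rightarrow> nat set set \<Rightarrow> nat set set"
  where "permute_partition \<sigma> P = (\<lambda>B. \<sigma> ` B) ` P"

definition asymptotic_frequency :: "nat set \<Rightarrow> real"
  where "asymptotic_frequency B = lim (\<lambda>n. real (card (B \<inter> {1..n})) / real n)"

text \<open>For \<open>i \<ge> 1\<close>, the \<open>i\<close>-th largest block frequency, counted with multiplicity; it is 0 if there
  are fewer than \<open>i\<close> blocks.\<close>

definition ranked_frequency :: "nat set set \<Rightarrow> nat \<Rightarrow> real"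
  where "ranked_frequency P i =
    Sup (insert 0 {x. \<exists>F \<subseteq> P. card F = i \<and> (\<forall>B\<in>F. x \<le> asymptotic_frequency B)})"


section \<open>Homogeneous fragmentations\<close>

definition natural_filtration :: "'a measure \<Rightarrow> (real \<Rightarrow> 'a \<Rightarrow> nat set set) \<Rightarrow> real \<Rightarrow> 'a measure"
  where "natural_filtration M X s =
    sigma (space M) {X u -` E \<inter> space M | u E. 0 \<le> u \<and> u \<le> s \<and> E \<in> sets partition_algebra}"

text \<open>In \<open>branching\<close>, the labels in \<open>{1..n}\<close> are split at time \<open>s\<close> into the blocks of \<open>\<eta>\<close>.
  Conditionally on the past, these evolve independently, and each \<open>B \<in> \<eta>\<close> is fragmented during the
  next \<open>t\<close> units of time as the one-block partition is, restricted to the labels of \<open>B\<close>. This is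
  the Markov property together with the independence and homogeneity of the blocks.\<close>

locale homogeneous_fragmentation = prob_space M
  for M :: "'a measure" and X :: "real \<Rightarrow> 'a \<Rightarrow> nat set set" +
  assumes random_partition:
      "\<And>t. 0 \<le> t \<Longrightarrow> X t \<in> M \<rightarrow>\<^sub>M partition_algebra"
    and one_block_start:
      "AE \<omega> in M. X 0 \<omega> = {positive_nats}"
    and right_continuous:
      "\<And>\<omega> t n. \<omega> \<in> space M \<Longrightarrow> 0 \<le> t \<Longrightarrow>
        \<forall>\<^sub>F u in at_right t. restrict_partition (X u \<omega>) {1..n} = restrict_partition (X t \<omega>) {1..n}"
    and left_limits:
      "\<And>\<omega> t. \<omega> \<in> space M \<Longrightarrow> 0 < t \<Longrightarrow>
        \<exists>P. partition_on positive_nats P \<and>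
          (\<forall>n. \<forall>\<^sub>F u in at_left t. restrict_partition (X u \<omega>) {1..n} = restrict_partition P {1..n})"
    and exchangeable:
      "\<And>\<sigma> n. \<sigma> permutes {1..n} \<Longrightarrow>
        distr M (PiM {0..} (\<lambda>_. partition_algebra)) (\<lambda>\<omega>. \<lambda>t\<in>{0..}. permute_partition \<sigma> (X t \<omega>)) =
        distr M (PiM {0..} (\<lambda>_. partition_algebra)) (\<lambda>\<omega>. \<lambda>t\<in>{0..}. X t \<omega>)"
    and branching:
      "\<And>s t n A \<eta> \<pi>. 0 \<le> s \<Longrightarrow> 0 \<le> t \<Longrightarrow> A \<in> sets (natural_filtration M X s) \<Longrightarrow>
        partition_on {1..n} \<eta> \<Longrightarrow> partition_on {1..n} \<pi> \<Longrightarrow>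
        prob {\<omega> \<in> A. restrict_partition (X s \<omega>) {1..n} = \<eta> \<and>
                     restrict_partition (X (s + t) \<omega>) {1..n} = \<pi>} =
        prob {\<omega> \<in> A. restrict_partition (X s \<omega>) {1..n} = \<eta>} *
        (if refines {1..n} \<pi> \<eta>
         then \<Prod>B\<in>\<eta>. prob {\<omega> \<in> space M.
                restrict_partition (X t \<omega>) B = restrict_partition \<pi> B}
         else 0)"


section \<open>Binary dislocations\<close>

text \<open>The labels in the finite set \<open>S\<close> are assigned independently to two daughters, with
  probabilities \<open>x\<close> and \<open>1 - x\<close>.\<close>

definition binary_paintbox :: "real \<Rightarrow> nat set \<Rightarrow> nat set set pmf"
  where "binary_paintbox x S =
    map_pmf (\<lambda>f. {{i\<in>S. f i}, {i\<in>S. \<not> f i}} - {{}}) (Pi_pmf S False (\<lambda>_. bernoulli_pmf x))"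

definition dislocation_rate :: "real measure \<Rightarrow> nat set \<Rightarrow> nat set set \<Rightarrow> real"
  where "dislocation_rate \<nu> S \<eta> = (\<integral>x. pmf (binary_paintbox x S) \<eta> \<partial>\<nu>)"

text \<open>A conservative binary fragmentation without erosion: the restriction to \<open>{1..n}\<close> leaves the
  one-block partition for \<open>\<eta>\<close> at the rate at which the dislocation measure \<open>\<nu>\<close> produces \<open>\<eta>\<close>.
  The rates of the other blocks follow from \<open>branching\<close> and \<open>exchangeable\<close>.\<close>

locale binary_fragmentation = homogeneous_fragmentation M X
  for M :: "'a measure" and X :: "real \<Rightarrow> 'a \<Rightarrow> nat set set" +
  fixes \<nu> :: "real measure"
  assumes jump_rates:
      "\<And>n \<eta>. 2 \<le> n \<Longrightarrow> partition_on {1..n} \<eta> \<Longrightarrow> \<eta> \<noteq> {{1..n}} \<Longrightarrow>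
        ((\<lambda>t. prob {\<omega> \<in> space M. restrict_partition (X t \<omega>) {1..n} = \<eta>} / t)
          \<longlongrightarrow> dislocation_rate \<nu> {1..n} \<eta>) (at_right 0)"

definition beta_dislocation :: "real \<Rightarrow> real measure"
  where "beta_dislocation \<beta> =
    density lborel (\<lambda>x. ennreal (indicator {1/2..<1} x * (x powr \<beta> * (1 - x) powr \<beta>)))"

definition phi_beta :: "real \<Rightarrow> real \<Rightarrow> real"
  where "phi_beta \<beta> z = integral {0..1} (\<lambda>s. (1 - s powr z) * s powr (\<beta> + 1) * (1 - s) powr \<beta>)"

definition r_beta :: "real \<Rightarrow> real"
  where "r_beta \<beta> = phi_beta \<beta> 1"

definition W_beta :: "real \<Rightarrow> (real \<Rightarrow> 'a \<Rightarrow> nat set set) \<Rightarrow> real \<Rightarrow> 'a \<Rightarrow> real"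
  where "W_beta \<beta> X t \<omega> = exp (r_beta \<beta> * t) * (\<Sum>i. (ranked_frequency (X t \<omega>) (Suc i))\<^sup>2)"

text \<open>The set of times is almost surely nonempty, and then its infimum is attained by
  right-continuity.\<close>

definition leaf_height :: "(real \<Rightarrow> 'a \<Rightarrow> nat set set) \<Rightarrow> nat \<Rightarrow> nat \<Rightarrow> 'a \<Rightarrow> real"
  where "leaf_height X n i \<omega> = Inf {t. 0 \<le> t \<and> {i} \<in> restrict_partition (X t \<omega>) {1..n}}"

definition max_height :: "(real \<Rightarrow> 'a \<Rightarrow> nat set set) \<Rightarrow> nat \<Rightarrow> 'a \<Rightarrow> real"
  where "max_height X n \<omega> = Max ((\<lambda>i. leaf_height X n i \<omega>) ` {1..n})"


section \<open>Explicit rates\<close>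

lemma r_beta_eq_Beta:
  assumes "\<beta> > -2"
  shows "r_beta \<beta> = Beta (\<beta> + 2) (\<beta> + 2)"
proof -
  have "((\<lambda>s. s powr (\<beta> + 2 - 1) * (1 - s) powr (\<beta> + 2 - 1)) has_integral
      Beta (\<beta> + 2) (\<beta> + 2)) {0..1}"
    using assms by (intro has_integral_Beta_real) auto
  moreover have eq: "s powr (\<beta> + 2 - 1) * (1 - s) powr (\<beta> + 2 - 1) =
      (1 - s powr 1) * s powr (\<beta> + 1) * (1 - s) powr \<beta>" if "s \<in> {0..1}" for s :: real
  proof -
    have "(1 - s) powr (\<beta> + 1) = (1 - s) powr \<beta> * (1 - s)"
      using that by (cases "s = 1") (auto simp: powr_add)
    then show ?thesis
      using that by (simp add: mult.commute mult.left_commute add.commute)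
  qed
  ultimately have "((\<lambda>s. (1 - s powr 1) * s powr (\<beta> + 1) * (1 - s) powr \<beta>) has_integral
      Beta (\<beta> + 2) (\<beta> + 2)) {0..1}"
    by (rule has_integral_eq[rotated])
  then show ?thesis
    unfolding r_beta_def phi_beta_def by (rule integral_unique)
qed

lemma pmf_binary_paintbox:
  assumes fin: "finite A" "finite B" and ne: "A \<noteq> {}" "B \<noteq> {}" and disj: "A \<inter> B = {}"
    and x: "0 \<le> x" "x \<le> 1"
  shows "pmf (binary_paintbox x (A \<union> B)) {A, B} =
    x ^ card A * (1 - x) ^ card B + x ^ card B * (1 - x) ^ card A"
proof -
  let ?S = "A \<union> B" and ?a = "\<lambda>i. i \<in> A" and ?b = "\<lambda>i. i \<in> B"
  let ?p = "Pi_pmf ?S False (\<lambda>_. bernoulli_pmf x)"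
  let ?g = "\<lambda>f. {{i\<in>?S. f i}, {i\<in>?S. \<not> f i}} - {{}}"
  have eq: "f = ?a \<or> f = ?b" if f: "f \<in> set_pmf ?p" and g: "?g f = {A, B}" for f
  proof -
    have off: "\<not> f i" if "i \<notin> ?S" for i
      using set_Pi_pmf_subset[of ?S False "\<lambda>_. bernoulli_pmf x"] f fin that by auto
    have "A \<in> ?g f" unfolding g by simp
    then have "A = {i\<in>?S. f i} \<or> A = {i\<in>?S. \<not> f i}"
      by blast
    then show ?thesis
    proof
      assume "A = {i\<in>?S. f i}"
      then have "f = ?a" using off by (intro ext) blast
      then show ?thesis ..
    next
      assume "A = {i\<in>?S. \<not> f i}"
      then have "f = ?b" using off disj by (intro ext) blast
      then show ?thesis ..
    qed
  qed
  have out: "i \<notin> B" if "i \<in> A" for i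
    using disj that by blast
  have out': "i \<notin> A" if "i \<in> B" for i
    using disj that by blast
  have ga: "?g ?a = {A, B}"
  proof -
    have "{i\<in>?S. i \<in> A} = A" "{i\<in>?S. i \<notin> A} = B" using disj by auto
    then show ?thesis using ne by auto
  qed
  have gb: "?g ?b = {A, B}"
  proof -
    have "{i\<in>?S. i \<in> B} = B" "{i\<in>?S. i \<notin> B} = A" using disj by auto
    then show ?thesis using ne by auto
  qed
  have "pmf (binary_paintbox x ?S) {A, B} = measure_pmf.prob ?p (?g -` {{A, B}})"
    by (simp add: binary_paintbox_def pmf_map)
  also have "\<dots> = measure_pmf.prob ?p {?a, ?b}"
  proof (rule measure_pmf.finite_measure_eq_AE)
    show "AE f in ?p. (f \<in> ?g -` {{A, B}}) = (f \<in> {?a, ?b})"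
    proof (rule AE_pmfI)
      fix f assume "f \<in> set_pmf ?p"
      from eq[OF this] ga gb show "(f \<in> ?g -` {{A, B}}) = (f \<in> {?a, ?b})"
        unfolding vimage_def mem_Collect_eq singleton_iff insert_iff empty_iff by blast
    qed
  qed auto
  also have "\<dots> = pmf ?p ?a + pmf ?p ?b"
  proof -
    have "?a \<noteq> ?b" using ne disj by (metis disjoint_iff ex_in_conv)
    then show ?thesis by (simp add: measure_measure_pmf_finite)
  qed
  also have "pmf ?p ?a = x ^ card A * (1 - x) ^ card B"
  proof -
    have "pmf ?p ?a = (\<Prod>i\<in>?S. pmf (bernoulli_pmf x) (i \<in> A))"
      using fin by (intro pmf_Pi') auto
    also have "\<dots> = (\<Prod>i\<in>A. x) * (\<Prod>i\<in>B. 1 - x)"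
      unfolding prod.union_disjoint[OF fin disj]
      using x by (intro arg_cong2[of _ _ _ _ "(*)"] prod.cong) (auto simp: out out')
    finally show ?thesis by simp
  qed
  also have "pmf ?p ?b = x ^ card B * (1 - x) ^ card A"
  proof -
    have "pmf ?p ?b = (\<Prod>i\<in>?S. pmf (bernoulli_pmf x) (i \<in> B))"
      using fin by (intro pmf_Pi') auto
    also have "\<dots> = (\<Prod>i\<in>A. 1 - x) * (\<Prod>i\<in>B. x)"
      unfolding prod.union_disjoint[OF fin disj]
      using x by (intro arg_cong2[of _ _ _ _ "(*)"] prod.cong) (auto simp: out out')
    finally show ?thesis by (simp add: mult.commute)
  qed
  finally show ?thesis .
qed

text \<open>The rate of an unordered split. Each of its two orderings has half this rate, so an ordered
  split of \<open>m\<close> labels into sizes \<open>i\<close> and \<open>m - i\<close> has rate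
  \<open>1/2 * (m choose i) * Beta (i + \<beta> + 1) (m - i + \<beta> + 1)\<close>.\<close>

lemma dislocation_rate_beta:
  assumes \<beta>: "\<beta> > -2"
    and fin: "finite A" "finite B" and ne: "A \<noteq> {}" "B \<noteq> {}" and disj: "A \<inter> B = {}"
  shows "dislocation_rate (beta_dislocation \<beta>) (A \<union> B) {A, B} =
    Beta (real (card A) + \<beta> + 1) (real (card B) + \<beta> + 1)"
proof -
  define a b where "a = card A" and "b = card B"
  have pos: "a \<ge> 1" "b \<ge> 1"
    using fin ne by (auto simp: a_def b_def Suc_le_eq card_gt_0_iff)
  let ?h = "\<lambda>x::real. x powr (real a + \<beta>) * (1 - x) powr (real b + \<beta>)"
  have B: "(?h has_integral Beta (real a + \<beta> + 1) (real b + \<beta> + 1)) {0..1}"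
    using has_integral_Beta_real[of "real a + \<beta> + 1" "real b + \<beta> + 1"] \<beta> pos by simp
  have h1: "?h integrable_on {1/2..1}" and h0: "?h integrable_on {0..1/2}"
    by (rule integrable_subinterval_real[OF has_integral_integrable[OF B]]; simp)+
  have flip: "((\<lambda>x. ?h (1 - x)) has_integral integral {0..1/2} ?h) {1/2..1}"
  proof -
    have "(?h has_integral integral {0..1/2} ?h) (cbox 0 (1/2))"
      using h0 by (simp add: integrable_integral)
    from has_integral_affinity[OF this, of "-1" 1]
    show ?thesis
      by (simp add: image_affinity_atLeastAtMost_diff image_affinity_atLeastAtMost algebra_simps)
  qed
  let ?k = "\<lambda>x. ?h x + ?h (1 - x)"
  have folded: "(?k has_integral Beta (real a + \<beta> + 1) (real b + \<beta> + 1)) {1/2..1}"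
  proof -
    have "(?k has_integral (integral {1/2..1} ?h + integral {0..1/2} ?h)) {1/2..1}"
      using has_integral_add[OF integrable_integral[OF h1] flip] .
    moreover have "integral {0..1/2} ?h + integral {1/2..1} ?h = integral {0..1} ?h"
      by (rule Henstock_Kurzweil_Integration.integral_combine[OF _ _ has_integral_integrable[OF B]])
        simp_all
    ultimately show ?thesis using integral_unique[OF B] by (simp add: add.commute)
  qed
  have H: "(?k has_integral Beta (real a + \<beta> + 1) (real b + \<beta> + 1)) {1/2..<1}"
    by (rule has_integral_spike_set_eq[THEN iffD1, OF _ _ folded];
        rule negligible_subset[of "{1::real}"]; force)
  have "?k absolutely_integrable_on {1/2..<1}"
    by (rule nonnegative_absolutely_integrable_1[OF has_integral_integrable[OF H]]) simp
  from set_lebesgue_integral_eq_integral(2)[OF this] integral_unique[OF H]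
  have leb: "(LINT x|lebesgue. indicator {1/2..<1} x * ?k x) =
      Beta (real a + \<beta> + 1) (real b + \<beta> + 1)"
    by (simp only: set_lebesgue_integral_def real_scaleR_def)
  have "dislocation_rate (beta_dislocation \<beta>) (A \<union> B) {A, B} =
      (\<integral>x. x ^ a * (1 - x) ^ b + x ^ b * (1 - x) ^ a \<partial>beta_dislocation \<beta>)"
  proof -
    have clamp: "bernoulli_pmf x = bernoulli_pmf (max 0 (min 1 x))" for x :: real
      by (rule pmf_eqI) (simp add: bernoulli_pmf.rep_eq max_def min_def)
    define c where "c = (\<lambda>x::real. max 0 (min 1 x))"
    have "pmf (binary_paintbox x (A \<union> B)) {A, B} =
        c x ^ a * (1 - c x) ^ b + c x ^ b * (1 - c x) ^ a" for x
    proof -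
      have "binary_paintbox x (A \<union> B) = binary_paintbox (c x) (A \<union> B)"
        unfolding binary_paintbox_def c_def by (subst clamp) (rule refl)
      then show ?thesis
        using pmf_binary_paintbox[OF fin ne disj, of "c x"] by (simp add: a_def b_def c_def)
    qed
    moreover have "AE x in beta_dislocation \<beta>. c x = x"
      unfolding beta_dislocation_def c_def
      by (subst AE_density) (auto simp: indicator_def)
    ultimately show ?thesis
      unfolding dislocation_rate_def
      by (intro integral_cong_AE) (auto simp: beta_dislocation_def c_def)
  qed
  also have "\<dots> = (\<integral>x. indicator {1/2..<1} x * (x powr \<beta> * (1 - x) powr \<beta>) *
      (x ^ a * (1 - x) ^ b + x ^ b * (1 - x) ^ a) \<partial>lborel)"
    unfolding beta_dislocation_def
    by (subst integral_density) (auto simp: indicator_def)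
  also have "\<dots> = (\<integral>x. indicator {1/2..<1} x * ?k x \<partial>lborel)"
    by (intro Bochner_Integration.integral_cong)
      (auto simp: indicator_def powr_add powr_realpow algebra_simps)
  also have "\<dots> = (LINT x|lebesgue. indicator {1/2..<1} x * ?k x)"
    by (subst integral_completion) auto
  finally show ?thesis using leb by (simp add: a_def b_def)
qed

end

theory Submission
  imports Defs "HOL-Real_Asymp.Real_Asymp"
begin

text \<open>Everything is read off from the pair density, the sum of the squared block frequencies. It is the
  limiting proportion of pairs of labels that share a block, and a pair stays together for an
  exponential time of rate \<open>r\<close>; so \<open>exp (r * t)\<close> times the pair density has mean 1, and it equals
  \<open>W_beta\<close> almost surely. Given the past, different blocks evolve independently, so only quadruples of labels in one
  block contribute to the conditional variance of an increment. It is therefore at most the sum of the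
  fourth powers of the frequencies (\<open>second_moment_bound\<close>), which is at most the \<open>8/5\<close>-th power of the
  sum of the powers \<open>5/2\<close> (\<open>mass_moment_3_le\<close>). The mean of the latter sum decays strictly faster than
  \<open>exp (- 5/4 * r * t)\<close>: it is a moment of the frequency of a tagged block, and the rate is a strict
  case of the Cauchy--Schwarz inequality between the moments that belong to two and three labels
  (\<open>power_moment_decay\<close>). Hence the increments of \<open>W_beta\<close> over a fixed time step are exponentially
  small in mean (\<open>density_increment_L1\<close>), and \<open>W_beta\<close> converges almost surely and in mean to a limit
  \<open>W_limit\<close> of mean 1. Between the points of a grid the pair density is monotone.

  The assertion concerns all real times at once, so block frequencies have to exist simultaneously at
  all times. The block of a label at time \<open>t\<close> consists of the labels whose separation time from it
  exceeds \<open>t\<close>; these separation times are exchangeable, and an exchangeable sequence has all its level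
  frequencies on one almost sure event (\<open>AE_regular\<close>, from \<open>exchangeable_glivenko_cantelli\<close>).

  The largest height is at most \<open>t\<close> if and only if the labels \<open>1, \<dots>, n\<close> lie in different blocks at
  time \<open>t\<close>. If the number of labels were Poisson with mean \<open>l\<close>, the probability of this given the
  frequencies \<open>p\<close> would be the product of \<open>(1 + l * p) * exp (- l * p)\<close>, which is close to
  \<open>exp (- l\<^sup>2 / 2 * pair_density)\<close> up to \<open>l powr (5/2)\<close> times the sum of \<open>p powr (5/2)\<close>. For \<open>l\<close> near
  \<open>n\<close> and \<open>t = (2 * ln n + x) / r\<close> that error vanishes by the same rate of decay, and
  \<open>l\<^sup>2 * pair_density\<close> converges to \<open>exp (- x) * W_limit\<close>. The probability is monotone in the number
  of labels, so the Poisson number can be replaced by \<open>n\<close> (\<open>separation_prob_limit\<close>).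

  Let \<open>q\<close> be the probability that \<open>W_limit\<close> vanishes, the limit of that law as \<open>x\<close> tends to minus
  infinity. If two labels lie in different blocks at time \<open>s\<close>, and both blocks contain a positive
  proportion of the \<open>n\<close> labels, then two independent samples have to be separated later on. As every
  block has positive frequency (\<open>AE_freq_pos\<close>), letting \<open>s\<close> grow gives \<open>q \<le> q\<^sup>2\<close>; and \<open>q < 1\<close> because
  the mean is 1 (\<open>AE_W_limit_pos\<close>). So the limit law is a probability distribution on the line, and
  dividing the height by \<open>ln n\<close> leaves the constant \<open>2 / r\<close>.\<close>

section \<open>Blocks of a partition\<close>

text \<open>A partition is handled through the relation of lying in one block: restriction, refinement and
  relabelling act on it pointwise, and it is given by countably many measurable events.\<close>

definition same_block :: "nat set set \<Rightarrow> nat \<Rightarrow> nat \<Rightarrow> bool"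
  where "same_block P i j \<longleftrightarrow> (\<exists>B\<in>P. i \<in> B \<and> j \<in> B)"

definition block_of :: "nat set set \<Rightarrow> nat \<Rightarrow> nat set"
  where "block_of P i = {j. same_block P i j}"

definition block_count :: "nat set set \<Rightarrow> nat \<Rightarrow> nat \<Rightarrow> nat"
  where "block_count P i N = card (block_of P i \<inter> {1..N})"

definition freq :: "nat set set \<Rightarrow> nat \<Rightarrow> real"
  where "freq P i = asymptotic_frequency (block_of P i)"

definition emp_freq :: "nat set set \<Rightarrow> nat \<Rightarrow> nat \<Rightarrow> real"
  where "emp_freq P i N = real (block_count P i N) / real N"

text \<open>\<open>asymptotic_frequency\<close> is a bare \<open>lim\<close>; on regular partitions it is a genuine limit for every
  block.\<close>

definition regular :: "nat set set \<Rightarrow> bool"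
  where "regular P \<longleftrightarrow> (\<forall>i\<ge>1. convergent (emp_freq P i))"

definition separated :: "nat set \<Rightarrow> nat set set \<Rightarrow> bool"
  where "separated F P \<longleftrightarrow> (\<forall>i\<in>F. \<forall>j\<in>F. i \<noteq> j \<longrightarrow> \<not> same_block P i j)"

lemma same_block_sym: "same_block P i j \<longleftrightarrow> same_block P j i"
  unfolding same_block_def by auto

lemma same_block_refl: "partition_on A P \<Longrightarrow> i \<in> A \<Longrightarrow> same_block P i i"
  unfolding same_block_def partition_on_def by auto

lemma same_block_trans:
  "partition_on A P \<Longrightarrow> same_block P i j \<Longrightarrow> same_block P j k \<Longrightarrow> same_block P i k"
  unfolding same_block_def partition_on_def disjoint_def by (metis disjoint_iff)

lemma same_block_in: "partition_on A P \<Longrightarrow> same_block P i j \<Longrightarrow> i \<in> A \<and> j \<in> A"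
  unfolding same_block_def partition_on_def by auto

lemma block_of_eq: "partition_on A P \<Longrightarrow> B \<in> P \<Longrightarrow> i \<in> B \<Longrightarrow> block_of P i = B"
proof -
  assume P: "partition_on A P" and B: "B \<in> P" "i \<in> B"
  have "C = B" if "C \<in> P" "i \<in> C" for C
    using P B that unfolding partition_on_def disjoint_def by (metis IntI empty_iff)
  then have "same_block P i j \<longleftrightarrow> j \<in> B" for j
    using B unfolding same_block_def by metis
  then show ?thesis by (auto simp: block_of_def)
qed

lemma block_of_in: "partition_on A P \<Longrightarrow> i \<in> A \<Longrightarrow> block_of P i \<in> P"
proof -
  assume P: "partition_on A P" "i \<in> A"
  then obtain B where "B \<in> P" "i \<in> B" unfolding partition_on_def by blast
  with block_of_eq[OF P(1) this] show ?thesis by simp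
qed

lemma partition_eq_if_same_block:
  assumes "partition_on A P" "partition_on A Q" "\<And>i j. i \<in> A \<Longrightarrow> j \<in> A \<Longrightarrow> same_block P i j \<longleftrightarrow> same_block Q i j"
  shows "P = Q"
proof -
  have *: "P \<subseteq> Q" if P: "partition_on A P" and Q: "partition_on A Q"
    and eq: "\<And>i j. i \<in> A \<Longrightarrow> j \<in> A \<Longrightarrow> same_block P i j \<longleftrightarrow> same_block Q i j" for P Q
  proof
    fix B assume B: "B \<in> P"
    have "B \<noteq> {}" "B \<subseteq> A" using P B unfolding partition_on_def by auto
    then obtain i where i: "i \<in> B" "i \<in> A" by auto
    have "block_of P i = block_of Q i"
      unfolding block_of_def using eq i same_block_in[OF P] same_block_in[OF Q] by blast
    with block_of_eq[OF P B i(1)] block_of_in[OF Q i(2)] show "B \<in> Q" by simp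
  qed
  from *[OF assms] *[OF assms(2,1)] assms(3) show ?thesis by blast
qed

lemma partition_on_restrict_partition:
  assumes "partition_on A P" "S \<subseteq> A"
  shows "partition_on S (restrict_partition P S)"
proof (rule partition_onI)
  show "\<Union> (restrict_partition P S) = S"
  proof -
    have "\<Union> (restrict_partition P S) = \<Union>P \<inter> S" unfolding restrict_partition_def by blast
    then show ?thesis using assms unfolding partition_on_def by auto
  qed
  fix a b assume "a \<in> restrict_partition P S" "b \<in> restrict_partition P S" "a \<noteq> b"
  then obtain B C where "B \<in> P" "C \<in> P" "a = B \<inter> S" "b = C \<inter> S" "B \<noteq> C"
    unfolding restrict_partition_def by auto
  moreover from this have "B \<inter> C = {}" using assms unfolding partition_on_def disjoint_def by simp
  ultimately show "disjnt a b" by (auto simp: disjnt_def)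
qed (auto simp: restrict_partition_def)

lemma same_block_restrict:
  "same_block (restrict_partition P S) i j \<longleftrightarrow> i \<in> S \<and> j \<in> S \<and> same_block P i j"
proof
  assume "same_block (restrict_partition P S) i j"
  then obtain B where "B \<in> P" "i \<in> B \<inter> S" "j \<in> B \<inter> S"
    unfolding same_block_def restrict_partition_def by auto
  then show "i \<in> S \<and> j \<in> S \<and> same_block P i j" unfolding same_block_def by auto
next
  assume *: "i \<in> S \<and> j \<in> S \<and> same_block P i j"
  then obtain B where B: "B \<in> P" "i \<in> B" "j \<in> B" unfolding same_block_def by auto
  with * have "B \<inter> S \<in> restrict_partition P S" unfolding restrict_partition_def by auto
  moreover have "i \<in> B \<inter> S" "j \<in> B \<inter> S" using * B by simp_all
  ultimately show "same_block (restrict_partition P S) i j"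
    unfolding same_block_def by (intro bexI[of _ "B \<inter> S"] conjI)
qed

lemma restrict_partition_eq_iff:
  assumes "partition_on A P" "S \<subseteq> A" "partition_on S \<eta>"
  shows "restrict_partition P S = \<eta> \<longleftrightarrow> (\<forall>i\<in>S. \<forall>j\<in>S. same_block P i j \<longleftrightarrow> same_block \<eta> i j)"
proof
  assume "\<forall>i\<in>S. \<forall>j\<in>S. same_block P i j \<longleftrightarrow> same_block \<eta> i j"
  then show "restrict_partition P S = \<eta>"
    by (intro partition_eq_if_same_block[OF partition_on_restrict_partition[OF assms(1,2)] assms(3)])
      (simp add: same_block_restrict)
next
  assume "restrict_partition P S = \<eta>"
  then show "\<forall>i\<in>S. \<forall>j\<in>S. same_block P i j \<longleftrightarrow> same_block \<eta> i j"
    using same_block_restrict[of P S] by blast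
qed

lemma restrict_partition_self: "partition_on S \<eta> \<Longrightarrow> restrict_partition \<eta> S = \<eta>"
  using restrict_partition_eq_iff[of S \<eta> S \<eta>] by simp

lemma restrict_eq_whole_iff:
  assumes "partition_on A P" "S \<subseteq> A" "S \<noteq> {}"
  shows "restrict_partition P S = {S} \<longleftrightarrow> (\<forall>i\<in>S. \<forall>j\<in>S. same_block P i j)"
proof -
  have "partition_on S {S}" using assms(3) by (auto simp: partition_on_def disjoint_def)
  from restrict_partition_eq_iff[OF assms(1,2) this] show ?thesis by (auto simp: same_block_def)
qed

lemma partition_on_singletons: "partition_on S ((\<lambda>i. {i}) ` S)"
  by (auto simp: partition_on_def disjoint_def)

lemma restrict_eq_singletons_iff:
  assumes "partition_on A P" "S \<subseteq> A"
  shows "restrict_partition P S = (\<lambda>i. {i}) ` S \<longleftrightarrow> (\<forall>i\<in>S. \<forall>j\<in>S. i \<noteq> j \<longrightarrow> \<not> same_block P i j)"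
proof -
  have "same_block ((\<lambda>i. {i}) ` S) i j \<longleftrightarrow> i = j" if "i \<in> S" for i j
    using that unfolding same_block_def by blast
  moreover have "same_block P i i" if "i \<in> S" for i
    using same_block_refl[OF assms(1)] assms(2) that by blast
  ultimately show ?thesis
    using restrict_partition_eq_iff[OF assms partition_on_singletons[of S]] by metis
qed

lemma finite_partitions: "finite S \<Longrightarrow> finite {\<eta>. partition_on S \<eta>}"
  by (rule finite_subset[of _ "Pow (Pow S)"]) (auto simp: partition_on_def)

lemma refines_iff_same_block:
  assumes P: "partition_on S P" and Q: "partition_on S Q"
  shows "refines S P Q \<longleftrightarrow> (\<forall>i j. same_block P i j \<longrightarrow> same_block Q i j)"
proof
  assume "refines S P Q"
  then show "\<forall>i j. same_block P i j \<longrightarrow> same_block Q i j"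
    unfolding refines_def same_block_def by (meson subsetD)
next
  assume *: "\<forall>i j. same_block P i j \<longrightarrow> same_block Q i j"
  show "refines S P Q" unfolding refines_def
  proof (intro conjI assms ballI)
    fix X assume X: "X \<in> P"
    have "X \<noteq> {}" "X \<subseteq> S" using P X unfolding partition_on_def by auto
    then obtain i where i: "i \<in> X" "i \<in> S" by auto
    have "X \<subseteq> block_of Q i" using * block_of_eq[OF P X i(1)] unfolding block_of_def by blast
    with block_of_in[OF Q i(2)] show "\<exists>Y\<in>Q. X \<subseteq> Y" by blast
  qed
qed

definition alone :: "nat \<Rightarrow> nat \<Rightarrow> nat set set \<Rightarrow> bool"
  where "alone n i P \<longleftrightarrow> (\<forall>j\<in>{1..n}. j \<noteq> i \<longrightarrow> \<not> same_block P i j)"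

lemma singleton_in_restrict_iff_alone:
  assumes "partition_on positive_nats P" "i \<in> {1..n}"
  shows "{i} \<in> restrict_partition P {1..n} \<longleftrightarrow> alone n i P"
proof -
  let ?Q = "restrict_partition P {1..n}"
  have part: "partition_on {1..n} ?Q" by (rule partition_on_restrict_partition[OF assms(1)]) auto
  have self: "same_block ?Q i i" by (rule same_block_refl[OF part assms(2)])
  have "{i} \<in> ?Q \<longleftrightarrow> block_of ?Q i = {i}"
    using block_of_eq[OF part, of "{i}" i] block_of_in[OF part assms(2)] by auto
  also have "\<dots> \<longleftrightarrow> (\<forall>j. same_block ?Q i j \<longrightarrow> j = i)"
    using self unfolding block_of_def by auto
  also have "\<dots> \<longleftrightarrow> alone n i P"
    using assms(2) unfolding alone_def same_block_restrict by auto
  finally show ?thesis .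
qed

lemma separated_iff_alone: "separated {1..n} P \<longleftrightarrow> (\<forall>i\<in>{1..n}. alone n i P)"
  unfolding separated_def alone_def by auto

subsection \<open>Relabelling\<close>

lemma same_block_permute:
  assumes "bij \<sigma>"
  shows "same_block (permute_partition \<sigma> P) (\<sigma> i) (\<sigma> j) \<longleftrightarrow> same_block P i j"
  using bij_is_inj[OF assms] unfolding same_block_def permute_partition_def by (auto simp: inj_image_mem_iff)

lemma permutes_positive_nats: "\<sigma> permutes {1..n} \<Longrightarrow> \<sigma> permutes positive_nats"
  by (rule permutes_subset) auto

lemma partition_on_permute:
  assumes "\<sigma> permutes A" "partition_on A P"
  shows "partition_on A (permute_partition \<sigma> P)"
proof -
  have inj: "inj \<sigma>" using assms(1) permutes_inj by blast
  have im: "\<sigma> ` A = A" using assms(1) permutes_image by blast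
  have "\<Union> (permute_partition \<sigma> P) = \<sigma> ` \<Union>P" unfolding permute_partition_def by auto
  moreover have "disjoint (permute_partition \<sigma> P)"
  proof (rule disjointI)
    fix a b assume "a \<in> permute_partition \<sigma> P" "b \<in> permute_partition \<sigma> P" and ne: "a \<noteq> b"
    then obtain a' b' where ab: "a' \<in> P" "b' \<in> P" "a = \<sigma> ` a'" "b = \<sigma> ` b'"
      unfolding permute_partition_def by auto
    with ne have "a' \<noteq> b'" by auto
    with ab assms(2) have "a' \<inter> b' = {}" unfolding partition_on_def disjoint_def by auto
    then show "a \<inter> b = {}" using ab image_Int[OF inj, of a' b'] by simp
  qed
  ultimately show ?thesis using assms(2) im unfolding partition_on_def permute_partition_def by auto
qed

lemma block_of_permute:
  assumes "bij \<sigma>" shows "block_of (permute_partition \<sigma> P) (\<sigma> i) = \<sigma> ` block_of P i"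
proof (intro set_eqI iffI)
  fix j assume "j \<in> block_of (permute_partition \<sigma> P) (\<sigma> i)"
  moreover obtain k where "j = \<sigma> k" using bij_is_surj[OF assms] by (metis surjD)
  ultimately show "j \<in> \<sigma> ` block_of P i" by (auto simp: block_of_def same_block_permute[OF assms])
qed (auto simp: block_of_def same_block_permute[OF assms])

lemma block_count_permute:
  assumes "\<sigma> permutes {1..n}" "n \<le> N"
  shows "block_count (permute_partition \<sigma> P) (\<sigma> i) N = block_count P i N"
proof -
  have p: "\<sigma> permutes {1..N}" by (rule permutes_subset[OF assms(1)]) (use assms(2) in auto)
  have "\<sigma> ` (block_of P i \<inter> {1..N}) = \<sigma> ` block_of P i \<inter> \<sigma> ` {1..N}"
    using image_Int[OF permutes_inj[OF p]] .
  also have "\<dots> = block_of (permute_partition \<sigma> P) (\<sigma> i) \<inter> {1..N}"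
    using block_of_permute[OF permutes_bij[OF p]] permutes_image[OF p] by simp
  finally show ?thesis unfolding block_count_def
    by (metis card_image inj_on_subset permutes_inj[OF p] subset_UNIV)
qed

text \<open>If neither sequence converges, \<open>lim\<close> is the same unspecified value for both.\<close>

lemma lim_eventually_eq:
  fixes f g :: "nat \<Rightarrow> 'a::t2_space"
  assumes "\<And>N. N \<ge> n \<Longrightarrow> f N = g N" shows "lim f = lim g"
proof -
  have "f \<longlonglongrightarrow> L \<longleftrightarrow> g \<longlonglongrightarrow> L" for L
    by (rule filterlim_cong[OF refl refl]) (use assms in \<open>auto simp: eventually_sequentially\<close>)
  then show ?thesis unfolding lim_def by simp
qed

lemma freq_eq_lim: "freq P i = lim (emp_freq P i)"
  unfolding freq_def asymptotic_frequency_def emp_freq_def block_count_def ..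

lemma emp_freq_permute:
  assumes "\<sigma> permutes {1..n}" "n \<le> N"
  shows "emp_freq (permute_partition \<sigma> P) (\<sigma> i) N = emp_freq P i N"
  unfolding emp_freq_def block_count_permute[OF assms] ..

lemma freq_permute:
  assumes "\<sigma> permutes {1..n}"
  shows "freq (permute_partition \<sigma> P) (\<sigma> i) = freq P i"
  unfolding freq_eq_lim using emp_freq_permute[OF assms] by (rule lim_eventually_eq)

text \<open>Exchangeability concerns permutations of an initial segment. To move finitely many labels to
  prescribed places it is applied to a permutation that extends the partial map.\<close>

lemma ex_permutes_extending:
  assumes A: "finite A" "K \<subseteq> A" and f: "inj_on f K" "f ` K \<subseteq> A"
  shows "\<exists>\<sigma>. \<sigma> permutes A \<and> (\<forall>i\<in>K. \<sigma> i = f i)"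
proof -
  have "card (A - K) = card (A - f ` K)"
    using A f card_image[OF f(1)] by (simp add: card_Diff_subset finite_subset)
  then obtain g where g: "bij_betw g (A - K) (A - f ` K)"
    using finite_same_card_bij[of "A - K" "A - f ` K"] A(1) by auto
  define \<sigma> where "\<sigma> = (\<lambda>i. if i \<in> K then f i else if i \<in> A then g i else i)"
  have "bij_betw \<sigma> (K \<union> (A - K)) (f ` K \<union> (A - f ` K))"
  proof (rule bij_betw_combine)
    show "bij_betw \<sigma> K (f ` K)"
      using inj_on_imp_bij_betw[OF f(1)]
      by (rule bij_betw_cong[THEN iffD1, rotated]) (simp add: \<sigma>_def)
    show "bij_betw \<sigma> (A - K) (A - f ` K)"
      using g by (rule bij_betw_cong[THEN iffD1, rotated]) (auto simp: \<sigma>_def)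
  qed auto
  moreover have "K \<union> (A - K) = A" "f ` K \<union> (A - f ` K) = A"
    using A f by auto
  ultimately have "\<sigma> permutes A"
    by (intro bij_imp_permutes) (use A in \<open>auto simp: \<sigma>_def\<close>)
  then show ?thesis by (intro exI[of _ \<sigma>]) (auto simp: \<sigma>_def)
qed

subsection \<open>Measurability\<close>

lemma space_partition_algebra: "space partition_algebra = {P. partition_on positive_nats P}"
  unfolding partition_algebra_def by (intro space_measure_of) auto

lemma sets_restrict_event:
  "{P \<in> space partition_algebra. restrict_partition P {1..n} = \<eta>} \<in> sets partition_algebra"
proof -
  have "{P. partition_on positive_nats P \<and> restrict_partition P {1..n} = \<eta>} \<in> sets partition_algebra"
    unfolding partition_algebra_def by (subst sets_measure_of) auto
  then show ?thesis by (simp add: space_partition_algebra)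
qed

lemma pred_restrict_event[measurable]:
  "Measurable.pred partition_algebra (\<lambda>P. restrict_partition P {1..n} = \<eta>)"
  using sets_restrict_event by (simp add: pred_def)

lemma pred_same_block[measurable]: "Measurable.pred partition_algebra (\<lambda>P. same_block P i j)"
proof -
  define n where "n = max i j"
  define E where "E = {\<eta>. partition_on {1..n} \<eta> \<and> same_block \<eta> i j}"
  have fin: "finite E" using finite_partitions[of "{1..n}"] by (auto simp: E_def intro: finite_subset)
  have "same_block P i j \<longleftrightarrow> (\<exists>\<eta>\<in>E. restrict_partition P {1..n} = \<eta>)"
    if "P \<in> space partition_algebra" for P
  proof -
    have P: "partition_on positive_nats P" using that by (simp add: space_partition_algebra)
    have "partition_on {1..n} (restrict_partition P {1..n})"
      by (rule partition_on_restrict_partition[OF P]) auto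
    then show ?thesis
      using same_block_in[OF P, of i j] by (auto simp: E_def same_block_restrict n_def)
  qed
  then have "Measurable.pred partition_algebra (\<lambda>P. same_block P i j) \<longleftrightarrow>
      Measurable.pred partition_algebra (\<lambda>P. \<exists>\<eta>\<in>E. restrict_partition P {1..n} = \<eta>)"
    by (rule measurable_cong)
  also have \<dots>
    by (rule pred_intros_finite(4)[OF fin]) (rule pred_restrict_event)
  finally show ?thesis .
qed

lemma block_count_eq_sum: "block_count P i N = (\<Sum>j=1..N. if same_block P i j then 1 else 0)"
proof -
  have "block_of P i \<inter> {1..N} = {j\<in>{1..N}. same_block P i j}" by (auto simp: block_of_def)
  then show ?thesis unfolding block_count_def by (simp flip: sum.inter_filter)
qed

lemma measurable_emp_freq[measurable]: "(\<lambda>P. emp_freq P i N) \<in> borel_measurable partition_algebra"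
  unfolding emp_freq_def block_count_eq_sum by simp measurable

lemma measurable_freq[measurable]: "(\<lambda>P. freq P i) \<in> borel_measurable partition_algebra"
  unfolding freq_eq_lim by measurable

text \<open>A permutation of \<open>{1..n}\<close> moves labels across the boundary of \<open>{1..m}\<close> for \<open>m < n\<close>, so the preimage
  of a generator is in general not a generator; it is described through \<open>same_block\<close>.\<close>

lemma measurable_permute_partition:
  assumes "\<sigma> permutes {1..n}"
  shows "permute_partition \<sigma> \<in> partition_algebra \<rightarrow>\<^sub>M partition_algebra"
proof -
  have bij: "bij \<sigma>" using assms permutes_bij by blast
  have sb: "same_block (permute_partition \<sigma> P) i j \<longleftrightarrow> same_block P (inv \<sigma> i) (inv \<sigma> j)" for P i j
    using same_block_permute[OF bij, of P "inv \<sigma> i" "inv \<sigma> j"] by (simp add: bij bij_is_surj surj_f_inv_f)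
  have sp: "permute_partition \<sigma> P \<in> space partition_algebra" if "P \<in> space partition_algebra" for P
    using partition_on_permute[OF permutes_positive_nats[OF assms]] that by (simp add: space_partition_algebra)
  show ?thesis
    unfolding partition_algebra_def
  proof (rule measurable_sigma_sets)
    show "permute_partition \<sigma> \<in> space (sigma {P. partition_on positive_nats P}
         {{P. partition_on positive_nats P \<and> restrict_partition P {1..n} = \<eta>} |n \<eta>. True}) \<rightarrow> {P. partition_on positive_nats P}"
      using sp unfolding partition_algebra_def[symmetric] space_partition_algebra by blast
    fix Y assume "Y \<in> {{P. partition_on positive_nats P \<and> restrict_partition P {1..n} = \<eta>} |n \<eta>. True}"
    then obtain m \<eta> where Y: "Y = {P. partition_on positive_nats P \<and> restrict_partition P {1..m} = \<eta>}" by auto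
    have "permute_partition \<sigma> -` Y \<inter> space partition_algebra =
      {P\<in>space partition_algebra. partition_on {1..m} \<eta> \<and>
         (\<forall>i\<in>{1..m}. \<forall>j\<in>{1..m}. same_block P (inv \<sigma> i) (inv \<sigma> j) \<longleftrightarrow> same_block \<eta> i j)}"
    proof (intro set_eqI)
      fix P
      show "P \<in> permute_partition \<sigma> -` Y \<inter> space partition_algebra \<longleftrightarrow> P \<in> {P\<in>space partition_algebra. partition_on {1..m} \<eta> \<and>
         (\<forall>i\<in>{1..m}. \<forall>j\<in>{1..m}. same_block P (inv \<sigma> i) (inv \<sigma> j) \<longleftrightarrow> same_block \<eta> i j)}"
      proof (cases "P \<in> space partition_algebra \<and> partition_on {1..m} \<eta>")
        case True
        then have "partition_on positive_nats (permute_partition \<sigma> P)"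
          using sp by (auto simp: space_partition_algebra)
        from restrict_partition_eq_iff[OF this _ conjunct2[OF True]] this True show ?thesis
          by (auto simp: Y sb)
      next
        case False
        then show ?thesis
          using sp[of P] partition_on_restrict_partition[of positive_nats "permute_partition \<sigma> P" "{1..m}"]
          by (auto simp: Y space_partition_algebra)
      qed
    qed
    also have "\<dots> \<in> sets partition_algebra" by measurable
    finally show "permute_partition \<sigma> -` Y \<inter> space (sigma {P. partition_on positive_nats P}
         {{P. partition_on positive_nats P \<and> restrict_partition P {1..n} = \<eta>} |n \<eta>. True})
         \<in> sets (sigma {P. partition_on positive_nats P}
         {{P. partition_on positive_nats P \<and> restrict_partition P {1..n} = \<eta>} |n \<eta>. True})"
      unfolding partition_algebra_def .
  next
    show "sets (sigma {P. partition_on positive_nats P}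
         {{P. partition_on positive_nats P \<and> restrict_partition P {1..n} = \<eta>} |n \<eta>. True}) =
      sigma_sets {P. partition_on positive_nats P}
         {{P. partition_on positive_nats P \<and> restrict_partition P {1..n} = \<eta>} |n \<eta>. True}"
      by (rule sets_measure_of) blast
    show "{{P. partition_on positive_nats P \<and> restrict_partition P {1..n} = \<eta>} |n \<eta>. True}
      \<subseteq> Pow {P. partition_on positive_nats P}"
      by blast
  qed
qed

section \<open>Exchangeable sequences\<close>

text \<open>The squares are dense enough for a monotone count with steps at most one to follow them, since the
  gaps are of order \<open>k = o(k^2)\<close>, and sparse enough for the errors in the law of large numbers to be
  summable along them.\<close>

lemma convergent_along_squares:
  fixes c :: "nat \<Rightarrow> real"
  assumes mono: "\<And>n. c n \<le> c (Suc n)" and lip: "\<And>n. c (Suc n) \<le> c n + 1" and c0: "c 0 = 0"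
    and conv: "convergent (\<lambda>k. c ((Suc k)\<^sup>2) / real ((Suc k)\<^sup>2))"
  shows "convergent (\<lambda>n. c n / real n)"
proof -
  obtain L where "(\<lambda>k. c ((Suc k)\<^sup>2) / real ((Suc k)\<^sup>2)) \<longlonglongrightarrow> L"
    using conv unfolding convergent_def by blast
  then have L: "(\<lambda>k. c (k\<^sup>2) / real (k\<^sup>2)) \<longlonglongrightarrow> L"
    by (rule LIMSEQ_imp_Suc)
  have incr: "c m \<le> c n \<and> c n \<le> c m + real (n - m)" if "m \<le> n" for m n
    using that
  proof (induction n rule: dec_induct)
    case (step n)
    have "real (Suc n - m) = real (n - m) + 1" using step(1) by (simp add: Suc_diff_le)
    then show ?case using step mono[of n] lip[of n] by linarith
  qed simp
  have pos: "0 \<le> c n" "c n \<le> real n" for n using incr[of 0 n] c0 by auto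
  define k where "k = floor_sqrt"
  have k1: "(k n)\<^sup>2 \<le> n" and k2: "n < (Suc (k n))\<^sup>2" for n
    unfolding k_def using Suc_floor_sqrt_power2_gt by auto
  have k_top: "filterlim k at_top sequentially"
    unfolding filterlim_at_top eventually_sequentially
  proof
    fix Z show "\<exists>N. \<forall>n\<ge>N. Z \<le> k n"
    proof (intro exI[of _ "Z\<^sup>2"] allI impI)
      fix n assume "Z\<^sup>2 \<le> n"
      then have "Z\<^sup>2 < (Suc (k n))\<^sup>2" using k2[of n] by linarith
      then have "Z < Suc (k n)" using power_less_imp_less_base by blast
      then show "Z \<le> k n" by simp
    qed
  qed
  have bound: "norm (c n / real n - c ((k n)\<^sup>2) / real ((k n)\<^sup>2)) \<le> 4 * inverse (real (k n))" if "n \<ge> 1" for n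
  proof -
    define m where "m = k n"
    have m1: "m \<ge> 1" using k2[of n] that unfolding m_def by (cases "k n = 0") auto
    have mn: "m\<^sup>2 \<le> n" and nm: "n \<le> m\<^sup>2 + 2 * m"
      using k1[of n] k2[of n] unfolding m_def by (auto simp: power2_eq_square)
    define d where "d = real n - real (m\<^sup>2)"
    have "real n \<le> real (m\<^sup>2 + 2 * m)" "real (m\<^sup>2) \<le> real n" using mn nm by (simp_all only: of_nat_le_iff)
    then have d: "0 \<le> d" "d \<le> 2 * real m" unfolding d_def by simp_all
    have c1: "0 \<le> c n - c (m\<^sup>2)" "c n - c (m\<^sup>2) \<le> d"
      using incr[OF mn] mn by (auto simp: d_def of_nat_diff)
    have pm: "real (m\<^sup>2) > 0" "real n > 0" using m1 that by auto
    have "c n / real n - c (m\<^sup>2) / real (m\<^sup>2) =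
      (c n - c (m\<^sup>2)) / real n - (c (m\<^sup>2) / real (m\<^sup>2)) * (d / real n)"
      using pm by (simp add: d_def field_simps)
    also have "\<bar>\<dots>\<bar> \<le> \<bar>(c n - c (m\<^sup>2)) / real n\<bar> + \<bar>(c (m\<^sup>2) / real (m\<^sup>2)) * (d / real n)\<bar>"
      by (rule abs_triangle_ineq4)
    also have "\<bar>(c n - c (m\<^sup>2)) / real n\<bar> \<le> d / real n"
      using c1 pm by (simp add: divide_right_mono)
    also have "\<bar>(c (m\<^sup>2) / real (m\<^sup>2)) * (d / real n)\<bar> \<le> 1 * (d / real n)"
      unfolding abs_mult using pos[of "m\<^sup>2"] pm d by (intro mult_mono) auto
    also have "d / real n + 1 * (d / real n) \<le> 4 * inverse (real m)"
    proof -
      have "d / real n \<le> 2 * real m / real (m\<^sup>2)"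
        using d pm mn by (intro frac_le) auto
      also have "\<dots> = 2 * inverse (real m)" using m1 by (simp add: power2_eq_square field_simps)
      finally show ?thesis by simp
    qed
    finally show ?thesis by (simp add: m_def)
  qed
  have inv: "(\<lambda>n. 4 * inverse (real (k n))) \<longlonglongrightarrow> 4 * 0"
    by (intro tendsto_mult tendsto_const filterlim_compose[OF _ k_top] tendsto_inverse_0_at_top filterlim_real_sequentially)
  have "(\<lambda>n. c n / real n - c ((k n)\<^sup>2) / real ((k n)\<^sup>2)) \<longlonglongrightarrow> 0"
    by (rule Lim_null_comparison[OF _ inv[unfolded mult_zero_right]])
      (use bound in \<open>auto simp: eventually_sequentially\<close>)
  moreover have "(\<lambda>n. c ((k n)\<^sup>2) / real ((k n)\<^sup>2)) \<longlonglongrightarrow> L"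
    by (rule filterlim_compose[OF L k_top])
  ultimately have "(\<lambda>n. c n / real n) \<longlonglongrightarrow> 0 + L"
    using tendsto_add by fastforce
  then show ?thesis by (auto simp: convergent_def)
qed

text \<open>A sequence whose increments have summable first absolute moments is Cauchy almost surely and
  in mean; this replaces the martingale convergence theorem wherever a rate is available.\<close>

lemma (in prob_space) summable_increments:
  fixes f :: "nat \<Rightarrow> 'a \<Rightarrow> real"
  assumes int: "\<And>k. integrable M (f k)"
    and c: "summable c" "\<And>k. (\<integral>w. \<bar>f (Suc k) w - f k w\<bar> \<partial>M) \<le> c k"
  shows "AE w in M. convergent (\<lambda>k. f k w)"
    and "integrable M (\<lambda>w. lim (\<lambda>k. f k w))"
    and "(\<lambda>k. \<integral>w. \<bar>f k w - lim (\<lambda>k. f k w)\<bar> \<partial>M) \<longlonglongrightarrow> 0"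
proof -
  have [measurable]: "f k \<in> borel_measurable M" for k using int by auto
  define d where "d = (\<lambda>k w. f (Suc k) w - f k w)"
  have dint: "integrable M (d k)" for k unfolding d_def using int by auto
  have c0: "0 \<le> c k" for k using c(2)[of k] by (rule order_trans[rotated]) (simp add: integral_nonneg_AE)
  have dc: "(\<integral>w. norm (d k w) \<partial>M) \<le> c k" for k unfolding d_def using c(2)[of k] by simp
  have nn: "(\<integral>\<^sup>+w. (\<Sum>k. ennreal (norm (d (k + m) w))) \<partial>M) \<le> ennreal (\<Sum>k. c (k + m))" for m
  proof -
    have "(\<integral>\<^sup>+w. (\<Sum>k. ennreal (norm (d (k + m) w))) \<partial>M) = (\<Sum>k. \<integral>\<^sup>+w. ennreal (norm (d (k + m) w)) \<partial>M)"
      by (rule nn_integral_suminf) (simp add: d_def)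
    also have "\<dots> = (\<Sum>k. ennreal (\<integral>w. norm (d (k + m) w) \<partial>M))"
      using dint by (simp add: nn_integral_eq_integral integrable_norm)
    also have "\<dots> \<le> (\<Sum>k. ennreal (c (k + m)))"
      using dc by (intro suminf_le) (auto intro!: ennreal_leI)
    also have "\<dots> = ennreal (\<Sum>k. c (k + m))"
      using c0 c(1) by (intro suminf_ennreal2) (auto simp: summable_iff_shift)
    finally show ?thesis .
  qed
  have AEs: "AE w in M. summable (\<lambda>k. norm (d k w))"
  proof -
    have "AE w in M. (\<Sum>k. ennreal (norm (d k w))) \<noteq> \<infinity>"
      using nn[of 0] by (intro nn_integral_PInf_AE) (auto simp: d_def top_unique)
    then show ?thesis
      by eventually_elim (intro summable_suminf_not_top, auto)
  qed
  have tel: "(\<Sum>k<n. d k w) = f n w - f 0 w" for n w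
    unfolding d_def by (rule sum_lessThan_telescope)
  show conv: "AE w in M. convergent (\<lambda>k. f k w)"
    using AEs
  proof eventually_elim
    case (elim w)
    then have "summable (\<lambda>k. d k w)" by (rule summable_norm_cancel)
    then have "convergent (\<lambda>n. f n w - f 0 w)" by (simp add: summable_iff_convergent tel)
    then have "convergent (\<lambda>n. f n w - f 0 w + f 0 w)" by (intro convergent_add convergent_const)
    then show ?case by simp
  qed
  let ?F = "\<lambda>w. lim (\<lambda>k. f k w)"
  have Fm[measurable]: "?F \<in> borel_measurable M" by measurable
  have near: "AE w in M. ennreal (norm (f m w - ?F w)) \<le> (\<Sum>k. ennreal (norm (d (k + m) w)))" for m
    using AEs conv
  proof eventually_elim
    case (elim w)
    have s: "summable (\<lambda>k. norm (d (k + m) w))"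
      using elim(1) by (rule summable_ignore_initial_segment)
    have s': "summable (\<lambda>k. d k w)" using elim(1) by (rule summable_norm_cancel)
    have "(\<lambda>n. f n w - f 0 w) \<longlonglongrightarrow> ?F w - f 0 w"
      using elim(2) by (intro tendsto_diff tendsto_const) (simp add: convergent_LIMSEQ_iff)
    then have "(\<lambda>k. d k w) sums (?F w - f 0 w)" unfolding sums_def by (simp add: tel)
    then have "(\<lambda>k. d (k + m) w) sums (?F w - f 0 w - (\<Sum>k<m. d k w))"
      by (rule sums_split_initial_segment)
    then have "(\<Sum>k. d (k + m) w) = ?F w - f m w" by (simp add: tel sums_iff)
    with summable_norm[OF s] have "norm (f m w - ?F w) \<le> (\<Sum>k. norm (d (k + m) w))"
      by (simp add: norm_minus_commute)
    then have "ennreal (norm (f m w - ?F w)) \<le> ennreal (\<Sum>k. norm (d (k + m) w))" by (rule ennreal_leI)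
    also have "\<dots> = (\<Sum>k. ennreal (norm (d (k + m) w)))"
      using s by (intro suminf_ennreal2[symmetric]) auto
    finally show ?case .
  qed
  have L1: "(\<integral>\<^sup>+w. ennreal (norm (f m w - ?F w)) \<partial>M) \<le> ennreal (\<Sum>k. c (k + m))" for m
    using nn_integral_mono_AE[OF near[of m]] nn[of m] by (rule order_trans)
  have idiff: "integrable M (\<lambda>w. f m w - ?F w)" for m
    by (rule integrableI_bounded) (use L1[of m] in \<open>auto simp: less_top[symmetric] top_unique\<close>)
  show "integrable M ?F"
    using Bochner_Integration.integrable_diff[OF int[of 0] idiff[of 0]] by simp
  have bd: "(\<integral>w. \<bar>f m w - ?F w\<bar> \<partial>M) \<le> (\<Sum>k. c (k + m))" for m
  proof -
    have "ennreal (\<integral>w. norm (f m w - ?F w) \<partial>M) \<le> ennreal (\<Sum>k. c (k + m))"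
      using L1[of m] idiff[of m] by (simp add: nn_integral_eq_integral integrable_norm)
    then show ?thesis using c0 c(1)
      by (subst (asm) ennreal_le_iff) (auto intro!: suminf_nonneg simp: summable_iff_shift)
  qed
  have tail: "(\<lambda>m. (\<Sum>k. c (k + m))) \<longlonglongrightarrow> 0"
    using c(1) by (rule suminf_exist_split2)
  show "(\<lambda>k. \<integral>w. \<bar>f k w - ?F w\<bar> \<partial>M) \<longlonglongrightarrow> 0"
    by (rule tendsto_sandwich[OF _ _ tendsto_const tail]) (use bd in \<open>auto intro!: always_eventually integral_nonneg_AE\<close>)
qed

text \<open>From \<open>0 \<le> (\<bar>Z\<bar> - a)\<^sup>2\<close>; near the optimal \<open>a\<close> this is as good as a square root and needs no root of
  an integral.\<close>

lemma (in prob_space) abs_moment_le_second_moment: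
  fixes Z :: "'a \<Rightarrow> real"
  assumes "integrable M Z" "integrable M (\<lambda>w. (Z w)\<^sup>2)" "a > 0"
  shows "(\<integral>w. \<bar>Z w\<bar> \<partial>M) \<le> ((\<integral>w. (Z w)\<^sup>2 \<partial>M) / a + a) / 2"
proof -
  have "\<bar>z\<bar> \<le> (z\<^sup>2 / a + a) / 2" for z :: real
  proof -
    have "0 \<le> (\<bar>z\<bar> - a)\<^sup>2 / a" using assms(3) by simp
    also have "\<dots> = z\<^sup>2 / a + a - 2 * \<bar>z\<bar>" using assms(3) by (simp add: power2_eq_square field_simps)
    finally show ?thesis by simp
  qed
  then have "(\<integral>w. \<bar>Z w\<bar> \<partial>M) \<le> (\<integral>w. ((Z w)\<^sup>2 / a + a) / 2 \<partial>M)"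
    using assms(1,2) by (intro integral_mono) auto
  also have "\<dots> = ((\<integral>w. (Z w)\<^sup>2 \<partial>M) / a + a) / 2"
    using assms(2) by (simp add: prob_space)
  finally show ?thesis .
qed

text \<open>For \<open>m \<le> n\<close> the averages \<open>A\<^sub>m\<close>, \<open>A\<^sub>n\<close> have \<open>E (A\<^sub>m - A\<^sub>n)\<^sup>2 = (p - p\<^sub>2) (1/m - 1/n)\<close>. Along the squares the
  resulting first moments are summable, and monotonicity of the partial sums fills the gaps.\<close>

lemma (in prob_space) pairwise_exchangeable_average_converges:
  fixes Y :: "nat \<Rightarrow> 'a \<Rightarrow> real"
  assumes [measurable]: "\<And>l. Y l \<in> borel_measurable M"
    and Y01: "\<And>l w. 0 \<le> Y l w" "\<And>l w. Y l w \<le> 1"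
    and p: "\<And>l. (\<integral>w. Y l w * Y l w \<partial>M) = p"
    and p2: "\<And>l m. l \<noteq> m \<Longrightarrow> (\<integral>w. Y l w * Y m w \<partial>M) = p2"
  shows "AE w in M. convergent (\<lambda>n. (\<Sum>l<n. Y l w) / real n)"
proof -
  define S where "S = (\<lambda>n w. \<Sum>l<n. Y l w)"
  have [measurable]: "S n \<in> borel_measurable M" for n unfolding S_def by measurable
  have intYY: "integrable M (\<lambda>w. Y l w * Y m w)" for l m
    by (rule integrable_const_bound[where B=1]) (use Y01 in \<open>auto simp: abs_mult intro!: mult_le_one\<close>)
  have Sb: "0 \<le> S n w" "S n w \<le> real n" for n w
  proof -
    show "0 \<le> S n w" unfolding S_def by (intro sum_nonneg Y01)
    have "S n w \<le> (\<Sum>l<n. 1)" unfolding S_def by (intro sum_mono Y01)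
    then show "S n w \<le> real n" by simp
  qed
  have intS: "integrable M (S n)" for n
    by (rule integrable_const_bound[where B="real n"]) (use Sb in auto)
  have SS: "(\<integral>w. S n w * S m w \<partial>M) = real n * (p + (real m - 1) * p2)" if "n \<le> m" "0 < m" for n m
  proof -
    have "(\<integral>w. S n w * S m w \<partial>M) = (\<integral>w. (\<Sum>l<n. \<Sum>k<m. Y l w * Y k w) \<partial>M)"
      unfolding S_def by (simp add: sum_product)
    also have "\<dots> = (\<Sum>l<n. \<Sum>k<m. (\<integral>w. Y l w * Y k w \<partial>M))"
      using intYY by simp
    also have "\<dots> = (\<Sum>l<n. \<Sum>k<m. (if k = l then p - p2 else 0) + p2)"
      by (intro sum.cong refl) (use p p2 in auto)
    also have "\<dots> = (\<Sum>l<n. p + (real m - 1) * p2)"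
    proof (rule sum.cong[OF refl])
      fix l assume "l \<in> {..<n}"
      then have "l < m" using that by auto
      then have "(\<Sum>k<m. (if k = l then p - p2 else 0) + p2) = p - p2 + real m * p2"
        by (simp add: sum.distrib sum.delta)
      then show "(\<Sum>k<m. (if k = l then p - p2 else 0) + p2) = p + (real m - 1) * p2"
        by (simp add: algebra_simps)
    qed
    finally show ?thesis by simp
  qed
  have pp: "0 \<le> p2" "p \<le> 1"
  proof -
    show "0 \<le> p2" using p2[of 0 1] Y01 by (auto intro!: integral_nonneg simp flip: p2[of 0 1])
    have "(\<integral>w. Y 0 w * Y 0 w \<partial>M) \<le> (\<integral>w. 1 \<partial>M)"
      using Y01 intYY by (intro integral_mono) (auto intro!: mult_le_one)
    then show "p \<le> 1" using p by (simp add: prob_space)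
  qed
  define sq where "sq = (\<lambda>k. (Suc k)\<^sup>2)"
  define A where "A = (\<lambda>k w. S (sq k) w / real (sq k))"
  define c where "c = (\<lambda>k. (3/2) * real (Suc k) powr (-(3/2)))"
  have "summable (\<lambda>n. real n powr (-(3/2)))" by (simp add: summable_real_powr_iff)
  then have csum: "summable c" unfolding c_def
    by (intro summable_mult) (subst summable_Suc_iff)
  have Ab: "0 \<le> A k w" "A k w \<le> 1" for k w
    using Sb[of "sq k" w] by (auto simp: A_def sq_def divide_le_eq simp del: power_Suc of_nat_Suc of_nat_power)
  have Am[measurable]: "A k \<in> borel_measurable M" for k unfolding A_def by measurable
  have intA: "integrable M (A k)" for k
    by (rule integrable_const_bound[where B=1]) (use Ab in auto)
  have bound: "(\<integral>w. \<bar>A (Suc k) w - A k w\<bar> \<partial>M) \<le> c k" for k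
  proof -
    define n m where "n = sq k" and "m = sq (Suc k)"
    have nm: "n \<le> m" "0 < n" "0 < m" unfolding n_def m_def sq_def by (auto intro: power_mono)
    have intSS: "integrable M (\<lambda>w. S i w * S j w)" for i j
      unfolding S_def sum_product using intYY by auto
    have "(\<integral>w. (A (Suc k) w - A k w)\<^sup>2 \<partial>M) =
      (\<integral>w. (1 / (real m)\<^sup>2) * (S m w * S m w) - (2 / (real n * real m)) * (S n w * S m w) + (1 / (real n)\<^sup>2) * (S n w * S n w) \<partial>M)"
      by (intro Bochner_Integration.integral_cong refl)
        (use nm in \<open>simp add: A_def n_def[symmetric] m_def[symmetric] power2_eq_square field_simps\<close>)
    also have "\<dots> = (1 / (real m)\<^sup>2) * (real m * (p + (real m - 1) * p2)) - (2 / (real n * real m)) * (real n * (p + (real m - 1) * p2))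
        + (1 / (real n)\<^sup>2) * (real n * (p + (real n - 1) * p2))"
      using intSS nm by (simp add: SS)
    also have "\<dots> = (p - p2) * (1 / real n - 1 / real m)"
      using nm by (simp add: power2_eq_square field_simps)
    also have "\<dots> \<le> 1 * (1 / real n - 1 / real m)"
      using pp nm by (intro mult_right_mono) (auto simp: field_simps)
    also have "\<dots> \<le> 2 / real (Suc k) ^ 3"
    proof -
      have "1 / real n - 1 / real m = (2 * real k + 3) / ((real k + 1)\<^sup>2 * (real k + 2)\<^sup>2)"
      proof -
        have *: "1 / x\<^sup>2 - 1 / (x + 1)\<^sup>2 = (2 * x + 1) / (x\<^sup>2 * (x + 1)\<^sup>2)" if "x > 0" for x :: real
          using that by (simp add: divide_simps) (simp add: power2_eq_square algebra_simps)
        have "real n = (real k + 1)\<^sup>2" "real m = (real k + 1 + 1)\<^sup>2"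
          unfolding n_def m_def sq_def by (simp_all add: add.commute)
        with *[of "real k + 1"] show ?thesis by (simp add: algebra_simps)
      qed
      also have "\<dots> \<le> 2 / (real k + 1) ^ 3"
      proof -
        have "(2 * real k + 3) * (real k + 1) ^ 3 \<le> 2 * ((real k + 1)\<^sup>2 * (real k + 2)\<^sup>2)"
          by (simp add: power2_eq_square power3_eq_cube algebra_simps)
        then show ?thesis by (simp add: frac_le_eq divide_le_eq pos_divide_le_eq field_simps)
      qed
      finally show ?thesis by (simp add: add.commute)
    qed
    finally have sqb: "(\<integral>w. (A (Suc k) w - A k w)\<^sup>2 \<partial>M) \<le> 2 / real (Suc k) ^ 3" .
    define a where "a = real (Suc k) powr (-(3/2))"
    have a: "a > 0" unfolding a_def by simp
    have "a * a = inverse (real (Suc k) ^ 3)"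
      unfolding a_def powr_add[symmetric] by (simp add: powr_minus powr_numeral)
    then have aa: "2 / real (Suc k) ^ 3 / a = 2 * a" using a by (simp add: field_simps)
    have "(\<integral>w. \<bar>A (Suc k) w - A k w\<bar> \<partial>M) \<le> ((\<integral>w. (A (Suc k) w - A k w)\<^sup>2 \<partial>M) / a + a) / 2"
    proof (rule abs_moment_le_second_moment[OF _ _ a])
      have "\<bar>A (Suc k) w - A k w\<bar> \<le> 1" for w using Ab[of k w] Ab[of "Suc k" w] by linarith
      then have "(A (Suc k) w - A k w)\<^sup>2 \<le> 1" for w using abs_square_le_1 by blast
      then show "integrable M (\<lambda>w. (A (Suc k) w - A k w)\<^sup>2)"
        by (intro integrable_const_bound[where B=1]) auto
    qed (use intA in auto)
    also have "\<dots> \<le> (2 / real (Suc k) ^ 3 / a + a) / 2"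
      using sqb a by (intro divide_right_mono add_right_mono) auto
    also have "\<dots> = c k" by (simp only: aa) (simp add: c_def a_def)
    finally show ?thesis .
  qed
  have "AE w in M. convergent (\<lambda>k. A k w)"
    by (rule summable_increments(1)[OF intA csum bound])
  then show ?thesis
  proof eventually_elim
    case (elim w)
    have "convergent (\<lambda>n. S n w / real n)"
      by (rule convergent_along_squares)
        (use elim Y01 in \<open>auto simp: S_def A_def sq_def\<close>)
    then show ?case by (simp add: S_def)
  qed
qed

text \<open>The companions of a fixed index are counted from the next index on, so that the permutations in
  question can fix it; this undoes the shift.\<close>

lemma convergent_frequency_shift:
  fixes F S :: "nat \<Rightarrow> real"
  assumes S: "convergent (\<lambda>n. S n / real n)" and F: "\<And>n. F (n + k) = c + S n"
  shows "convergent (\<lambda>N. F N / real N)"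
proof -
  obtain L where L: "(\<lambda>n. S n / real n) \<longlonglongrightarrow> L" using S by (auto simp: convergent_def)
  have 1: "(\<lambda>n. real n / real (n + k)) \<longlonglongrightarrow> 1" by real_asymp
  have 2: "(\<lambda>n. c / real (n + k)) \<longlonglongrightarrow> 0" by real_asymp
  have "(\<lambda>n. c / real (n + k) + S n / real n * (real n / real (n + k))) \<longlonglongrightarrow> 0 + L * 1"
    by (intro tendsto_add tendsto_mult L 1 2)
  moreover have "eventually (\<lambda>n. c / real (n + k) + S n / real n * (real n / real (n + k)) = F (n + k) / real (n + k)) sequentially"
    using eventually_gt_at_top[of 0] by eventually_elim (simp add: F add_divide_distrib)
  ultimately have "(\<lambda>n. F (n + k) / real (n + k)) \<longlonglongrightarrow> 0 + L * 1"
    by (rule Lim_transform_eventually)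
  then have "(\<lambda>n. F (n + k) / real (n + k)) \<longlonglongrightarrow> L" by simp
  then have "(\<lambda>N. F N / real N) \<longlonglongrightarrow> L" by (rule LIMSEQ_offset)
  then show ?thesis by (auto simp: convergent_def)
qed

subsection \<open>A Glivenko--Cantelli theorem\<close>

text \<open>Ranks among the first \<open>N\<close> values, with ties excluded or included. Both are needed because
  exchangeable variables may coincide with positive probability.\<close>

definition strictly_above :: "nat \<Rightarrow> nat \<Rightarrow> (nat \<Rightarrow> real) \<Rightarrow> real"
  where "strictly_above N j x = real (card {l. l < N \<and> x j < x l})"

definition weakly_above :: "nat \<Rightarrow> nat \<Rightarrow> (nat \<Rightarrow> real) \<Rightarrow> real"
  where "weakly_above N j x = real (card {l. l < N \<and> x j \<le> x l})"

lemma card_Collect_less_eq_sum: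
  "real (card {l. l < (N::nat) \<and> Q l}) = (\<Sum>l<N. if Q l then 1 else 0)"
proof -
  have "{l. l < N \<and> Q l} = {l\<in>{..<N}. Q l}" by auto
  then show ?thesis by (simp flip: sum.inter_filter)
qed

lemma measurable_above[measurable]:
  "strictly_above N j \<in> borel_measurable (PiM UNIV (\<lambda>_. borel))"
  "weakly_above N j \<in> borel_measurable (PiM UNIV (\<lambda>_. borel))"
  unfolding strictly_above_def[abs_def] weakly_above_def[abs_def] card_Collect_less_eq_sum by measurable

lemma above_permute:
  assumes "\<sigma> permutes {..<n}" "n \<le> N"
  shows "strictly_above N j (\<lambda>l. x (\<sigma> l)) = strictly_above N (\<sigma> j) x"
    and "weakly_above N j (\<lambda>l. x (\<sigma> l)) = weakly_above N (\<sigma> j) x"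
proof -
  have p: "\<sigma> permutes {..<N}" by (rule permutes_subset[OF assms(1)]) (use assms(2) in auto)
  have *: "card {l. l < N \<and> Q (\<sigma> l)} = card {l. l < N \<and> Q l}" for Q
  proof -
    have "\<sigma> ` {l. l < N \<and> Q (\<sigma> l)} = {l. l < N \<and> Q l}"
    proof (intro set_eqI iffI)
      fix l assume l: "l \<in> {l. l < N \<and> Q l}"
      then have "l \<in> \<sigma> ` {..<N}" using permutes_image[OF p] by simp
      then obtain k where "k < N" "\<sigma> k = l" by auto
      with l show "l \<in> \<sigma> ` {l. l < N \<and> Q (\<sigma> l)}" by auto
    next
      fix l assume "l \<in> \<sigma> ` {l. l < N \<and> Q (\<sigma> l)}"
      then show "l \<in> {l. l < N \<and> Q l}" using permutes_in_image[OF p] by auto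
    qed
    moreover have "inj_on \<sigma> {l. l < N \<and> Q (\<sigma> l)}" by (rule inj_on_subset[OF permutes_inj[OF p]]) simp
    then have "card (\<sigma> ` {l. l < N \<and> Q (\<sigma> l)}) = card {l. l < N \<and> Q (\<sigma> l)}" by (rule card_image)
    ultimately show ?thesis by (simp only:)
  qed
  show "strictly_above N j (\<lambda>l. x (\<sigma> l)) = strictly_above N (\<sigma> j) x"
    "weakly_above N j (\<lambda>l. x (\<sigma> l)) = weakly_above N (\<sigma> j) x"
    unfolding strictly_above_def weakly_above_def
    using *[of "\<lambda>l. x (\<sigma> j) < x l"] *[of "\<lambda>l. x (\<sigma> j) \<le> x l"] by simp_all
qed

text \<open>The indices below the quantile \<open>c\<close> are bounded by looking at a smallest one of them, those
  above \<open>d\<close> by looking at a largest one.\<close>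

lemma many_indices_between_quantiles:
  fixes x :: "nat \<Rightarrow> real"
  assumes "0 \<le> c" "c < d" "d \<le> 1" "N > 0"
  shows "(d - c) * real N \<le> real (card {j. j < N \<and> strictly_above N j x \<le> d * real N \<and> c * real N \<le> weakly_above N j x})"
proof -
  define A where "A = {j. j < N \<and> weakly_above N j x < c * real N}"
  define D where "D = {j. j < N \<and> d * real N < strictly_above N j x}"
  define H where "H = {j. j < N \<and> strictly_above N j x \<le> d * real N \<and> c * real N \<le> weakly_above N j x}"
  have fin: "finite A" "finite D" "finite H" unfolding A_def D_def H_def by auto
  have A: "real (card A) \<le> c * real N"
  proof (cases "A = {}")
    case False
    define m where "m = Min (x ` A)"
    have "m \<in> x ` A" unfolding m_def using False fin by (intro Min_in) auto
    then obtain j where j: "j \<in> A" "x j = m" by auto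
    have "A \<subseteq> {l. l < N \<and> x j \<le> x l}"
      using fin(1) unfolding j(2) m_def by (auto simp: A_def)
    then have "real (card A) \<le> weakly_above N j x"
      unfolding weakly_above_def by (intro of_nat_mono card_mono) auto
    then show ?thesis using j(1) unfolding A_def by auto
  qed (use assms in auto)
  have D: "real (card D) \<le> (1 - d) * real N"
  proof (cases "D = {}")
    case False
    define m where "m = Max (x ` D)"
    have "m \<in> x ` D" unfolding m_def using False fin by (intro Max_in) auto
    then obtain j where j: "j \<in> D" "x j = m" by auto
    have le: "x l \<le> x j" if "l \<in> D" for l using that fin(2) unfolding j(2) m_def by auto
    have "{l. l < N \<and> x j < x l} \<subseteq> {..<N} - D"
      using le by (force simp: not_less)
    then have "strictly_above N j x \<le> real (card ({..<N} - D))"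
      unfolding strictly_above_def by (intro of_nat_mono card_mono) auto
    also have "\<dots> = real N - real (card D)"
    proof -
      have "D \<subseteq> {..<N}" unfolding D_def by auto
      then show ?thesis using card_mono[of "{..<N}" D] fin by (simp add: card_Diff_subset of_nat_diff)
    qed
    finally show ?thesis using j(1) unfolding D_def by (auto simp: algebra_simps)
  qed (use assms in auto)
  have "{..<N} \<subseteq> A \<union> D \<union> H" unfolding A_def D_def H_def by auto
  then have "card {..<N} \<le> card (A \<union> D \<union> H)" using fin by (intro card_mono) auto
  also have "\<dots> \<le> card A + card D + card H"
    by (meson add_right_mono card_Un_le order_trans)
  finally have "real N \<le> real (card A) + real (card D) + real (card H)" by (simp flip: of_nat_add)
  with A D show ?thesis unfolding H_def[symmetric] by (simp add: algebra_simps)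
qed

text \<open>Otherwise two rationals \<open>c < d\<close> fit strictly between the lower and the upper limit, which excludes
  both alternatives for them.\<close>

lemma convergent_between_rationals:
  fixes a :: "nat \<Rightarrow> real"
  assumes bd: "\<And>n. 0 \<le> a n" "\<And>n. a n \<le> 1"
    and dich: "\<And>c d. c \<in> \<rat> \<Longrightarrow> d \<in> \<rat> \<Longrightarrow> 0 \<le> c \<Longrightarrow> c < d \<Longrightarrow> d \<le> 1 \<Longrightarrow>
      (\<forall>\<epsilon>>0. eventually (\<lambda>n. a n \<le> d + \<epsilon>) sequentially) \<or> (\<forall>\<epsilon>>0. eventually (\<lambda>n. c - \<epsilon> \<le> a n) sequentially)"
  shows "convergent a"
proof (rule ccontr)
  assume nc: "\<not> convergent a"
  define u where "u = limsup (\<lambda>n. ereal (a n))"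
  define v where "v = liminf (\<lambda>n. ereal (a n))"
  have vu: "v \<le> u" unfolding u_def v_def by (rule Liminf_le_Limsup) simp
  have u1: "u \<le> 1" unfolding u_def using bd by (intro Limsup_bounded) (auto simp: one_ereal_def)
  have v0: "0 \<le> v" unfolding v_def using bd by (intro Liminf_bounded) auto
  obtain u' where u': "u = ereal u'" using u1 v0 vu by (cases u) auto
  obtain v' where v': "v = ereal v'" using u1 v0 vu by (cases v) auto
  have "v' \<noteq> u'"
  proof
    assume "v' = u'"
    then have "(\<lambda>n. ereal (a n)) \<longlonglongrightarrow> ereal u'"
      using tendsto_iff_Liminf_eq_Limsup[of sequentially "\<lambda>n. ereal (a n)" "ereal u'"] u' v' u_def v_def by simp
    then have "a \<longlonglongrightarrow> u'" by simp
    with nc show False by (auto simp: convergent_def)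
  qed
  then have "v' < u'" using vu u' v' by simp
  then obtain c where c: "c \<in> \<rat>" "v' < c" "c < u'" using Rats_dense_in_real by blast
  obtain d where d: "d \<in> \<rat>" "c < d" "d < u'" using Rats_dense_in_real[OF c(3)] by blast
  have "0 \<le> c" "d \<le> 1" using c d v0 u1 unfolding u' v' by (auto simp: one_ereal_def zero_ereal_def)
  from dich[OF c(1) d(1) this(1) d(2) this(2)] show False
  proof
    assume *: "\<forall>\<epsilon>>0. eventually (\<lambda>n. a n \<le> d + \<epsilon>) sequentially"
    have "eventually (\<lambda>n. a n \<le> d + (u' - d) / 2) sequentially" using * d by simp
    then have "u \<le> ereal (d + (u' - d) / 2)" unfolding u_def by (intro Limsup_bounded) simp
    then show False using d unfolding u' by (simp add: field_simps)
  next
    assume *: "\<forall>\<epsilon>>0. eventually (\<lambda>n. c - \<epsilon> \<le> a n) sequentially"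
    have "eventually (\<lambda>n. c - (c - v') / 2 \<le> a n) sequentially" using * c by simp
    then have "ereal (c - (c - v') / 2) \<le> v" unfolding v_def by (intro Liminf_bounded) simp
    then show False using c unfolding v' by (simp add: field_simps)
  qed
qed

text \<open>The frequencies of the values above \<open>T\<^sub>j\<close> exist for every index \<open>j\<close>, and almost surely some \<open>T\<^sub>j\<close>
  has its rank in any given rational interval; so the counting function at an arbitrary \<open>t\<close> is
  squeezed between counting functions at the \<open>T\<^sub>j\<close>. In particular \<open>t\<close> may depend on \<open>w\<close>.\<close>

theorem (in prob_space) exchangeable_glivenko_cantelli:
  fixes T :: "nat \<Rightarrow> 'a \<Rightarrow> real"
  assumes meas[measurable]: "\<And>l. T l \<in> borel_measurable M"
    and exch: "\<And>\<sigma> n. \<sigma> permutes {..<n} \<Longrightarrow>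
      distr M (PiM UNIV (\<lambda>_. borel)) (\<lambda>w l. T (\<sigma> l) w) = distr M (PiM UNIV (\<lambda>_. borel)) (\<lambda>w l. T l w)"
  shows "AE w in M. \<forall>t. convergent (\<lambda>N. real (card {l. l < N \<and> t < T l w}) / real N)"
proof -
  let ?P = "PiM UNIV (\<lambda>_::nat. borel :: real measure)"
  have mT[measurable]: "(\<lambda>w l. T (\<sigma> l) w) \<in> M \<rightarrow>\<^sub>M ?P" for \<sigma> :: "nat \<Rightarrow> nat"
    by (rule measurable_abs_UNIV) simp
  have sym: "(\<integral>w. h (\<lambda>l. T (\<sigma> l) w) \<partial>M) = (\<integral>w. h (\<lambda>l. T l w) \<partial>M)"
    if "\<sigma> permutes {..<n}" "h \<in> borel_measurable ?P" for \<sigma> n and h :: "(nat \<Rightarrow> real) \<Rightarrow> real"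
  proof -
    have "(\<integral>w. h (\<lambda>l. T (\<sigma> l) w) \<partial>M) = integral\<^sup>L (distr M ?P (\<lambda>w l. T (\<sigma> l) w)) h"
      by (rule integral_distr[symmetric]) (use that(2) mT[of \<sigma>] in auto)
    also have "\<dots> = integral\<^sup>L (distr M ?P (\<lambda>w l. T l w)) h" unfolding exch[OF that(1)] ..
    also have "\<dots> = (\<integral>w. h (\<lambda>l. T l w) \<partial>M)"
      by (rule integral_distr) (use that(2) mT[of "\<lambda>l. l"] in auto)
    finally show ?thesis .
  qed
  \<comment> \<open>For fixed \<open>j\<close> the indicators over the other indices have equal first and equal mixed second
    moments, which is what the pairwise law of large numbers requires.\<close>
  have freq: "AE w in M. convergent (\<lambda>N. real (card {l. l < N \<and> Q (T j w) (T l w)}) / real N)"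
    if Q[measurable]: "\<And>j l. Measurable.pred ?P (\<lambda>x. Q (x j) (x l))" for Q j
  proof -
    define h where "h = (\<lambda>l m x. (if Q (x j) (x l) then 1 else 0) * (if Q (x j) (x m) then 1 else (0::real)))"
    have hm: "h l m \<in> borel_measurable ?P" for l m unfolding h_def by measurable
    define Y where "Y = (\<lambda>l w. if Q (T j w) (T (j + 1 + l) w) then 1 else (0::real))"
    have YY: "Y l w * Y m w = h (j + 1 + l) (j + 1 + m) (\<lambda>l. T l w)" for l m w
      by (simp add: Y_def h_def)
    have [measurable]: "Y l \<in> borel_measurable M" for l
      using measurable_compose[OF mT[of "\<lambda>l. l"] Q[of j "j + 1 + l"]] unfolding Y_def by measurable
    have "AE w in M. convergent (\<lambda>n. (\<Sum>l<n. Y l w) / real n)"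
    proof (rule pairwise_exchangeable_average_converges)
      fix l show "(\<integral>w. Y l w * Y l w \<partial>M) = (\<integral>w. h (j + 1) (j + 1) (\<lambda>l. T l w) \<partial>M)"
      proof -
        define f where "f = (\<lambda>i. if i = j then j else j + 1 + l)"
        have "\<exists>\<sigma>. \<sigma> permutes {..<j + 2 + l} \<and> (\<forall>i\<in>{j, j + 1}. \<sigma> i = f i)"
          by (rule ex_permutes_extending) (auto simp: f_def inj_on_def)
        then obtain \<sigma> where \<sigma>: "\<sigma> permutes {..<j + 2 + l}" "\<sigma> j = j" "\<sigma> (j + 1) = j + 1 + l"
          by (auto simp: f_def)
        from sym[OF \<sigma>(1) hm[of "j + 1" "j + 1"]] show ?thesis
          unfolding YY by (simp add: h_def \<sigma>(2) \<sigma>(3)[simplified])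
      qed
    next
      fix l m :: nat assume "l \<noteq> m"
      show "(\<integral>w. Y l w * Y m w \<partial>M) = (\<integral>w. h (j + 1) (j + 2) (\<lambda>l. T l w) \<partial>M)"
      proof -
        define f where "f = (\<lambda>i. if i = j then j else if i = j + 1 then j + 1 + l else j + 1 + m)"
        have "\<exists>\<sigma>. \<sigma> permutes {..<j + 3 + l + m} \<and> (\<forall>i\<in>{j, j + 1, j + 2}. \<sigma> i = f i)"
          by (rule ex_permutes_extending) (use \<open>l \<noteq> m\<close> in \<open>auto simp: f_def inj_on_def\<close>)
        then obtain \<sigma> where \<sigma>: "\<sigma> permutes {..<j + 3 + l + m}" "\<sigma> j = j" "\<sigma> (j + 1) = j + 1 + l" "\<sigma> (j + 2) = j + 1 + m"
          by (auto simp: f_def)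
        from sym[OF \<sigma>(1) hm[of "j + 1" "j + 2"]] show ?thesis
          unfolding YY by (simp add: h_def \<sigma>(2) \<sigma>(3,4)[simplified])
      qed
    qed (auto simp: Y_def)
    then show ?thesis
    proof eventually_elim
      case (elim w)
      show ?case
      proof (rule convergent_frequency_shift[OF elim])
        fix n
        show "real (card {l. l < n + (j + 1) \<and> Q (T j w) (T l w)}) =
          real (card {l. l < j + 1 \<and> Q (T j w) (T l w)}) + (\<Sum>l<n. Y l w)"
          unfolding card_Collect_less_eq_sum by (induction n) (simp_all add: Y_def add.commute)
      qed
    qed
  qed
  define g where "g = (\<lambda>j x. lim (\<lambda>N. strictly_above N j x / real N))"
  define G where "G = (\<lambda>j x. lim (\<lambda>N. weakly_above N j x / real N))"
  have [measurable]: "g j \<in> borel_measurable ?P" "G j \<in> borel_measurable ?P" for j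
    unfolding g_def G_def by measurable
  let ?T = "\<lambda>w l. T l w"
  have conv: "AE w in M. \<forall>j. (\<lambda>N. strictly_above N j (?T w) / real N) \<longlonglongrightarrow> g j (?T w) \<and>
      (\<lambda>N. weakly_above N j (?T w) / real N) \<longlonglongrightarrow> G j (?T w)"
  proof -
    have "AE w in M. convergent (\<lambda>N. strictly_above N j (?T w) / real N)" for j
      unfolding strictly_above_def by (rule freq) measurable
    moreover have "AE w in M. convergent (\<lambda>N. weakly_above N j (?T w) / real N)" for j
      unfolding weakly_above_def by (rule freq) (simp only: not_less[symmetric], measurable)
    ultimately show ?thesis unfolding g_def G_def convergent_LIMSEQ_iff AE_all_countable by auto
  qed
  \<comment> \<open>At least \<open>(d - c) * N\<close> of the first \<open>N\<close> indices have an empirical rank between \<open>c\<close> and \<open>d\<close>.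
    On the event that no index has a limiting rank there, each of them contributes an error
    \<open>F N j = 1\<close>; but the errors have the common mean \<open>e N\<close>, which tends to 0.\<close>
  have dense: "AE w in M. \<exists>j. g j (?T w) \<le> d \<and> c \<le> G j (?T w)" if cd: "0 \<le> c" "c < d" "d \<le> 1" for c d
  proof -
    define HN where "HN = (\<lambda>N j x. if strictly_above N j x \<le> d * real N \<and> c * real N \<le> weakly_above N j x then 1 else (0::real))"
    define Hb where "Hb = (\<lambda>j x. if g j x \<le> d \<and> c \<le> G j x then 1 else (0::real))"
    define F where "F = (\<lambda>N j x. max 0 (HN N j x - Hb j x))"
    have Fm[measurable]: "F N j \<in> borel_measurable ?P" for N j unfolding F_def HN_def Hb_def by measurable
    have FT[measurable]: "(\<lambda>w. F N j (?T w)) \<in> borel_measurable M" for N j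
      by (rule measurable_compose[OF mT[of "\<lambda>l. l"] Fm])
    have F01: "0 \<le> F N j x" "F N j x \<le> 1" for N j x unfolding F_def HN_def Hb_def by auto
    have intF: "integrable M (\<lambda>w. F N j (?T w))" for N j
      by (rule integrable_const_bound[where B=1]) (use F01 in auto)
    define e where "e = (\<lambda>N. \<integral>w. F N 0 (?T w) \<partial>M)"
    have ej: "(\<integral>w. F N j (?T w) \<partial>M) = e N" if "j < N" for N j
    proof -
      define \<sigma> where "\<sigma> = Transposition.transpose 0 j"
      have \<sigma>: "\<sigma> permutes {..<N}" unfolding \<sigma>_def using that by (intro permutes_swap_id) auto
      have s0: "\<sigma> 0 = j" unfolding \<sigma>_def by simp
      have "g 0 (\<lambda>l. x (\<sigma> l)) = g j x" "G 0 (\<lambda>l. x (\<sigma> l)) = G j x" for x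
        unfolding g_def G_def by (rule lim_eventually_eq[of N], simp add: above_permute[OF \<sigma>] s0)+
      then have Feq: "F N 0 (\<lambda>l. x (\<sigma> l)) = F N j x" for x
        unfolding F_def HN_def Hb_def using above_permute[OF \<sigma>, of N 0 x] by (simp add: s0)
      have "(\<lambda>w. F N j (?T w)) = (\<lambda>w. F N 0 (\<lambda>l. T (\<sigma> l) w))"
        by (intro ext) (rule Feq[of "\<lambda>l. T l w" for w, symmetric])
      then show ?thesis using sym[OF \<sigma> Fm[of N 0]] unfolding e_def by simp
    qed
    have e0: "e \<longlonglongrightarrow> 0"
    proof -
      have "(\<lambda>N. \<integral>w. F N 0 (?T w) \<partial>M) \<longlonglongrightarrow> (\<integral>w. 0 \<partial>M)"
      proof (rule integral_dominated_convergence[where w="\<lambda>_. 1"])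
        show "AE w in M. (\<lambda>N. F N 0 (?T w)) \<longlonglongrightarrow> 0"
          using conv
        proof eventually_elim
          case (elim w)
          define x where "x = ?T w"
          have l: "(\<lambda>N. strictly_above N 0 x / real N) \<longlonglongrightarrow> g 0 x" "(\<lambda>N. weakly_above N 0 x / real N) \<longlonglongrightarrow> G 0 x"
            using elim unfolding x_def by auto
          have "eventually (\<lambda>N. F N 0 x = 0) sequentially"
          proof (cases "g 0 x \<le> d \<and> c \<le> G 0 x")
            case True
            then show ?thesis by (simp add: F_def HN_def Hb_def)
          next
            case False
            then consider "g 0 x > d" | "G 0 x < c" by linarith
            then have "eventually (\<lambda>N. HN N 0 x = 0) sequentially"
            proof cases
              case 1
              from order_tendstoD(1)[OF l(1) 1] eventually_gt_at_top[of 0] show ?thesis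
                by eventually_elim (auto simp: HN_def field_simps)
            next
              case 2
              from order_tendstoD(2)[OF l(2) 2] eventually_gt_at_top[of 0] show ?thesis
                by eventually_elim (auto simp: HN_def field_simps)
            qed
            then show ?thesis by eventually_elim (auto simp: F_def Hb_def)
          qed
          then show ?case unfolding x_def by (rule tendsto_eventually)
        qed
      qed (use F01 in auto)
      then show ?thesis unfolding e_def by simp
    qed
    define B where "B = {w\<in>space M. \<forall>j. Hb j (?T w) = 0}"
    have Bm[measurable]: "B \<in> sets M"
    proof -
      have "(\<lambda>w. Hb j (?T w)) \<in> borel_measurable M" for j
        by (rule measurable_compose[OF mT[of "\<lambda>l. l"]]) (simp add: Hb_def)
      then show ?thesis unfolding B_def by measurable
    qed
    have le: "(d - c) * measure M B \<le> e N" if "N > 0" for N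
    proof -
      have "(d - c) * real N * indicator B w \<le> (\<Sum>j<N. F N j (?T w))" if "w \<in> space M" for w
      proof (cases "w \<in> B")
        case True
        then have "F N j (?T w) = HN N j (?T w)" for j unfolding B_def F_def HN_def by auto
        then have "(\<Sum>j<N. F N j (?T w)) = real (card {j. j < N \<and> strictly_above N j (?T w) \<le> d * real N \<and> c * real N \<le> weakly_above N j (?T w)})"
          unfolding card_Collect_less_eq_sum HN_def by simp
        then show ?thesis using many_indices_between_quantiles[OF cd \<open>N > 0\<close>, of "?T w"] True by simp
      qed (use F01 in \<open>auto intro: sum_nonneg\<close>)
      then have "(\<integral>w. (d - c) * real N * indicator B w \<partial>M) \<le> (\<integral>w. (\<Sum>j<N. F N j (?T w)) \<partial>M)"
        using intF by (intro integral_mono integrable_mult_right Bochner_Integration.integrable_sum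
            integrable_real_indicator) (auto simp: emeasure_eq_measure)
      also have "\<dots> = (\<Sum>j<N. e N)" using intF ej by simp
      finally show ?thesis using that by simp
    qed
    have "(d - c) * measure M B \<le> 0"
      by (rule tendsto_lowerbound[OF e0]) (use le in \<open>auto simp: eventually_sequentially intro!: exI[of _ 1]\<close>)
    then have "measure M B = 0" using cd by (simp add: mult_le_0_iff measure_le_0_iff)
    then have "AE w in M. w \<notin> B"
      by (intro AE_not_in) (simp add: null_sets_def emeasure_eq_measure)
    then show ?thesis using AE_space
      by eventually_elim (auto simp: B_def Hb_def split: if_splits)
  qed
  have "AE w in M. \<forall>c\<in>\<rat>. \<forall>d\<in>\<rat>. 0 \<le> c \<longrightarrow> c < d \<longrightarrow> d \<le> 1 \<longrightarrow> (\<exists>j. g j (?T w) \<le> d \<and> c \<le> G j (?T w))"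
  proof (intro AE_ball_countable[THEN iffD2] ballI countable_rat)
    fix c d :: real
    show "AE w in M. 0 \<le> c \<longrightarrow> c < d \<longrightarrow> d \<le> 1 \<longrightarrow> (\<exists>j. g j (?T w) \<le> d \<and> c \<le> G j (?T w))"
      using dense[of c d] by (cases "0 \<le> c \<and> c < d \<and> d \<le> 1") auto
  qed
  then show ?thesis using conv
  proof eventually_elim
    case (elim w)
    define x where "x = ?T w"
    show ?case
    proof
      fix t
      define a where "a = (\<lambda>N. real (card {l. l < N \<and> t < x l}) / real N)"
      have mono: "card {l. l < N \<and> A l} \<le> card {l. l < N \<and> B l}" if "\<And>l. A l \<Longrightarrow> B l" for A B :: "nat \<Rightarrow> bool" and N :: nat
        by (intro card_mono) (use that in auto)
      have "convergent a"
      proof (rule convergent_between_rationals)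
        fix n show "0 \<le> a n" by (simp add: a_def)
        have "card {l. l < n \<and> t < x l} \<le> card {..<n}" by (intro card_mono) auto
        then show "a n \<le> 1" by (cases "n = 0") (auto simp: a_def divide_le_eq_1)
      next
        fix c d :: real assume cd: "c \<in> \<rat>" "d \<in> \<rat>" "0 \<le> c" "c < d" "d \<le> 1"
        from elim(1) cd obtain j where j: "g j x \<le> d" "c \<le> G j x" unfolding x_def by blast
        have l: "(\<lambda>N. strictly_above N j x / real N) \<longlonglongrightarrow> g j x" "(\<lambda>N. weakly_above N j x / real N) \<longlonglongrightarrow> G j x"
          using elim(2) unfolding x_def by auto
        show "(\<forall>\<epsilon>>0. eventually (\<lambda>n. a n \<le> d + \<epsilon>) sequentially) \<or> (\<forall>\<epsilon>>0. eventually (\<lambda>n. c - \<epsilon> \<le> a n) sequentially)"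
        proof (cases "x j \<le> t")
          case True
          have *: "a N \<le> strictly_above N j x / real N" for N
            unfolding a_def strictly_above_def using True by (intro divide_right_mono of_nat_mono mono) auto
          have "eventually (\<lambda>n. a n \<le> d + \<epsilon>) sequentially" if "\<epsilon> > 0" for \<epsilon>
          proof -
            have "eventually (\<lambda>N. strictly_above N j x / real N < d + \<epsilon>) sequentially"
              using l(1) by (rule order_tendstoD) (use j that in simp)
            then show ?thesis by eventually_elim (use * in \<open>meson less_imp_le order_trans\<close>)
          qed
          then show ?thesis by blast
        next
          case False
          have *: "weakly_above N j x / real N \<le> a N" for N
            unfolding a_def weakly_above_def using False by (intro divide_right_mono of_nat_mono mono) auto
          have "eventually (\<lambda>n. c - \<epsilon> \<le> a n) sequentially" if "\<epsilon> > 0" for \<epsilon>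
          proof -
            have "eventually (\<lambda>N. c - \<epsilon> < weakly_above N j x / real N) sequentially"
              using l(2) by (rule order_tendstoD) (use j that in simp)
            then show ?thesis by eventually_elim (use * in \<open>meson less_imp_le order_trans\<close>)
          qed
          then show ?thesis by blast
        qed
      qed
      then show "convergent (\<lambda>N. real (card {l. l < N \<and> t < T l w}) / real N)"
        unfolding a_def x_def .
    qed
  qed
qed

section \<open>Partitions with block frequencies\<close>

definition mean_power :: "real \<Rightarrow> nat set set \<Rightarrow> nat \<Rightarrow> real"
  where "mean_power \<alpha> P N = (\<Sum>i=1..N. freq P i powr \<alpha>) / real N"

text \<open>For a partition with block frequencies, \<open>mass_moment \<alpha>\<close> is the sum of \<open>|B| powr (1 + \<alpha>)\<close> over
  the blocks. As a limit of averages over labels it is a measurable function of every partition and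
  is visibly monotone under refinement.\<close>

definition mass_moment :: "real \<Rightarrow> nat set set \<Rightarrow> real"
  where "mass_moment \<alpha> P = lim (mean_power \<alpha> P)"

lemma measurable_mass_moment[measurable]: "mass_moment \<alpha> \<in> borel_measurable partition_algebra"
  unfolding mass_moment_def[abs_def] mean_power_def by measurable

lemma emp_freq_bounds: "0 \<le> emp_freq P i N" "emp_freq P i N \<le> 1"
proof -
  have "block_count P i N \<le> card {1..N}" unfolding block_count_def by (intro card_mono) auto
  then show "0 \<le> emp_freq P i N" "emp_freq P i N \<le> 1"
    unfolding emp_freq_def by (auto simp: divide_le_eq_1) 
qed

lemma emp_freq_tendsto: "regular P \<Longrightarrow> 1 \<le> i \<Longrightarrow> emp_freq P i \<longlonglongrightarrow> freq P i"
  unfolding regular_def freq_eq_lim by (simp add: convergent_LIMSEQ_iff)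

lemma freq_bounds:
  assumes "regular P" "1 \<le> i" shows "0 \<le> freq P i" "freq P i \<le> 1"
  using LIMSEQ_le_const[OF emp_freq_tendsto[OF assms], of 0]
    LIMSEQ_le_const2[OF emp_freq_tendsto[OF assms], of 1] emp_freq_bounds by auto

lemma freq_antimono:
  assumes "regular P" "regular Q" "1 \<le> i" "\<And>j. same_block P i j \<Longrightarrow> same_block Q i j"
  shows "freq P i \<le> freq Q i"
proof (rule LIMSEQ_le[OF emp_freq_tendsto[OF assms(1,3)] emp_freq_tendsto[OF assms(2,3)]])
  have "emp_freq P i N \<le> emp_freq Q i N" for N
    unfolding emp_freq_def block_count_def block_of_def
    by (intro divide_right_mono of_nat_mono card_mono) (use assms(4) in auto)
  then show "\<exists>N. \<forall>n\<ge>N. emp_freq P i n \<le> emp_freq Q i n" by blast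
qed

locale regular_partition =
  fixes P :: "nat set set"
  assumes part: "partition_on positive_nats P" and reg: "regular P"
begin

abbreviation "af \<equiv> asymptotic_frequency"

lemma block_nonempty: "B \<in> P \<Longrightarrow> \<exists>i\<in>B. 1 \<le> i"
  using part unfolding partition_on_def by (metis UnionI atLeast_iff ex_in_conv)

lemma freq_eq_af: "B \<in> P \<Longrightarrow> i \<in> B \<Longrightarrow> freq P i = af B"
  unfolding freq_def using block_of_eq[OF part] by simp

lemma af_tendsto:
  assumes "B \<in> P" shows "(\<lambda>N. real (card (B \<inter> {1..N})) / real N) \<longlonglongrightarrow> af B"
proof -
  obtain i where i: "i \<in> B" "1 \<le> i" using block_nonempty[OF assms] by auto
  have "emp_freq P i = (\<lambda>N. real (card (B \<inter> {1..N})) / real N)"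
    unfolding emp_freq_def block_count_def using block_of_eq[OF part assms i(1)] by auto
  with emp_freq_tendsto[OF reg i(2)] freq_eq_af[OF assms i(1)] show ?thesis by simp
qed

lemma af_bounds: assumes "B \<in> P" shows "0 \<le> af B" "af B \<le> 1"
proof -
  obtain i where i: "i \<in> B" "1 \<le> i" using block_nonempty[OF assms] by auto
  show "0 \<le> af B" "af B \<le> 1" using freq_bounds[OF reg i(2)] freq_eq_af[OF assms i(1)] by auto
qed

lemma sum_over_blocks:
  assumes F: "finite F" "F \<subseteq> P"
  shows "(\<Sum>B\<in>F. \<Sum>i\<in>B \<inter> {1..N}. f i) = (\<Sum>i\<in>\<Union>F \<inter> {1..N}. f i)"
proof -
  have "(\<Sum>i\<in>(\<Union>B\<in>F. B \<inter> {1..N}). f i) = (\<Sum>B\<in>F. \<Sum>i\<in>B \<inter> {1..N}. f i)"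
  proof (rule sum.UNION_disjoint)
    show "\<forall>A\<in>F. \<forall>B\<in>F. A \<noteq> B \<longrightarrow> A \<inter> {1..N} \<inter> (B \<inter> {1..N}) = {}"
      using part F(2) unfolding partition_on_def disjoint_def by blast
  qed (use F in auto)
  moreover have "(\<Union>B\<in>F. B \<inter> {1..N}) = \<Union>F \<inter> {1..N}" by blast
  ultimately show ?thesis by (simp only:)
qed

lemma sum_af_le_1:
  assumes F: "finite F" "F \<subseteq> P" shows "(\<Sum>B\<in>F. af B) \<le> 1"
proof -
  have "(\<lambda>N. \<Sum>B\<in>F. real (card (B \<inter> {1..N})) / real N) \<longlonglongrightarrow> (\<Sum>B\<in>F. af B)"
    using F af_tendsto by (intro tendsto_sum) auto
  moreover have "(\<Sum>B\<in>F. real (card (B \<inter> {1..N})) / real N) \<le> 1" for N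
  proof -
    have "(\<Sum>B\<in>F. real (card (B \<inter> {1..N}))) = real (card (\<Union>F \<inter> {1..N}))"
      using sum_over_blocks[OF F, of "\<lambda>_. 1::real" N] by simp
    also have "\<dots> \<le> real (card {1..N})" by (intro of_nat_mono card_mono) auto
    finally have "(\<Sum>B\<in>F. real (card (B \<inter> {1..N}))) \<le> real N" by simp
    then show ?thesis
      by (cases "N = 0") (auto simp: divide_le_eq_1 simp flip: sum_divide_distrib)
  qed
  ultimately show ?thesis by (intro LIMSEQ_le_const2) auto
qed

lemma finite_large_blocks:
  assumes "\<epsilon> > 0" shows "finite {B\<in>P. \<epsilon> < af B}"
proof (rule ccontr)
  assume inf: "infinite {B\<in>P. \<epsilon> < af B}"
  obtain n :: nat where n: "1 / \<epsilon> < real n" using reals_Archimedean2 by blast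
  obtain F where F: "finite F" "card F = n" "F \<subseteq> {B\<in>P. \<epsilon> < af B}"
    using infinite_arbitrarily_large[OF inf] by blast
  have "real n * \<epsilon> = (\<Sum>B\<in>F. \<epsilon>)" using F by simp
  also have "\<dots> \<le> (\<Sum>B\<in>F. af B)" using F by (intro sum_mono) auto
  also have "\<dots> \<le> 1" using F by (intro sum_af_le_1) auto
  finally show False using n assms by (simp add: field_simps)
qed

text \<open>Blocks of frequency at most \<open>\<epsilon>\<close> contribute at most \<open>\<epsilon> powr \<alpha>\<close> to the average, and only finitely
  many blocks are larger.\<close>

lemma mass_moment_characterization:
  assumes \<alpha>: "\<alpha> > 0"
  shows "mean_power \<alpha> P \<longlonglongrightarrow> mass_moment \<alpha> P"
    and "\<And>F. finite F \<Longrightarrow> F \<subseteq> P \<Longrightarrow> (\<Sum>B\<in>F. af B powr (1 + \<alpha>)) \<le> mass_moment \<alpha> P"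
    and "\<And>\<epsilon>. \<epsilon> > 0 \<Longrightarrow> \<exists>F. finite F \<and> F \<subseteq> P \<and> mass_moment \<alpha> P - \<epsilon> \<le> (\<Sum>B\<in>F. af B powr (1 + \<alpha>))"
proof -
  define \<Sigma> where "\<Sigma> = (\<lambda>F. \<Sum>B\<in>F. af B powr (1 + \<alpha>))"
  define S where "S = {\<Sigma> F |F. finite F \<and> F \<subseteq> P}"
  have le1: "x powr \<alpha> \<le> 1" if "0 \<le> x" "x \<le> 1" for x :: real
    using powr_mono2[of \<alpha> x 1] that \<alpha> by simp
  have pw: "af B powr (1 + \<alpha>) = af B powr \<alpha> * af B" if "B \<in> P" for B
    using af_bounds[OF that] by (cases "af B = 0") (auto simp: powr_add)
  have \<Sigma>1: "\<Sigma> F \<le> 1" if "finite F" "F \<subseteq> P" for F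
  proof -
    have "\<Sigma> F \<le> (\<Sum>B\<in>F. af B)"
      unfolding \<Sigma>_def
    proof (rule sum_mono)
      fix B assume "B \<in> F"
      then have "B \<in> P" using that by auto
      then show "af B powr (1 + \<alpha>) \<le> af B"
        using pw[of B] af_bounds[of B] le1[of "af B"] mult_right_mono[of "af B powr \<alpha>" 1 "af B"] by simp
    qed
    with sum_af_le_1[OF that] show ?thesis by simp
  qed
  have bdd: "bdd_above S" unfolding S_def using \<Sigma>1 by (intro bdd_aboveI[of _ 1]) auto
  have ne: "S \<noteq> {}" unfolding S_def by blast
  have up: "\<Sigma> F \<le> Sup S" if "finite F" "F \<subseteq> P" for F
    using that by (intro cSup_upper bdd) (auto simp: S_def)
  have near: "\<exists>F. finite F \<and> F \<subseteq> P \<and> Sup S - \<epsilon> \<le> \<Sigma> F" if "\<epsilon> > 0" for \<epsilon>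
  proof -
    have "Sup S - \<epsilon> < Sup S" using that by simp
    then obtain x where "x \<in> S" "Sup S - \<epsilon> < x" using less_cSup_iff[OF ne bdd] by blast
    then show ?thesis unfolding S_def by fastforce
  qed
  define part_mean where "part_mean = (\<lambda>F N. (\<Sum>B\<in>F. af B powr \<alpha> * (real (card (B \<inter> {1..N})) / real N)))"
  have pm_lim: "part_mean F \<longlonglongrightarrow> \<Sigma> F" if "finite F" "F \<subseteq> P" for F
  proof -
    have "part_mean F \<longlonglongrightarrow> (\<Sum>B\<in>F. af B powr \<alpha> * af B)"
      unfolding part_mean_def using that af_tendsto by (intro tendsto_sum tendsto_mult tendsto_const) auto
    also have "(\<Sum>B\<in>F. af B powr \<alpha> * af B) = \<Sigma> F"
      unfolding \<Sigma>_def using that pw by (intro sum.cong refl) auto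
    finally show ?thesis .
  qed
  have pm_eq: "part_mean F N = (\<Sum>i\<in>\<Union>F \<inter> {1..N}. freq P i powr \<alpha>) / real N" if "finite F" "F \<subseteq> P" for F N
  proof -
    have "(\<Sum>i\<in>\<Union>F \<inter> {1..N}. freq P i powr \<alpha>) = (\<Sum>B\<in>F. \<Sum>i\<in>B \<inter> {1..N}. freq P i powr \<alpha>)"
      by (rule sum_over_blocks[OF that, symmetric])
    also have "\<dots> = (\<Sum>B\<in>F. \<Sum>i\<in>B \<inter> {1..N}. af B powr \<alpha>)"
      using that freq_eq_af by (intro sum.cong refl) auto
    finally show ?thesis unfolding part_mean_def by (simp add: sum_divide_distrib mult.commute)
  qed
  have lower: "part_mean F N \<le> mean_power \<alpha> P N" if "finite F" "F \<subseteq> P" for F N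
    unfolding pm_eq[OF that] mean_power_def
    by (intro divide_right_mono sum_mono2) auto
  have upper: "mean_power \<alpha> P N \<le> part_mean {B\<in>P. \<epsilon> < af B} N + \<epsilon> powr \<alpha>" if "\<epsilon> > 0" for \<epsilon> N
  proof -
    define F where "F = {B\<in>P. \<epsilon> < af B}"
    have F: "finite F" "F \<subseteq> P" unfolding F_def using finite_large_blocks[OF that] by auto
    have "(\<Sum>i=1..N. freq P i powr \<alpha>) = (\<Sum>i\<in>\<Union>F \<inter> {1..N}. freq P i powr \<alpha>) + (\<Sum>i\<in>{1..N} - \<Union>F. freq P i powr \<alpha>)"
      by (subst sum.union_disjoint[symmetric]) (auto intro!: sum.cong)
    also have "(\<Sum>i\<in>{1..N} - \<Union>F. freq P i powr \<alpha>) \<le> (\<Sum>i\<in>{1..N} - \<Union>F. \<epsilon> powr \<alpha>)"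
    proof (rule sum_mono)
      fix i assume i: "i \<in> {1..N} - \<Union>F"
      have b: "block_of P i \<in> P" "i \<in> block_of P i" 
        using block_of_in[OF part, of i] i same_block_refl[OF part, of i] by (auto simp: block_of_def)
      with i have "freq P i \<le> \<epsilon>" using freq_eq_af[OF b] by (force simp: F_def)
      then show "freq P i powr \<alpha> \<le> \<epsilon> powr \<alpha>" using freq_bounds[OF reg, of i] i \<alpha> by (intro powr_mono2) auto
    qed
    also have "\<dots> \<le> real N * \<epsilon> powr \<alpha>"
    proof -
      have "card ({1..N} - \<Union>F) \<le> card {1..N}" by (intro card_mono) auto
      then show ?thesis by (simp add: mult_right_mono)
    qed
    finally have "(\<Sum>i=1..N. freq P i powr \<alpha>) \<le> (\<Sum>i\<in>\<Union>F \<inter> {1..N}. freq P i powr \<alpha>) + real N * \<epsilon> powr \<alpha>"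
      by simp
    then have "mean_power \<alpha> P N \<le> ((\<Sum>i\<in>\<Union>F \<inter> {1..N}. freq P i powr \<alpha>) + real N * \<epsilon> powr \<alpha>) / real N"
      unfolding mean_power_def by (intro divide_right_mono) auto
    also have "\<dots> \<le> part_mean F N + \<epsilon> powr \<alpha>"
      unfolding pm_eq[OF F] by (cases "N = 0") (auto simp: add_divide_distrib)
    finally show ?thesis unfolding F_def .
  qed
  have lim: "mean_power \<alpha> P \<longlonglongrightarrow> Sup S"
  proof (rule LIMSEQ_I)
    fix e :: real assume e: "e > 0"
    obtain F where F: "finite F" "F \<subseteq> P" "Sup S - e / 2 \<le> \<Sigma> F" using near[of "e / 2"] e by auto
    define \<epsilon> where "\<epsilon> = (e / 2) powr (1 / \<alpha>)"
    have \<epsilon>: "\<epsilon> > 0" "\<epsilon> powr \<alpha> = e / 2" unfolding \<epsilon>_def using e \<alpha> by (auto simp: powr_powr)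
    define G where "G = {B\<in>P. \<epsilon> < af B}"
    have G: "finite G" "G \<subseteq> P" unfolding G_def using finite_large_blocks[OF \<epsilon>(1)] by auto
    have "eventually (\<lambda>N. part_mean F N > \<Sigma> F - e / 2) sequentially"
      using pm_lim[OF F(1,2)] by (rule order_tendstoD) (use e in simp)
    moreover have "eventually (\<lambda>N. part_mean G N < \<Sigma> G + e / 2) sequentially"
      using pm_lim[OF G] by (rule order_tendstoD) (use e in simp)
    ultimately have "eventually (\<lambda>N. norm (mean_power \<alpha> P N - Sup S) < e) sequentially"
    proof eventually_elim
      case (elim N)
      have "mean_power \<alpha> P N > Sup S - e" using elim(1) lower[OF F(1,2), of N] F(3) by simp
      moreover have "mean_power \<alpha> P N < Sup S + e"
        using elim(2) upper[OF \<epsilon>(1), of N] up[OF G] \<epsilon>(2) unfolding G_def[symmetric] by simp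
      ultimately show ?case by (simp add: abs_less_iff)
    qed
    then show "\<exists>no. \<forall>n\<ge>no. norm (mean_power \<alpha> P n - Sup S) < e" by (simp add: eventually_sequentially)
  qed
  then have eq: "mass_moment \<alpha> P = Sup S" unfolding mass_moment_def by (rule limI)
  show "mean_power \<alpha> P \<longlonglongrightarrow> mass_moment \<alpha> P" using lim eq by simp
  show "\<And>F. finite F \<Longrightarrow> F \<subseteq> P \<Longrightarrow> (\<Sum>B\<in>F. af B powr (1 + \<alpha>)) \<le> mass_moment \<alpha> P"
    using up unfolding \<Sigma>_def eq .
  show "\<And>\<epsilon>. \<epsilon> > 0 \<Longrightarrow> \<exists>F. finite F \<and> F \<subseteq> P \<and> mass_moment \<alpha> P - \<epsilon> \<le> (\<Sum>B\<in>F. af B powr (1 + \<alpha>))"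
    using near unfolding \<Sigma>_def eq .
qed

lemma freq_powr_le_mass_moment:
  assumes "\<alpha> > 0" "1 \<le> i" shows "freq P i powr (1 + \<alpha>) \<le> mass_moment \<alpha> P"
proof -
  have b: "block_of P i \<in> P" using block_of_in[OF part, of i] assms by auto
  then show ?thesis using mass_moment_characterization(2)[OF assms(1), of "{block_of P i}"]
    by (simp add: freq_def)
qed

lemma mean_power_bounds: assumes "\<alpha> > 0" shows "0 \<le> mean_power \<alpha> P N" "mean_power \<alpha> P N \<le> 1"
proof -
  show "0 \<le> mean_power \<alpha> P N" unfolding mean_power_def by (auto intro!: divide_nonneg_nonneg sum_nonneg)
  have "freq P i powr \<alpha> \<le> 1" if "1 \<le> i" for i
    using powr_mono2[of \<alpha> "freq P i" 1] freq_bounds[OF reg that] assms by simp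
  then have "(\<Sum>i=1..N. freq P i powr \<alpha>) \<le> (\<Sum>i=1..N. 1)" by (intro sum_mono) auto
  then show "mean_power \<alpha> P N \<le> 1" unfolding mean_power_def by (cases "N = 0") auto
qed

lemma mass_moment_bounds: assumes "\<alpha> > 0" shows "0 \<le> mass_moment \<alpha> P" "mass_moment \<alpha> P \<le> 1"
  using LIMSEQ_le_const[OF mass_moment_characterization(1)[OF assms], of 0]
    LIMSEQ_le_const2[OF mass_moment_characterization(1)[OF assms], of 1] mean_power_bounds[OF assms] by auto

text \<open>The powers are those for which \<open>8/5 * (1 + 3/2) = 1 + 3\<close>.\<close>

lemma mass_moment_3_le: "mass_moment 3 P \<le> mass_moment (3/2) P powr (8/5)"
proof -
  define u where "u = mass_moment (3/2) P"
  have u0: "0 \<le> u" unfolding u_def by (rule mass_moment_bounds) simp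
  have pt: "freq P i powr 3 \<le> u powr (3/5) * freq P i powr (3/2)" if i: "1 \<le> i" for i
  proof -
    have "freq P i powr (5/2) \<le> u" using freq_powr_le_mass_moment[of "3/2" i] i by (simp add: u_def)
    then have "(freq P i powr (5/2)) powr (3/5) \<le> u powr (3/5)" by (intro powr_mono2) auto
    then have "freq P i powr (3/2) \<le> u powr (3/5)" by (simp add: powr_powr)
    then have "freq P i powr (3/2) * freq P i powr (3/2) \<le> u powr (3/5) * freq P i powr (3/2)"
      by (intro mult_right_mono) auto
    then show ?thesis by (simp flip: powr_add)
  qed
  have "mean_power 3 P N \<le> u powr (3/5) * mean_power (3/2) P N" for N
  proof -
    have "(\<Sum>i=1..N. freq P i powr 3) \<le> (\<Sum>i=1..N. u powr (3/5) * freq P i powr (3/2))"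
      using pt by (intro sum_mono) auto
    then show ?thesis unfolding mean_power_def sum_distrib_left[symmetric] times_divide_eq_right
      by (intro divide_right_mono) auto
  qed
  then have "mass_moment 3 P \<le> u powr (3/5) * u"
    unfolding u_def
    by (intro LIMSEQ_le[OF mass_moment_characterization(1) tendsto_mult_left[OF mass_moment_characterization(1)]]) auto
  also have "\<dots> = u powr (8/5)" using u0 by (cases "u = 0") (auto simp: powr_add[of u "3/5" 1, simplified])
  finally show ?thesis unfolding u_def .
qed

text \<open>Finite sums of squares of frequencies and of ranked frequencies dominate each other: removing a
  smallest block of a family of \<open>n\<close> blocks costs at most the \<open>n\<close>-th ranked square, and blocks nearly
  attaining the first \<open>n\<close> ranked values can be chosen one by one.\<close>

lemma suminf_ranked_frequency_squares: "(\<Sum>i. (ranked_frequency P (Suc i))\<^sup>2) = mass_moment 1 P"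
proof -
  define R where "R = ranked_frequency P"
  define A where "A = (\<lambda>i. {x. \<exists>F\<subseteq>P. card F = i \<and> (\<forall>B\<in>F. x \<le> af B)})"
  have R: "R i = Sup (insert 0 (A i))" for i unfolding R_def ranked_frequency_def A_def ..
  have A1: "x \<le> 1" if "x \<in> A (Suc i)" for x i
  proof -
    from that obtain F where F: "F \<subseteq> P" "card F = Suc i" "\<forall>B\<in>F. x \<le> af B" unfolding A_def by auto
    then obtain B where "B \<in> F" by (metis all_not_in_conv card.empty nat.distinct(1))
    with F af_bounds[of B] show ?thesis by force
  qed
  have bdd: "bdd_above (insert 0 (A (Suc i)))" for i using A1 by (intro bdd_aboveI[of _ 1]) auto
  have R01: "0 \<le> R (Suc i)" "R (Suc i) \<le> 1" for i
  proof -
    show "0 \<le> R (Suc i)" unfolding R by (rule cSup_upper[OF _ bdd]) simp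
    show "R (Suc i) \<le> 1" unfolding R by (rule cSup_least) (use A1 in auto)
  qed
  have sq: "af B powr (1 + 1) = (af B)\<^sup>2" if "B \<in> P" for B
    using af_bounds[OF that] by (cases "af B = 0") auto
  have sqs: "(\<Sum>B\<in>F. af B powr (1 + 1)) = (\<Sum>B\<in>F. (af B)\<^sup>2)" if "F \<subseteq> P" for F
    using that sq by (intro sum.cong refl) auto
  have 1: "(\<Sum>B\<in>F. (af B)\<^sup>2) \<le> (\<Sum>i<card F. (R (Suc i))\<^sup>2)" if "finite F" "F \<subseteq> P" for F
    using that
  proof (induction "card F" arbitrary: F)
    case (Suc n)
    then have "af ` F \<noteq> {}" "finite (af ` F)" by auto
    then have "Min (af ` F) \<in> af ` F" by (rule Min_in[rotated])
    then obtain B where B: "B \<in> F" "af B = Min (af ` F)" by auto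
    then have min: "af B \<le> af C" if "C \<in> F" for C using that Suc(3) by auto
    have card: "card (F - {B}) = n" using Suc B by simp
    have "af B \<in> A (Suc n)" unfolding A_def using min Suc by auto
    then have "af B \<le> R (Suc n)" unfolding R by (intro cSup_upper[OF _ bdd]) simp
    moreover have "0 \<le> af B" using af_bounds[of B] B Suc by auto
    ultimately have "(af B)\<^sup>2 \<le> (R (Suc n))\<^sup>2" by (rule power_mono)
    moreover have "(\<Sum>C\<in>F - {B}. (af C)\<^sup>2) \<le> (\<Sum>i<n. (R (Suc i))\<^sup>2)"
      using Suc(1)[of "F - {B}"] Suc(3,4) card by auto
    moreover have "(\<Sum>C\<in>F. (af C)\<^sup>2) = (af B)\<^sup>2 + (\<Sum>C\<in>F - {B}. (af C)\<^sup>2)"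
      using B Suc(3) by (simp add: sum.remove)
    ultimately show ?case by (simp flip: Suc(2))
  qed auto
  have 2: "\<exists>F. finite F \<and> F \<subseteq> P \<and> card F \<le> n \<and> (\<Sum>i<n. (max 0 (R (Suc i) - \<epsilon>))\<^sup>2) \<le> (\<Sum>B\<in>F. (af B)\<^sup>2)"
    if "\<epsilon> > 0" for \<epsilon> n
  proof (induction n)
    case (Suc n)
    then obtain F where F: "finite F" "F \<subseteq> P" "card F \<le> n" "(\<Sum>i<n. (max 0 (R (Suc i) - \<epsilon>))\<^sup>2) \<le> (\<Sum>B\<in>F. (af B)\<^sup>2)" by auto
    show ?case
    proof (cases "R (Suc n) \<le> \<epsilon>")
      case True
      then show ?thesis using F by (intro exI[of _ F]) auto
    next
      case False
      then have "R (Suc n) - \<epsilon> < Sup (insert 0 (A (Suc n)))" using that by (simp add: R)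
      then obtain x where x: "x \<in> insert 0 (A (Suc n))" "R (Suc n) - \<epsilon> < x"
        using less_cSup_iff[OF _ bdd] by blast
      then have "x \<in> A (Suc n)" using False by auto
      then obtain G where G: "G \<subseteq> P" "card G = Suc n" "\<forall>B\<in>G. x \<le> af B" unfolding A_def by auto
      have "\<not> G \<subseteq> F" using card_mono[OF F(1), of G] F(3) G(2) by auto
      then obtain B where B: "B \<in> G" "B \<notin> F" by auto
      have "(max 0 (R (Suc n) - \<epsilon>))\<^sup>2 \<le> (af B)\<^sup>2"
        using x(2) G(3) B(1) False by (intro power_mono) auto
      then show ?thesis using F B G by (intro exI[of _ "insert B F"]) auto
    qed
  qed (intro exI[of _ "{}"], simp)
  have partial: "(\<Sum>i<n. (R (Suc i))\<^sup>2) \<le> mass_moment 1 P" for n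
  proof (rule field_le_epsilon)
    fix e :: real assume e: "e > 0"
    define \<epsilon> where "\<epsilon> = e / (2 * (real n + 1))"
    have \<epsilon>: "\<epsilon> > 0" "2 * real n * \<epsilon> \<le> e" unfolding \<epsilon>_def using e by (auto simp: field_simps)
    obtain F where F: "finite F" "F \<subseteq> P" "(\<Sum>i<n. (max 0 (R (Suc i) - \<epsilon>))\<^sup>2) \<le> (\<Sum>B\<in>F. (af B)\<^sup>2)"
      using 2[OF \<epsilon>(1), of n] by auto
    have "x\<^sup>2 \<le> (max 0 (x - \<epsilon>))\<^sup>2 + 2 * \<epsilon>" if "0 \<le> x" "x \<le> 1" for x
    proof (cases "x \<le> \<epsilon>")
      case True
      have "x * x \<le> x * 1" using that by (intro mult_left_mono) auto
      then show ?thesis using True \<epsilon> by (simp add: power2_eq_square)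
    next
      case False
      have "(max 0 (x - \<epsilon>))\<^sup>2 + 2 * \<epsilon> - x\<^sup>2 = \<epsilon> * \<epsilon> + 2 * \<epsilon> * (1 - x)"
        using False by (simp add: power2_eq_square algebra_simps)
      moreover have "0 \<le> 2 * \<epsilon> * (1 - x)" "0 \<le> \<epsilon> * \<epsilon>" using that \<epsilon>(1) by simp_all
      ultimately show ?thesis by linarith
    qed
    then have "(\<Sum>i<n. (R (Suc i))\<^sup>2) \<le> (\<Sum>i<n. (max 0 (R (Suc i) - \<epsilon>))\<^sup>2 + 2 * \<epsilon>)"
      using R01 by (intro sum_mono) auto
    also have "\<dots> = (\<Sum>i<n. (max 0 (R (Suc i) - \<epsilon>))\<^sup>2) + 2 * real n * \<epsilon>" by (simp add: sum.distrib)
    also have "\<dots> \<le> mass_moment 1 P + e"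
      using F(3) mass_moment_characterization(2)[of 1 F] F(1,2) \<epsilon>(2) sqs[OF F(2)] by simp
    finally show "(\<Sum>i<n. (R (Suc i))\<^sup>2) \<le> mass_moment 1 P + e" .
  qed
  have summ: "summable (\<lambda>i. (R (Suc i))\<^sup>2)"
    by (rule bounded_imp_summable[of _ "mass_moment 1 P"]) (use partial[of "Suc n" for n] in \<open>auto simp: lessThan_Suc_atMost\<close>)
  have "(\<Sum>i. (R (Suc i))\<^sup>2) \<le> mass_moment 1 P"
    using partial by (intro suminf_le_const summ)
  moreover have "mass_moment 1 P \<le> (\<Sum>i. (R (Suc i))\<^sup>2)"
  proof (rule field_le_epsilon)
    fix e :: real assume "e > 0"
    then obtain F where F: "finite F" "F \<subseteq> P" "mass_moment 1 P - e \<le> (\<Sum>B\<in>F. af B powr (1 + 1))"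
      using mass_moment_characterization(3)[of 1 e] by auto
    have "(\<Sum>B\<in>F. (af B)\<^sup>2) \<le> (\<Sum>i<card F. (R (Suc i))\<^sup>2)" by (rule 1[OF F(1,2)])
    also have "\<dots> \<le> (\<Sum>i. (R (Suc i))\<^sup>2)" by (intro sum_le_suminf summ) auto
    finally show "mass_moment 1 P \<le> (\<Sum>i. (R (Suc i))\<^sup>2) + e" using F(3) sqs[OF F(2)] by simp
  qed
  ultimately show ?thesis unfolding R_def by simp
qed

end

lemma mass_moment_antimono:
  assumes "regular_partition P" "regular_partition Q" "\<And>i j. same_block P i j \<Longrightarrow> same_block Q i j" "\<alpha> > 0"
  shows "mass_moment \<alpha> P \<le> mass_moment \<alpha> Q"
proof -
  interpret P: regular_partition P by fact
  interpret Q: regular_partition Q by fact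
  have "mean_power \<alpha> P N \<le> mean_power \<alpha> Q N" for N
    unfolding mean_power_def
    by (intro divide_right_mono sum_mono powr_mono2 freq_antimono P.reg Q.reg)
      (use assms(3,4) freq_bounds[OF P.reg] in auto)
  then show ?thesis
    by (intro LIMSEQ_le[OF P.mass_moment_characterization(1) Q.mass_moment_characterization(1)] assms(4)) auto
qed

lemma mass_moment_permute:
  assumes "\<sigma> permutes {1..n}"
  shows "mass_moment \<alpha> (permute_partition \<sigma> P) = mass_moment \<alpha> P"
  unfolding mass_moment_def
proof (rule lim_eventually_eq[of n])
  fix N assume "n \<le> N"
  then have p: "\<sigma> permutes {1..N}" using permutes_subset[OF assms, of "{1..N}"] by auto
  have "(\<Sum>i=1..N. freq (permute_partition \<sigma> P) i powr \<alpha>) = (\<Sum>i=1..N. freq (permute_partition \<sigma> P) (\<sigma> i) powr \<alpha>)"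
    using sum.permute[OF p, of "\<lambda>i. freq (permute_partition \<sigma> P) i powr \<alpha>"] by (simp add: o_def)
  also have "\<dots> = (\<Sum>i=1..N. freq P i powr \<alpha>)" using freq_permute[OF assms] by simp
  finally show "mean_power \<alpha> (permute_partition \<sigma> P) N = mean_power \<alpha> P N" unfolding mean_power_def by simp
qed

section \<open>Sample paths of a homogeneous fragmentation\<close>

text \<open>The time at which \<open>i\<close> and \<open>j\<close> separate, on the bounded scale \<open>1 - exp (-t)\<close>. Only rational
  times are used, so this is a measurable function of the path.\<close>

definition separation_level :: "nat \<Rightarrow> nat \<Rightarrow> (real \<Rightarrow> nat set set) \<Rightarrow> real"
  where "separation_level i j x = (SUP q\<in>{q\<in>\<rat>. 0 \<le> q}. if same_block (x q) i j then 1 - exp (-q) else 0)"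

lemma separation_level_bdd: "bdd_above ((\<lambda>q::real. if same_block (x q) i j then 1 - exp (-q) else 0) ` I)"
  by (rule bdd_aboveI[of _ 1]) auto

lemma measurable_separation_level[measurable]:
  "separation_level i j \<in> borel_measurable (PiM {0..} (\<lambda>_. partition_algebra))"
  unfolding separation_level_def[abs_def]
proof (rule borel_measurable_cSUP)
  show "countable {q::real. q \<in> \<rat> \<and> 0 \<le> q}"
    by (rule countable_subset[OF _ countable_rat]) auto
  fix q :: real assume "q \<in> {q\<in>\<rat>. 0 \<le> q}"
  then have [measurable]: "(\<lambda>x. x q) \<in> PiM {0..} (\<lambda>_. partition_algebra) \<rightarrow>\<^sub>M partition_algebra"
    by (intro measurable_component_singleton) auto
  show "(\<lambda>x. if same_block (x q) i j then 1 - exp (- q) else 0) \<in> borel_measurable (PiM {0..} (\<lambda>_. partition_algebra))"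
    by measurable
qed (rule separation_level_bdd)

context homogeneous_fragmentation
begin

abbreviation restr :: "nat \<Rightarrow> real \<Rightarrow> 'a \<Rightarrow> nat set set"
  where "restr n t w \<equiv> restrict_partition (X t w) {1..n}"

lemma partition_X: "w \<in> space M \<Longrightarrow> 0 \<le> t \<Longrightarrow> partition_on positive_nats (X t w)"
  using measurable_space[OF random_partition] by (simp add: space_partition_algebra)

lemma measurable_X[measurable (raw)]:
  "f \<in> partition_algebra \<rightarrow>\<^sub>M N \<Longrightarrow> 0 \<le> t \<Longrightarrow> (\<lambda>w. f (X t w)) \<in> M \<rightarrow>\<^sub>M N"
  by (rule measurable_compose[OF random_partition])

abbreviation path_algebra :: "(real \<Rightarrow> nat set set) measure"
  where "path_algebra \<equiv> PiM {0..} (\<lambda>_. partition_algebra)"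

abbreviation path :: "'a \<Rightarrow> real \<Rightarrow> nat set set"
  where "path w \<equiv> \<lambda>t\<in>{0..}. X t w"

abbreviation permuted_path :: "(nat \<Rightarrow> nat) \<Rightarrow> 'a \<Rightarrow> real \<Rightarrow> nat set set"
  where "permuted_path \<sigma> w \<equiv> \<lambda>t\<in>{0..}. permute_partition \<sigma> (X t w)"

lemma measurable_path[measurable]: "path \<in> M \<rightarrow>\<^sub>M path_algebra"
  by (rule measurable_restrict) (rule random_partition, simp)

lemma measurable_permuted_path:
  "\<sigma> permutes {1..n} \<Longrightarrow> permuted_path \<sigma> \<in> M \<rightarrow>\<^sub>M path_algebra"
  by (rule measurable_restrict)
    (auto intro: measurable_compose[OF random_partition measurable_permute_partition])

lemma exchangeable_path:
  fixes h :: "(real \<Rightarrow> nat set set) \<Rightarrow> real"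
  assumes \<sigma>: "\<sigma> permutes {1..n}" and h: "h \<in> borel_measurable path_algebra"
  shows "(\<integral>w. h (permuted_path \<sigma> w) \<partial>M) = (\<integral>w. h (path w) \<partial>M)"
  using integral_distr[OF measurable_permuted_path[OF \<sigma>] h] integral_distr[OF measurable_path h]
    exchangeable[OF \<sigma>] by simp

lemma exchangeable_time:
  fixes f :: "nat set set \<Rightarrow> real"
  assumes \<sigma>: "\<sigma> permutes {1..n}" and f[measurable]: "f \<in> borel_measurable partition_algebra" and t: "0 \<le> t"
  shows "(\<integral>w. f (permute_partition \<sigma> (X t w)) \<partial>M) = (\<integral>w. f (X t w) \<partial>M)"
proof -
  have "(\<lambda>x. x t) \<in> path_algebra \<rightarrow>\<^sub>M partition_algebra"
    by (rule measurable_component_singleton) (use t in auto)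
  from measurable_compose[OF this f] have "(\<lambda>x. f (x t)) \<in> borel_measurable path_algebra" .
  from exchangeable_path[OF \<sigma> this] t show ?thesis by simp
qed

lemma exchangeable_two_times:
  fixes f :: "nat set set \<Rightarrow> nat set set \<Rightarrow> real"
  assumes \<sigma>: "\<sigma> permutes {1..n}" and s: "0 \<le> s" and t: "0 \<le> t"
    and f: "(\<lambda>(P, Q). f P Q) \<in> borel_measurable (partition_algebra \<Otimes>\<^sub>M partition_algebra)"
  shows "(\<integral>w. f (permute_partition \<sigma> (X s w)) (permute_partition \<sigma> (X t w)) \<partial>M) = (\<integral>w. f (X s w) (X t w) \<partial>M)"
proof -
  have 1: "(\<lambda>x. (x s, x t)) \<in> path_algebra \<rightarrow>\<^sub>M (partition_algebra \<Otimes>\<^sub>M partition_algebra)"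
    using s t by (intro measurable_Pair measurable_component_singleton) auto
  have "(\<lambda>x. f (x s) (x t)) \<in> borel_measurable path_algebra"
    using measurable_compose[OF 1 f] by simp
  from exchangeable_path[OF \<sigma> this] s t show ?thesis by simp
qed

lemma right_continuous_same_block:
  assumes "w \<in> space M" "0 \<le> t"
  shows "\<forall>\<^sub>F u in at_right t. same_block (X u w) i j \<longleftrightarrow> same_block (X t w) i j"
proof -
  define n where "n = max i j"
  have in_range: "same_block (X u w) i j \<longleftrightarrow> same_block (restr n u w) i j" if "0 \<le> u" for u
    using same_block_in[OF partition_X[OF assms(1) that], of i j] by (auto simp: same_block_restrict n_def)
  show ?thesis
    using right_continuous[OF assms, of n] eventually_at_right_less[of t]
  proof eventually_elim
    case (elim u)
    then show ?case using in_range[of u] in_range[of t] assms(2) by simp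
  qed
qed

lemma rational_right_neighbour:
  assumes "w \<in> space M" "0 \<le> t" "t < b"
  shows "\<exists>q\<in>\<rat>. t < q \<and> q < b \<and> (same_block (X q w) i j \<longleftrightarrow> same_block (X t w) i j)"
proof -
  obtain c where c: "c > t" "\<And>u. t < u \<Longrightarrow> u < c \<Longrightarrow> same_block (X u w) i j \<longleftrightarrow> same_block (X t w) i j"
    using right_continuous_same_block[OF assms(1,2), of i j] by (auto simp: eventually_at_right[OF assms(3)])
  obtain q where "q \<in> \<rat>" "t < q" "q < min b c" using Rats_dense_in_real[of t "min b c"] c(1) assms(3) by auto
  with c(2) show ?thesis by auto
qed

lemma space_natural_filtration: "space (natural_filtration M X s) = space M"
  unfolding natural_filtration_def by (rule space_measure_of) auto

lemma sets_restrict_X[measurable]: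
  "0 \<le> t \<Longrightarrow> {w\<in>space M. restr n t w = \<eta>} \<in> sets M"
  using measurable_sets[OF measurable_X[OF pred_restrict_event, of t n \<eta>], of "{True}"]
  by (simp add: vimage_def Int_def conj_commute)

lemma sets_same_block_X[measurable]:
  "0 \<le> t \<Longrightarrow> {w\<in>space M. same_block (X t w) i j} \<in> sets M"
  using measurable_sets[OF measurable_X[OF pred_same_block, of t i j], of "{True}"]
  by (simp add: vimage_def Int_def conj_commute)

lemma sets_alone: "0 \<le> t \<Longrightarrow> {w\<in>space M. alone n i (X t w)} \<in> sets M"
proof -
  assume "0 \<le> t"
  note [measurable] = sets_same_block_X[OF this]
  show ?thesis unfolding alone_def by measurable
qed

text \<open>The branching property gives probability 0 to every pair of restrictions of which the later does
  not refine the earlier.\<close>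

lemma AE_refines:
  assumes "0 \<le> s" "s \<le> t"
  shows "AE w in M. \<forall>i j. same_block (X t w) i j \<longrightarrow> same_block (X s w) i j"
proof -
  have t: "0 \<le> t" using assms by simp
  have "AE w in M. \<forall>n. refines {1..n} (restr n t w) (restr n s w)"
    unfolding AE_all_countable
  proof
    fix n
    define E where "E = {\<eta>. partition_on {1..n::nat} \<eta>}"
    have fin: "finite E" unfolding E_def by (rule finite_partitions) simp
    have no: "AE w in M. \<not> (restr n s w = \<eta> \<and> restr n t w = \<pi>)"
      if "\<eta> \<in> E" "\<pi> \<in> E" "\<not> refines {1..n} \<pi> \<eta>" for \<eta> \<pi>
    proof -
      have top: "space M \<in> sets (natural_filtration M X s)"
        using sets.top[of "natural_filtration M X s"] by (simp add: space_natural_filtration)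
      have "prob {w\<in>space M. restr n s w = \<eta> \<and> restr n t w = \<pi>} = 0"
        using branching[OF assms(1) _ top, of "t - s" n \<eta> \<pi>] that assms by (simp add: E_def)
      moreover have "{w\<in>space M. restr n s w = \<eta> \<and> restr n t w = \<pi>} \<in> sets M"
        using assms t by measurable
      ultimately show ?thesis by (intro AE_I') (auto simp: null_sets_def emeasure_eq_measure)
    qed
    have "AE w in M. \<forall>\<eta>\<in>E. \<forall>\<pi>\<in>E. \<not> refines {1..n} \<pi> \<eta> \<longrightarrow>
        \<not> (restr n s w = \<eta> \<and> restr n t w = \<pi>)"
      using no by (intro AE_finite_allI fin) (auto intro: AE_impI)
    then show "AE w in M. refines {1..n} (restr n t w) (restr n s w)"
      using AE_space
    proof eventually_elim
      case (elim w)
      have "restr n u w \<in> E" if "0 \<le> u" for u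
        unfolding E_def using partition_on_restrict_partition[OF partition_X[OF elim(2) that], of "{1..n}"] by auto
      with elim(1) assms t show ?case by blast
    qed
  qed
  then show ?thesis using AE_space
  proof eventually_elim
    case (elim w)
    show ?case
    proof (intro allI impI)
      fix i j assume ij: "same_block (X t w) i j"
      define n where "n = max i j"
      note pt = partition_X[OF elim(2) t] and ps = partition_X[OF elim(2) assms(1)]
      have "i \<in> {1..n}" "j \<in> {1..n}" using same_block_in[OF pt ij] by (auto simp: n_def)
      then have "same_block (restr n t w) i j" using ij by (simp add: same_block_restrict)
      moreover have "refines {1..n} (restr n t w) (restr n s w)"
        using elim(1) by blast
      ultimately have "same_block (restr n s w) i j"
        using refines_iff_same_block[OF partition_on_restrict_partition[OF pt] partition_on_restrict_partition[OF ps], of "{1..n}"]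
        by auto
      then show "same_block (X s w) i j" by (simp add: same_block_restrict)
    qed
  qed
qed

text \<open>Right-continuity at both times carries the monotonicity from rational to real times.\<close>

lemma AE_monotone:
  "AE w in M. \<forall>s t i j. 0 \<le> s \<longrightarrow> s \<le> t \<longrightarrow> same_block (X t w) i j \<longrightarrow> same_block (X s w) i j"
proof -
  have "AE w in M. \<forall>p\<in>\<rat>. \<forall>q\<in>\<rat>. 0 \<le> p \<longrightarrow> p \<le> q \<longrightarrow> (\<forall>i j. same_block (X q w) i j \<longrightarrow> same_block (X p w) i j)"
  proof (intro AE_ball_countable[THEN iffD2] ballI countable_rat)
    fix p q :: real
    show "AE w in M. 0 \<le> p \<longrightarrow> p \<le> q \<longrightarrow> (\<forall>i j. same_block (X q w) i j \<longrightarrow> same_block (X p w) i j)"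
      using AE_refines[of p q] by (cases "0 \<le> p \<and> p \<le> q") auto
  qed
  then show ?thesis using AE_space
  proof eventually_elim
    case (elim w)
    show ?case
    proof (intro allI impI)
      fix s t :: real and i j assume st: "0 \<le> s" "s \<le> t" and ij: "same_block (X t w) i j"
      show "same_block (X s w) i j"
      proof (cases "s = t")
        case False
        then have "s < t" using st by simp
        obtain p where p: "p \<in> \<rat>" "s < p" "p < t" "same_block (X p w) i j \<longleftrightarrow> same_block (X s w) i j"
          using rational_right_neighbour[OF elim(2) st(1) \<open>s < t\<close>] by blast
        have "0 \<le> t" using st by simp
        obtain q where q: "q \<in> \<rat>" "t < q" "same_block (X q w) i j \<longleftrightarrow> same_block (X t w) i j"
          using rational_right_neighbour[OF elim(2) \<open>0 \<le> t\<close>, of "t + 1"] by auto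
        have "0 \<le> p" "p \<le> q" using p q st by auto
        with elim(1) p(1) q(1) have "same_block (X q w) i j \<longrightarrow> same_block (X p w) i j" by blast
        then show ?thesis using p(4) q(3) ij by simp
      qed (use ij in simp)
    qed
  qed
qed

text \<open>Right-continuity makes the inequality strict: labels that are together at \<open>t\<close> are still together
  slightly later.\<close>

lemma same_block_iff_separation_level:
  assumes w: "w \<in> space M" and t: "0 \<le> t"
    and mono: "\<forall>s t i j. 0 \<le> s \<longrightarrow> s \<le> t \<longrightarrow> same_block (X t w) i j \<longrightarrow> same_block (X s w) i j"
  shows "same_block (X t w) i j \<longleftrightarrow> 1 - exp (-t) < separation_level i j (path w)"
proof
  assume ij: "same_block (X t w) i j"
  obtain q where q: "q \<in> \<rat>" "t < q" "same_block (X q w) i j"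
    using rational_right_neighbour[OF w t, of "t + 1"] ij by auto
  have "1 - exp (-t) < (if same_block (path w q) i j then 1 - exp (-q) else 0)" using q t by simp
  also have "\<dots> \<le> separation_level i j (path w)"
    unfolding separation_level_def by (rule cSUP_upper[OF _ separation_level_bdd]) (use q t in auto)
  finally show "1 - exp (-t) < separation_level i j (path w)" .
next
  assume *: "1 - exp (-t) < separation_level i j (path w)"
  have ne: "{q::real. q \<in> \<rat> \<and> 0 \<le> q} \<noteq> {}" by (metis (mono_tags, lifting) Rats_0 empty_iff mem_Collect_eq order_refl)
  obtain q where q: "q \<in> \<rat>" "0 \<le> q" "1 - exp (-t) < (if same_block (path w q) i j then 1 - exp (-q) else 0)"
    using less_cSUP_iff[OF ne separation_level_bdd] * unfolding separation_level_def by blast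
  have "0 \<le> 1 - exp (-t)" using t by simp
  with q have "same_block (X q w) i j" "1 - exp (-t) < 1 - exp (-q)" by (auto split: if_splits)
  moreover from this(2) have "t < q" by simp
  ultimately show "same_block (X t w) i j" using mono t by (meson less_imp_le)
qed

text \<open>A permutation of the levels is a relabelling that fixes \<open>i\<close>.\<close>

lemma separation_levels_exchangeable:
  assumes i: "1 \<le> i" and \<sigma>: "\<sigma> permutes {..<n}"
  shows "distr M (PiM UNIV (\<lambda>_. borel)) (\<lambda>w l. separation_level i (i + 1 + \<sigma> l) (path w)) =
    distr M (PiM UNIV (\<lambda>_. borel)) (\<lambda>w l. separation_level i (i + 1 + l) (path w))"
proof -
  define f where "f = (\<lambda>k. if k = i then i else i + 1 + \<sigma> (k - i - 1))"
  have \<sigma>in: "\<sigma> k < n" if "k < n" for k using permutes_in_image[OF \<sigma>, of k] that by simp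
  have \<sigma>inj: "\<sigma> k = \<sigma> l \<longleftrightarrow> k = l" for k l using permutes_inj[OF \<sigma>] by (auto simp: inj_def)
  have "\<exists>\<rho>. \<rho> permutes {1..i + n} \<and> (\<forall>k\<in>{i..i + n}. \<rho> k = f k)"
  proof (rule ex_permutes_extending)
    show "inj_on f {i..i + n}"
    proof (rule inj_onI)
      fix x y assume "x \<in> {i..i + n}" "y \<in> {i..i + n}" "f x = f y"
      then show "x = y" by (auto simp: f_def \<sigma>inj split: if_splits)
    qed
    show "f ` {i..i + n} \<subseteq> {1..i + n}"
    proof
      fix y assume "y \<in> f ` {i..i + n}"
      then obtain k where k: "k \<in> {i..i + n}" "y = f k" by auto
      moreover have "k - i - 1 < n" if "k \<noteq> i" using k(1) that by auto
      ultimately show "y \<in> {1..i + n}" using i \<sigma>in[of "k - i - 1"] by (auto simp: f_def)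
    qed
  qed (use i in auto)
  then obtain \<rho> where \<rho>: "\<rho> permutes {1..i + n}" "\<And>k. k \<in> {i..i + n} \<Longrightarrow> \<rho> k = f k" by auto
  have \<rho>i: "\<rho> i = i" using \<rho>(2)[of i] by (simp add: f_def)
  have \<rho>l: "\<rho> (i + 1 + l) = i + 1 + \<sigma> l" for l
  proof (cases "l < n")
    case True
    then show ?thesis using \<rho>(2)[of "i + 1 + l"] by (simp add: f_def)
  next
    case False
    then have "\<sigma> l = l" using \<sigma> by (auto simp: permutes_def)
    then show ?thesis using \<rho>(1) False by (auto simp: permutes_def)
  qed
  have inv: "inv \<rho> permutes {1..i + n}" using permutes_inv[OF \<rho>(1)] .
  define \<Phi> where "\<Phi> = (\<lambda>x l. separation_level i (i + 1 + l) x)"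
  have \<Phi>: "\<Phi> \<in> path_algebra \<rightarrow>\<^sub>M PiM UNIV (\<lambda>_. borel)"
    unfolding \<Phi>_def by (rule measurable_abs_UNIV) measurable
  have sb: "same_block (permute_partition (inv \<rho>) P) i (i + 1 + l) \<longleftrightarrow> same_block P i (i + 1 + \<sigma> l)" for P l
    using same_block_permute[OF permutes_bij[OF inv], of P i "i + 1 + \<sigma> l"]
    by (metis \<rho>i \<rho>l \<rho>(1) permutes_inverses(2))
  have eq: "(\<lambda>l. separation_level i (i + 1 + \<sigma> l) (path w)) = \<Phi> (permuted_path (inv \<rho>) w)" for w
    unfolding \<Phi>_def separation_level_def by (intro ext SUP_cong refl) (simp add: sb[simplified])
  have "distr M (PiM UNIV (\<lambda>_. borel)) (\<lambda>w l. separation_level i (i + 1 + \<sigma> l) (path w)) =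
      distr (distr M path_algebra (permuted_path (inv \<rho>))) (PiM UNIV (\<lambda>_. borel)) \<Phi>"
    unfolding eq by (subst distr_distr[OF \<Phi> measurable_permuted_path[OF inv]]) (simp add: o_def)
  also have "\<dots> = distr (distr M path_algebra path) (PiM UNIV (\<lambda>_. borel)) \<Phi>"
    unfolding exchangeable[OF inv] ..
  also have "\<dots> = distr M (PiM UNIV (\<lambda>_. borel)) (\<lambda>w l. separation_level i (i + 1 + l) (path w))"
    by (subst distr_distr[OF \<Phi> measurable_path]) (simp add: o_def \<Phi>_def)
  finally show ?thesis .
qed

text \<open>Block frequencies exist for all times simultaneously, also at the random jump times: the block
  of \<open>i\<close> at time \<open>t\<close> consists of the labels whose separation time from \<open>i\<close> exceeds \<open>t\<close>, and these times
  form an exchangeable sequence.\<close>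

theorem AE_regular: "AE w in M. \<forall>t\<ge>0. regular_partition (X t w)"
proof -
  have "AE w in M. \<forall>i. 1 \<le> i \<longrightarrow> (\<forall>u. convergent (\<lambda>N. real (card {l. l < N \<and> u < separation_level i (i + 1 + l) (path w)}) / real N))"
    unfolding AE_all_countable
  proof
    fix i :: nat
    show "AE w in M. 1 \<le> i \<longrightarrow> (\<forall>u. convergent (\<lambda>N. real (card {l. l < N \<and> u < separation_level i (i + 1 + l) (path w)}) / real N))"
    proof (cases "1 \<le> i")
      case True
      have "AE w in M. \<forall>u. convergent (\<lambda>N. real (card {l. l < N \<and> u < separation_level i (i + 1 + l) (path w)}) / real N)"
      proof (rule exchangeable_glivenko_cantelli)
        show "(\<lambda>w. separation_level i (i + 1 + l) (path w)) \<in> borel_measurable M" for l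
          by (rule measurable_compose[OF measurable_path measurable_separation_level])
      qed (rule separation_levels_exchangeable[OF True])
      then show ?thesis by simp
    qed simp
  qed
  then show ?thesis using AE_monotone AE_space
  proof eventually_elim
    case (elim w)
    show ?case
    proof (intro allI impI)
      fix t :: real assume t: "0 \<le> t"
      show "regular_partition (X t w)"
      proof
        show "partition_on positive_nats (X t w)" by (rule partition_X[OF elim(3) t])
        show "regular (X t w)"
          unfolding regular_def
        proof (intro allI impI)
          fix i :: nat assume i: "1 \<le> i"
          have "convergent (\<lambda>N. real (card {l. l < N \<and> same_block (X t w) i (i + 1 + l)}) / real N)"
            using elim(1) i same_block_iff_separation_level[OF elim(3) t elim(2)] by simp
          then show "convergent (emp_freq (X t w) i)"
            unfolding emp_freq_def[abs_def]
          proof (rule convergent_frequency_shift)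
            fix n
            show "real (block_count (X t w) i (n + i)) =
              real (block_count (X t w) i i) + real (card {l. l < n \<and> same_block (X t w) i (i + 1 + l)})"
              unfolding card_Collect_less_eq_sum block_count_eq_sum
              by (induction n) (simp_all add: add.commute)
          qed
        qed
      qed
    qed
  qed
qed

end

section \<open>Splitting rates\<close>

lemma multiplicative_power:
  fixes f :: "real \<Rightarrow> real"
  assumes mult: "\<And>s t. 0 \<le> s \<Longrightarrow> 0 \<le> t \<Longrightarrow> f (s + t) = f s * f t"
    and "0 \<le> s" "0 < N"
  shows "f (real N * s) = f s ^ N"
  using assms(3)
proof (induction N rule: nat_induct_non_zero)
  case (Suc N)
  have "f (real (Suc N) * s) = f (s + real N * s)" by (simp add: algebra_simps)
  also have "\<dots> = f s * f (real N * s)" using assms(2) by (intro mult) auto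
  finally show ?case using Suc by simp
qed simp

text \<open>\<open>f t\<close> is the \<open>N\<close>-th power of \<open>f (t / N)\<close>, and both \<open>f (t / N)\<close> and \<open>exp (- c * t / N)\<close> are
  \<open>1 - c * t / N + o(1 / N)\<close>.\<close>

lemma multiplicative_imp_exp:
  fixes f :: "real \<Rightarrow> real"
  assumes mult: "\<And>s t. 0 \<le> s \<Longrightarrow> 0 \<le> t \<Longrightarrow> f (s + t) = f s * f t"
    and bd: "\<And>t. 0 \<le> t \<Longrightarrow> 0 \<le> f t" "\<And>t. 0 \<le> t \<Longrightarrow> f t \<le> 1"
    and rate: "((\<lambda>t. (1 - f t) / t) \<longlongrightarrow> c) (at_right 0)"
    and t: "0 \<le> t"
  shows "f t = exp (- c * t)"
proof -
  have c0: "0 \<le> c"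
    by (rule tendsto_lowerbound[OF rate])
      (use bd in \<open>auto simp: eventually_at_right_field intro!: exI[of _ 1] divide_nonneg_nonneg\<close>)
  have pos: "f t = exp (- c * t)" if t: "0 < t" for t
  proof -
    have seq: "filterlim (\<lambda>N. t / real N) (at_right 0) sequentially"
      using t by real_asymp
    have 1: "(\<lambda>N. (1 - f (t / real N)) / (t / real N)) \<longlonglongrightarrow> c"
      by (rule filterlim_compose[OF rate seq])
    have 2: "(\<lambda>N. (1 - exp (- c * (t / real N))) / (t / real N)) \<longlonglongrightarrow> c"
    proof -
      have "((\<lambda>u. (1 - exp (- c * u)) / u) \<longlongrightarrow> c) (at_right 0)" by real_asymp
      then show ?thesis by (rule filterlim_compose[OF _ seq])
    qed
    have 3: "(\<lambda>N. t * norm ((1 - f (t / real N)) / (t / real N) - (1 - exp (- c * (t / real N))) / (t / real N))) \<longlonglongrightarrow> 0"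
      using tendsto_mult[OF tendsto_const[of t] tendsto_norm[OF tendsto_diff[OF 1 2]]] by simp
    have "norm (f t - exp (- c * t)) \<le> t * norm ((1 - f (t / real N)) / (t / real N) - (1 - exp (- c * (t / real N))) / (t / real N))"
      if N: "N \<ge> 1" for N
    proof -
      have tN: "0 < t / real N" using t N by simp
      have "f t = f (t / real N) ^ N" using multiplicative_power[OF mult, of "t / real N" N] tN N by simp
      moreover have "exp (- c * t) = exp (- c * (t / real N)) ^ N"
        using N by (simp flip: exp_of_nat_mult)
      ultimately have "norm (f t - exp (- c * t)) = norm (f (t / real N) ^ N - exp (- c * (t / real N)) ^ N)" by simp
      also have "\<dots> \<le> real N * norm (f (t / real N) - exp (- c * (t / real N)))"
        by (rule norm_power_diff) (use bd tN mult_nonneg_nonneg[OF c0, of "t / real N"] in auto)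
      also have "\<dots> = t * norm ((1 - f (t / real N)) / (t / real N) - (1 - exp (- c * (t / real N))) / (t / real N))"
        unfolding diff_divide_distrib[symmetric] using t N by (simp add: abs_mult abs_minus_commute)
      finally show ?thesis .
    qed
    then have "norm (f t - exp (- c * t)) \<le> 0"
      by (intro tendsto_lowerbound[OF 3]) (auto simp: eventually_sequentially intro!: exI[of _ 1])
    then show ?thesis by simp
  qed
  show ?thesis
  proof (cases "t = 0")
    case True
    have "f 1 = f 0 * f 1" using mult[of 0 1] by simp
    then show ?thesis using True pos[of 1] by simp
  qed (use pos t in auto)
qed

lemma sum_Pow_by_card:
  fixes f :: "nat \<Rightarrow> real"
  assumes "finite S"
  shows "(\<Sum>A\<in>Pow S. f (card A)) = (\<Sum>k\<le>card S. real (card S choose k) * f k)"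
proof -
  have "(\<Sum>A\<in>Pow S. f (card A)) = (\<Sum>k\<le>card S. \<Sum>A\<in>{A\<in>Pow S. card A = k}. f (card A))"
    using assms by (intro sum.group[symmetric]) (auto intro: card_mono)
  also have "\<dots> = (\<Sum>k\<le>card S. real (card S choose k) * f k)"
  proof (rule sum.cong[OF refl])
    fix k
    have "card {A\<in>Pow S. card A = k} = card S choose k"
      using n_subsets[OF assms, of k] by (simp add: Pow_def)
    then show "(\<Sum>A\<in>{A\<in>Pow S. card A = k}. f (card A)) = real (card S choose k) * f k" by simp
  qed
  finally show ?thesis .
qed

lemma dislocation_rate_many_blocks:
  assumes "card \<eta> > 2" shows "dislocation_rate \<nu> S \<eta> = 0"
proof -
  have "pmf (binary_paintbox x S) \<eta> = 0" for x
  proof (rule ccontr)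
    assume "pmf (binary_paintbox x S) \<eta> \<noteq> 0"
    then have "\<eta> \<in> set_pmf (binary_paintbox x S)" by (simp add: set_pmf_iff)
    then obtain f where f: "\<eta> = {{i\<in>S. f i}, {i\<in>S. \<not> f i}} - {{}}" unfolding binary_paintbox_def by auto
    have "card \<eta> \<le> card {{i\<in>S. f i}, {i\<in>S. \<not> f i}}" unfolding f by (intro card_mono) auto
    also have "\<dots> \<le> 2" by (simp add: card_insert_if)
    finally show False using assms by simp
  qed
  then show ?thesis unfolding dislocation_rate_def by simp
qed

text \<open>Partitions of \<open>{1..n}\<close> into two blocks, indexed by the companions of the label \<open>1\<close>.\<close>

definition split_at :: "nat \<Rightarrow> nat set \<Rightarrow> nat set set"
  where "split_at n A = {insert 1 A, {2..n} - A}"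

lemma complement_if_insert_Un:
  assumes "insert x A \<union> B = insert x C" "x \<notin> A" "x \<notin> C" "B \<inter> insert x A = {}"
  shows "A \<subseteq> C \<and> B = C - A"
proof -
  have 1: "y = x \<or> y \<in> A \<or> y \<in> B \<longleftrightarrow> y = x \<or> y \<in> C" for y
    using assms(1) by (metis Un_iff insert_iff)
  have 2: "y \<in> B \<Longrightarrow> y \<noteq> x \<and> y \<notin> A" for y using assms(4) by auto
  have "y \<in> A \<Longrightarrow> y \<in> C" for y using 1[of y] assms(2) by metis
  moreover have "y \<in> B \<longleftrightarrow> y \<in> C \<and> y \<notin> A" for y using 1[of y] 2[of y] assms(3) by metis
  ultimately show ?thesis by (simp add: subset_iff set_eq_iff)
qed

lemma two_block_partition_iff:
  assumes "2 \<le> n"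
  shows "partition_on {1..n} \<eta> \<and> card \<eta> = 2 \<longleftrightarrow> \<eta> \<in> split_at n ` (Pow {2..n} - {{2..n}})"
proof
  assume *: "partition_on {1..n} \<eta> \<and> card \<eta> = 2"
  define A where "A = block_of \<eta> 1 - {1}"
  have 1: "block_of \<eta> 1 \<in> \<eta>" using block_of_in[of "{1..n}" \<eta> 1] * assms by auto
  have "1 \<in> block_of \<eta> 1" using same_block_refl[of "{1..n}" \<eta> 1] * assms by (auto simp: block_of_def)
  then have ins: "insert 1 A = block_of \<eta> 1" unfolding A_def by auto
  obtain B where B: "\<eta> = {block_of \<eta> 1, B}" "B \<noteq> block_of \<eta> 1"
  proof -
    have "card (\<eta> - {block_of \<eta> 1}) = 1" using * 1 by (simp add: card_Diff_subset)
    then obtain B where "\<eta> - {block_of \<eta> 1} = {B}" by (rule card_1_singletonE)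
    then show ?thesis using 1 that[of B] by blast
  qed
  have p: "partition_on {1..n} \<eta>" and B\<eta>: "B \<in> \<eta>" using * B(1) by auto
  have disj: "B \<inter> block_of \<eta> 1 = {}" by (rule disjointD[OF partition_onD2[OF p] B\<eta> 1 B(2)])
  have B0: "B \<noteq> {}" using partition_onD3[OF p] B\<eta> by auto
  have "\<Union>\<eta> = insert 1 A \<union> B" unfolding ins by (subst B(1)) simp
  then have "insert 1 A \<union> B = insert 1 {2..n}"
    using partition_onD1[OF p] assms by auto
  moreover have "1 \<notin> A" "1 \<notin> {2..n}" unfolding A_def by auto
  ultimately have "A \<subseteq> {2..n} \<and> B = {2..n} - A"
    by (rule complement_if_insert_Un) (use disj in \<open>simp only: ins\<close>)
  then have A: "A \<subseteq> {2..n}" "B = {2..n} - A" by simp_all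
  have "\<eta> = split_at n A" unfolding split_at_def using B(1) ins A(2) by simp
  moreover have "A \<noteq> {2..n}" using A(2) B0 by auto
  ultimately show "\<eta> \<in> split_at n ` (Pow {2..n} - {{2..n}})" using A(1) by blast
next
  assume "\<eta> \<in> split_at n ` (Pow {2..n} - {{2..n}})"
  then obtain A where A: "A \<subseteq> {2..n}" "A \<noteq> {2..n}" "\<eta> = {insert 1 A, {2..n} - A}" by (auto simp: split_at_def)
  have ne: "{2..n} - A \<noteq> {}" using A by blast
  have n1: "1 \<notin> {2..n} - A" by simp
  have "partition_on {1..n} \<eta>"
    unfolding A(3)
  proof (rule partition_onI)
    show "\<Union>{insert 1 A, {2..n} - A} = {1..n}" using A(1) assms by auto
  qed (use A ne in \<open>auto simp: disjnt_def\<close>)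
  moreover have "card \<eta> = 2" unfolding A(3) using n1 by (subst card_2_iff) blast
  ultimately show "partition_on {1..n} \<eta> \<and> card \<eta> = 2" by blast
qed

lemma split_at_inj: "inj_on (split_at n) (Pow {2..n})"
proof (rule inj_onI)
  fix A B assume AB: "A \<in> Pow {2..n}" "B \<in> Pow {2..n}" "split_at n A = split_at n B"
  then have "insert 1 A = insert 1 B \<or> insert 1 A = {2..n} - B"
    unfolding split_at_def doubleton_eq_iff by blast
  moreover have "1 \<in> insert 1 A" "1 \<notin> {2..n} - B" by simp_all
  then have "insert 1 A \<noteq> {2..n} - B" by metis
  ultimately have "insert 1 A = insert 1 B" by blast
  moreover have "1 \<notin> A" "1 \<notin> B" using AB by auto
  ultimately show "A = B" by (metis insert_ident)
qed

locale beta_fragmentation = binary_fragmentation M X "beta_dislocation \<beta>"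
  for M :: "'a measure" and X :: "real \<Rightarrow> 'a \<Rightarrow> nat set set" and \<beta> :: real +
  assumes beta: "\<beta> > -2"
begin

abbreviation "r \<equiv> r_beta \<beta>"

lemma r_pos: "r > 0"
  using r_beta_eq_Beta[OF beta] beta by (simp add: Beta_def)

text \<open>The rate of the split in which label \<open>1\<close> is joined by \<open>A\<close> and separated from the other labels.\<close>

definition set_rate :: "nat \<Rightarrow> nat set \<Rightarrow> real"
  where "set_rate n A = Beta (real (card A) + 1 + \<beta> + 1) (real (n - 1 - card A) + \<beta> + 1)"

lemma dislocation_rate_split_at:
  assumes "A \<subseteq> {2..n}" "A \<noteq> {2..n}"
  shows "dislocation_rate (beta_dislocation \<beta>) {1..n} (split_at n A) = set_rate n A"
proof -
  have fin: "finite A" using assms finite_subset by blast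
  have U: "insert 1 A \<union> ({2..n} - A) = {1..n}"
  proof -
    have "{2..n} \<noteq> {}" using assms by auto
    then show ?thesis using assms by auto
  qed
  have "1 \<notin> A" using assms by auto
  then have c1: "card (insert 1 A) = card A + 1" using fin by simp
  have c2: "card ({2..n} - A) = n - 1 - card A" using assms fin by (simp add: card_Diff_subset)
  have "dislocation_rate (beta_dislocation \<beta>) (insert 1 A \<union> ({2..n} - A)) {insert 1 A, {2..n} - A} =
    Beta (real (card (insert 1 A)) + \<beta> + 1) (real (card ({2..n} - A)) + \<beta> + 1)"
    by (rule dislocation_rate_beta[OF beta]) (use assms fin in auto)
  then show ?thesis unfolding U split_at_def set_rate_def c1 c2 by (simp add: add.commute)
qed

lemma split_event_rate:
  assumes n: "2 \<le> n" and \<A>: "\<A> \<subseteq> Pow {2..n} - {{2..n}}"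
    and E: "\<And>\<eta>. \<eta> \<in> E \<Longrightarrow> partition_on {1..n} \<eta> \<and> \<eta> \<noteq> {{1..n}}"
    and two: "{\<eta>\<in>E. card \<eta> = 2} = split_at n ` \<A>"
  shows "((\<lambda>t. prob {w\<in>space M. restr n t w \<in> E} / t) \<longlongrightarrow> (\<Sum>A\<in>\<A>. set_rate n A)) (at_right 0)"
proof -
  have finE: "finite E"
    by (rule finite_subset[OF _ finite_partitions[of "{1..n}"]]) (use E in auto)
  have "((\<lambda>t. \<Sum>\<eta>\<in>E. prob {w\<in>space M. restr n t w = \<eta>} / t) \<longlongrightarrow>
      (\<Sum>\<eta>\<in>E. dislocation_rate (beta_dislocation \<beta>) {1..n} \<eta>)) (at_right 0)"
    using jump_rates[OF n] E by (intro tendsto_sum) auto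
  moreover have "eventually (\<lambda>t. (\<Sum>\<eta>\<in>E. prob {w\<in>space M. restr n t w = \<eta>} / t) =
      prob {w\<in>space M. restr n t w \<in> E} / t) (at_right 0)"
    using eventually_at_right_less[of 0]
  proof eventually_elim
    case (elim t)
    have "prob (\<Union>\<eta>\<in>E. {w\<in>space M. restr n t w = \<eta>}) =
        (\<Sum>\<eta>\<in>E. prob {w\<in>space M. restr n t w = \<eta>})"
      using elim finE sets_restrict_X by (intro finite_measure_finite_Union) (auto simp: disjoint_family_on_def simp del: One_nat_def)
    moreover have "(\<Union>\<eta>\<in>E. {w\<in>space M. restr n t w = \<eta>}) = {w\<in>space M. restr n t w \<in> E}"
      by auto
    ultimately show ?case by (simp add: sum_divide_distrib)
  qed
  ultimately have 1: "((\<lambda>t. prob {w\<in>space M. restr n t w \<in> E} / t) \<longlongrightarrow>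
      (\<Sum>\<eta>\<in>E. dislocation_rate (beta_dislocation \<beta>) {1..n} \<eta>)) (at_right 0)"
    by (rule Lim_transform_eventually)
  have "(\<Sum>\<eta>\<in>E. dislocation_rate (beta_dislocation \<beta>) {1..n} \<eta>) =
      (\<Sum>\<eta>\<in>{\<eta>\<in>E. card \<eta> = 2}. dislocation_rate (beta_dislocation \<beta>) {1..n} \<eta>)"
  proof (rule sum.mono_neutral_right[OF finE])
    show "\<forall>\<eta>\<in>E - {\<eta>\<in>E. card \<eta> = 2}. dislocation_rate (beta_dislocation \<beta>) {1..n} \<eta> = 0"
    proof
      fix \<eta> assume \<eta>: "\<eta> \<in> E - {\<eta>\<in>E. card \<eta> = 2}"
      then have p: "partition_on {1..n} \<eta>" "\<eta> \<noteq> {{1..n}}" using E by auto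
      have "finite \<eta>" using p(1) by (auto simp: partition_on_def intro: finite_UnionD)
      moreover have "\<eta> \<noteq> {}" using p(1) n by (auto simp: partition_on_def)
      moreover have "card \<eta> \<noteq> 1"
      proof
        assume "card \<eta> = 1"
        then obtain B where "\<eta> = {B}" by (rule card_1_singletonE)
        with p show False by (auto simp: partition_on_def)
      qed
      ultimately have "card \<eta> > 2" using \<eta> by (cases "card \<eta>") auto
      then show "dislocation_rate (beta_dislocation \<beta>) {1..n} \<eta> = 0" by (rule dislocation_rate_many_blocks)
    qed
  qed auto
  also have "\<dots> = (\<Sum>A\<in>\<A>. dislocation_rate (beta_dislocation \<beta>) {1..n} (split_at n A))"
  proof -
    have "inj_on (split_at n) \<A>" by (rule inj_on_subset[OF split_at_inj]) (use \<A> in auto)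
    then show ?thesis unfolding two by (simp add: sum.reindex)
  qed
  also have "\<dots> = (\<Sum>A\<in>\<A>. set_rate n A)"
    using \<A> by (intro sum.cong refl dislocation_rate_split_at) auto
  finally show ?thesis using 1 by simp
qed

definition together :: "nat \<Rightarrow> real \<Rightarrow> real"
  where "together n t = prob {w\<in>space M. restr n t w = {{1..n}}}"

definition exit_rate :: "nat \<Rightarrow> real"
  where "exit_rate n = (\<Sum>A\<in>Pow {2..n} - {{2..n}}. set_rate n A)"

lemma partition_whole: "1 \<le> n \<Longrightarrow> partition_on {1..n} {{1..n}}" for n :: nat
  using atLeastatMost_empty_iff2[of 1 n] by (auto simp: partition_on_def disjoint_def simp del: One_nat_def)

lemma together_mult:
  assumes n: "1 \<le> n" and st: "0 \<le> s" "0 \<le> t"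
  shows "together n (s + t) = together n s * together n t"
proof -
  have top: "space M \<in> sets (natural_filtration M X s)"
    using sets.top[of "natural_filtration M X s"] by (simp add: space_natural_filtration)
  have 1: "prob {w\<in>space M. restr n s w = {{1..n}} \<and> restr n (s + t) w = {{1..n}}}
      = together n s * together n t"
    using branching[OF st top partition_whole[OF n] partition_whole[OF n]]
    by (simp add: together_def refines_refl[OF partition_whole[OF n]] restrict_partition_self[OF partition_whole[OF n]] del: One_nat_def)
  have 2: "prob {w\<in>space M. restr n s w = {{1..n}} \<and> restr n (s + t) w = {{1..n}}} =
      together n (s + t)"
    unfolding together_def
  proof (rule finite_measure_eq_AE)
    show "AE w in M. (w \<in> {w\<in>space M. restr n s w = {{1..n}} \<and> restr n (s + t) w = {{1..n}}}) =
      (w \<in> {w\<in>space M. restr n (s + t) w = {{1..n}}})"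
      using AE_refines[OF st(1), of "s + t", simplified, OF st(2)] AE_space
    proof eventually_elim
      case (elim w)
      have "0 \<le> s + t" using st by simp
      have "restr n u w = {{1..n}} \<longleftrightarrow> (\<forall>i\<in>{1..n}. \<forall>j\<in>{1..n}. same_block (X u w) i j)" if "0 \<le> u" for u
        by (rule restrict_eq_whole_iff[OF partition_X[OF elim(2) that]]) (use n in auto)
      from this[OF \<open>0 \<le> s\<close>] this[OF \<open>0 \<le> s + t\<close>] elim show ?case using st by auto
    qed
  qed (use st sets_restrict_X in \<open>auto simp: Collect_conj_eq[symmetric] intro!: sets.sets_Collect_conj simp del: One_nat_def\<close>)
  show ?thesis using 1 2 by simp
qed

text \<open>The jump rates give the derivative at time 0, and the branching property makes the probability
  multiplicative in time.\<close>

lemma together_exp: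
  assumes n: "2 \<le> n" and t: "0 \<le> t"
  shows "together n t = exp (- exit_rate n * t)"
proof (rule multiplicative_imp_exp[OF _ _ _ _ t])
  define E where "E = {\<eta>. partition_on {1..n} \<eta> \<and> \<eta> \<noteq> {{1..n}}}"
  have "{\<eta>\<in>E. card \<eta> = 2} = split_at n ` (Pow {2..n} - {{2..n}})"
    unfolding E_def using two_block_partition_iff[OF n] by (auto dest!: two_block_partition_iff[OF n, THEN iffD2, OF imageI])
  then have "((\<lambda>t. prob {w\<in>space M. restr n t w \<in> E} / t) \<longlongrightarrow> exit_rate n) (at_right 0)"
    unfolding exit_rate_def by (intro split_event_rate[OF n]) (auto simp: E_def)
  moreover have "eventually (\<lambda>t. prob {w\<in>space M. restr n t w \<in> E} / t = (1 - together n t) / t) (at_right 0)"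
    using eventually_at_right_less[of 0]
  proof eventually_elim
    case (elim t)
    have "{w\<in>space M. restr n t w \<in> E} = space M - {w\<in>space M. restr n t w = {{1..n}}}"
      using elim partition_X partition_on_restrict_partition[of positive_nats _ "{1..n}"] by (auto simp: E_def)
    then have "prob {w\<in>space M. restr n t w \<in> E} = 1 - together n t"
      unfolding together_def using elim by (simp add: prob_compl sets_restrict_X del: One_nat_def)
    then show ?case by simp
  qed
  ultimately show "((\<lambda>t. (1 - together n t) / t) \<longlongrightarrow> exit_rate n) (at_right 0)"
    by (rule Lim_transform_eventually)
qed (use together_mult n in \<open>auto simp: together_def\<close>)

lemma exit_rate_eq_sum:
  assumes n: "2 \<le> n"
  shows "exit_rate n = (\<Sum>k<n - 1. real (n - 1 choose k) * Beta (real k + 1 + \<beta> + 1) (real (n - 1 - k) + \<beta> + 1))"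
proof -
  define f where "f = (\<lambda>k. if k = n - 1 then 0 else Beta (real k + 1 + \<beta> + 1) (real (n - 1 - k) + \<beta> + 1))"
  have c: "card {2..n} = n - 1" by simp
  have full: "card A = n - 1 \<longleftrightarrow> A = {2..n}" if "A \<subseteq> {2..n}" for A
    using card_subset_eq[OF _ that] c by auto
  have "exit_rate n = (\<Sum>A\<in>Pow {2..n}. f (card A))"
    unfolding exit_rate_def set_rate_def f_def
    by (rule sum.mono_neutral_cong_left) (use full in auto)
  also have "\<dots> = (\<Sum>k\<le>n - 1. real (n - 1 choose k) * f k)"
    using sum_Pow_by_card[of "{2..n}" f] c by simp
  also have "\<dots> = (\<Sum>k<n - 1. real (n - 1 choose k) * f k)"
    by (simp add: f_def flip: lessThan_Suc_atMost)
  finally show ?thesis unfolding f_def by simp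
qed

lemma exit_rate_2: "exit_rate 2 = r"
  by (simp add: exit_rate_eq_sum r_beta_eq_Beta[OF beta] add_ac)

lemma beta_not_nonpos: "0 < x \<Longrightarrow> x \<notin> \<int>\<^sub>\<le>\<^sub>0" for x :: real
  by (auto elim!: nonpos_Ints_cases)

lemma Beta_shift:
  shows "Beta (\<beta> + 2) (\<beta> + 3) = r / 2"
    and "Beta (\<beta> + 3) (\<beta> + 3) = r * (\<beta> + 2) / (2 * (2 * \<beta> + 5))"
    and "Beta (\<beta> + 2) (\<beta> + 4) = r * (\<beta> + 3) / (2 * (2 * \<beta> + 5))"
proof -
  define b where "b = \<beta> + 2"
  have b: "b > 0" using beta by (simp add: b_def)
  have r: "r = Beta b b" using r_beta_eq_Beta[OF beta] by (simp add: b_def)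
  have 1: "(b + b) * Beta b (b + 1) = b * Beta b b" by (rule Beta_plus1_right[OF beta_not_nonpos[OF b]])
  then have 1: "Beta b (b + 1) = r / 2" using b by (simp add: r)
  have 2: "(b + (b + 1)) * Beta (b + 1) (b + 1) = b * Beta b (b + 1)"
    by (rule Beta_plus1_left[OF beta_not_nonpos[OF b]])
  have 3: "(b + (b + 1)) * Beta b (b + 1 + 1) = (b + 1) * Beta b (b + 1)"
    by (rule Beta_plus1_right) (use b in \<open>auto intro: beta_not_nonpos\<close>)
  show "Beta (\<beta> + 2) (\<beta> + 3) = r / 2" using 1 by (simp add: b_def add.assoc)
  have "Beta (b + 1) (b + 1) = b * (r / 2) / (b + (b + 1))" using 2 b unfolding 1 by (simp add: field_simps)
  then show "Beta (\<beta> + 3) (\<beta> + 3) = r * (\<beta> + 2) / (2 * (2 * \<beta> + 5))"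
    by (simp add: b_def add.assoc mult.commute)
  have "Beta b (b + 1 + 1) = (b + 1) * (r / 2) / (b + (b + 1))" using 3 b unfolding 1 by (simp add: field_simps)
  then show "Beta (\<beta> + 2) (\<beta> + 4) = r * (\<beta> + 3) / (2 * (2 * \<beta> + 5))"
    by (simp add: b_def add.assoc mult.commute)
qed

lemma exit_rate_3: "exit_rate 3 = 3 / 2 * r"
proof -
  have "exit_rate 3 = Beta (\<beta> + 2) (\<beta> + 3) + 2 * Beta (\<beta> + 3) (\<beta> + 2)"
    by (simp add: exit_rate_eq_sum numeral_eq_Suc lessThan_Suc add.commute)
  then show ?thesis using Beta_shift(1) by (simp add: Beta_commute)
qed

text \<open>The difference is \<open>r * (\<beta> + 2) / (2 * (2 * \<beta> + 5))\<close>. Its positivity makes the moment bound for the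
  tagged frequency strict.\<close>

lemma exit_rate_4: "exit_rate 4 < 2 * r"
proof -
  have "exit_rate 4 = Beta (\<beta> + 2) (\<beta> + 4) + 3 * Beta (\<beta> + 3) (\<beta> + 3) + 3 * Beta (\<beta> + 4) (\<beta> + 2)"
    by (simp add: exit_rate_eq_sum numeral_eq_Suc lessThan_Suc add.commute)
  also have "\<dots> = 4 * (r * (\<beta> + 3) / (2 * (2 * \<beta> + 5))) + 3 * (r * (\<beta> + 2) / (2 * (2 * \<beta> + 5)))"
    using Beta_shift(2,3) by (simp add: Beta_commute)
  also have "\<dots> = r * ((7 * \<beta> + 18) / (2 * (2 * \<beta> + 5)))"
    by (simp only: times_divide_eq_right add_divide_distrib[symmetric]) (simp add: algebra_simps)
  also have "\<dots> < r * 2"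
    using beta r_pos by (intro mult_strict_left_mono) (auto simp: field_simps)
  finally show ?thesis by simp
qed

text \<open>Among the binary splits only \<open>{{1}, {2..n}}\<close> isolates label \<open>1\<close>.\<close>

lemma singleton_rate:
  assumes n: "2 \<le> n"
  shows "((\<lambda>t. prob {w\<in>space M. alone n 1 (X t w)} / t) \<longlongrightarrow> Beta (\<beta> + 2) (real n + \<beta>)) (at_right 0)"
proof -
  define E where "E = {\<eta>. partition_on {1..n} \<eta> \<and> {1} \<in> \<eta>}"
  have ne: "{2..n} \<noteq> {}" using n by auto
  have E1: "partition_on {1..n} \<eta> \<and> \<eta> \<noteq> {{1..n}}" if "\<eta> \<in> E" for \<eta>
  proof -
    have "2 \<in> {1..n}" using n by auto
    then have "{1} \<noteq> {1..n}" by (metis numeral_One numeral_eq_iff semiring_norm(85) singletonD)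
    then show ?thesis using that unfolding E_def by blast
  qed
  have two: "{\<eta>\<in>E. card \<eta> = 2} = split_at n ` {{}}"
  proof (intro set_eqI iffI)
    fix \<eta> assume "\<eta> \<in> {\<eta>\<in>E. card \<eta> = 2}"
    then have *: "partition_on {1..n} \<eta>" "{1} \<in> \<eta>" "card \<eta> = 2" by (auto simp: E_def)
    then obtain A where A: "A \<subseteq> {2..n}" "\<eta> = split_at n A" using two_block_partition_iff[OF n, of \<eta>] by auto
    have "insert 1 A = {1}" 
    proof -
      have "{1} = insert 1 A \<or> {1} = {2..n} - A" using *(2) unfolding A(2) split_at_def by blast
      moreover have "1 \<notin> {2..n} - A" by simp
      ultimately show ?thesis by blast
    qed
    then have "A = {}" using A(1) by auto
    then show "\<eta> \<in> split_at n ` {{}}" using A(2) by simp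
  next
    fix \<eta> assume \<eta>: "\<eta> \<in> split_at n ` {{}}"
    then have "\<eta> \<in> split_at n ` (Pow {2..n} - {{2..n}})" using ne by auto
    with two_block_partition_iff[OF n, of \<eta>] have "partition_on {1..n} \<eta> \<and> card \<eta> = 2" by simp
    then show "\<eta> \<in> {\<eta>\<in>E. card \<eta> = 2}" using \<eta> by (auto simp: E_def split_at_def)
  qed
  have "((\<lambda>t. prob {w\<in>space M. restr n t w \<in> E} / t) \<longlongrightarrow> (\<Sum>A\<in>{{}}. set_rate n A)) (at_right 0)"
    by (rule split_event_rate[OF n _ E1 two]) (use ne in auto)
  also have "(\<Sum>A\<in>{{}}. set_rate n A) = Beta (\<beta> + 2) (real n + \<beta>)"
    using n by (simp add: set_rate_def of_nat_diff algebra_simps)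
  finally have 1: "((\<lambda>t. prob {w\<in>space M. restr n t w \<in> E} / t) \<longlongrightarrow> Beta (\<beta> + 2) (real n + \<beta>)) (at_right 0)" .
  have "eventually (\<lambda>t. prob {w\<in>space M. restr n t w \<in> E} / t = prob {w\<in>space M. alone n 1 (X t w)} / t) (at_right 0)"
    using eventually_at_right_less[of 0]
  proof eventually_elim
    case (elim t)
    have "restr n t w \<in> E \<longleftrightarrow> alone n 1 (X t w)" if w: "w \<in> space M" for w
    proof -
      have P: "partition_on positive_nats (X t w)" using partition_X[OF w] elim by simp
      have "partition_on {1..n} (restr n t w)" by (rule partition_on_restrict_partition[OF P]) auto
      moreover have "{1} \<in> restr n t w \<longleftrightarrow> alone n 1 (X t w)"
        by (rule singleton_in_restrict_iff_alone[OF P]) (use n in simp)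
      ultimately show ?thesis unfolding E_def by blast
    qed
    then have "{w\<in>space M. restr n t w \<in> E} = {w\<in>space M. alone n 1 (X t w)}" by blast
    then show ?case by simp
  qed
  with 1 show ?thesis by (rule Lim_transform_eventually)
qed

text \<open>Dominated convergence in the beta integral.\<close>

lemma Beta_tendsto_0: "(\<lambda>n. Beta (\<beta> + 2) (real n + \<beta>)) \<longlonglongrightarrow> 0"
proof -
  define a where "a = \<beta> + 2"
  have a: "a > 0" using beta by (simp add: a_def)
  define f where "f = (\<lambda>k s. s powr (a - 1) * (1 - s) powr (real k + a - 1))"
  have I: "(f k has_integral Beta a (real k + a)) {0..1}" for k
    unfolding f_def by (rule has_integral_Beta_real) (use a in auto)
  have "(\<lambda>k. integral {0..1} (f k)) \<longlonglongrightarrow> integral {0..1} (\<lambda>s::real. 0)"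
  proof (rule dominated_convergence(2)[where h="f 0"])
    show "f k integrable_on {0..1}" for k using I by (rule has_integral_integrable)
    show "f 0 integrable_on {0..1}" using I by (rule has_integral_integrable)
    show "norm (f k s) \<le> f 0 s" if "s \<in> {0..1}" for k s
      using that unfolding f_def by (auto simp: abs_mult intro!: mult_left_mono powr_mono')
    show "(\<lambda>k. f k s) \<longlonglongrightarrow> 0" if s: "s \<in> {0..1}" for s
    proof (cases "s = 0 \<or> s = 1")
      case False
      then have c: "0 < 1 - s" "1 - s < 1" using s by auto
      have "(\<lambda>k. s powr (a - 1) * ((1 - s) powr (a - 1) * (1 - s) ^ k)) \<longlonglongrightarrow> s powr (a - 1) * ((1 - s) powr (a - 1) * 0)"
        using c by (intro tendsto_mult tendsto_const LIMSEQ_power_zero) auto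
      moreover have "f k s = s powr (a - 1) * ((1 - s) powr (a - 1) * (1 - s) ^ k)" for k
        unfolding f_def powr_realpow[OF c(1), symmetric] powr_add[symmetric] by (simp add: algebra_simps)
      ultimately show ?thesis by simp
    qed (auto simp: f_def)
  qed
  then have "(\<lambda>k. Beta a (real k + a)) \<longlonglongrightarrow> 0" using integral_unique[OF I] by simp
  then have "(\<lambda>k. Beta (\<beta> + 2) (real (k + 2) + \<beta>)) \<longlonglongrightarrow> 0" by (simp add: a_def algebra_simps)
  then show ?thesis by (rule LIMSEQ_offset)
qed

end

(* The labels 1, 2, 3, 4 occur as arguments; they have to keep their form. *)
declare One_nat_def [simp del]

section \<open>The frequency of a tagged block\<close>

context homogeneous_fragmentation
begin

lemma (in prob_space) expectation_indicator:
  "(\<integral>w. indicator {w\<in>space M. Q w} w \<partial>M) = prob {w\<in>space M. Q w}"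
proof -
  have *: "{w\<in>space M. Q w} \<inter> space M = {w\<in>space M. Q w}" by blast
  show ?thesis by (simp only: Bochner_Integration.integral_indicator *)
qed

lemma emp_freq_eq_sum: "emp_freq P i N = (\<Sum>j=1..N. if same_block P i j then 1 else 0) / real N"
  unfolding emp_freq_def block_count_eq_sum of_nat_sum
  by (intro arg_cong2[of _ _ _ _ "(/)"] sum.cong) auto

text \<open>Sampling a further label: averaging over \<open>j\<close> replaces the event that \<open>j\<close> lies in the block of
  \<open>1\<close> by the frequency of that block.\<close>

lemma sampling:
  fixes Y :: "'a \<Rightarrow> real"
  assumes Y[measurable]: "Y \<in> borel_measurable M" and K: "AE w in M. \<bar>Y w\<bar> \<le> K" and t: "0 \<le> t"
    and c: "\<And>j. m < j \<Longrightarrow> (\<integral>w. Y w * (if same_block (X t w) 1 j then 1 else 0) \<partial>M) = c"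
  shows "(\<integral>w. Y w * freq (X t w) 1 \<partial>M) = c"
proof -
  define b where "b = (\<lambda>j. \<integral>w. Y w * (if same_block (X t w) 1 j then 1 else 0) \<partial>M)"
  have [measurable]: "(\<lambda>w. emp_freq (X t w) 1 N) \<in> borel_measurable M" "(\<lambda>w. freq (X t w) 1) \<in> borel_measurable M"
    "Measurable.pred M (\<lambda>w. same_block (X t w) i j)" for N i j
    using t by measurable
  have intY: "integrable M Y" by (rule integrable_const_bound[where B=K]) (use K in auto)
  have ib: "integrable M (\<lambda>w. Y w * (if same_block (X t w) 1 j then 1 else 0))" for j
    by (rule Bochner_Integration.integrable_bound[OF intY]) auto
  have 1: "(\<lambda>N. \<integral>w. Y w * emp_freq (X t w) 1 N \<partial>M) \<longlonglongrightarrow> (\<integral>w. Y w * freq (X t w) 1 \<partial>M)"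
  proof (rule integral_dominated_convergence[where w="\<lambda>w. \<bar>Y w\<bar>"])
    show "AE w in M. (\<lambda>N. Y w * emp_freq (X t w) 1 N) \<longlonglongrightarrow> Y w * freq (X t w) 1"
      using AE_regular
    proof eventually_elim
      case (elim w)
      then interpret regular_partition "X t w" using t by blast
      show ?case by (intro tendsto_mult tendsto_const emp_freq_tendsto reg) simp
    qed
    show "AE w in M. norm (Y w * emp_freq (X t w) 1 N) \<le> \<bar>Y w\<bar>" for N
      using emp_freq_bounds by (auto simp: abs_mult intro!: mult_left_le)
  qed (use intY in auto)
  have 2: "(\<integral>w. Y w * emp_freq (X t w) 1 N \<partial>M) = (\<Sum>j=1..N. b j) / real N" for N
  proof -
    have "Y w * emp_freq (X t w) 1 N = (\<Sum>j=1..N. Y w * (if same_block (X t w) 1 j then 1 else 0)) / real N" for w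
      unfolding emp_freq_eq_sum by (simp add: sum_distrib_left)
    then have "(\<integral>w. Y w * emp_freq (X t w) 1 N \<partial>M) = (\<integral>w. (\<Sum>j=1..N. Y w * (if same_block (X t w) 1 j then 1 else 0)) / real N \<partial>M)"
      by presburger
    also have "\<dots> = (\<Sum>j=1..N. b j) / real N" using ib by (simp add: b_def)
    finally show ?thesis .
  qed
  have "(\<lambda>N. (\<Sum>j=1..N. b j) / real N) \<longlonglongrightarrow> c"
  proof -
    have bc: "b j = c" if "m < j" for j using c[OF that] by (simp add: b_def)
    define D where "D = (\<Sum>j=1..m. b j) - real m * c"
    have "(\<lambda>N. c + D / real N) \<longlonglongrightarrow> c + 0" by (intro tendsto_add tendsto_const) real_asymp
    moreover have "eventually (\<lambda>N. c + D / real N = (\<Sum>j=1..N. b j) / real N) sequentially"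
      using eventually_gt_at_top[of m]
    proof eventually_elim
      case (elim N)
      have "(\<Sum>j=1..N. b j) = (\<Sum>j=1..m. b j) + (\<Sum>j=m+1..N. b j)"
        using elim sum.ub_add_nat[of 1 m b "N - m"] by simp
      also have "(\<Sum>j=m+1..N. b j) = (\<Sum>j=m+1..N. c)" using bc by (intro sum.cong) auto
      also have "\<dots> = (real N - real m) * c" using elim by (simp add: of_nat_diff)
      finally show ?case using elim by (simp add: D_def field_simps)
    qed
    ultimately show ?thesis by (simp add: Lim_transform_eventually)
  qed
  with 1 show ?thesis unfolding 2 by (rule LIMSEQ_unique)
qed

lemma AE_freq_bounds: "0 \<le> t \<Longrightarrow> 1 \<le> i \<Longrightarrow> AE w in M. 0 \<le> freq (X t w) i \<and> freq (X t w) i \<le> 1"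
  using AE_regular by eventually_elim (auto simp: regular_partition_def freq_bounds)

lemma AE_tagged_bounds: "0 \<le> t \<Longrightarrow> AE w in M. 0 \<le> freq (X t w) 1 \<and> freq (X t w) 1 \<le> 1"
  using AE_freq_bounds[of t 1] by blast

lemma transposition_permutes: "1 \<le> i \<Longrightarrow> 1 \<le> j \<Longrightarrow> Transposition.transpose i j permutes {1..max i j}" for i j :: nat
  by (rule permutes_swap_id) auto

lemma same_block_permute_eq:
  assumes "\<sigma> permutes A" "\<sigma> i = k" "\<sigma> j = l"
  shows "same_block (permute_partition \<sigma> P) k l = same_block P i j"
  using same_block_permute[OF permutes_bij[OF assms(1)], of P i j] assms(2,3) by simp

lemma measurable_freq_X: "0 \<le> t \<Longrightarrow> (\<lambda>w. freq (X t w) i) \<in> borel_measurable M"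
  by measurable

text \<open>The labels \<open>2, \<dots>, k + 1\<close> are sampled one after the other.\<close>

lemma weighted_freq_moment:
  fixes y :: "nat set set \<Rightarrow> real"
  assumes t: "0 \<le> t" and y[measurable]: "y \<in> borel_measurable partition_algebra"
    and K: "AE w in M. \<bar>y (X t w)\<bar> \<le> K"
    and inv: "\<And>\<sigma> n P. \<sigma> permutes {1..n} \<Longrightarrow> y (permute_partition \<sigma> P) = y P"
  shows "(\<integral>w. y (X t w) * freq (X t w) 1 ^ k \<partial>M) =
    (\<integral>w. y (X t w) * (if \<forall>i\<in>{1..k + 1}. same_block (X t w) 1 i then 1 else 0) \<partial>M)"
proof -
  define f where "f = (\<lambda>m k P. y P * (if \<forall>i\<in>{1..m}. same_block P 1 i then 1 else 0) * freq P 1 ^ k)"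
  have fm[measurable]: "f m k \<in> borel_measurable partition_algebra" for m k unfolding f_def by measurable
  have fX[measurable]: "(\<lambda>w. f m k (X t w)) \<in> borel_measurable M" for m k using t by measurable
  have step: "(\<integral>w. f m (Suc k) (X t w) \<partial>M) = (\<integral>w. f (Suc m) k (X t w) \<partial>M)" if m: "1 \<le> m" for m k
  proof -
    have "(\<integral>w. f m k (X t w) * freq (X t w) 1 \<partial>M) = (\<integral>w. f (Suc m) k (X t w) \<partial>M)"
    proof (rule sampling[OF fX _ t])
      show "AE w in M. \<bar>f m k (X t w)\<bar> \<le> K"
        using AE_tagged_bounds[OF t] K
      proof eventually_elim
        case (elim w)
        have "\<bar>y (X t w)\<bar> * freq (X t w) 1 ^ k \<le> \<bar>y (X t w)\<bar> * 1"
          using elim(1) by (intro mult_left_mono) (auto simp: power_le_one)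
        then show ?case using elim by (auto simp: f_def abs_mult power_abs)
      qed
    next
      fix j assume j: "m < j"
      define \<sigma> where "\<sigma> = Transposition.transpose (Suc m) j"
      have \<sigma>: "\<sigma> permutes {1..max (Suc m) j}" unfolding \<sigma>_def by (rule transposition_permutes) (use j in auto)
      have \<sigma>2: "\<sigma> (Suc m) = j" unfolding \<sigma>_def by simp
      have fix_le: "\<sigma> i = i" if "i \<le> m" for i unfolding \<sigma>_def using that j by (simp add: transpose_apply_other)
      have "f m k (permute_partition \<sigma> P) * (if same_block (permute_partition \<sigma> P) 1 j then 1 else 0) = f (Suc m) k P" for P
      proof -
        have "same_block (permute_partition \<sigma> P) 1 i = same_block P 1 i" if "i \<in> {1..m}" for i
          by (rule same_block_permute_eq[OF \<sigma>]) (use that m in \<open>auto intro!: fix_le\<close>)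
        moreover have "same_block (permute_partition \<sigma> P) 1 j = same_block P 1 (Suc m)"
          by (rule same_block_permute_eq[OF \<sigma>]) (use m in \<open>auto intro!: fix_le \<sigma>2\<close>)
        moreover have "freq (permute_partition \<sigma> P) 1 = freq P 1"
          using freq_permute[OF \<sigma>, of P 1] fix_le[OF m] by simp
        moreover have "{1..Suc m} = insert (Suc m) {1..m}" by auto
        ultimately show ?thesis unfolding f_def inv[OF \<sigma>] by auto
      qed
      moreover have "(\<lambda>P. f m k P * (if same_block P 1 j then 1 else 0)) \<in> borel_measurable partition_algebra" by measurable
      ultimately show "(\<integral>w. f m k (X t w) * (if same_block (X t w) 1 j then 1 else 0) \<partial>M) = (\<integral>w. f (Suc m) k (X t w) \<partial>M)"
        using exchangeable_time[OF \<sigma> _ t, of "\<lambda>P. f m k P * (if same_block P 1 j then 1 else 0)"] by simp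
    qed
    moreover have "f m k P * freq P 1 = f m (Suc k) P" for P by (simp add: f_def)
    ultimately show ?thesis by simp
  qed
  have "(\<integral>w. f m k (X t w) \<partial>M) = (\<integral>w. f (m + k) 0 (X t w) \<partial>M)" if "1 \<le> m" for m
    using that
  proof (induction k arbitrary: m)
    case (Suc k)
    then show ?case using step[of m k] Suc.IH[of "Suc m"] by simp
  qed simp
  then have "(\<integral>w. f 1 k (X t w) \<partial>M) = (\<integral>w. f (k + 1) 0 (X t w) \<partial>M)" by (simp add: add.commute)
  moreover have "(\<integral>w. f 1 k (X t w) \<partial>M) = (\<integral>w. y (X t w) * freq (X t w) 1 ^ k \<partial>M)"
    by (intro Bochner_Integration.integral_cong refl)
      (use t in \<open>auto simp: f_def intro!: same_block_refl[OF partition_X]\<close>)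
  ultimately show ?thesis by (simp add: f_def)
qed

lemma freq_moment:
  assumes t: "0 \<le> t"
  shows "(\<integral>w. freq (X t w) 1 ^ k \<partial>M) = prob {w\<in>space M. \<forall>i\<in>{1..k + 1}. same_block (X t w) 1 i}"
proof -
  have "(\<integral>w. freq (X t w) 1 ^ k \<partial>M) = (\<integral>w. (if \<forall>i\<in>{1..k + 1}. same_block (X t w) 1 i then 1 else 0) \<partial>M)"
    using weighted_freq_moment[OF t, of "\<lambda>_. 1" 1 k] by simp
  also have "\<dots> = (\<integral>w. indicator {w\<in>space M. \<forall>i\<in>{1..k + 1}. same_block (X t w) 1 i} w \<partial>M)"
    by (intro Bochner_Integration.integral_cong refl) (auto simp: indicator_def)
  finally show ?thesis by (simp only: expectation_indicator)
qed

end

context beta_fragmentation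
begin

lemma freq_moment_together:
  assumes t: "0 \<le> t" shows "(\<integral>w. freq (X t w) 1 ^ k \<partial>M) = together (k + 1) t"
proof -
  have "restrict_partition (X t w) {1..k + 1} = {{1..k + 1}} \<longleftrightarrow> (\<forall>i\<in>{1..k + 1}. same_block (X t w) 1 i)"
    if "w \<in> space M" for w
  proof -
    have "restrict_partition (X t w) {1..k + 1} = {{1..k + 1}} \<longleftrightarrow> (\<forall>i\<in>{1..k + 1}. \<forall>j\<in>{1..k + 1}. same_block (X t w) i j)"
      by (rule restrict_eq_whole_iff[OF partition_X[OF that t]]) auto
    also have "\<dots> \<longleftrightarrow> (\<forall>i\<in>{1..k + 1}. same_block (X t w) 1 i)"
      using same_block_trans[OF partition_X[OF that t]] same_block_sym[of "X t w"]
      by (metis atLeastAtMost_iff le_add2 order_refl)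
    finally show ?thesis .
  qed
  then have "{w\<in>space M. restrict_partition (X t w) {1..k + 1} = {{1..k + 1}}} = {w\<in>space M. \<forall>i\<in>{1..k + 1}. same_block (X t w) 1 i}"
    by blast
  then show ?thesis unfolding together_def freq_moment[OF t] by simp
qed

text \<open>A block contains label \<open>1\<close> with probability its frequency, so this is also the mean of the sum of
  \<open>|B| powr (1 + \<alpha>)\<close> over the blocks.\<close>

definition power_moment :: "real \<Rightarrow> real \<Rightarrow> real"
  where "power_moment \<alpha> t = (\<integral>w. freq (X t w) 1 powr \<alpha> \<partial>M)"

lemma AE_freq_powr_le_1:
  assumes "0 \<le> t" "0 < \<alpha>" shows "AE w in M. \<bar>freq (X t w) 1 powr \<alpha>\<bar> \<le> 1"
  using AE_tagged_bounds[OF assms(1)]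
proof eventually_elim
  case (elim w)
  then show ?case using powr_mono2[of \<alpha> "freq (X t w) 1" 1] assms(2) by simp
qed

lemma integrable_freq_powr: "0 \<le> t \<Longrightarrow> 0 < \<alpha> \<Longrightarrow> integrable M (\<lambda>w. freq (X t w) 1 powr \<alpha>)"
  by (rule integrable_const_bound[where B=1]) (use AE_freq_powr_le_1 measurable_freq_X in auto)

lemma integrable_freq_power: "0 \<le> t \<Longrightarrow> integrable M (\<lambda>w. freq (X t w) 1 ^ k)"
proof (rule integrable_const_bound[where B=1])
  assume t: "0 \<le> t"
  show "AE w in M. norm (freq (X t w) 1 ^ k) \<le> 1"
    using AE_tagged_bounds[OF t] by eventually_elim (auto simp: power_abs power_le_one)
  show "(\<lambda>w. freq (X t w) 1 ^ k) \<in> borel_measurable M"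
    using measurable_freq_X[OF t] by measurable
qed

lemma power_moment_bounds:
  assumes "0 \<le> t" "0 < \<alpha>" shows "0 \<le> power_moment \<alpha> t" "power_moment \<alpha> t \<le> 1"
proof -
  show "0 \<le> power_moment \<alpha> t" unfolding power_moment_def by simp
  have "power_moment \<alpha> t \<le> (\<integral>w. 1 \<partial>M)" unfolding power_moment_def
    by (rule integral_mono_AE) (use AE_freq_powr_le_1[OF assms] integrable_freq_powr[OF assms] in auto)
  then show "power_moment \<alpha> t \<le> 1" by (simp add: prob_space)
qed

text \<open>The integer moments of the tagged frequency are multiplicative in time, so by Weierstrass
  approximation its law at time \<open>s + t\<close> is that of a product of independent copies at times \<open>s\<close> and \<open>t\<close>,
  and all moments are multiplicative.\<close>

lemma power_moment_mult:
  assumes \<alpha>: "0 < \<alpha>" and s: "0 \<le> s" and t: "0 \<le> t"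
  shows "power_moment \<alpha> (s + t) = power_moment \<alpha> s * power_moment \<alpha> t"
proof -
  define F where "F = (\<lambda>u w. freq (X u w) 1)"
  have st: "0 \<le> s + t" using s t by simp
  have Fm[measurable]: "F u \<in> borel_measurable M" if "0 \<le> u" for u unfolding F_def by (rule measurable_freq_X[OF that])
  have pm: "power_moment \<alpha> u = (\<integral>w. F u w powr \<alpha> \<partial>M)" for u by (simp add: power_moment_def F_def)
  have Fb: "AE w in M. F u w \<in> {0..1}" if "0 \<le> u" for u
    using AE_tagged_bounds[OF that] by eventually_elim (simp add: F_def)
  have intF: "integrable M (\<lambda>w. F u w ^ k)" if "0 \<le> u" for u k unfolding F_def by (rule integrable_freq_power[OF that])
  have intFp: "integrable M (\<lambda>w. F u w powr \<alpha>)" if "0 \<le> u" for u unfolding F_def by (rule integrable_freq_powr[OF that \<alpha>])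
  define m where "m = (\<lambda>u k. \<integral>w. F u w ^ k \<partial>M)"
  have m_mult: "m (s + t) k = m s k * m t k" for k
    using together_mult[of "k + 1" s t] s t st unfolding m_def F_def by (simp add: freq_moment_together)
  have approx: "\<bar>power_moment \<alpha> (s + t) - power_moment \<alpha> s * power_moment \<alpha> t\<bar> \<le> 3 * e" if e: "0 < e" for e
  proof -
    have "continuous_on {0..1} (\<lambda>x::real. x powr \<alpha>)"
      using \<alpha> by (intro continuous_on_powr') (auto intro!: continuous_intros)
    then obtain p where p: "real_polynomial_function p" "\<And>x. x \<in> {0..1} \<Longrightarrow> \<bar>x powr \<alpha> - p x\<bar> < e"
      using Stone_Weierstrass_real_polynomial_function[of "{0..1}" "\<lambda>x::real. x powr \<alpha>" e] e by auto
    then obtain a N where pa: "p = (\<lambda>x. \<Sum>i\<le>N. a i * x ^ i)" by (auto simp: real_polynomial_function_iff_sum)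
    have intp: "integrable M (\<lambda>w. p (F u w))" if "0 \<le> u" for u unfolding pa using intF[OF that] by simp
    have Ep: "(\<integral>w. p (F u w) \<partial>M) = (\<Sum>i\<le>N. a i * m u i)" if "0 \<le> u" for u
      unfolding pa m_def using intF[OF that] by simp
    have inner: "(\<integral>w'. p (x * F t w') \<partial>M) = (\<Sum>i\<le>N. a i * x ^ i * m t i)" for x
      unfolding pa m_def using intF[OF t] by (simp add: power_mult_distrib mult.assoc[symmetric])
    have inner_int: "integrable M (\<lambda>w'. p (x * F t w'))" for x
      unfolding pa using intF[OF t] by (simp add: power_mult_distrib mult.assoc[symmetric])
    have nested: "(\<integral>w. (\<integral>w'. p (F s w * F t w') \<partial>M) \<partial>M) = (\<integral>w. p (F (s + t) w) \<partial>M)"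
    proof -
      have "(\<integral>w. (\<integral>w'. p (F s w * F t w') \<partial>M) \<partial>M) = (\<Sum>i\<le>N. a i * m s i * m t i)"
        unfolding inner using intF[OF s] by (simp add: m_def)
      also have "\<dots> = (\<Sum>i\<le>N. a i * m (s + t) i)" by (simp add: m_mult mult.assoc)
      finally show ?thesis using Ep[OF st] by simp
    qed
    have b1: "\<bar>power_moment \<alpha> (s + t) - (\<integral>w. p (F (s + t) w) \<partial>M)\<bar> \<le> e"
    proof -
      have "power_moment \<alpha> (s + t) - (\<integral>w. p (F (s + t) w) \<partial>M) = (\<integral>w. F (s + t) w powr \<alpha> - p (F (s + t) w) \<partial>M)"
        unfolding pm using intFp[OF st] intp[OF st] by simp
      also have "\<bar>\<dots>\<bar> \<le> (\<integral>w. \<bar>F (s + t) w powr \<alpha> - p (F (s + t) w)\<bar> \<partial>M)" by (rule integral_abs_bound)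
      also have "\<dots> \<le> (\<integral>w. e \<partial>M)"
      proof (rule integral_mono_AE)
        show "AE w in M. \<bar>F (s + t) w powr \<alpha> - p (F (s + t) w)\<bar> \<le> e"
          using Fb[OF st] by eventually_elim (use p(2) in \<open>simp add: less_imp_le\<close>)
      qed (use intFp[OF st] intp[OF st] in auto)
      finally show ?thesis by (simp add: prob_space)
    qed
    have pt: "\<bar>x powr \<alpha> * power_moment \<alpha> t - (\<integral>w'. p (x * F t w') \<partial>M)\<bar> \<le> e" if x: "x \<in> {0..1}" for x
    proof -
      have i1: "integrable M (\<lambda>w'. (x * F t w') powr \<alpha>)"
      proof (rule integrable_const_bound[where B=1])
        show "AE w' in M. norm ((x * F t w') powr \<alpha>) \<le> 1"
          using Fb[OF t]
        proof eventually_elim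
          case (elim w')
          then have "x * F t w' \<le> 1" "0 \<le> x * F t w'" using x by (auto intro: mult_le_one)
          then show ?case using powr_mono2[of \<alpha> "x * F t w'" 1] \<alpha> by simp
        qed
      qed (use Fm[OF t] in measurable)
      have "x powr \<alpha> * power_moment \<alpha> t = (\<integral>w'. (x * F t w') powr \<alpha> \<partial>M)"
      proof -
        have "x powr \<alpha> * power_moment \<alpha> t = (\<integral>w'. x powr \<alpha> * F t w' powr \<alpha> \<partial>M)"
          unfolding pm using intFp[OF t] by simp
        also have "\<dots> = (\<integral>w'. (x * F t w') powr \<alpha> \<partial>M)"
          using Fb[OF t] Fm[OF t] x by (intro integral_cong_AE) (auto elim!: eventually_mono simp: powr_mult)
        finally show ?thesis .
      qed
      then have "x powr \<alpha> * power_moment \<alpha> t - (\<integral>w'. p (x * F t w') \<partial>M) = (\<integral>w'. (x * F t w') powr \<alpha> - p (x * F t w') \<partial>M)"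
        using i1 inner_int by simp
      also have "\<bar>\<dots>\<bar> \<le> (\<integral>w'. \<bar>(x * F t w') powr \<alpha> - p (x * F t w')\<bar> \<partial>M)" by (rule integral_abs_bound)
      also have "\<dots> \<le> (\<integral>w'. e \<partial>M)"
      proof (rule integral_mono_AE)
        show "AE w' in M. \<bar>(x * F t w') powr \<alpha> - p (x * F t w')\<bar> \<le> e"
          using Fb[OF t]
        proof eventually_elim
          case (elim w')
          then have "x * F t w' \<in> {0..1}" using x by (auto intro: mult_le_one)
          from p(2)[OF this] show ?case by simp
        qed
      qed (use i1 inner_int in auto)
      finally show ?thesis by (simp add: prob_space)
    qed
    have b2: "\<bar>power_moment \<alpha> s * power_moment \<alpha> t - (\<integral>w. (\<integral>w'. p (F s w * F t w') \<partial>M) \<partial>M)\<bar> \<le> e"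
    proof -
      have i2: "integrable M (\<lambda>w. \<integral>w'. p (F s w * F t w') \<partial>M)"
        unfolding inner using intF[OF s] by simp
      have i3: "integrable M (\<lambda>w. F s w powr \<alpha> * power_moment \<alpha> t)" using intFp[OF s] by simp
      have "power_moment \<alpha> s * power_moment \<alpha> t - (\<integral>w. (\<integral>w'. p (F s w * F t w') \<partial>M) \<partial>M) =
          (\<integral>w. F s w powr \<alpha> * power_moment \<alpha> t - (\<integral>w'. p (F s w * F t w') \<partial>M) \<partial>M)"
        using i2 i3 intFp[OF s] by (simp add: pm[of s])
      also have "\<bar>\<dots>\<bar> \<le> (\<integral>w. \<bar>F s w powr \<alpha> * power_moment \<alpha> t - (\<integral>w'. p (F s w * F t w') \<partial>M)\<bar> \<partial>M)" by (rule integral_abs_bound)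
      also have "\<dots> \<le> (\<integral>w. e \<partial>M)"
      proof (rule integral_mono_AE)
        show "AE w in M. \<bar>F s w powr \<alpha> * power_moment \<alpha> t - (\<integral>w'. p (F s w * F t w') \<partial>M)\<bar> \<le> e"
          using Fb[OF s] by eventually_elim (rule pt)
      qed (use i2 i3 in auto)
      finally show ?thesis by (simp add: prob_space)
    qed
    show ?thesis using b1 b2 unfolding nested by linarith
  qed
  have "\<bar>power_moment \<alpha> (s + t) - power_moment \<alpha> s * power_moment \<alpha> t\<bar> \<le> 0"
  proof (rule field_le_epsilon)
    fix e :: real assume "e > 0"
    then show "\<bar>power_moment \<alpha> (s + t) - power_moment \<alpha> s * power_moment \<alpha> t\<bar> \<le> 0 + e" using approx[of "e / 3"] by simp
  qed
  then show ?thesis by simp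
qed

text \<open>There is no dust. A block of frequency zero is almost surely a singleton, and label \<open>1\<close> becomes a
  singleton among \<open>n\<close> labels at a rate which vanishes as \<open>n\<close> grows.\<close>

lemma AE_freq_pos:
  assumes t: "0 \<le> t" shows "AE w in M. freq (X t w) 1 > 0"
proof -
  define h where "h = (\<lambda>u. prob {w\<in>space M. freq (X u w) 1 > 0})"
  define q where "q = (\<lambda>n u. prob {w\<in>space M. alone n 1 (X u w)})"
  have ms: "{w\<in>space M. freq (X u w) 1 > 0} \<in> sets M" if "0 \<le> u" for u
    using measurable_freq_X[OF that, of 1] by measurable
  have h_lim: "(\<lambda>k. power_moment (1 / real (Suc k)) u) \<longlonglongrightarrow> h u" if u: "0 \<le> u" for u
  proof -
    have "(\<lambda>k. \<integral>w. freq (X u w) 1 powr (1 / real (Suc k)) \<partial>M) \<longlonglongrightarrow> (\<integral>w. indicator {w\<in>space M. freq (X u w) 1 > 0} w \<partial>M)"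
    proof (rule integral_dominated_convergence[where w="\<lambda>_. 1"])
      show "AE w in M. (\<lambda>k. freq (X u w) 1 powr (1 / real (Suc k))) \<longlonglongrightarrow> indicator {w\<in>space M. freq (X u w) 1 > 0} w"
        using AE_tagged_bounds[OF u] AE_space
      proof eventually_elim
        case (elim w)
        show ?case
        proof (cases "freq (X u w) 1 > 0")
          case True
          have "(\<lambda>k. x powr (1 / real (Suc k))) \<longlonglongrightarrow> 1" if "x > 0" for x :: real using that by real_asymp
          from this[OF True] show ?thesis using True elim by simp
        next
          case False
          then have "freq (X u w) 1 = 0" using elim by simp
          then show ?thesis using False by simp
        qed
      qed
      show "AE w in M. norm (freq (X u w) 1 powr (1 / real (Suc k))) \<le> 1" for k
        using AE_freq_powr_le_1[OF u, of "1 / real (Suc k)"] by simp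
    qed (use ms[OF u] measurable_freq_X[OF u] in auto)
    then show ?thesis by (simp only: expectation_indicator h_def power_moment_def)
  qed
  have h_mult: "h (u + v) = h u * h v" if "0 \<le> u" "0 \<le> v" for u v
  proof (rule LIMSEQ_unique[OF h_lim])
    show "(\<lambda>k. power_moment (1 / real (Suc k)) (u + v)) \<longlonglongrightarrow> h u * h v"
      using tendsto_mult[OF h_lim h_lim] that by (simp add: power_moment_mult)
  qed (use that in auto)
  have h01: "0 \<le> h u" "h u \<le> 1" for u unfolding h_def by auto
  have h_q: "1 - h u \<le> q n u" if u: "0 \<le> u" for u n
  proof -
    define Y where "Y = (\<lambda>P. if freq P 1 = 0 then 1 else (0::real))"
    have Ym[measurable]: "Y \<in> borel_measurable partition_algebra" unfolding Y_def by measurable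
    have YX[measurable]: "(\<lambda>w. Y (X u w)) \<in> borel_measurable M" using u by measurable
    define c where "c = (\<integral>w. Y (X u w) * (if same_block (X u w) 1 2 then 1 else 0) \<partial>M)"
    have cj: "(\<integral>w. Y (X u w) * (if same_block (X u w) 1 j then 1 else 0) \<partial>M) = c" if j: "1 < j" for j
    proof -
      define \<sigma> where "\<sigma> = Transposition.transpose 2 j"
      have \<sigma>: "\<sigma> permutes {1..max 2 j}" unfolding \<sigma>_def by (rule transposition_permutes) (use j in auto)
      have \<sigma>1: "\<sigma> 1 = 1" unfolding \<sigma>_def using j by (simp add: transpose_apply_other)
      have "Y (permute_partition \<sigma> P) * (if same_block (permute_partition \<sigma> P) 1 j then 1 else 0) = Y P * (if same_block P 1 2 then 1 else 0)" for P
      proof -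
        have "same_block (permute_partition \<sigma> P) 1 j = same_block P 1 2"
          by (rule same_block_permute_eq[OF \<sigma> \<sigma>1]) (simp add: \<sigma>_def)
        moreover have "freq (permute_partition \<sigma> P) 1 = freq P 1" using freq_permute[OF \<sigma>, of P 1] \<sigma>1 by simp
        ultimately show ?thesis unfolding Y_def by simp
      qed
      then show ?thesis
        using exchangeable_time[OF \<sigma> _ u, of "\<lambda>P. Y P * (if same_block P 1 j then 1 else 0)"] by (simp add: c_def)
    qed
    have "(\<integral>w. Y (X u w) * freq (X u w) 1 \<partial>M) = c"
      by (rule sampling[OF YX _ u cj, of 1]) (auto simp: Y_def)
    moreover have "Y P * freq P 1 = 0" for P by (simp add: Y_def)
    ultimately have c0: "c = 0" by simp
    have "AE w in M. freq (X u w) 1 = 0 \<longrightarrow> \<not> same_block (X u w) 1 j" if j: "1 < j" for j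
    proof -
      have jm[measurable]: "Measurable.pred M (\<lambda>w. same_block (X u w) 1 j)" using u by measurable
      have "AE w in M. Y (X u w) * (if same_block (X u w) 1 j then 1 else 0) = 0"
      proof (subst integral_nonneg_eq_0_iff_AE[symmetric])
        show "integrable M (\<lambda>w. Y (X u w) * (if same_block (X u w) 1 j then 1 else 0))"
          by (rule integrable_const_bound[where B=1, OF _ borel_measurable_times[OF YX]]) (auto simp: Y_def)
      qed (use cj[OF j] c0 in \<open>auto simp: Y_def\<close>)
      then show ?thesis by eventually_elim (auto simp: Y_def split: if_splits)
    qed
    then have AEs: "AE w in M. \<forall>j. 1 < j \<longrightarrow> freq (X u w) 1 = 0 \<longrightarrow> \<not> same_block (X u w) 1 j"
      unfolding AE_all_countable by auto
    have "1 - h u = prob (space M - {w\<in>space M. freq (X u w) 1 > 0})"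
      unfolding h_def using ms[OF u] by (simp add: prob_compl)
    also have "\<dots> \<le> q n u"
      unfolding q_def
    proof (rule finite_measure_mono_AE)
      show "AE w in M. w \<in> space M - {w\<in>space M. freq (X u w) 1 > 0} \<longrightarrow> w \<in> {w\<in>space M. alone n 1 (X u w)}"
        using AEs AE_tagged_bounds[OF u] by eventually_elim (auto simp: alone_def)
    qed (rule sets_alone[OF u])
    finally show ?thesis .
  qed
  have "h t = 1"
  proof (cases "t = 0")
    case True
    have "h 0 * h 0 = h 0" using h_mult[of 0 0] by simp
    moreover have "h 0 \<noteq> 0"
    proof -
      have "(\<integral>w. freq (X 0 w) 1 ^ 1 \<partial>M) = together 2 0" using freq_moment_together[of 0 1] by (simp add: numeral_2_eq_2)
      also have "\<dots> = 1" using together_exp[of 2 0] by simp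
      finally have I: "(\<integral>w. freq (X 0 w) 1 \<partial>M) = 1" by simp
      have "(\<integral>w. freq (X 0 w) 1 \<partial>M) \<le> (\<integral>w. indicator {w\<in>space M. freq (X 0 w) 1 > 0} w \<partial>M)"
      proof (rule integral_mono_AE)
        show "AE w in M. freq (X 0 w) 1 \<le> indicator {w\<in>space M. freq (X 0 w) 1 > 0} w"
          using AE_tagged_bounds[of 0, OF order_refl] AE_space by eventually_elim (auto simp: indicator_def)
      qed (use integrable_freq_power[of 0 1] ms[of 0] in \<open>auto simp: emeasure_eq_measure\<close>)
      then show ?thesis using I unfolding expectation_indicator h_def by linarith
    qed
    ultimately show ?thesis using True by simp
  next
    case False
    then have tp: "t > 0" using t by simp
    have le: "1 - h t \<le> t * Beta (\<beta> + 2) (real n + \<beta>)" if n: "2 \<le> n" for n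
    proof -
      have seq: "filterlim (\<lambda>N. t / real N) (at_right 0) sequentially" using tp by real_asymp
      have "(\<lambda>N. t * (q n (t / real N) / (t / real N))) \<longlonglongrightarrow> t * Beta (\<beta> + 2) (real n + \<beta>)"
        using singleton_rate[OF n] unfolding q_def
        by (intro tendsto_mult tendsto_const filterlim_compose[OF _ seq])
      moreover have "1 - h t \<le> t * (q n (t / real N) / (t / real N))" if N: "N \<ge> 1" for N
      proof -
        have "h t = h (t / real N) ^ N" using multiplicative_power[of h "t / real N" N] h_mult tp N by simp
        moreover have "1 + real N * (h (t / real N) - 1) \<le> (1 + (h (t / real N) - 1)) ^ N"
          by (rule Bernoulli_inequality) (use h01 in simp)
        ultimately have "1 - h t \<le> real N * (1 - h (t / real N))" by (simp add: algebra_simps)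
        also have "\<dots> \<le> real N * q n (t / real N)" using tp by (intro mult_left_mono h_q) auto
        also have "\<dots> = t * (q n (t / real N) / (t / real N))" using tp N by simp
        finally show ?thesis .
      qed
      ultimately show ?thesis by (intro LIMSEQ_le_const) auto
    qed
    have "(\<lambda>n. t * Beta (\<beta> + 2) (real n + \<beta>)) \<longlonglongrightarrow> t * 0" by (intro tendsto_mult tendsto_const Beta_tendsto_0)
    then have "1 - h t \<le> 0" using le by (intro LIMSEQ_le_const[where X="\<lambda>n. t * Beta (\<beta> + 2) (real n + \<beta>)"]) auto
    then show ?thesis using h01(2)[of t] by simp
  qed
  then show ?thesis unfolding h_def using ms[OF t] by (simp add: prob_eq_1)
qed

text \<open>The exponent \<open>5/4 r\<close> is the Cauchy--Schwarz bound from the first two moments \<open>exp (- r)\<close> and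
  \<open>exp (- 3/2 r)\<close>; it is strict because the third moment is too large for the frequency to take a
  single nonzero value.\<close>

lemma power_moment_1_less: "power_moment (3/2) 1 < exp (- (5/4) * r)"
proof -
  define F where "F = (\<lambda>w. freq (X 1 w) 1)"
  have M1: "(\<integral>w. F w ^ 1 \<partial>M) = exp (- r)"
    using freq_moment_together[of 1 1] together_exp[of 2 1] exit_rate_2 by (simp add: F_def numeral_2_eq_2)
  have M2: "(\<integral>w. F w ^ 2 \<partial>M) = exp (- (3/2) * r)"
    using freq_moment_together[of 1 2] together_exp[of 3 1] exit_rate_3 by (simp add: F_def numeral_3_eq_3 numeral_2_eq_2)
  have M3: "(\<integral>w. F w ^ 3 \<partial>M) > exp (- 2 * r)"
    using freq_moment_together[of 1 3] together_exp[of 4 1] exit_rate_4 by (simp add: F_def)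
  have int: "integrable M (\<lambda>w. F w ^ k)" for k unfolding F_def by (rule integrable_freq_power) simp
  define a where "a = exp (- r / 4)"
  have a: "a > 0" "a \<le> 1" using r_pos by (auto simp: a_def)
  have pw: "exp (- r) = a ^ 4" "exp (- (3/2) * r) = a ^ 6" "exp (- 2 * r) = a ^ 8" "exp (- (5/4) * r) = a ^ 5"
    unfolding a_def by (simp_all flip: exp_of_nat_mult)
  \<comment> \<open>Cauchy--Schwarz as a pointwise inequality that keeps a remainder: for \<open>y = sqrt x\<close> the
    difference of the two sides is \<open>y\<^sup>2 * (y - a)\<^sup>2 * (4 - (y + a)\<^sup>2) / (8 * a)\<close>.\<close>
  have pt: "x powr (3/2) \<le> x ^ 2 / (2 * a) + a * x / 2 - (x ^ 3 - 2 * a ^ 2 * x ^ 2 + a ^ 4 * x) / (8 * a)"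
    if x: "0 \<le> x" "x \<le> 1" for x
  proof -
    define y where "y = sqrt x"
    have y: "0 \<le> y" "y \<le> 1" "x = y ^ 2" using x by (auto simp: y_def real_sqrt_le_1_iff)
    have "x powr (3/2) = y ^ 3"
    proof (cases "x = 0")
      case False
      then have "x powr (3/2) = (x powr (1/2)) powr 3" by (simp add: powr_powr)
      then show ?thesis using x False by (simp add: powr_half_sqrt y_def powr_numeral)
    qed (simp add: y_def)
    moreover have "y ^ 4 / (2 * a) + a * y ^ 2 / 2 - (y ^ 6 - 2 * a ^ 2 * y ^ 4 + a ^ 4 * y ^ 2) / (8 * a) - y ^ 3
        = y ^ 2 * (y - a) ^ 2 * (4 - (y + a) ^ 2) / (8 * a)"
    proof -
      have "y ^ 6 - 2 * a ^ 2 * y ^ 4 + a ^ 4 * y ^ 2 = y ^ 2 * (y - a) ^ 2 * (y + a) ^ 2"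
        by (simp add: power_numeral_reduce algebra_simps)
      moreover have "y ^ 4 / (2 * a) + a * y ^ 2 / 2 - y ^ 3 = y ^ 2 * (y - a) ^ 2 * 4 / (8 * a)"
        using a(1) by (simp add: divide_simps) (simp add: power_numeral_reduce algebra_simps)
      ultimately show ?thesis by (simp add: right_diff_distrib diff_divide_distrib)
    qed
    moreover have "0 \<le> y ^ 2 * (y - a) ^ 2 * (4 - (y + a) ^ 2) / (8 * a)"
    proof -
      have "(y + a) ^ 2 \<le> 2 ^ 2" using y a by (intro power_mono) auto
      then show ?thesis using a by simp
    qed
    moreover have "x ^ 2 = y ^ 4" "x ^ 3 = y ^ 6" unfolding y(3) by (simp_all flip: power_mult)
    ultimately show ?thesis using y(3) by simp
  qed
  have "power_moment (3/2) 1 \<le> (\<integral>w. F w ^ 2 / (2 * a) + a * F w ^ 1 / 2 - (F w ^ 3 - 2 * a ^ 2 * F w ^ 2 + a ^ 4 * F w ^ 1) / (8 * a) \<partial>M)"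
    unfolding power_moment_def
  proof (rule integral_mono_AE)
    show "AE w in M. freq (X 1 w) 1 powr (3/2) \<le> F w ^ 2 / (2 * a) + a * F w ^ 1 / 2 - (F w ^ 3 - 2 * a ^ 2 * F w ^ 2 + a ^ 4 * F w ^ 1) / (8 * a)"
      using AE_tagged_bounds[of 1, OF zero_le_one] by eventually_elim (use pt in \<open>auto simp: F_def\<close>)
  next
    show "integrable M (\<lambda>w. F w ^ 2 / (2 * a) + a * F w ^ 1 / 2 - (F w ^ 3 - 2 * a ^ 2 * F w ^ 2 + a ^ 4 * F w ^ 1) / (8 * a))"
      by (intro Bochner_Integration.integrable_diff Bochner_Integration.integrable_add integrable_divide integrable_mult_right int)
  qed (use integrable_freq_powr[of 1 "3/2"] in auto)
  also have "\<dots> = a ^ 6 / (2 * a) + a * a ^ 4 / 2 - ((\<integral>w. F w ^ 3 \<partial>M) - 2 * a ^ 2 * a ^ 6 + a ^ 4 * a ^ 4) / (8 * a)"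
  proof -
    have "(\<integral>w. F w ^ 2 / (2 * a) + a * F w ^ 1 / 2 - (F w ^ 3 - 2 * a ^ 2 * F w ^ 2 + a ^ 4 * F w ^ 1) / (8 * a) \<partial>M)
      = (\<integral>w. F w ^ 2 \<partial>M) / (2 * a) + a * (\<integral>w. F w ^ 1 \<partial>M) / 2 -
        ((\<integral>w. F w ^ 3 \<partial>M) - 2 * a ^ 2 * (\<integral>w. F w ^ 2 \<partial>M) + a ^ 4 * (\<integral>w. F w ^ 1 \<partial>M)) / (8 * a)"
      using int[of 1] int[of 2] int[of 3] by simp
    then show ?thesis unfolding M1 M2 pw .
  qed
  also have "\<dots> = a ^ 5 - ((\<integral>w. F w ^ 3 \<partial>M) - a ^ 8) / (8 * a)"
    using a(1) by (simp add: divide_simps) (simp add: power_numeral_reduce algebra_simps)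
  also have "\<dots> < a ^ 5" using M3 a(1) unfolding pw by simp
  finally show ?thesis unfolding pw .
qed

text \<open>Multiplicativity in time turns the strict inequality at time 1 into an exponential rate.\<close>

lemma power_moment_decay:
  "\<exists>\<kappa> C. 5/4 * r < \<kappa> \<and> 0 < C \<and> (\<forall>t\<ge>0. power_moment (3/2) t \<le> C * exp (- \<kappa> * t))"
proof -
  \<comment> \<open>The maximum keeps \<open>\<theta>\<close> positive, so that it has a logarithm.\<close>
  define \<theta> where "\<theta> = max (power_moment (3/2) 1) (exp (- (5/4) * r - 1))"
  have \<theta>: "0 < \<theta>" "\<theta> < exp (- (5/4) * r)" "power_moment (3/2) 1 \<le> \<theta>"
    unfolding \<theta>_def using power_moment_1_less by (auto simp: less_max_iff_disj)
  define \<kappa> where "\<kappa> = - ln \<theta>"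
  have e\<kappa>: "exp (- \<kappa>) = \<theta>" unfolding \<kappa>_def using \<theta> by simp
  have "ln \<theta> < - (5/4) * r" using \<theta> by (metis exp_gt_zero ln_exp ln_less_cancel_iff)
  then have \<kappa>: "5/4 * r < \<kappa>" unfolding \<kappa>_def by simp
  have \<kappa>0: "\<kappa> > 0" using \<kappa> r_pos by simp
  have pow: "power_moment (3/2) (real N) \<le> \<theta> ^ N" for N
  proof (induction N)
    case (Suc N)
    have "power_moment (3/2) (real (Suc N)) = power_moment (3/2) 1 * power_moment (3/2) (real N)"
      using power_moment_mult[of "3/2" 1 "real N"] by (simp add: add.commute)
    also have "\<dots> \<le> \<theta> * \<theta> ^ N" using Suc \<theta> power_moment_bounds[of "real N" "3/2"] by (intro mult_mono) auto
    finally show ?case by simp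
  qed (use power_moment_bounds[of 0 "3/2"] in auto)
  have "power_moment (3/2) t \<le> exp \<kappa> * exp (- \<kappa> * t)" if t: "0 \<le> t" for t
  proof -
    define N where "N = nat \<lfloor>t\<rfloor>"
    have N: "real N \<le> t" "t < real N + 1" unfolding N_def using t by (simp_all add: floor_less_iff)
    have "power_moment (3/2) t = power_moment (3/2) (real N) * power_moment (3/2) (t - real N)"
      using power_moment_mult[of "3/2" "real N" "t - real N"] N by simp
    also have "\<dots> \<le> \<theta> ^ N * 1"
      using pow[of N] power_moment_bounds[of "t - real N" "3/2"] power_moment_bounds[of "real N" "3/2"] N \<theta> by (intro mult_mono) auto
    also have "\<dots> = exp (- \<kappa> * real N)" unfolding e\<kappa>[symmetric] by (simp flip: exp_of_nat_mult add: mult.commute)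
    also have "\<dots> \<le> exp (\<kappa> - \<kappa> * t)"
      using mult_left_mono[of "t" "real N + 1" \<kappa>] N \<kappa>0 by (simp add: algebra_simps)
    also have "\<dots> = exp \<kappa> * exp (- \<kappa> * t)" by (simp flip: exp_add)
    finally show ?thesis .
  qed
  then show ?thesis using \<kappa> by (intro exI[of _ \<kappa>] exI[of _ "exp \<kappa>"]) auto
qed

end

section \<open>Averages over labels\<close>

text \<open>The counterpart of \<open>mean_power\<close> with empirical frequencies. For \<open>\<alpha> = 1\<close> it is the proportion of
  pairs in \<open>{1..N}\<close> that share a block.\<close>

definition emp_mean :: "real \<Rightarrow> nat set set \<Rightarrow> nat \<Rightarrow> real"
  where "emp_mean \<alpha> P N = (\<Sum>i=1..N. emp_freq P i N powr \<alpha>) / real N"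

lemma measurable_emp_mean[measurable]: "(\<lambda>P. emp_mean \<alpha> P N) \<in> borel_measurable partition_algebra"
  unfolding emp_mean_def by measurable

lemma measurable_mean_power[measurable]: "(\<lambda>P. mean_power \<alpha> P N) \<in> borel_measurable partition_algebra"
  unfolding mean_power_def by measurable

context homogeneous_fragmentation
begin

lemma expectation_label_invariant:
  fixes h :: "nat set set \<Rightarrow> nat \<Rightarrow> real"
  assumes t: "0 \<le> t" and i: "1 \<le> i" "i \<le> N"
    and h: "(\<lambda>P. h P i) \<in> borel_measurable partition_algebra"
    and inv: "\<And>\<sigma> P j. \<sigma> permutes {1..N} \<Longrightarrow> h (permute_partition \<sigma> P) (\<sigma> j) = h P j"
  shows "(\<integral>w. h (X t w) i \<partial>M) = (\<integral>w. h (X t w) 1 \<partial>M)"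
proof -
  define \<sigma> where "\<sigma> = Transposition.transpose 1 i"
  have \<sigma>: "\<sigma> permutes {1..N}" unfolding \<sigma>_def using i by (intro permutes_swap_id) auto
  have "h (permute_partition \<sigma> P) i = h P 1" for P using inv[OF \<sigma>, of P 1] by (simp add: \<sigma>_def)
  then show ?thesis using exchangeable_time[OF \<sigma> h t] by simp
qed

lemma expectation_average:
  fixes h :: "nat set set \<Rightarrow> nat \<Rightarrow> real"
  assumes t: "0 \<le> t" and N: "1 \<le> N"
    and h: "\<And>i. (\<lambda>P. h P i) \<in> borel_measurable partition_algebra"
    and inv: "\<And>\<sigma> P j. \<sigma> permutes {1..N} \<Longrightarrow> h (permute_partition \<sigma> P) (\<sigma> j) = h P j"
    and int: "\<And>i. 1 \<le> i \<Longrightarrow> i \<le> N \<Longrightarrow> integrable M (\<lambda>w. h (X t w) i)"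
  shows "(\<integral>w. (\<Sum>i=1..N. h (X t w) i) / real N \<partial>M) = (\<integral>w. h (X t w) 1 \<partial>M)"
proof -
  have "(\<integral>w. (\<Sum>i=1..N. h (X t w) i) / real N \<partial>M) = (\<Sum>i=1..N. \<integral>w. h (X t w) i \<partial>M) / real N"
    using int by simp
  also have "(\<Sum>i=1..N. \<integral>w. h (X t w) i \<partial>M) = (\<Sum>i=1..N. \<integral>w. h (X t w) 1 \<partial>M)"
    by (intro sum.cong refl expectation_label_invariant[OF t _ _ h inv]) auto
  finally show ?thesis using N by simp
qed

lemma measurable_mass_moment_X: "0 \<le> t \<Longrightarrow> (\<lambda>w. mass_moment \<alpha> (X t w)) \<in> borel_measurable M"
  by measurable

lemma AE_regular_at: "0 \<le> t \<Longrightarrow> AE w in M. regular_partition (X t w)"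
  using AE_regular by eventually_elim auto

lemma AE_mass_moment_bounds:
  assumes "0 \<le> t" "0 < \<alpha>" shows "AE w in M. 0 \<le> mass_moment \<alpha> (X t w) \<and> mass_moment \<alpha> (X t w) \<le> 1"
  using AE_regular_at[OF assms(1)]
  by eventually_elim (use assms(2) in \<open>auto simp: regular_partition.mass_moment_bounds\<close>)

lemma integrable_mass_moment: "0 \<le> t \<Longrightarrow> 0 < \<alpha> \<Longrightarrow> integrable M (\<lambda>w. mass_moment \<alpha> (X t w))"
proof (rule integrable_const_bound[where B=1])
  assume *: "0 \<le> t" "0 < \<alpha>"
  show "AE w in M. norm (mass_moment \<alpha> (X t w)) \<le> 1"
    using AE_mass_moment_bounds[OF *] by eventually_elim auto
qed (rule measurable_mass_moment_X)

lemma powr_le_1: "0 \<le> x \<Longrightarrow> x \<le> 1 \<Longrightarrow> 0 < \<alpha> \<Longrightarrow> x powr \<alpha> \<le> (1::real)"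
  using powr_mono2[of \<alpha> x 1] by simp

lemma AE_freq_powr_bounds:
  assumes "0 \<le> t" "0 < \<alpha>" "1 \<le> i"
  shows "AE w in M. 0 \<le> freq (X t w) i powr \<alpha> \<and> freq (X t w) i powr \<alpha> \<le> 1"
  using AE_freq_bounds[OF assms(1,3)] by eventually_elim (use assms(2) in \<open>auto intro: powr_le_1\<close>)

lemma integrable_label_powr:
  assumes "0 \<le> t" "0 < \<alpha>" "1 \<le> i" shows "integrable M (\<lambda>w. freq (X t w) i powr \<alpha>)"
proof (rule integrable_const_bound[where B=1])
  show "AE w in M. norm (freq (X t w) i powr \<alpha>) \<le> 1"
    using AE_freq_powr_bounds[OF assms] by eventually_elim simp
qed (use measurable_freq_X[OF assms(1)] in measurable)

lemma measurable_emp_freq_X: "0 \<le> t \<Longrightarrow> (\<lambda>w. emp_freq (X t w) i N) \<in> borel_measurable M"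
  by measurable

lemma emp_freq_powr_le_1: "0 < \<alpha> \<Longrightarrow> emp_freq P i N powr \<alpha> \<le> 1"
  by (rule powr_le_1[OF emp_freq_bounds])

lemma integrable_emp_powr:
  assumes "0 \<le> t" "0 < \<alpha>" shows "integrable M (\<lambda>w. emp_freq (X t w) i N powr \<alpha>)"
  by (rule integrable_const_bound[where B=1])
    (use emp_freq_powr_le_1[OF assms(2)] measurable_emp_freq_X[OF assms(1)] in auto)

lemma tagged_emp_freq_converges:
  assumes t: "0 \<le> t" and \<alpha>: "0 < \<alpha>"
  shows "(\<lambda>N. \<integral>w. \<bar>emp_freq (X t w) 1 N powr \<alpha> - freq (X t w) 1 powr \<alpha>\<bar> \<partial>M) \<longlonglongrightarrow> 0"
proof -
  have [measurable]: "(\<lambda>w. emp_freq (X t w) 1 N) \<in> borel_measurable M" "(\<lambda>w. freq (X t w) 1) \<in> borel_measurable M" for N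
    using measurable_emp_freq_X[OF t] measurable_freq_X[OF t] by auto
  have "(\<lambda>N. \<integral>w. \<bar>emp_freq (X t w) 1 N powr \<alpha> - freq (X t w) 1 powr \<alpha>\<bar> \<partial>M) \<longlonglongrightarrow> (\<integral>w. 0 \<partial>M)"
  proof (rule integral_dominated_convergence[where w="\<lambda>_. 1"])
    show "AE w in M. (\<lambda>N. \<bar>emp_freq (X t w) 1 N powr \<alpha> - freq (X t w) 1 powr \<alpha>\<bar>) \<longlonglongrightarrow> 0"
      using AE_regular_at[OF t]
    proof eventually_elim
      case (elim w)
      interpret regular_partition "X t w" by fact
      have "(\<lambda>N. emp_freq (X t w) 1 N powr \<alpha>) \<longlonglongrightarrow> freq (X t w) 1 powr \<alpha>"
        by (intro tendsto_powr' emp_freq_tendsto reg tendsto_const) (use \<alpha> emp_freq_bounds in auto)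
      then show ?case by (intro tendsto_rabs_zero) (simp add: LIM_zero_iff)
    qed
    show "AE w in M. norm \<bar>emp_freq (X t w) 1 N powr \<alpha> - freq (X t w) 1 powr \<alpha>\<bar> \<le> 1" for N
      using AE_freq_powr_bounds[OF t \<alpha> order_refl]
    proof eventually_elim
      case (elim w)
      have "0 \<le> emp_freq (X t w) 1 N powr \<alpha>" "emp_freq (X t w) 1 N powr \<alpha> \<le> 1"
        using emp_freq_powr_le_1[OF \<alpha>] by auto
      with elim show ?case by (simp only: real_norm_def abs_abs) linarith
    qed
  qed auto
  then show ?thesis by simp
qed

lemma mean_power_L1:
  assumes t: "0 \<le> t" and \<alpha>: "0 < \<alpha>"
  shows "(\<lambda>N. \<integral>w. \<bar>mean_power \<alpha> (X t w) N - mass_moment \<alpha> (X t w)\<bar> \<partial>M) \<longlonglongrightarrow> 0"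
proof -
  have [measurable]: "(\<lambda>w. mean_power \<alpha> (X t w) N) \<in> borel_measurable M" for N using t by measurable
  note [measurable] = measurable_mass_moment_X[OF t]
  have "(\<lambda>N. \<integral>w. \<bar>mean_power \<alpha> (X t w) N - mass_moment \<alpha> (X t w)\<bar> \<partial>M) \<longlonglongrightarrow> (\<integral>w. 0 \<partial>M)"
  proof (rule integral_dominated_convergence[where w="\<lambda>_. 1"])
    show "AE w in M. (\<lambda>N. \<bar>mean_power \<alpha> (X t w) N - mass_moment \<alpha> (X t w)\<bar>) \<longlonglongrightarrow> 0"
      using AE_regular_at[OF t]
      by eventually_elim
        (intro tendsto_rabs_zero LIM_zero regular_partition.mass_moment_characterization(1) \<alpha>)
    show "AE w in M. norm \<bar>mean_power \<alpha> (X t w) N - mass_moment \<alpha> (X t w)\<bar> \<le> 1" for N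
      using AE_regular_at[OF t]
    proof eventually_elim
      case (elim w)
      interpret regular_partition "X t w" by fact
      show ?case using mean_power_bounds[OF \<alpha>, of N] mass_moment_bounds[OF \<alpha>] by (simp add: abs_le_iff)
    qed
  qed auto
  then show ?thesis by simp
qed

text \<open>By exchangeability the mean error of the average is at most the mean error at label \<open>1\<close>.\<close>

lemma emp_mean_L1:
  assumes t: "0 \<le> t" and \<alpha>: "0 < \<alpha>"
  shows "(\<lambda>N. \<integral>w. \<bar>emp_mean \<alpha> (X t w) N - mass_moment \<alpha> (X t w)\<bar> \<partial>M) \<longlonglongrightarrow> 0"
proof -
  have int: "integrable M (\<lambda>w. emp_mean \<alpha> (X t w) N)" "integrable M (\<lambda>w. mean_power \<alpha> (X t w) N)" for N
    unfolding emp_mean_def mean_power_def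
    by (intro integrable_divide Bochner_Integration.integrable_sum integrable_emp_powr[OF t \<alpha>] integrable_label_powr[OF t \<alpha>]; simp)+
  note intm = integrable_mass_moment[OF t \<alpha>]
  have diff: "(\<integral>w. \<bar>emp_mean \<alpha> (X t w) N - mean_power \<alpha> (X t w) N\<bar> \<partial>M) \<le>
      (\<integral>w. \<bar>emp_freq (X t w) 1 N powr \<alpha> - freq (X t w) 1 powr \<alpha>\<bar> \<partial>M)" if N: "1 \<le> N" for N
  proof -
    define h where "h = (\<lambda>P i. \<bar>emp_freq P i N powr \<alpha> - freq P i powr \<alpha>\<bar>)"
    have hint: "integrable M (\<lambda>w. h (X t w) i)" if "1 \<le> i" for i
      unfolding h_def using integrable_emp_powr[OF t \<alpha>] integrable_label_powr[OF t \<alpha> that] by auto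
    have "\<bar>emp_mean \<alpha> P N - mean_power \<alpha> P N\<bar> \<le> (\<Sum>i=1..N. h P i) / real N" for P
    proof -
      have "emp_mean \<alpha> P N - mean_power \<alpha> P N = (\<Sum>i=1..N. emp_freq P i N powr \<alpha> - freq P i powr \<alpha>) / real N"
        by (simp add: emp_mean_def mean_power_def sum_subtractf diff_divide_distrib)
      then show ?thesis unfolding h_def by (auto intro!: divide_right_mono sum_abs)
    qed
    then have "(\<integral>w. \<bar>emp_mean \<alpha> (X t w) N - mean_power \<alpha> (X t w) N\<bar> \<partial>M) \<le> (\<integral>w. (\<Sum>i=1..N. h (X t w) i) / real N \<partial>M)"
      using int by (intro integral_mono integrable_divide Bochner_Integration.integrable_sum hint) auto
    also have "\<dots> = (\<integral>w. h (X t w) 1 \<partial>M)"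
    proof (rule expectation_average[OF t N])
      show "(\<lambda>P. h P i) \<in> borel_measurable partition_algebra" for i unfolding h_def by measurable
      show "h (permute_partition \<sigma> P) (\<sigma> j) = h P j" if "\<sigma> permutes {1..N}" for \<sigma> P j
        unfolding h_def using emp_freq_permute[OF that order_refl] freq_permute[OF that] by simp
    qed (use hint in auto)
    finally show ?thesis unfolding h_def .
  qed
  have "(\<lambda>N. (\<integral>w. \<bar>emp_freq (X t w) 1 N powr \<alpha> - freq (X t w) 1 powr \<alpha>\<bar> \<partial>M) +
      (\<integral>w. \<bar>mean_power \<alpha> (X t w) N - mass_moment \<alpha> (X t w)\<bar> \<partial>M)) \<longlonglongrightarrow> 0 + 0"
    by (intro tendsto_add tagged_emp_freq_converges mean_power_L1 assms)
  then have lim: "(\<lambda>N. (\<integral>w. \<bar>emp_freq (X t w) 1 N powr \<alpha> - freq (X t w) 1 powr \<alpha>\<bar> \<partial>M) +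
      (\<integral>w. \<bar>mean_power \<alpha> (X t w) N - mass_moment \<alpha> (X t w)\<bar> \<partial>M)) \<longlonglongrightarrow> 0" by simp
  show ?thesis
  proof (rule tendsto_sandwich[OF _ _ tendsto_const lim])
    show "\<forall>\<^sub>F N in sequentially. (\<integral>w. \<bar>emp_mean \<alpha> (X t w) N - mass_moment \<alpha> (X t w)\<bar> \<partial>M) \<le>
        (\<integral>w. \<bar>emp_freq (X t w) 1 N powr \<alpha> - freq (X t w) 1 powr \<alpha>\<bar> \<partial>M) +
        (\<integral>w. \<bar>mean_power \<alpha> (X t w) N - mass_moment \<alpha> (X t w)\<bar> \<partial>M)"
      using eventually_ge_at_top[of 1]
    proof eventually_elim
      case (elim N)
      have "(\<integral>w. \<bar>emp_mean \<alpha> (X t w) N - mass_moment \<alpha> (X t w)\<bar> \<partial>M) \<le>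
          (\<integral>w. \<bar>emp_mean \<alpha> (X t w) N - mean_power \<alpha> (X t w) N\<bar> + \<bar>mean_power \<alpha> (X t w) N - mass_moment \<alpha> (X t w)\<bar> \<partial>M)"
        using int intm by (intro integral_mono) auto
      also have "\<dots> = (\<integral>w. \<bar>emp_mean \<alpha> (X t w) N - mean_power \<alpha> (X t w) N\<bar> \<partial>M) +
          (\<integral>w. \<bar>mean_power \<alpha> (X t w) N - mass_moment \<alpha> (X t w)\<bar> \<partial>M)"
        using int intm by (intro Bochner_Integration.integral_add) auto
      finally show ?case using diff[OF elim] by linarith
    qed
  qed auto
qed

text \<open>Because the weight is invariant under relabelling, every label contributes to the average what
  label \<open>1\<close> does.\<close>

lemma weighted_mass_moment:
  fixes y :: "nat set set \<Rightarrow> real"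
  assumes t: "0 \<le> t" and \<alpha>: "0 < \<alpha>" and y[measurable]: "y \<in> borel_measurable partition_algebra"
    and K: "AE w in M. \<bar>y (X t w)\<bar> \<le> K"
    and inv: "\<And>\<sigma> n P. \<sigma> permutes {1..n} \<Longrightarrow> y (permute_partition \<sigma> P) = y P"
  shows "(\<integral>w. y (X t w) * mass_moment \<alpha> (X t w) \<partial>M) = (\<integral>w. y (X t w) * freq (X t w) 1 powr \<alpha> \<partial>M)"
proof -
  have [measurable]: "(\<lambda>w. y (X t w)) \<in> borel_measurable M" "(\<lambda>w. mean_power \<alpha> (X t w) N) \<in> borel_measurable M" for N using t by measurable
  note [measurable] = measurable_mass_moment_X[OF t] measurable_freq_X[OF t]
  have inty: "integrable M (\<lambda>w. y (X t w))"
    by (rule integrable_const_bound[where B=K]) (use K in auto)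
  have "(\<lambda>N. \<integral>w. y (X t w) * mean_power \<alpha> (X t w) N \<partial>M) \<longlonglongrightarrow> (\<integral>w. y (X t w) * mass_moment \<alpha> (X t w) \<partial>M)"
  proof (rule integral_dominated_convergence[where w="\<lambda>w. \<bar>y (X t w)\<bar>"])
    show "AE w in M. (\<lambda>N. y (X t w) * mean_power \<alpha> (X t w) N) \<longlonglongrightarrow> y (X t w) * mass_moment \<alpha> (X t w)"
      using AE_regular_at[OF t]
      by eventually_elim (intro tendsto_mult tendsto_const regular_partition.mass_moment_characterization(1) \<alpha>)
    show "AE w in M. norm (y (X t w) * mean_power \<alpha> (X t w) N) \<le> \<bar>y (X t w)\<bar>" for N
      using AE_regular_at[OF t]
    proof eventually_elim
      case (elim w)
      interpret regular_partition "X t w" by fact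
      show ?case using mean_power_bounds[OF \<alpha>, of N] by (auto simp: abs_mult intro!: mult_left_le)
    qed
  qed (use inty in auto)
  moreover have "eventually (\<lambda>N. (\<integral>w. y (X t w) * mean_power \<alpha> (X t w) N \<partial>M) = (\<integral>w. y (X t w) * freq (X t w) 1 powr \<alpha> \<partial>M)) sequentially"
    using eventually_ge_at_top[of 1]
  proof eventually_elim
    case (elim N)
    define h where "h = (\<lambda>P i. y P * freq P i powr \<alpha>)"
    have "y P * mean_power \<alpha> P N = (\<Sum>i=1..N. h P i) / real N" for P
      by (simp add: h_def mean_power_def sum_distrib_left)
    moreover have "(\<integral>w. (\<Sum>i=1..N. h (X t w) i) / real N \<partial>M) = (\<integral>w. h (X t w) 1 \<partial>M)"
    proof (rule expectation_average[OF t elim])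
      show "(\<lambda>P. h P i) \<in> borel_measurable partition_algebra" for i unfolding h_def by measurable
      show "h (permute_partition \<sigma> P) (\<sigma> j) = h P j" if "\<sigma> permutes {1..N}" for \<sigma> P j
        unfolding h_def using inv[OF that] freq_permute[OF that] by simp
      show "integrable M (\<lambda>w. h (X t w) i)" if "1 \<le> i" "i \<le> N" for i
      proof (rule Bochner_Integration.integrable_bound[OF inty])
        show "AE w in M. norm (h (X t w) i) \<le> norm (y (X t w))"
          using AE_freq_powr_bounds[OF t \<alpha> that(1)]
          by eventually_elim (auto simp: h_def abs_mult intro!: mult_left_le)
      qed (simp add: h_def)
    qed
    ultimately show ?case unfolding h_def by simp
  qed
  then have "(\<lambda>N. \<integral>w. y (X t w) * mean_power \<alpha> (X t w) N \<partial>M) \<longlonglongrightarrow> (\<integral>w. y (X t w) * freq (X t w) 1 powr \<alpha> \<partial>M)"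
    by (rule tendsto_eventually)
  ultimately show ?thesis by (rule LIMSEQ_unique)
qed

end

section \<open>The variance of the pair density given the past\<close>

context homogeneous_fragmentation
begin

definition linked :: "real \<Rightarrow> nat \<Rightarrow> nat \<Rightarrow> 'a \<Rightarrow> real"
  where "linked u i j w = (if same_block (X u w) i j then 1 else 0)"

lemma measurable_linked[measurable]: "0 \<le> u \<Longrightarrow> linked u i j \<in> borel_measurable M"
  unfolding linked_def[abs_def] by measurable

lemma emp_mean_1_eq:
  assumes "1 \<le> N" shows "emp_mean 1 (X u w) N = (\<Sum>i=1..N. \<Sum>j=1..N. linked u i j w) / (real N)\<^sup>2"
proof -
  have "emp_freq (X u w) i N powr 1 = (\<Sum>j=1..N. linked u i j w) / real N" for i
    unfolding powr_one[OF emp_freq_bounds(1)] by (simp only: emp_freq_eq_sum linked_def)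
  then show ?thesis unfolding emp_mean_def by (simp add: sum_divide_distrib[symmetric] power2_eq_square)
qed

lemma filtration_subalgebra: assumes "0 \<le> s" shows "subalgebra M (natural_filtration M X s)"
proof -
  have gen: "{X u -` E \<inter> space M |u E. 0 \<le> u \<and> u \<le> s \<and> E \<in> sets partition_algebra} \<subseteq> sets M"
    using measurable_sets[OF random_partition] by auto
  then show ?thesis
    unfolding subalgebra_def space_natural_filtration
    by (subst natural_filtration_def, subst sets_measure_of) (use sets.sigma_sets_subset[OF gen] in auto)
qed

lemma X_adapted: assumes "0 \<le> s" shows "X s \<in> natural_filtration M X s \<rightarrow>\<^sub>M partition_algebra"
proof (rule measurableI)
  show "X s w \<in> space partition_algebra" if "w \<in> space (natural_filtration M X s)" for w
    using partition_X[OF _ assms] that by (simp add: space_natural_filtration space_partition_algebra)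
  show "X s -` A \<inter> space (natural_filtration M X s) \<in> sets (natural_filtration M X s)" if "A \<in> sets partition_algebra" for A
    unfolding space_natural_filtration
    by (subst natural_filtration_def, subst sets_measure_of) (use assms that in auto)
qed

text \<open>A statement about conditional probabilities given the past, tested on events, extends to bounded
  weights that depend on the past.\<close>

lemma conditional_transfer:
  assumes s: "0 \<le> s" and Y: "Y \<in> borel_measurable (natural_filtration M X s)"
    and K: "\<And>w. w \<in> space M \<Longrightarrow> \<bar>Y w\<bar> \<le> K"
    and S: "S \<in> sets M" and E: "E \<in> sets (natural_filtration M X s)"
    and eq: "\<And>A. A \<in> sets (natural_filtration M X s) \<Longrightarrow> prob (A \<inter> S) = c * prob (A \<inter> E)"
  shows "(\<integral>w. Y w * indicator S w \<partial>M) = c * (\<integral>w. Y w * indicator E w \<partial>M)"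
proof -
  let ?F = "natural_filtration M X s"
  interpret F: finite_measure_subalgebra M ?F
    by unfold_locales (rule filtration_subalgebra[OF s])
  have sub: "A \<in> sets M" if "A \<in> sets ?F" for A using filtration_subalgebra[OF s] that by (auto simp: subalgebra_def)
  note [measurable] = S E sub[OF E]
  have YM[measurable]: "Y \<in> borel_measurable M" by (rule measurable_from_subalg[OF filtration_subalgebra[OF s] Y])
  have "AE w in M. real_cond_exp M ?F (indicator S) w = c * indicator E w"
  proof (rule F.real_cond_exp_charact)
    fix A assume A: "A \<in> sets ?F"
    note [measurable] = sub[OF A]
    have "(\<integral>x\<in>A. indicat_real S x \<partial>M) = (\<integral>x. indicat_real (A \<inter> S) x \<partial>M)"
      unfolding set_lebesgue_integral_def by (simp add: indicator_inter_arith)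
    also have "\<dots> = prob (A \<inter> S)" by simp
    also have "\<dots> = c * prob (A \<inter> E)" by (rule eq[OF A])
    also have "\<dots> = (\<integral>x. c * indicator (A \<inter> E) x \<partial>M)" by simp
    also have "\<dots> = (\<integral>x\<in>A. c * indicator E x \<partial>M)"
      unfolding set_lebesgue_integral_def by (simp add: indicator_inter_arith algebra_simps)
    finally show "(\<integral>x\<in>A. indicat_real S x \<partial>M) = (\<integral>x\<in>A. c * indicator E x \<partial>M)" .
  qed (auto simp: emeasure_eq_measure)
  moreover have "(\<integral>w. Y w * real_cond_exp M ?F (indicator S) w \<partial>M) = (\<integral>w. Y w * indicator S w \<partial>M)"
  proof (rule F.real_cond_exp_intg(2)[OF _ Y])
    show "integrable M (\<lambda>w. Y w * indicator S w)"
      by (rule integrable_const_bound[where B="\<bar>K\<bar>"])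
        (use K in \<open>auto simp: indicator_def intro!: AE_I2 order_trans[OF K abs_ge_self]\<close>)
  qed simp
  ultimately have "(\<integral>w. Y w * indicator S w \<partial>M) = (\<integral>w. Y w * (c * indicator E w) \<partial>M)"
    by (subst (asm) integral_cong_AE[of _ M "\<lambda>w. Y w * (c * indicator E w)"]) auto
  then show ?thesis by (simp add: mult.left_commute)
qed

end

context beta_fragmentation
begin

text \<open>The sum of the squared block frequencies, that is, the probability that two labels sampled from the
  partition share a block.\<close>

definition pair_density :: "real \<Rightarrow> 'a \<Rightarrow> real"
  where "pair_density t w = mass_moment 1 (X t w)"

definition density_increment :: "real \<Rightarrow> real \<Rightarrow> 'a \<Rightarrow> real"
  where "density_increment s t w = pair_density (s + t) w - exp (- r * t) * pair_density s w"

definition link_increment :: "real \<Rightarrow> real \<Rightarrow> nat \<Rightarrow> nat \<Rightarrow> 'a \<Rightarrow> real"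
  where "link_increment s t i j w = linked (s + t) i j w - exp (- r * t) * linked s i j w"

lemma measurable_pair_density: "0 \<le> t \<Longrightarrow> pair_density t \<in> borel_measurable M"
  unfolding pair_density_def[abs_def] by (rule measurable_mass_moment_X)

lemma AE_pair_density_bounds: "0 \<le> t \<Longrightarrow> AE w in M. 0 \<le> pair_density t w \<and> pair_density t w \<le> 1"
  unfolding pair_density_def by (rule AE_mass_moment_bounds) simp_all

lemma integrable_pair_density: "0 \<le> t \<Longrightarrow> integrable M (pair_density t)"
  unfolding pair_density_def[abs_def] by (rule integrable_mass_moment) simp_all

lemma exp_le_1: "0 \<le> t \<Longrightarrow> exp (- r * t) \<le> 1" using r_pos by simp

lemma AE_density_increment_bound:
  assumes "0 \<le> s" "0 \<le> t" shows "AE w in M. \<bar>density_increment s t w\<bar> \<le> 1"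
proof -
  have "0 \<le> s + t" using assms by simp
  show ?thesis
    using AE_pair_density_bounds[OF \<open>0 \<le> s + t\<close>] AE_pair_density_bounds[OF assms(1)]
  proof eventually_elim
    case (elim w)
    have "0 \<le> exp (- r * t) * pair_density s w" "exp (- r * t) * pair_density s w \<le> 1"
      using elim exp_le_1[OF assms(2)] by (auto intro!: mult_le_one)
    then show ?case using elim unfolding density_increment_def by linarith
  qed
qed

lemma link_increment_bound: "0 \<le> t \<Longrightarrow> \<bar>link_increment s t i j w\<bar> \<le> 1"
proof -
  assume t: "0 \<le> t"
  have *: "\<bar>a - x * b\<bar> \<le> 1" if "a \<in> {0, 1}" "b \<in> {0, 1}" "0 \<le> x" "x \<le> 1" for a b x :: real
    using that by auto
  show ?thesis unfolding link_increment_def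
    by (rule *) (use exp_le_1[OF t] in \<open>auto simp: linked_def\<close>)
qed

lemma measurable_increments:
  assumes "0 \<le> s" "0 \<le> t"
  shows "density_increment s t \<in> borel_measurable M" "link_increment s t i j \<in> borel_measurable M"
proof -
  have "0 \<le> s + t" using assms by simp
  note [measurable] = measurable_pair_density[OF this] measurable_pair_density[OF assms(1)]
    measurable_linked[OF \<open>0 \<le> s + t\<close>] measurable_linked[OF assms(1)]
  show "density_increment s t \<in> borel_measurable M" unfolding density_increment_def[abs_def] by measurable
  show "link_increment s t i j \<in> borel_measurable M" unfolding link_increment_def[abs_def] by measurable
qed

text \<open>The pair density is the limit of averages over pairs of labels, and pairs which are not distinct or
  use one of the first \<open>m\<close> labels are negligible.\<close>

lemma pair_sampling:
  assumes s: "0 \<le> s" and t: "0 \<le> t" and Y[measurable]: "Y \<in> borel_measurable M"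
    and K: "AE w in M. \<bar>Y w\<bar> \<le> K"
    and c: "\<And>i j. m < i \<Longrightarrow> m < j \<Longrightarrow> i \<noteq> j \<Longrightarrow> (\<integral>w. Y w * link_increment s t i j w \<partial>M) = c"
  shows "(\<integral>w. Y w * density_increment s t w \<partial>M) = c"
proof -
  have st: "0 \<le> s + t" using s t by simp
  define b where "b = (\<lambda>i j. \<integral>w. Y w * link_increment s t i j w \<partial>M)"
  define e where "e = exp (- r * t)"
  have e: "0 \<le> e" "e \<le> 1" unfolding e_def using exp_le_1[OF t] by auto
  define K' where "K' = \<bar>K\<bar>"
  have K': "AE w in M. \<bar>Y w\<bar> \<le> K'" using K unfolding K'_def by eventually_elim linarith
  have K0: "0 \<le> K'" unfolding K'_def by simp
  define D where "D = (\<lambda>N w. emp_mean 1 (X (s + t) w) N - e * emp_mean 1 (X s w) N)"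
  note [measurable] = measurable_increments[OF s t]
  have intY: "integrable M Y" by (rule integrable_const_bound[where B=K']) (use K' in auto)
  have intb: "integrable M (\<lambda>w. Y w * link_increment s t i j w)" for i j
    by (rule Bochner_Integration.integrable_bound[OF intY])
      (use link_increment_bound[OF t] in \<open>auto simp: abs_mult intro!: mult_left_le\<close>)
  have int1: "integrable M (\<lambda>w. emp_mean 1 (X u w) N)" if "0 \<le> u" for u N
    unfolding emp_mean_def by (intro integrable_divide Bochner_Integration.integrable_sum integrable_emp_powr that) simp
  have intD: "integrable M (D N)" for N unfolding D_def using int1[OF st] int1[OF s] by auto
  have intI: "integrable M (density_increment s t)"
    unfolding density_increment_def[abs_def] using integrable_pair_density[OF st] integrable_pair_density[OF s] by auto
  have intYD: "integrable M (\<lambda>w. Y w * f w)" if "integrable M f" for f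
    by (rule Bochner_Integration.integrable_bound[of M "\<lambda>w. K' * f w"])
      (use that K' K0 in \<open>auto simp: abs_mult elim!: eventually_mono intro!: mult_right_mono\<close>)
  have 1: "(\<integral>w. Y w * D N w \<partial>M) = (\<Sum>i=1..N. \<Sum>j=1..N. b i j) / (real N)\<^sup>2" if N: "1 \<le> N" for N
  proof -
    have "Y w * D N w = (\<Sum>i=1..N. \<Sum>j=1..N. Y w * link_increment s t i j w) / (real N)\<^sup>2" for w
      unfolding D_def emp_mean_1_eq[OF N] link_increment_def e_def
      by (simp add: sum_subtractf sum_distrib_left diff_divide_distrib algebra_simps)
    then have "(\<integral>w. Y w * D N w \<partial>M) = (\<integral>w. (\<Sum>i=1..N. \<Sum>j=1..N. Y w * link_increment s t i j w) / (real N)\<^sup>2 \<partial>M)"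
      by presburger
    also have "\<dots> = (\<Sum>i=1..N. \<Sum>j=1..N. b i j) / (real N)\<^sup>2" using intb by (simp add: b_def)
    finally show ?thesis .
  qed
  have bK: "\<bar>b i j\<bar> \<le> K'" for i j
  proof -
    have "\<bar>b i j\<bar> \<le> (\<integral>w. \<bar>Y w * link_increment s t i j w\<bar> \<partial>M)" unfolding b_def by (rule integral_abs_bound)
    also have "\<dots> \<le> (\<integral>w. K' \<partial>M)"
    proof (rule integral_mono_AE)
      show "AE w in M. \<bar>Y w * link_increment s t i j w\<bar> \<le> K'"
        using K'
      proof eventually_elim
        case (elim w)
        have "\<bar>Y w\<bar> * \<bar>link_increment s t i j w\<bar> \<le> K' * 1"
          using elim link_increment_bound[OF t] K0 by (intro mult_mono) auto
        then show ?case by (simp add: abs_mult)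
      qed
    qed (use intb in auto)
    finally show ?thesis by (simp add: prob_space)
  qed
  define C where "C = K' + \<bar>c\<bar>"
  have C0: "0 \<le> C" unfolding C_def using K0 by simp
  have 2: "\<bar>(\<Sum>i=1..N. \<Sum>j=1..N. b i j) / (real N)\<^sup>2 - c\<bar> \<le> C * (2 * real m + 1) / real N" if N: "1 \<le> N" for N
  proof -
    have pt: "\<bar>b i j - c\<bar> \<le> C * (if i \<le> m then 1 else 0) + (C * (if j \<le> m then 1 else 0) + C * (if i = j then 1 else 0))" for i j
    proof (cases "m < i \<and> m < j \<and> i \<noteq> j")
      case True
      then show ?thesis using c[of i j] C0 by (simp add: b_def)
    next
      case False
      have "\<bar>b i j - c\<bar> \<le> C" using bK[of i j] unfolding C_def by linarith
      then show ?thesis using False C0 by auto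
    qed
    have few: "(\<Sum>i=1..N. if i \<le> m then 1 else (0::real)) \<le> real m"
    proof -
      have "(\<Sum>i=1..N. if i \<le> m then 1 else (0::real)) = real (card {i\<in>{1..N}. i \<le> m})"
        by (simp flip: sum.inter_filter)
      also have "\<dots> \<le> real (card {1..m})" by (intro of_nat_mono card_mono) auto
      finally show ?thesis by simp
    qed
    have "(\<Sum>i=1..N. \<Sum>j=1..N. b i j) / (real N)\<^sup>2 - c = (\<Sum>i=1..N. \<Sum>j=1..N. b i j - c) / (real N)\<^sup>2"
      using N by (simp add: sum_subtractf diff_divide_distrib power2_eq_square)
    also have "\<bar>\<dots>\<bar> \<le> (\<Sum>i=1..N. \<Sum>j=1..N. \<bar>b i j - c\<bar>) / (real N)\<^sup>2"
      by (simp add: abs_divide) (intro divide_right_mono order_trans[OF sum_abs] sum_mono sum_abs; simp)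
    also have "\<dots> \<le> (\<Sum>i=1..N. \<Sum>j=1..N. C * (if i \<le> m then 1 else 0) + (C * (if j \<le> m then 1 else 0) + C * (if i = j then 1 else 0))) / (real N)\<^sup>2"
      by (intro divide_right_mono sum_mono pt) simp
    also have "\<dots> = (C * real N * (\<Sum>i=1..N. if i \<le> m then 1 else 0) + (real N * (C * (\<Sum>j=1..N. if j \<le> m then 1 else 0)) + C * real N)) / (real N)\<^sup>2"
    proof -
      define p where "p = (\<lambda>i. if i \<le> m then 1 else (0::real))"
      have "(\<Sum>j=1..N. C * p i + (C * p j + C * (if i = j then 1 else 0))) = real N * (C * p i) + (C * sum p {1..N} + C)"
        if "i \<in> {1..N}" for i
        using that by (simp add: sum.distrib flip: sum_distrib_left)
      then have "(\<Sum>i=1..N. \<Sum>j=1..N. C * p i + (C * p j + C * (if i = j then 1 else 0))) =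
          (\<Sum>i=1..N. real N * (C * p i) + (C * sum p {1..N} + C))"
        by (intro sum.cong refl) auto
      also have "\<dots> = real N * (C * sum p {1..N}) + real N * (C * sum p {1..N} + C)"
        by (simp add: sum.distrib flip: sum_distrib_left)
      finally show ?thesis unfolding p_def by (simp add: algebra_simps)
    qed
    also have "\<dots> \<le> (C * real N * real m + (real N * (C * real m) + C * real N)) / (real N)\<^sup>2"
      using few C0 by (intro divide_right_mono add_mono mult_left_mono) auto
    also have "\<dots> = C * (2 * real m + 1) / real N"
      using N by (simp add: power2_eq_square field_simps)
    finally show ?thesis .
  qed
  have l1: "(\<lambda>N. \<integral>w. Y w * D N w \<partial>M) \<longlonglongrightarrow> c"
  proof (rule Lim_transform_eventually)
    show "eventually (\<lambda>N. (\<Sum>i=1..N. \<Sum>j=1..N. b i j) / (real N)\<^sup>2 = (\<integral>w. Y w * D N w \<partial>M)) sequentially"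
      using eventually_ge_at_top[of 1] by eventually_elim (simp add: 1)
    have "(\<lambda>N. C * (2 * real m + 1) / real N) \<longlonglongrightarrow> 0" by real_asymp
    then have "(\<lambda>N. (\<Sum>i=1..N. \<Sum>j=1..N. b i j) / (real N)\<^sup>2 - c) \<longlonglongrightarrow> 0"
      by (rule Lim_null_comparison[rotated]) (use 2 in \<open>auto simp: eventually_sequentially intro!: exI[of _ 1]\<close>)
    then show "(\<lambda>N. (\<Sum>i=1..N. \<Sum>j=1..N. b i j) / (real N)\<^sup>2) \<longlonglongrightarrow> c" by (simp add: LIM_zero_iff)
  qed
  have l2: "(\<lambda>N. \<integral>w. Y w * D N w \<partial>M) \<longlonglongrightarrow> (\<integral>w. Y w * density_increment s t w \<partial>M)"
  proof -
    define R where "R = (\<lambda>u N. \<integral>w. \<bar>emp_mean 1 (X u w) N - mass_moment 1 (X u w)\<bar> \<partial>M)"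
    have Rl: "R u \<longlonglongrightarrow> 0" if "0 \<le> u" for u unfolding R_def by (rule emp_mean_L1[OF that]) simp
    have le: "\<bar>(\<integral>w. Y w * D N w \<partial>M) - (\<integral>w. Y w * density_increment s t w \<partial>M)\<bar> \<le> K' * (R (s + t) N + R s N)" for N
    proof -
      have "(\<integral>w. Y w * D N w \<partial>M) - (\<integral>w. Y w * density_increment s t w \<partial>M) = (\<integral>w. Y w * D N w - Y w * density_increment s t w \<partial>M)"
        using intYD[OF intD] intYD[OF intI] by simp
      also have "\<bar>\<dots>\<bar> \<le> (\<integral>w. \<bar>Y w * D N w - Y w * density_increment s t w\<bar> \<partial>M)" by (rule integral_abs_bound)
      also have "\<dots> \<le> (\<integral>w. K' * (\<bar>emp_mean 1 (X (s + t) w) N - mass_moment 1 (X (s + t) w)\<bar> + \<bar>emp_mean 1 (X s w) N - mass_moment 1 (X s w)\<bar>) \<partial>M)"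
      proof (rule integral_mono_AE)
        show "AE w in M. \<bar>Y w * D N w - Y w * density_increment s t w\<bar> \<le> K' * (\<bar>emp_mean 1 (X (s + t) w) N - mass_moment 1 (X (s + t) w)\<bar> + \<bar>emp_mean 1 (X s w) N - mass_moment 1 (X s w)\<bar>)"
          using K'
        proof eventually_elim
          case (elim w)
          define x y where "x = emp_mean 1 (X (s + t) w) N - mass_moment 1 (X (s + t) w)"
            and "y = emp_mean 1 (X s w) N - mass_moment 1 (X s w)"
          have "Y w * D N w - Y w * density_increment s t w = Y w * (x - e * y)"
            unfolding D_def density_increment_def pair_density_def x_def y_def e_def by (simp add: algebra_simps)
          moreover have "\<bar>x - e * y\<bar> \<le> \<bar>x\<bar> + \<bar>y\<bar>"
          proof -
            have "\<bar>e * y\<bar> \<le> 1 * \<bar>y\<bar>" unfolding abs_mult using e by (intro mult_right_mono) auto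
            then show ?thesis by linarith
          qed
          ultimately show ?case unfolding x_def[symmetric] y_def[symmetric]
            using elim K0 by (simp add: abs_mult mult_mono)
        qed
      qed (use intYD[OF intD] intYD[OF intI] int1[OF st] int1[OF s] integrable_mass_moment[OF st] integrable_mass_moment[OF s] in auto)
      also have "\<dots> = K' * (R (s + t) N + R s N)"
        unfolding R_def using int1[OF st] int1[OF s] integrable_mass_moment[OF st] integrable_mass_moment[OF s] by simp
      finally show ?thesis .
    qed
    have "(\<lambda>N. K' * (R (s + t) N + R s N)) \<longlonglongrightarrow> K' * (0 + 0)"
      by (intro tendsto_mult tendsto_add tendsto_const Rl st s)
    then have "(\<lambda>N. K' * (R (s + t) N + R s N)) \<longlonglongrightarrow> 0" by simp
    then have "(\<lambda>N. (\<integral>w. Y w * D N w \<partial>M) - (\<integral>w. Y w * density_increment s t w \<partial>M)) \<longlonglongrightarrow> 0"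
      by (rule Lim_null_comparison[rotated]) (use le in auto)
    then show ?thesis by (simp add: LIM_zero_iff)
  qed
  show ?thesis by (rule LIMSEQ_unique[OF l2 l1])
qed

lemma together_2: "0 \<le> t \<Longrightarrow> together 2 t = exp (- r * t)"
  using together_exp[of 2 t] exit_rate_2 by simp

lemma prob_same_block:
  assumes t: "0 \<le> t" and ij: "1 \<le> i" "1 \<le> j" "i \<noteq> j"
  shows "prob {w\<in>space M. same_block (X t w) i j} = exp (- r * t)"
proof -
  have eq: "prob {w\<in>space M. same_block (X t w) k l} = (\<integral>w. (if same_block (X t w) k l then 1 else 0) \<partial>M)" for k l
  proof -
    have "(\<integral>w. (if same_block (X t w) k l then 1 else 0) \<partial>M) = (\<integral>w. indicat_real {w\<in>space M. same_block (X t w) k l} w \<partial>M)"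
      by (intro Bochner_Integration.integral_cong refl) (auto simp: indicator_def)
    then show ?thesis unfolding expectation_indicator by simp
  qed
  define f where "f = (\<lambda>k::nat. if k = 1 then i else j)"
  have "\<exists>\<sigma>. \<sigma> permutes {1..max 2 (max i j)} \<and> (\<forall>k\<in>{1, 2}. \<sigma> k = f k)"
    by (rule ex_permutes_extending) (use ij in \<open>auto simp: f_def inj_on_def\<close>)
  then obtain \<sigma> where \<sigma>: "\<sigma> permutes {1..max 2 (max i j)}" "\<sigma> 1 = i" "\<sigma> 2 = j" by (auto simp: f_def)
  have "same_block (permute_partition \<sigma> P) i j = same_block P 1 2" for P
    by (rule same_block_permute_eq[OF \<sigma>])
  then have "prob {w\<in>space M. same_block (X t w) i j} = prob {w\<in>space M. same_block (X t w) 1 2}"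
    unfolding eq using exchangeable_time[OF \<sigma>(1) _ t, of "\<lambda>P. if same_block P i j then 1 else 0"] by simp
  also have "\<dots> = together 2 t"
  proof -
    have "restr 2 t w = {{1..2}} \<longleftrightarrow> same_block (X t w) 1 2" if "w \<in> space M" for w
    proof -
      have s: "{1..2::nat} = {1, 2}" by auto
      have "restr 2 t w = {{1..2}} \<longleftrightarrow> (\<forall>i\<in>{1..2}. \<forall>j\<in>{1..2}. same_block (X t w) i j)"
        by (rule restrict_eq_whole_iff[OF partition_X[OF that t]]) auto
      then show ?thesis unfolding s
        using same_block_sym[of "X t w" 1 2] same_block_refl[OF partition_X[OF that t]] by auto
    qed
    then show ?thesis unfolding together_def by (intro arg_cong[of _ _ prob]) blast
  qed
  finally show ?thesis using together_2[OF t] by simp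
qed

text \<open>Pairs in different blocks evolve independently given the past, so only quadruples in a common block
  contribute to the second moment.\<close>

lemma second_moment_bound:
  fixes y :: "nat set set \<Rightarrow> real"
  assumes s: "0 \<le> s" and t: "0 \<le> t" and y[measurable]: "y \<in> borel_measurable partition_algebra"
    and K: "\<And>P. 0 \<le> y P" "\<And>P. y P \<le> K"
    and inv: "\<And>\<sigma> n P. \<sigma> permutes {1..n} \<Longrightarrow> y (permute_partition \<sigma> P) = y P"
  shows "(\<integral>w. y (X s w) * (density_increment s t w)\<^sup>2 \<partial>M) \<le> (\<integral>w. y (X s w) * mass_moment 3 (X s w) \<partial>M)"
proof -
  have st: "0 \<le> s + t" using s t by simp
  define e where "e = exp (- r * t)"
  have e: "0 \<le> e" "e \<le> 1" unfolding e_def using exp_le_1[OF t] by auto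
  have K0: "0 \<le> K" using K[of "{}"] by linarith
  define Y where "Y = (\<lambda>w. y (X s w))"
  have YM[measurable]: "Y \<in> borel_measurable M" unfolding Y_def using s by measurable
  have YK: "\<bar>Y w\<bar> \<le> K" "0 \<le> Y w" for w using K[of "X s w"] by (auto simp: Y_def)
  note [measurable] = measurable_increments[OF s t] measurable_linked[OF s] measurable_linked[OF st]
  let ?D = "density_increment s t" and ?d = "link_increment s t"
  have pm[measurable]: "Measurable.pred (partition_algebra \<Otimes>\<^sub>M partition_algebra) (\<lambda>x. same_block (fst x) i j)"
    "Measurable.pred (partition_algebra \<Otimes>\<^sub>M partition_algebra) (\<lambda>x. same_block (snd x) i j)" for i j
    by (auto intro: measurable_compose[OF measurable_fst pred_same_block] measurable_compose[OF measurable_snd pred_same_block])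
  have mm[measurable]: "(\<lambda>x. mass_moment 1 (fst x)) \<in> borel_measurable (partition_algebra \<Otimes>\<^sub>M partition_algebra)"
    "(\<lambda>x. mass_moment 1 (snd x)) \<in> borel_measurable (partition_algebra \<Otimes>\<^sub>M partition_algebra)"
    "(\<lambda>x. y (fst x)) \<in> borel_measurable (partition_algebra \<Otimes>\<^sub>M partition_algebra)"
    by (auto intro: measurable_compose[OF measurable_fst measurable_mass_moment] measurable_compose[OF measurable_snd measurable_mass_moment]
        measurable_compose[OF measurable_fst y])
  define l where "l = (\<lambda>i j P Q. (if same_block Q i j then 1 else 0) - e * (if same_block P i j then 1 else (0::real)))"
  have dl: "?d i j w = l i j (X s w) (X (s + t) w)" for i j w
    by (simp add: link_increment_def l_def linked_def e_def)
  have lm[measurable]: "(\<lambda>x. l i j (fst x) (snd x)) \<in> borel_measurable (partition_algebra \<Otimes>\<^sub>M partition_algebra)" for i j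
    unfolding l_def by measurable
  have lp: "l (\<sigma> i) (\<sigma> j) (permute_partition \<sigma> P) (permute_partition \<sigma> Q) = l i j P Q" if "\<sigma> permutes {1..n}" for \<sigma> n i j P Q
    unfolding l_def using same_block_permute[OF permutes_bij[OF that]] by simp
  define DD where "DD = (\<lambda>P Q. mass_moment 1 Q - e * mass_moment 1 P)"
  have DDD: "?D w = DD (X s w) (X (s + t) w)" for w by (simp add: density_increment_def DD_def pair_density_def e_def)
  have DDp: "DD (permute_partition \<sigma> P) (permute_partition \<sigma> Q) = DD P Q" if "\<sigma> permutes {1..n}" for \<sigma> n P Q
    unfolding DD_def using mass_moment_permute[OF that] by simp
  \<comment> \<open>One factor of the square is replaced by the pair \<open>1, 2\<close>, the other one by the disjoint pair
    \<open>3, 4\<close>.\<close>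
  have step1: "(\<integral>w. (Y w * ?D w) * ?D w \<partial>M) = (\<integral>w. (Y w * ?D w) * ?d 1 2 w \<partial>M)"
  proof (rule pair_sampling[OF s t, where K=K and m=0])
    show "AE w in M. \<bar>Y w * ?D w\<bar> \<le> K"
      using AE_density_increment_bound[OF s t]
    proof eventually_elim
      case (elim w)
      have "\<bar>Y w\<bar> * \<bar>?D w\<bar> \<le> K * 1" using elim YK K0 by (intro mult_mono) auto
      then show ?case by (simp add: abs_mult)
    qed
    fix i j :: nat assume ij: "0 < i" "0 < j" "i \<noteq> j"
    define f where "f = (\<lambda>k::nat. if k = 1 then i else j)"
    have "\<exists>\<sigma>. \<sigma> permutes {1..max 2 (max i j)} \<and> (\<forall>k\<in>{1, 2}. \<sigma> k = f k)"
      by (rule ex_permutes_extending) (use ij in \<open>auto simp: f_def inj_on_def Suc_le_eq\<close>)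
    then obtain \<sigma> where \<sigma>: "\<sigma> permutes {1..max 2 (max i j)}" "\<sigma> 1 = i" "\<sigma> 2 = j" by (auto simp: f_def)
    define g where "g = (\<lambda>P Q. y P * DD P Q * l i j P Q)"
    have "(\<lambda>(P, Q). g P Q) \<in> borel_measurable (partition_algebra \<Otimes>\<^sub>M partition_algebra)"
      unfolding g_def DD_def split_beta by measurable
    from exchangeable_two_times[OF \<sigma>(1) s st this]
    have "(\<integral>w. y (X s w) * DD (X s w) (X (s + t) w) * l 1 2 (X s w) (X (s + t) w) \<partial>M) = (\<integral>w. g (X s w) (X (s + t) w) \<partial>M)"
      unfolding g_def using inv[OF \<sigma>(1)] DDp[OF \<sigma>(1)] lp[OF \<sigma>(1), of 1 2] \<sigma>(2,3) by simp
    then show "(\<integral>w. (Y w * ?D w) * ?d i j w \<partial>M) = (\<integral>w. (Y w * ?D w) * ?d 1 2 w \<partial>M)"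
      by (simp add: Y_def DDD dl g_def)
  qed measurable
  have step2: "(\<integral>w. (Y w * ?d 1 2 w) * ?D w \<partial>M) = (\<integral>w. (Y w * ?d 1 2 w) * ?d 3 4 w \<partial>M)"
  proof (rule pair_sampling[OF s t, where K=K and m=2])
    show "AE w in M. \<bar>Y w * ?d 1 2 w\<bar> \<le> K"
    proof (rule AE_I2)
      fix w
      have "\<bar>Y w\<bar> * \<bar>?d 1 2 w\<bar> \<le> K * 1" using link_increment_bound[OF t] YK K0 by (intro mult_mono) auto
      then show "\<bar>Y w * ?d 1 2 w\<bar> \<le> K" by (simp add: abs_mult)
    qed
    fix i j :: nat assume ij: "2 < i" "2 < j" "i \<noteq> j"
    define f where "f = (\<lambda>k::nat. if k = 3 then i else if k = 4 then j else k)"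
    have "\<exists>\<sigma>. \<sigma> permutes {1..max 4 (max i j)} \<and> (\<forall>k\<in>{1, 2, 3, 4}. \<sigma> k = f k)"
      by (rule ex_permutes_extending) (use ij in \<open>auto simp: f_def inj_on_def\<close>)
    then obtain \<sigma> where \<sigma>: "\<sigma> permutes {1..max 4 (max i j)}" "\<sigma> 1 = 1" "\<sigma> 2 = 2" "\<sigma> 3 = i" "\<sigma> 4 = j" by (auto simp: f_def)
    define g where "g = (\<lambda>P Q. y P * l 1 2 P Q * l i j P Q)"
    have "(\<lambda>(P, Q). g P Q) \<in> borel_measurable (partition_algebra \<Otimes>\<^sub>M partition_algebra)"
      unfolding g_def split_beta by measurable
    from exchangeable_two_times[OF \<sigma>(1) s st this]
    have "(\<integral>w. y (X s w) * l 1 2 (X s w) (X (s + t) w) * l 3 4 (X s w) (X (s + t) w) \<partial>M) = (\<integral>w. g (X s w) (X (s + t) w) \<partial>M)"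
      unfolding g_def using inv[OF \<sigma>(1)] lp[OF \<sigma>(1), of 1 2] lp[OF \<sigma>(1), of 3 4] \<sigma>(2-) by simp
    then show "(\<integral>w. (Y w * ?d 1 2 w) * ?d i j w \<partial>M) = (\<integral>w. (Y w * ?d 1 2 w) * ?d 3 4 w \<partial>M)"
      by (simp add: Y_def dl g_def)
  qed measurable
  define \<eta> :: "nat set set" where "\<eta> = {{1, 2}, {3, 4}}"
  have s4: "{1..4::nat} = {1, 2, 3, 4}" by auto
  have p\<eta>: "partition_on {1..4} \<eta>" unfolding \<eta>_def s4 by (rule partition_onI) (auto simp: disjnt_def)
  \<comment> \<open>On \<open>E\<close> the two pairs lie in different blocks at time \<open>s\<close>, and the product of their increments
    has mean zero given the past.\<close>
  define E where "E = {w\<in>space M. restr 4 s w = \<eta>}"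
  have EF: "E \<in> sets (natural_filtration M X s)"
  proof -
    have "X s -` {P\<in>space partition_algebra. restrict_partition P {1..4} = \<eta>} \<inter> space (natural_filtration M X s) \<in> sets (natural_filtration M X s)"
      by (rule measurable_sets[OF X_adapted[OF s] sets_restrict_event])
    also have "X s -` {P\<in>space partition_algebra. restrict_partition P {1..4} = \<eta>} \<inter> space (natural_filtration M X s) = E"
      using partition_X[OF _ s] by (auto simp: E_def space_natural_filtration space_partition_algebra)
    finally show ?thesis .
  qed
  have EM[measurable]: "E \<in> sets M" unfolding E_def by (rule sets_restrict_X[OF s])
  have sb\<eta>: "same_block \<eta> 1 2" "same_block \<eta> 3 4" "\<not> same_block \<eta> 1 3" unfolding same_block_def \<eta>_def by auto
  have r\<eta>: "restr 4 u w = \<eta> \<longleftrightarrow> same_block (X u w) 1 2 \<and> same_block (X u w) 3 4 \<and> \<not> same_block (X u w) 1 3"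
    if w: "w \<in> space M" and u: "0 \<le> u" for u w
  proof
    assume *: "restr 4 u w = \<eta>"
    have "same_block \<eta> i j \<longleftrightarrow> i \<in> {1..4} \<and> j \<in> {1..4} \<and> same_block (X u w) i j" for i j
      unfolding *[symmetric] by (rule same_block_restrict)
    then show "same_block (X u w) 1 2 \<and> same_block (X u w) 3 4 \<and> \<not> same_block (X u w) 1 3"
      using sb\<eta> by auto
  next
    assume *: "same_block (X u w) 1 2 \<and> same_block (X u w) 3 4 \<and> \<not> same_block (X u w) 1 3"
    note P = partition_X[OF w u]
    note tr = same_block_trans[OF P]
    have sy: "same_block (X u w) i j \<Longrightarrow> same_block (X u w) j i" for i j using same_block_sym by blast
    have n14: "\<not> same_block (X u w) 1 4" using * tr[of 1 4 3] sy[of 3 4] by blast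
    have n23: "\<not> same_block (X u w) 2 3" using * tr[of 1 2 3] by blast
    have n24: "\<not> same_block (X u w) 2 4" using n14 * tr[of 1 2 4] by blast
    have rf: "same_block (X u w) i i" if "1 \<le> i" for i using same_block_refl[OF P, of i] that by simp
    have e1: "same_block \<eta> i j \<longleftrightarrow> (i \<in> {1, 2} \<and> j \<in> {1, 2}) \<or> (i \<in> {3, 4} \<and> j \<in> {3, 4})" for i j
      unfolding same_block_def \<eta>_def by simp
    have sub: "{1..4} \<subseteq> positive_nats" by auto
    have "\<forall>i\<in>{1..4}. \<forall>j\<in>{1..4}. same_block (X u w) i j \<longleftrightarrow> same_block \<eta> i j"
      unfolding s4 e1 using * n14 n23 n24 rf sy by (simp; blast)
    then show "restr 4 u w = \<eta>"
      using restrict_partition_eq_iff[OF P sub p\<eta>] by blast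
  qed
  define T where "T = (\<lambda>i j. {w\<in>space M. same_block (X (s + t) w) i j})"
  have TM[measurable]: "T i j \<in> sets M" for i j unfolding T_def by (rule sets_same_block_X[OF st])
  have YF: "Y \<in> borel_measurable (natural_filtration M X s)"
    unfolding Y_def by (rule measurable_compose[OF X_adapted[OF s] y])
  have sub: "A \<in> sets M" if "A \<in> sets (natural_filtration M X s)" for A
    using filtration_subalgebra[OF s] that by (auto simp: subalgebra_def)
  define I where "I = (\<lambda>S. \<integral>w. Y w * indicator S w \<partial>M)"
  have Iu: "I (T 1 2 \<inter> E) = e * I E"
    unfolding I_def
  proof (rule conditional_transfer[OF s YF YK(1)])
    fix A assume A: "A \<in> sets (natural_filtration M X s)"
    have AE: "A \<inter> E \<in> sets (natural_filtration M X s)" using A EF by auto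
    have s2: "{1..2::nat} = {1, 2}" by auto
    have v: "partition_on {1..2::nat} {{1..2}}" by (rule partition_whole) simp
    have r2: "restr 2 u w = {{1..2}} \<longleftrightarrow> same_block (X u w) 1 2" if "w \<in> space M" "0 \<le> u" for u w
    proof -
      have "restr 2 u w = {{1..2}} \<longleftrightarrow> (\<forall>i\<in>{1..2}. \<forall>j\<in>{1..2}. same_block (X u w) i j)"
        by (rule restrict_eq_whole_iff[OF partition_X[OF that]]) auto
      then show ?thesis unfolding s2
        using same_block_sym[of "X u w" 1 2] same_block_refl[OF partition_X[OF that]] by auto
    qed
    have "prob {w\<in>A \<inter> E. restr 2 s w = {{1..2}} \<and> restr 2 (s + t) w = {{1..2}}} =
        prob {w\<in>A \<inter> E. restr 2 s w = {{1..2}}} * together 2 t"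
      using branching[OF s t AE v v] by (simp add: refines_refl[OF v] restrict_partition_self[OF v] together_def)
    moreover have "{w\<in>A \<inter> E. restr 2 s w = {{1..2}} \<and> restr 2 (s + t) w = {{1..2}}} = A \<inter> (T 1 2 \<inter> E)"
      using r2 r\<eta> s st by (auto simp: E_def T_def)
    moreover have "{w\<in>A \<inter> E. restr 2 s w = {{1..2}}} = A \<inter> E"
      using r2 r\<eta> s by (auto simp: E_def)
    ultimately show "prob (A \<inter> (T 1 2 \<inter> E)) = e * prob (A \<inter> E)" using together_2[OF t] by (simp add: e_def)
  qed (use EF in auto)
  have Iuv: "I (T 1 2 \<inter> T 3 4 \<inter> E) = e\<^sup>2 * I E"
    unfolding I_def
  proof (rule conditional_transfer[OF s YF YK(1)])
    fix A assume A: "A \<in> sets (natural_filtration M X s)"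
    note [measurable] = sub[OF A]
    have p: "prob {w\<in>space M. restrict_partition (X t w) {i, j} = restrict_partition \<eta> {i, j}} = e"
      if ij: "{i, j} \<in> \<eta>" "i \<noteq> j" for i j
    proof -
      have ij1: "1 \<le> i" "1 \<le> j" using ij by (auto simp: \<eta>_def doubleton_eq_iff)
      have sb: "same_block \<eta> i j" "same_block \<eta> i i" "same_block \<eta> j j" "same_block \<eta> j i" 
        unfolding same_block_def by (rule bexI[OF _ ij(1)]; simp)+
      have "{i, j} \<subseteq> {1..4}" using ij p\<eta> by (auto simp: partition_on_def)
      then have "restrict_partition \<eta> {i, j} = {{i, j}}"
        using restrict_eq_whole_iff[OF p\<eta>, of "{i, j}"] sb by auto
      moreover have "restrict_partition (X t w) {i, j} = {{i, j}} \<longleftrightarrow> same_block (X t w) i j" if "w \<in> space M" for w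
      proof -
        have "restrict_partition (X t w) {i, j} = {{i, j}} \<longleftrightarrow> (\<forall>k\<in>{i, j}. \<forall>l\<in>{i, j}. same_block (X t w) k l)"
          by (rule restrict_eq_whole_iff[OF partition_X[OF that t]]) (use ij1 in auto)
        then show ?thesis
          using same_block_sym[of "X t w" i j] same_block_refl[OF partition_X[OF that t]] ij1 by auto
      qed
      ultimately have "{w\<in>space M. restrict_partition (X t w) {i, j} = restrict_partition \<eta> {i, j}} = {w\<in>space M. same_block (X t w) i j}"
        by auto
      then show ?thesis using prob_same_block[OF t ij1 ij(2)] by (simp add: e_def)
    qed
    have ne: "{1, 2} \<noteq> {3, 4::nat}" by (auto simp: doubleton_eq_iff)
    have "(\<Prod>B\<in>\<eta>. prob {w\<in>space M. restrict_partition (X t w) B = restrict_partition \<eta> B}) = e\<^sup>2"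
    proof -
      have "(\<Prod>B\<in>\<eta>. prob {w\<in>space M. restrict_partition (X t w) B = restrict_partition \<eta> B}) =
        prob {w\<in>space M. restrict_partition (X t w) {1, 2} = restrict_partition \<eta> {1, 2}} *
        prob {w\<in>space M. restrict_partition (X t w) {3, 4} = restrict_partition \<eta> {3, 4}}"
        by (subst (1) \<eta>_def) (use ne in simp)
      then show ?thesis using p[of 1 2] p[of 3 4] by (simp add: \<eta>_def power2_eq_square)
    qed
    then have "prob {w\<in>A. restr 4 s w = \<eta> \<and> restr 4 (s + t) w = \<eta>} =
        prob {w\<in>A. restr 4 s w = \<eta>} * e\<^sup>2"
      using branching[OF s t A p\<eta> p\<eta>] by (simp add: refines_refl[OF p\<eta>])
    moreover have Asp: "A \<subseteq> space M" using sets.sets_into_space[OF sub[OF A]] .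
    then have 1: "{w\<in>A. restr 4 s w = \<eta>} = A \<inter> E" by (auto simp: E_def)
    moreover have "prob {w\<in>A. restr 4 s w = \<eta> \<and> restr 4 (s + t) w = \<eta>} =
        prob (A \<inter> (T 1 2 \<inter> T 3 4 \<inter> E))"
    proof (rule finite_measure_eq_AE)
      show "AE w in M. (w \<in> {w\<in>A. restr 4 s w = \<eta> \<and> restr 4 (s + t) w = \<eta>}) =
        (w \<in> A \<inter> (T 1 2 \<inter> T 3 4 \<inter> E))"
        using AE_refines[OF s, of "s + t", simplified, OF t] AE_space
      proof eventually_elim
        case (elim w)
        have "\<not> same_block (X (s + t) w) 1 3" if "restr 4 s w = \<eta>"
          using elim that r\<eta>[OF elim(2) s] by blast
        then show ?case using elim(2) r\<eta>[OF elim(2) st] by (auto simp: E_def T_def)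
      qed
      have "{w\<in>A. restr 4 s w = \<eta> \<and> restr 4 (s + t) w = \<eta>} =
          A \<inter> E \<inter> {w\<in>space M. restr 4 (s + t) w = \<eta>}" using Asp by (auto simp: E_def)
      then show "{w\<in>A. restr 4 s w = \<eta> \<and> restr 4 (s + t) w = \<eta>} \<in> sets M"
        using sets_restrict_X[OF st, of 4 \<eta>] sub[OF A] EM by auto
    qed measurable
    ultimately show "prob (A \<inter> (T 1 2 \<inter> T 3 4 \<inter> E)) = e\<^sup>2 * prob (A \<inter> E)" by simp
  qed (use EF in auto)
  have Iv: "I (T 3 4 \<inter> E) = I (T 1 2 \<inter> E)"
  proof -
    define f where "f = (\<lambda>k::nat. if k = 1 then 3 else if k = 2 then 4 else if k = 3 then 1 else 2::nat)"
    have "\<exists>\<sigma>. \<sigma> permutes {1..4::nat} \<and> (\<forall>k\<in>{1, 2, 3, 4}. \<sigma> k = f k)"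
      by (rule ex_permutes_extending) (auto simp: f_def inj_on_def)
    then obtain \<sigma> where \<sigma>: "\<sigma> permutes {1..4::nat}" "\<sigma> 1 = 3" "\<sigma> 2 = 4" "\<sigma> 3 = 1" "\<sigma> 4 = 2" by (auto simp: f_def)
    define g where "g = (\<lambda>i j P Q. y P * (if same_block Q i j \<and> same_block P 1 2 \<and> same_block P 3 4 \<and> \<not> same_block P 1 3 then 1 else (0::real)))"
    have "(\<lambda>(P, Q). g 3 4 P Q) \<in> borel_measurable (partition_algebra \<Otimes>\<^sub>M partition_algebra)"
      unfolding g_def split_beta by measurable
    note ex = exchangeable_two_times[OF \<sigma>(1) s st this]
    have "g 3 4 (permute_partition \<sigma> P) (permute_partition \<sigma> Q) = g 1 2 P Q" for P Q
    proof -
      have "same_block (permute_partition \<sigma> R) 3 4 = same_block R 1 2" "same_block (permute_partition \<sigma> R) 1 2 = same_block R 3 4"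
        "same_block (permute_partition \<sigma> R) 1 3 = same_block R 3 1" for R
        by (rule same_block_permute_eq[OF \<sigma>(1)]; simp add: \<sigma>)+
      then show ?thesis unfolding g_def using inv[OF \<sigma>(1)] same_block_sym[of P 3 1] by auto
    qed
    moreover have "I (T i j \<inter> E) = (\<integral>w. g i j (X s w) (X (s + t) w) \<partial>M)" for i j
      unfolding I_def
      by (intro Bochner_Integration.integral_cong refl)
        (use r\<eta>[OF _ s] in \<open>auto simp: g_def Y_def E_def T_def indicator_def\<close>)
    ultimately show ?thesis using ex by simp
  qed
  have intI: "integrable M (\<lambda>w. Y w * indicator S w)" if "S \<in> sets M" for S
    by (rule integrable_const_bound[where B=K]) (use that YK K0 in \<open>auto simp: indicator_def\<close>)
  have zero: "(\<integral>w. Y w * indicator E w * (?d 1 2 w * ?d 3 4 w) \<partial>M) = 0"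
  proof -
    have "(\<integral>w. Y w * indicator E w * (?d 1 2 w * ?d 3 4 w) \<partial>M) =
      (\<integral>w. Y w * indicator (T 1 2 \<inter> T 3 4 \<inter> E) w - e * (Y w * indicator (T 1 2 \<inter> E) w) - e * (Y w * indicator (T 3 4 \<inter> E) w) + e\<^sup>2 * (Y w * indicator E w) \<partial>M)"
    proof (intro Bochner_Integration.integral_cong refl)
      fix w assume w: "w \<in> space M"
      show "Y w * indicator E w * (?d 1 2 w * ?d 3 4 w) = Y w * indicator (T 1 2 \<inter> T 3 4 \<inter> E) w - e * (Y w * indicator (T 1 2 \<inter> E) w) - e * (Y w * indicator (T 3 4 \<inter> E) w) + e\<^sup>2 * (Y w * indicator E w)"
      proof (cases "w \<in> E")
        case True
        then have "same_block (X s w) 1 2" "same_block (X s w) 3 4" using r\<eta>[OF w s] by (auto simp: E_def)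
        then have dd: "?d 1 2 w = indicator (T 1 2) w - e" "?d 3 4 w = indicator (T 3 4) w - e"
          using w by (auto simp: link_increment_def linked_def T_def e_def)
        show ?thesis unfolding dd using True by (simp add: indicator_inter_arith power2_eq_square algebra_simps)
      qed simp
    qed
    also have "\<dots> = I (T 1 2 \<inter> T 3 4 \<inter> E) - e * I (T 1 2 \<inter> E) - e * I (T 3 4 \<inter> E) + e\<^sup>2 * I E"
      unfolding I_def using intI[of "T 1 2 \<inter> T 3 4 \<inter> E"] intI[of "T 1 2 \<inter> E"] intI[of "T 3 4 \<inter> E"] intI[of E] by simp
    also have "\<dots> = 0" unfolding Iv Iu Iuv by (simp add: power2_eq_square)
    finally show ?thesis .
  qed
  \<comment> \<open>A nonzero product requires both pairs to be together at time \<open>s\<close>: either \<open>E\<close> occurs or all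
    four labels share a block.\<close>
  define G where "G = (\<lambda>w. if \<forall>i\<in>{1..3 + 1}. same_block (X s w) 1 i then 1 else (0::real))"
  have GM[measurable]: "G \<in> borel_measurable M" unfolding G_def using s by measurable
  have intG: "integrable M (\<lambda>w. Y w * G w)"
  proof (rule integrable_const_bound[where B=K])
    show "AE w in M. norm (Y w * G w) \<le> K" using YK K0 by (auto simp: G_def)
  qed measurable
  have dd1: "\<bar>?d 1 2 w * ?d 3 4 w\<bar> \<le> 1" for w
    unfolding abs_mult using link_increment_bound[OF t] by (intro mult_le_one) auto
  have intd: "integrable M (\<lambda>w. Z w * (?d 1 2 w * ?d 3 4 w))" if "integrable M Z" for Z :: "'a \<Rightarrow> real"
    by (rule Bochner_Integration.integrable_bound[OF that])
      (use that dd1 in \<open>auto simp: abs_mult[of "Z _" for Z] intro!: mult_left_le\<close>)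
  have intY: "integrable M Y" by (rule integrable_const_bound[where B=K]) (use YK in auto)
  have "(\<integral>w. Y w * (?D w)\<^sup>2 \<partial>M) = (\<integral>w. (Y w * ?D w) * ?D w \<partial>M)" by (simp add: power2_eq_square mult_ac)
  also have "\<dots> = (\<integral>w. (Y w * ?d 1 2 w) * ?D w \<partial>M)" unfolding step1 by (simp add: mult_ac)
  also have "\<dots> = (\<integral>w. Y w * (?d 1 2 w * ?d 3 4 w) \<partial>M)" unfolding step2 by (simp add: mult_ac)
  also have "\<dots> \<le> (\<integral>w. Y w * G w + Y w * indicator E w * (?d 1 2 w * ?d 3 4 w) \<partial>M)"
  proof (rule integral_mono_AE)
    show "AE w in M. Y w * (?d 1 2 w * ?d 3 4 w) \<le> Y w * G w + Y w * indicator E w * (?d 1 2 w * ?d 3 4 w)"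
      using AE_refines[OF s, of "s + t", simplified, OF t] AE_space
    proof eventually_elim
      case (elim w)
      note tr = same_block_trans[OF partition_X[OF elim(2) s]]
      show ?case
      proof (cases "same_block (X s w) 1 2 \<and> same_block (X s w) 3 4")
        case False
        then have "?d 1 2 w = 0 \<or> ?d 3 4 w = 0" using elim(1) by (auto simp: link_increment_def linked_def)
        then have z: "?d 1 2 w * ?d 3 4 w = 0" by auto
        show ?thesis unfolding z using YK(2)[of w] by (simp add: G_def)
      next
        case T: True
        show ?thesis
        proof (cases "same_block (X s w) 1 3")
          case True
          have s4': "{1..3 + 1::nat} = {1, 2, 3, 4}" by auto
          have "G w = 1" unfolding G_def s4'
            using True T tr[of 1 3 4] same_block_refl[OF partition_X[OF elim(2) s], of 1] by auto
          moreover have "w \<notin> E" using True r\<eta>[OF elim(2) s] by (auto simp: E_def)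
          moreover have "Y w * (?d 1 2 w * ?d 3 4 w) \<le> Y w * 1"
            using YK(2)[of w] dd1[of w] by (intro mult_left_mono) auto
          ultimately show ?thesis by simp
        next
          case False
          then have "w \<in> E" using T r\<eta>[OF elim(2) s] elim(2) by (auto simp: E_def)
          then show ?thesis using YK(2)[of w] by (simp add: G_def)
        qed
      qed
    qed
  qed (use intd[OF intY] intd[OF intI[OF EM]] intG in auto)
  also have "\<dots> = (\<integral>w. Y w * G w \<partial>M)" using intd[OF intI[OF EM]] intG zero by simp
  also have "\<dots> = (\<integral>w. y (X s w) * freq (X s w) 1 ^ 3 \<partial>M)"
    unfolding Y_def G_def by (rule weighted_freq_moment[OF s y _ inv, symmetric]) (use K in \<open>auto simp: abs_of_nonneg\<close>)
  also have "\<dots> = (\<integral>w. y (X s w) * freq (X s w) 1 powr 3 \<partial>M)"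
  proof (rule integral_cong_AE)
    show "AE w in M. y (X s w) * freq (X s w) 1 ^ 3 = y (X s w) * freq (X s w) 1 powr 3"
      using AE_tagged_bounds[OF s] by eventually_elim (auto simp: powr_numeral)
  qed (use measurable_freq_X[OF s] YM[unfolded Y_def] in auto)
  also have "\<dots> = (\<integral>w. y (X s w) * mass_moment 3 (X s w) \<partial>M)"
    by (rule weighted_mass_moment[OF s _ y _ inv, symmetric]) (use K in \<open>auto simp: abs_of_nonneg\<close>)
  finally show ?thesis by (simp add: Y_def)
qed

end

section \<open>Convergence of the additive martingale\<close>

text \<open>The tangent of a concave power at \<open>c\<close>; integrated, it is Jensen's inequality.\<close>

lemma powr_four_fifths_tangent:
  fixes z c :: real
  assumes z: "0 \<le> z" and c: "0 < c"
  shows "z powr (4/5) \<le> 4/5 * z * c powr (-1/5) + 1/5 * c powr (4/5)"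
proof -
  define x where "x = (z / c) powr (1/5)"
  have x0: "0 \<le> x" unfolding x_def by simp
  have x5: "x ^ 5 = z / c"
  proof (cases "z = 0")
    case False
    then have "x ^ 5 = x powr 5" using x0 z c by (simp add: x_def powr_numeral)
    then show ?thesis using z c by (simp add: x_def powr_powr)
  qed (simp add: x_def)
  have x4: "z powr (4/5) = c powr (4/5) * x ^ 4"
  proof (cases "z = 0")
    case False
    then have "x ^ 4 = x powr 4" using z c by (simp add: x_def powr_numeral)
    also have "\<dots> = (z / c) powr (4/5)" by (simp add: x_def powr_powr)
    finally show ?thesis using z c by (simp add: powr_divide)
  qed (simp add: x_def)
  have "0 \<le> (x - 1) ^ 2 * (4 * x ^ 3 + 3 * x ^ 2 + 2 * x + 1)" using x0 by simp
  also have "\<dots> = 4 * x ^ 5 + 1 - 5 * x ^ 4" by (simp add: power_numeral_reduce algebra_simps)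
  finally have "x ^ 4 \<le> 4/5 * x ^ 5 + 1/5" by simp
  then have "c powr (4/5) * x ^ 4 \<le> c powr (4/5) * (4/5 * x ^ 5 + 1/5)" by (intro mult_left_mono) auto
  also have "\<dots> = 4/5 * z * (c powr (4/5) / c) + 1/5 * c powr (4/5)" unfolding x5 by (simp add: algebra_simps)
  also have "c powr (4/5) / c = c powr (-1/5)" using powr_diff[of c "4/5" 1] c by simp
  finally show ?thesis unfolding x4 .
qed

context beta_fragmentation
begin

lemma expectation_mass_moment:
  assumes "0 \<le> t" "0 < \<alpha>" shows "(\<integral>w. mass_moment \<alpha> (X t w) \<partial>M) = power_moment \<alpha> t"
  using weighted_mass_moment[OF assms, of "\<lambda>_. 1" 1] by (simp add: power_moment_def)

text \<open>\<open>\<bar>D\<bar> \<le> (y * D\<^sup>2 + 1 / y) / 2\<close> for the increment \<open>D\<close> and the weight \<open>y = 1 / (z + \<epsilon>)\<close>, where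
  \<open>z = mass_moment (3/2) powr (4/5)\<close> belongs to the past. Because \<open>mass_moment 3 \<le> z\<^sup>2\<close>, the weighted
  second moment is at most the mean of \<open>z\<close>, and the second term is of the same size. Without a weight
  this would fail: the martingale is not bounded in mean square, as four labels are first split at a
  rate less than \<open>2 * r\<close>.\<close>

lemma density_increment_L1:
  assumes s: "0 \<le> s" and t: "0 \<le> t" and c: "0 < c" "power_moment (3/2) s \<le> c"
  shows "(\<integral>w. \<bar>density_increment s t w\<bar> \<partial>M) \<le> c powr (4/5)"
proof (rule field_le_epsilon)
  fix \<epsilon> :: real assume \<epsilon>: "\<epsilon> > 0"
  define z where "z = (\<lambda>P. mass_moment (3/2) P powr (4/5))"
  have zm[measurable]: "z \<in> borel_measurable partition_algebra" unfolding z_def by measurable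
  define y where "y = (\<lambda>P. 1 / (z P + \<epsilon>))"
  have z0: "0 \<le> z P" for P by (simp add: z_def)
  have ym[measurable]: "y \<in> borel_measurable partition_algebra" unfolding y_def by measurable
  have y0: "0 \<le> y P" for P using z0[of P] \<epsilon> by (simp add: y_def)
  have y1: "y P \<le> 1 / \<epsilon>" for P using z0[of P] \<epsilon> unfolding y_def by (intro frac_le) auto
  have yX[measurable]: "(\<lambda>w. y (X s w)) \<in> borel_measurable M" "(\<lambda>w. z (X s w)) \<in> borel_measurable M" using s by measurable
  note [measurable] = measurable_increments[OF s t] measurable_mass_moment_X[OF s]
  have AEz: "AE w in M. z (X s w) \<le> 1"
    using AE_mass_moment_bounds[OF s, of "3/2", simplified]
    by (auto simp: z_def intro!: powr_le_1 elim!: eventually_elim2)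
  have intz: "integrable M (\<lambda>w. z (X s w))"
    by (rule integrable_const_bound[where B=1]) (use AEz z0 in auto)
  have Ez: "(\<integral>w. z (X s w) \<partial>M) \<le> c powr (4/5)"
  proof -
    have "(\<integral>w. z (X s w) \<partial>M) \<le> (\<integral>w. 4/5 * mass_moment (3/2) (X s w) * c powr (-1/5) + 1/5 * c powr (4/5) \<partial>M)"
    proof (rule integral_mono_AE[OF intz])
      show "integrable M (\<lambda>w. 4/5 * mass_moment (3/2) (X s w) * c powr (-1/5) + 1/5 * c powr (4/5))"
        using integrable_mass_moment[OF s, of "3/2"] by auto
      show "AE w in M. z (X s w) \<le> 4/5 * mass_moment (3/2) (X s w) * c powr (-1/5) + 1/5 * c powr (4/5)"
        using AE_regular_at[OF s]
        by eventually_elim (simp only: z_def, rule powr_four_fifths_tangent[OF regular_partition.mass_moment_bounds(1) c(1)], simp_all)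
    qed
    also have "\<dots> = 4/5 * power_moment (3/2) s * c powr (-1/5) + 1/5 * c powr (4/5)"
      using integrable_mass_moment[OF s, of "3/2"] expectation_mass_moment[OF s, of "3/2"] by (simp add: prob_space)
    also have "\<dots> \<le> 4/5 * c * c powr (-1/5) + 1/5 * c powr (4/5)"
      using c by (intro add_right_mono mult_right_mono mult_left_mono) auto
    finally show ?thesis using powr_add[of c 1 "-1/5"] c(1) by (simp add: mult.assoc)
  qed
  have intD2: "integrable M (\<lambda>w. y (X s w) * (density_increment s t w)\<^sup>2)"
  proof (rule integrable_const_bound[where B="1 / \<epsilon>"])
    show "AE w in M. norm (y (X s w) * (density_increment s t w)\<^sup>2) \<le> 1 / \<epsilon>"
      using AE_density_increment_bound[OF s t]
    proof eventually_elim
      case (elim w)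
      then have "(density_increment s t w)\<^sup>2 \<le> 1" by (simp add: abs_square_le_1)
      then have "y (X s w) * (density_increment s t w)\<^sup>2 \<le> 1 / \<epsilon> * 1" using y0 y1 \<epsilon> by (intro mult_mono) auto
      then show ?case using y0 by simp
    qed
  qed measurable
  have intm3: "integrable M (\<lambda>w. y (X s w) * mass_moment 3 (X s w))"
  proof (rule integrable_const_bound[where B="1 / \<epsilon>"])
    show "AE w in M. norm (y (X s w) * mass_moment 3 (X s w)) \<le> 1 / \<epsilon>"
      using AE_regular_at[OF s]
    proof eventually_elim
      case (elim w)
      interpret regular_partition "X s w" by fact
      have "y (X s w) * mass_moment 3 (X s w) \<le> 1 / \<epsilon> * 1" using y0 y1 \<epsilon> mass_moment_bounds[of 3] by (intro mult_mono) auto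
      then show ?case using y0 mass_moment_bounds[of 3] by (simp add: abs_mult)
    qed
  qed measurable
  have ED: "(\<integral>w. y (X s w) * (density_increment s t w)\<^sup>2 \<partial>M) \<le> (\<integral>w. z (X s w) \<partial>M)"
  proof -
    have "(\<integral>w. y (X s w) * (density_increment s t w)\<^sup>2 \<partial>M) \<le> (\<integral>w. y (X s w) * mass_moment 3 (X s w) \<partial>M)"
      by (rule second_moment_bound[OF s t ym y0 y1]) (simp add: y_def z_def mass_moment_permute)
    also have "\<dots> \<le> (\<integral>w. z (X s w) \<partial>M)"
    proof (rule integral_mono_AE[OF intm3 intz])
      show "AE w in M. y (X s w) * mass_moment 3 (X s w) \<le> z (X s w)"
        using AE_regular_at[OF s]
      proof eventually_elim
        case (elim w)
        interpret regular_partition "X s w" by fact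
        have "mass_moment 3 (X s w) \<le> z (X s w) * z (X s w)"
          using mass_moment_3_le by (simp add: z_def flip: powr_add)
        then have "y (X s w) * mass_moment 3 (X s w) \<le> y (X s w) * (z (X s w) * z (X s w))"
          using y0 by (intro mult_left_mono) auto
        also have "\<dots> = z (X s w) * (z (X s w) / (z (X s w) + \<epsilon>))" by (simp add: y_def)
        also have "\<dots> \<le> z (X s w) * 1" using z0[of "X s w"] \<epsilon> by (intro mult_left_mono) (auto simp: divide_le_eq_1)
        finally show ?case by simp
      qed
    qed
    finally show ?thesis .
  qed
  have intD: "integrable M (\<lambda>w. \<bar>density_increment s t w\<bar>)"
    by (rule integrable_const_bound[where B=1]) (use AE_density_increment_bound[OF s t] in auto)
  have "(\<integral>w. \<bar>density_increment s t w\<bar> \<partial>M) \<le> (\<integral>w. (y (X s w) * (density_increment s t w)\<^sup>2 + (z (X s w) + \<epsilon>)) / 2 \<partial>M)"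
  proof (rule integral_mono[OF intD])
    show "integrable M (\<lambda>w. (y (X s w) * (density_increment s t w)\<^sup>2 + (z (X s w) + \<epsilon>)) / 2)"
      using intD2 intz by auto
    fix w
    define d v where "d = \<bar>density_increment s t w\<bar>" and "v = z (X s w) + \<epsilon>"
    have v: "v > 0" unfolding v_def using z0[of "X s w"] \<epsilon> by simp
    have "0 \<le> (d - v)\<^sup>2 / v" using v by simp
    also have "\<dots> = d\<^sup>2 / v + v - 2 * d" using v by (simp add: power2_eq_square field_simps)
    finally show "\<bar>density_increment s t w\<bar> \<le> (y (X s w) * (density_increment s t w)\<^sup>2 + (z (X s w) + \<epsilon>)) / 2"
      by (simp add: d_def v_def y_def)
  qed
  also have "\<dots> = ((\<integral>w. y (X s w) * (density_increment s t w)\<^sup>2 \<partial>M) + ((\<integral>w. z (X s w) \<partial>M) + \<epsilon>)) / 2"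
    using intD2 intz by (simp add: prob_space)
  also have "\<dots> \<le> c powr (4/5) + \<epsilon>" using ED Ez \<epsilon> by simp
  finally show "(\<integral>w. \<bar>density_increment s t w\<bar> \<partial>M) \<le> c powr (4/5) + \<epsilon>" .
qed

definition martingale :: "real \<Rightarrow> 'a \<Rightarrow> real"
  where "martingale t w = exp (r * t) * pair_density t w"

lemma measurable_martingale: "0 \<le> t \<Longrightarrow> martingale t \<in> borel_measurable M"
  unfolding martingale_def[abs_def] using measurable_pair_density[of t] by measurable

lemma integrable_martingale: "0 \<le> t \<Longrightarrow> integrable M (martingale t)"
  unfolding martingale_def[abs_def] using integrable_pair_density[of t] by auto

lemma expectation_martingale: assumes "0 \<le> t" shows "(\<integral>w. martingale t w \<partial>M) = 1"
proof -
  have "(\<integral>w. pair_density t w \<partial>M) = power_moment 1 t"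
    unfolding pair_density_def by (rule expectation_mass_moment[OF assms]) simp
  also have "\<dots> = (\<integral>w. freq (X t w) 1 ^ 1 \<partial>M)"
    unfolding power_moment_def
  proof (rule integral_cong_AE)
    show "AE w in M. freq (X t w) 1 powr 1 = freq (X t w) 1 ^ 1"
      using AE_tagged_bounds[OF assms] by eventually_elim auto
  qed (use measurable_freq_X[OF assms] in auto)
  also have "\<dots> = exp (- r * t)" using freq_moment_together[OF assms, of 1] together_2[OF assms] by simp
  finally show ?thesis unfolding martingale_def by (simp flip: exp_add)
qed

text \<open>The normalisation grows like \<open>exp (r * s)\<close>, and \<open>4/5 * \<kappa> > r\<close>.\<close>

lemma martingale_increment_L1:
  "\<exists>C \<delta>. 0 < C \<and> 0 < \<delta> \<and> (\<forall>s\<ge>0. \<forall>t\<ge>0. (\<integral>w. \<bar>martingale (s + t) w - martingale s w\<bar> \<partial>M) \<le> C * exp (r * t) * exp (- \<delta> * s))"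
proof -
  obtain \<kappa> C where \<kappa>: "5/4 * r < \<kappa>" "0 < C" "\<And>t. 0 \<le> t \<Longrightarrow> power_moment (3/2) t \<le> C * exp (- \<kappa> * t)"
    using power_moment_decay by blast
  define \<delta> where "\<delta> = 4/5 * \<kappa> - r"
  have \<delta>: "\<delta> > 0" using \<kappa>(1) by (simp add: \<delta>_def)
  have "(\<integral>w. \<bar>martingale (s + t) w - martingale s w\<bar> \<partial>M) \<le> C powr (4/5) * exp (r * t) * exp (- \<delta> * s)"
    if s: "0 \<le> s" and t: "0 \<le> t" for s t
  proof -
    have "martingale (s + t) w - martingale s w = exp (r * (s + t)) * density_increment s t w" for w
    proof -
      have "exp (r * (s + t)) * exp (- r * t) = exp (r * s)" by (simp add: algebra_simps flip: exp_add)
      then show ?thesis unfolding martingale_def density_increment_def by (simp add: algebra_simps)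
    qed
    then have "(\<integral>w. \<bar>martingale (s + t) w - martingale s w\<bar> \<partial>M) = exp (r * (s + t)) * (\<integral>w. \<bar>density_increment s t w\<bar> \<partial>M)"
      by (simp add: abs_mult)
    also have "\<dots> \<le> exp (r * (s + t)) * (C * exp (- \<kappa> * s)) powr (4/5)"
      using \<kappa> s t by (intro mult_left_mono density_increment_L1) auto
    also have "(C * exp (- \<kappa> * s)) powr (4/5) = C powr (4/5) * exp (- (4/5 * \<kappa>) * s)"
      using \<kappa>(2) by (simp add: powr_mult powr_def[of "exp _"] mult_ac)
    also have "exp (r * (s + t)) * (C powr (4/5) * exp (- (4/5 * \<kappa>) * s)) = C powr (4/5) * exp (r * t) * exp (- \<delta> * s)"
      unfolding \<delta>_def by (simp add: algebra_simps flip: exp_add)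
    finally show ?thesis .
  qed
  then show ?thesis using \<delta> \<kappa>(2) by (intro exI[of _ "C powr (4/5)"] exI[of _ \<delta>]) auto
qed

text \<open>Along the integers the limit is visibly measurable.\<close>

definition W_limit :: "'a \<Rightarrow> real"
  where "W_limit w = lim (\<lambda>k. martingale (real k) w)"

lemma measurable_W_limit[measurable]: "W_limit \<in> borel_measurable M"
proof -
  have [measurable]: "martingale (real k) \<in> borel_measurable M" for k by (rule measurable_martingale) simp
  show ?thesis unfolding W_limit_def[abs_def] by measurable
qed

lemma martingale_grid:
  assumes h: "0 < h"
  shows "AE w in M. convergent (\<lambda>k. martingale (real k * h) w)"
    and "integrable M (\<lambda>w. lim (\<lambda>k. martingale (real k * h) w))"
    and "(\<lambda>k. \<integral>w. \<bar>martingale (real k * h) w - lim (\<lambda>k. martingale (real k * h) w)\<bar> \<partial>M) \<longlonglongrightarrow> 0"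
proof -
  obtain C \<delta> where C: "0 < C" "0 < \<delta>"
    "\<And>s t. 0 \<le> s \<Longrightarrow> 0 \<le> t \<Longrightarrow> (\<integral>w. \<bar>martingale (s + t) w - martingale s w\<bar> \<partial>M) \<le> C * exp (r * t) * exp (- \<delta> * s)"
    using martingale_increment_L1 by blast
  define c where "c = (\<lambda>k. C * exp (r * h) * exp (- \<delta> * h) ^ k)"
  have "exp (- \<delta> * h) < 1" using C h by simp
  then have sc: "summable c" unfolding c_def by (intro summable_mult summable_geometric) simp
  have b: "(\<integral>w. \<bar>martingale (real (Suc k) * h) w - martingale (real k * h) w\<bar> \<partial>M) \<le> c k" for k
  proof -
    have "real (Suc k) * h = real k * h + h" by (simp add: algebra_simps)
    moreover have "exp (- \<delta> * (real k * h)) = exp (- \<delta> * h) ^ k" by (simp add: mult_ac flip: exp_of_nat_mult)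
    ultimately show ?thesis using C(3)[of "real k * h" h] h by (simp add: c_def)
  qed
  have i: "integrable M (martingale (real k * h))" for k by (rule integrable_martingale) (use h in simp)
  note S = summable_increments[of "\<lambda>k. martingale (real k * h)" c, OF i sc b]
  show "AE w in M. convergent (\<lambda>k. martingale (real k * h) w)"
    "integrable M (\<lambda>w. lim (\<lambda>k. martingale (real k * h) w))"
    "(\<lambda>k. \<integral>w. \<bar>martingale (real k * h) w - lim (\<lambda>k. martingale (real k * h) w)\<bar> \<partial>M) \<longlonglongrightarrow> 0"
    using S by auto
qed

lemma integrable_W_limit: "integrable M W_limit"
  using martingale_grid(2)[of 1] by (simp add: W_limit_def[abs_def])

text \<open>Between the points of a grid the pair density is monotone, so the martingale varies at most by a factor
  \<open>exp (r * h)\<close>.\<close>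

lemma AE_martingale_converges: "AE w in M. ((\<lambda>t. martingale t w) \<longlongrightarrow> W_limit w) at_top"
proof -
  have "AE w in M. \<forall>m. convergent (\<lambda>k. martingale (real k * (1 / real (Suc m))) w)"
    unfolding AE_all_countable by (intro allI martingale_grid) simp
  then show ?thesis using AE_regular AE_monotone
  proof eventually_elim
    case (elim w)
    have anti: "pair_density t w \<le> pair_density s w" if "0 \<le> s" "s \<le> t" for s t
      unfolding pair_density_def
      by (rule mass_moment_antimono) (use elim(2,3) that in auto)
    have nn: "0 \<le> pair_density t w" if "0 \<le> t" for t
      unfolding pair_density_def by (rule regular_partition.mass_moment_bounds(1)) (use elim(2) that in auto)
    define L where "L = W_limit w"
    have conv: "(\<lambda>k. martingale (real k * (1 / real (Suc m))) w) \<longlonglongrightarrow> L" for m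
    proof -
      obtain l where l: "(\<lambda>k. martingale (real k * (1 / real (Suc m))) w) \<longlonglongrightarrow> l"
        using elim(1) by (auto simp: convergent_def)
      have "strict_mono (\<lambda>k. k * Suc m)" by (simp add: strict_mono_def del: mult_Suc_right)
      from LIMSEQ_subseq_LIMSEQ[OF l this] have "(\<lambda>k. martingale (real (k * Suc m) * (1 / real (Suc m))) w) \<longlonglongrightarrow> l"
        by (simp add: o_def)
      moreover have eq: "real (k * Suc m) * (1 / real (Suc m)) = real k" for k
        by (simp del: of_nat_Suc mult_Suc_right)
      ultimately have "(\<lambda>k. martingale (real k) w) \<longlonglongrightarrow> l" by (simp only: eq)
      then have "L = l" unfolding L_def W_limit_def by (rule limI)
      then show ?thesis using l by simp
    qed
    show ?case
      unfolding L_def[symmetric]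
    proof (rule tendstoI)
      fix e :: real assume e: "e > 0"
      have "(\<lambda>m. exp (r * (1 / real (Suc m))) * (L + 1 / real (Suc m))) \<longlonglongrightarrow> L" by real_asymp
      then have 1: "eventually (\<lambda>m. exp (r * (1 / real (Suc m))) * (L + 1 / real (Suc m)) < L + e) sequentially"
        by (rule order_tendstoD) (use e in simp)
      have "(\<lambda>m. exp (- r * (1 / real (Suc m))) * (L - 1 / real (Suc m))) \<longlonglongrightarrow> L" by real_asymp
      then have 2: "eventually (\<lambda>m. exp (- r * (1 / real (Suc m))) * (L - 1 / real (Suc m)) > L - e) sequentially"
        by (rule order_tendstoD) (use e in simp)
      obtain m where m: "exp (r * (1 / real (Suc m))) * (L + 1 / real (Suc m)) < L + e"
          "exp (- r * (1 / real (Suc m))) * (L - 1 / real (Suc m)) > L - e"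
        using eventually_happens[OF eventually_conj[OF 1 2]] by auto
      define h where "h = 1 / real (Suc m)"
      have h: "h > 0" unfolding h_def by simp
      have "eventually (\<lambda>k. dist (martingale (real k * h) w) L < h) sequentially"
        using conv[of m] h unfolding h_def[symmetric] by (rule tendstoD)
      then obtain K where K: "\<And>k. k \<ge> K \<Longrightarrow> \<bar>martingale (real k * h) w - L\<bar> < h"
        by (auto simp: eventually_sequentially dist_real_def)
      have "dist (martingale t w) L < e" if t: "t \<ge> real K * h" for t
      proof -
        have t0: "0 \<le> t" using t h by (meson mult_nonneg_nonneg of_nat_0_le_iff less_imp_le order_trans)
        define k where "k = nat \<lfloor>t / h\<rfloor>"
        have k: "real k \<le> t / h" "t / h < real k + 1" unfolding k_def using t0 h by (simp_all add: floor_less_iff)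
        have kt: "real k * h \<le> t" "t < real (Suc k) * h" using k h by (simp_all add: field_simps)
        have "real K \<le> t / h" using t h by (simp add: field_simps)
        then have Kk: "K \<le> k" unfolding k_def using le_nat_floor by blast
        have "martingale t w \<le> exp (r * h) * martingale (real k * h) w"
        proof -
          have "r * t \<le> r * (h + real k * h)"
            using kt r_pos by (intro mult_left_mono) (auto simp: algebra_simps)
          then have "martingale t w \<le> exp (r * (h + real k * h)) * pair_density (real k * h) w"
            unfolding martingale_def
            using anti[of "real k * h" t] kt h nn[OF t0] by (intro mult_mono) auto
          then show ?thesis unfolding martingale_def by (simp add: distrib_left exp_add mult_ac)
        qed
        also have "\<dots> \<le> exp (r * h) * (L + h)" using K[OF Kk] by (intro mult_left_mono) auto
        finally have up: "martingale t w < L + e" using m(1) unfolding h_def by simp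
        have "exp (- r * h) * (L - h) \<le> exp (- r * h) * martingale (real (Suc k) * h) w"
          using K[of "Suc k"] Kk by (intro mult_left_mono) auto
        also have "\<dots> \<le> martingale t w"
        proof -
          have "exp (- r * h) * exp (r * (real (Suc k) * h)) = exp (r * (real k * h))"
            unfolding exp_add[symmetric] by (simp add: algebra_simps)
          then have "exp (- r * h) * martingale (real (Suc k) * h) w = exp (r * (real k * h)) * pair_density (real (Suc k) * h) w"
            unfolding martingale_def by (simp only: mult.assoc[symmetric])
          also have "\<dots> \<le> exp (r * t) * pair_density t w"
            using anti[of t "real (Suc k) * h"] kt h t0 nn[of "real (Suc k) * h"] r_pos
            by (intro mult_mono) auto
          finally show ?thesis unfolding martingale_def .
        qed
        finally have "martingale t w > L - e" using m(2) unfolding h_def by simp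
        with up show ?thesis by (simp add: dist_real_def abs_less_iff)
      qed
      then show "eventually (\<lambda>t. dist (martingale t w) L < e) at_top"
        by (auto simp: eventually_at_top_linorder)
    qed
  qed
qed

lemma martingale_L1: "((\<lambda>t. \<integral>w. \<bar>martingale t w - W_limit w\<bar> \<partial>M) \<longlongrightarrow> 0) at_top"
proof -
  obtain C \<delta> where C: "0 < C" "0 < \<delta>"
    "\<And>s t. 0 \<le> s \<Longrightarrow> 0 \<le> t \<Longrightarrow> (\<integral>w. \<bar>martingale (s + t) w - martingale s w\<bar> \<partial>M) \<le> C * exp (r * t) * exp (- \<delta> * s)"
    using martingale_increment_L1 by blast
  define R where "R = (\<lambda>k. \<integral>w. \<bar>martingale (real k) w - W_limit w\<bar> \<partial>M)"
  have R0: "R \<longlonglongrightarrow> 0" unfolding R_def W_limit_def using martingale_grid(3)[of 1] by simp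
  have ft: "filterlim (\<lambda>t. nat \<lfloor>t\<rfloor>) sequentially (at_top :: real filter)" by real_asymp
  have "((\<lambda>t::real. C * exp r * exp (- \<delta> * real (nat \<lfloor>t\<rfloor>)) + R (nat \<lfloor>t\<rfloor>)) \<longlongrightarrow> 0 + 0) at_top"
  proof (intro tendsto_add filterlim_compose[OF R0 ft])
    have "(\<lambda>k. C * exp r * exp (- \<delta> * real k)) \<longlonglongrightarrow> 0" using C(2) by real_asymp
    then show "((\<lambda>t::real. C * exp r * exp (- \<delta> * real (nat \<lfloor>t\<rfloor>))) \<longlongrightarrow> 0) at_top" by (rule filterlim_compose[OF _ ft])
  qed
  then have lim: "((\<lambda>t::real. C * exp r * exp (- \<delta> * real (nat \<lfloor>t\<rfloor>)) + R (nat \<lfloor>t\<rfloor>)) \<longlongrightarrow> 0) at_top" by simp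
  show ?thesis
  proof (rule tendsto_sandwich[OF _ _ tendsto_const lim])
    show "eventually (\<lambda>t. (\<integral>w. \<bar>martingale t w - W_limit w\<bar> \<partial>M) \<le> C * exp r * exp (- \<delta> * real (nat \<lfloor>t\<rfloor>)) + R (nat \<lfloor>t\<rfloor>)) at_top"
      using eventually_ge_at_top[of 0]
    proof eventually_elim
      case (elim t)
      define k where "k = nat \<lfloor>t\<rfloor>"
      have k: "real k \<le> t" "t < real k + 1" unfolding k_def using elim by (simp_all add: floor_less_iff)
      have i: "integrable M (martingale t)" "integrable M (martingale (real k))" using integrable_martingale elim by auto
      have "(\<integral>w. \<bar>martingale t w - W_limit w\<bar> \<partial>M) \<le> (\<integral>w. \<bar>martingale t w - martingale (real k) w\<bar> + \<bar>martingale (real k) w - W_limit w\<bar> \<partial>M)"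
        using i integrable_W_limit by (intro integral_mono) auto
      also have "\<dots> = (\<integral>w. \<bar>martingale t w - martingale (real k) w\<bar> \<partial>M) + R k"
        unfolding R_def using i integrable_W_limit by (intro Bochner_Integration.integral_add) auto
      also have "(\<integral>w. \<bar>martingale t w - martingale (real k) w\<bar> \<partial>M) \<le> C * exp (r * (t - real k)) * exp (- \<delta> * real k)"
        using C(3)[of "real k" "t - real k"] k by simp
      also have "\<dots> \<le> C * exp r * exp (- \<delta> * real k)"
        using k C r_pos by (intro mult_right_mono mult_left_mono) auto
      finally show ?case unfolding k_def by simp
    qed
  qed auto
qed

lemma expectation_W_limit: "(\<integral>w. W_limit w \<partial>M) = 1"
proof -
  have "\<bar>1 - (\<integral>w. W_limit w \<partial>M)\<bar> \<le> (\<integral>w. \<bar>martingale t w - W_limit w\<bar> \<partial>M)" if "0 \<le> t" for t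
  proof -
    have "1 - (\<integral>w. W_limit w \<partial>M) = (\<integral>w. martingale t w - W_limit w \<partial>M)"
      using integrable_martingale[OF that] integrable_W_limit expectation_martingale[OF that] by simp
    then show ?thesis by (simp add: integral_abs_bound)
  qed
  then have "\<bar>1 - (\<integral>w. W_limit w \<partial>M)\<bar> \<le> 0"
    by (intro tendsto_lowerbound[OF martingale_L1]) (auto simp: eventually_at_top_linorder)
  then show ?thesis by simp
qed

lemma AE_W_limit_nonneg: "AE w in M. 0 \<le> W_limit w"
  using AE_martingale_converges AE_regular
proof eventually_elim
  case (elim w)
  have "eventually (\<lambda>t. 0 \<le> martingale t w) at_top"
    using eventually_ge_at_top[of 0]
    by eventually_elim (use elim(2) in \<open>auto simp: martingale_def pair_density_def regular_partition.mass_moment_bounds\<close>)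
  with elim(1) show ?case by (intro tendsto_lowerbound[OF elim(1)]) auto
qed

lemma W_beta_eq_martingale:
  assumes "regular_partition (X t w)" shows "W_beta \<beta> X t w = martingale t w"
  unfolding W_beta_def martingale_def pair_density_def
  using regular_partition.suminf_ranked_frequency_squares[OF assms] by simp

end

text \<open>Off the almost sure event that all frequencies exist, \<open>asymptotic_frequency\<close> still takes values in
  \<open>{..1}\<close> together with one unspecified number, so the suprema remain suprema of bounded sets.\<close>

lemma asymptotic_frequency_le:
  "asymptotic_frequency B \<le> max 1 (THE x::real. False)"
proof (cases "convergent (\<lambda>n. real (card (B \<inter> {1..n})) / real n)")
  case True
  have "card (B \<inter> {1..n}) \<le> card {1..n}" for n by (intro card_mono) auto
  then have "real (card (B \<inter> {1..n})) / real n \<le> 1" for n by (cases "n = 0") (auto simp: divide_le_eq_1)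
  then have "asymptotic_frequency B \<le> 1"
    unfolding asymptotic_frequency_def using True by (intro LIMSEQ_le_const2[OF convergent_LIMSEQ_iff[THEN iffD1]]) auto
  then show ?thesis by simp
next
  case False
  then have "(\<lambda>n. real (card (B \<inter> {1..n})) / real n) \<longlonglongrightarrow> L \<longleftrightarrow> False" for L by (auto simp: convergent_def)
  then show ?thesis unfolding asymptotic_frequency_def lim_def by simp
qed

lemma ranked_frequency_bdd:
  "bdd_above (insert 0 {x. \<exists>F\<subseteq>P. card F = Suc i \<and> (\<forall>B\<in>F. x \<le> asymptotic_frequency B)})"
proof (rule bdd_aboveI)
  fix x assume "x \<in> insert 0 {x. \<exists>F\<subseteq>P. card F = Suc i \<and> (\<forall>B\<in>F. x \<le> asymptotic_frequency B)}"
  then show "x \<le> max 1 (THE x::real. False)"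
  proof
    assume "x \<in> {x. \<exists>F\<subseteq>P. card F = Suc i \<and> (\<forall>B\<in>F. x \<le> asymptotic_frequency B)}"
    then obtain F where F: "F \<subseteq> P" "card F = Suc i" "\<forall>B\<in>F. x \<le> asymptotic_frequency B" by auto
    then obtain B where "B \<in> F" by (metis all_not_in_conv card.empty nat.distinct(1))
    with F asymptotic_frequency_le[of B] show ?thesis by force
  qed simp
qed

text \<open>Families of blocks are replaced by families of representatives, of which there are only countably
  many.\<close>

lemma ranked_frequency_greater_iff:
  assumes P: "partition_on positive_nats P" and a: "0 \<le> a"
  shows "a < ranked_frequency P (Suc i) \<longleftrightarrow>
    (\<exists>J. finite J \<and> J \<subseteq> positive_nats \<and> card J = Suc i \<and> separated J P \<and> (\<forall>j\<in>J. a < freq P j))"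
proof -
  define A where "A = {x. \<exists>F\<subseteq>P. card F = Suc i \<and> (\<forall>B\<in>F. x \<le> asymptotic_frequency B)}"
  have bdd: "bdd_above (insert 0 A)" unfolding A_def by (rule ranked_frequency_bdd)
  have "a < ranked_frequency P (Suc i) \<longleftrightarrow> (\<exists>x\<in>insert 0 A. a < x)"
    unfolding ranked_frequency_def A_def[symmetric] by (rule less_cSup_iff[OF _ bdd]) simp
  also have "\<dots> \<longleftrightarrow> (\<exists>F\<subseteq>P. card F = Suc i \<and> (\<forall>B\<in>F. a < asymptotic_frequency B))"
  proof
    assume "\<exists>x\<in>insert 0 A. a < x"
    then obtain x where "x \<in> A" "a < x" using a by auto
    then show "\<exists>F\<subseteq>P. card F = Suc i \<and> (\<forall>B\<in>F. a < asymptotic_frequency B)" unfolding A_def by force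
  next
    assume "\<exists>F\<subseteq>P. card F = Suc i \<and> (\<forall>B\<in>F. a < asymptotic_frequency B)"
    then obtain F where F: "F \<subseteq> P" "card F = Suc i" "\<forall>B\<in>F. a < asymptotic_frequency B" by auto
    then have fin: "finite F" "F \<noteq> {}" by (metis card.infinite nat.distinct(1), metis card.empty nat.distinct(1))
    define x where "x = Min (asymptotic_frequency ` F)"
    have "x \<in> A" unfolding A_def x_def using F fin by (intro CollectI exI[of _ F]) auto
    moreover have "a < x" unfolding x_def using F fin by simp
    ultimately show "\<exists>x\<in>insert 0 A. a < x" by blast
  qed
  also have "\<dots> \<longleftrightarrow> (\<exists>J. finite J \<and> J \<subseteq> positive_nats \<and> card J = Suc i \<and> separated J P \<and> (\<forall>j\<in>J. a < freq P j))"
  proof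
    assume "\<exists>F\<subseteq>P. card F = Suc i \<and> (\<forall>B\<in>F. a < asymptotic_frequency B)"
    then obtain F where F: "F \<subseteq> P" "card F = Suc i" "\<forall>B\<in>F. a < asymptotic_frequency B" by auto
    have fin: "finite F" using F(2) by (metis card.infinite nat.distinct(1))
    have "\<exists>j. j \<in> B \<and> 1 \<le> j" if "B \<in> F" for B
    proof -
      have "B \<noteq> {}" "B \<subseteq> {1..}" using P F(1) that by (auto simp: partition_on_def)
      then show ?thesis by (auto simp: subset_iff)
    qed
    then obtain f where f: "\<And>B. B \<in> F \<Longrightarrow> f B \<in> B \<and> 1 \<le> f B" by metis
    have bl: "block_of P (f B) = B" if "B \<in> F" for B using block_of_eq[OF P, of B "f B"] f[OF that] F(1) that by auto
    have inj: "inj_on f F" by (rule inj_onI) (metis bl)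
    have "\<not> same_block P (f B) (f C)" if "B \<in> F" "C \<in> F" "f B \<noteq> f C" for B C
    proof
      assume "same_block P (f B) (f C)"
      then have "f C \<in> B" using bl[OF that(1)] by (auto simp: block_of_def)
      then have "block_of P (f C) = B" using block_of_eq[OF P] F(1) that(1) by blast
      then show False using bl[OF that(2)] that(3) by simp
    qed
    then show "\<exists>J. finite J \<and> J \<subseteq> positive_nats \<and> card J = Suc i \<and> separated J P \<and> (\<forall>j\<in>J. a < freq P j)"
      using F fin f bl card_image[OF inj] by (intro exI[of _ "f ` F"]) (auto simp: freq_def separated_def)
  next
    assume "\<exists>J. finite J \<and> J \<subseteq> positive_nats \<and> card J = Suc i \<and> separated J P \<and> (\<forall>j\<in>J. a < freq P j)"
    then obtain J where J: "finite J" "J \<subseteq> positive_nats" "card J = Suc i" "\<forall>j\<in>J. \<forall>k\<in>J. j \<noteq> k \<longrightarrow> \<not> same_block P j k" "\<forall>j\<in>J. a < freq P j"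
      unfolding separated_def by blast
    have inj: "inj_on (block_of P) J"
    proof (rule inj_onI)
      fix j k assume jk: "j \<in> J" "k \<in> J" "block_of P j = block_of P k"
      have "k \<in> block_of P k" using same_block_refl[OF P, of k] jk(2) J(2) by (auto simp: block_of_def)
      then have "same_block P j k" using jk(3) by (auto simp: block_of_def)
      then show "j = k" using J(4) jk by blast
    qed
    show "\<exists>F\<subseteq>P. card F = Suc i \<and> (\<forall>B\<in>F. a < asymptotic_frequency B)"
      using J card_image[OF inj] block_of_in[OF P] by (intro exI[of _ "block_of P ` J"]) (auto simp: freq_def)
  qed
  finally show ?thesis .
qed

lemma ranked_frequency_greater_negative:
  assumes a: "a < 0" shows "a < ranked_frequency P (Suc i)"
proof -
  define A where "A = {x. \<exists>F\<subseteq>P. card F = Suc i \<and> (\<forall>B\<in>F. x \<le> asymptotic_frequency B)}"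
  have "bdd_above (insert 0 A)" unfolding A_def by (rule ranked_frequency_bdd)
  then have "0 \<le> ranked_frequency P (Suc i)"
    unfolding ranked_frequency_def A_def[symmetric] by (intro cSup_upper) auto
  with a show ?thesis by simp
qed

lemma measurable_ranked_frequency[measurable]:
  "(\<lambda>P. ranked_frequency P (Suc i)) \<in> borel_measurable partition_algebra"
proof (rule borel_measurable_iff_greater[THEN iffD2], intro allI)
  fix a :: real
  show "{P \<in> space partition_algebra. a < ranked_frequency P (Suc i)} \<in> sets partition_algebra"
  proof (cases "0 \<le> a")
    case True
    define \<J> where "\<J> = {J. finite J \<and> J \<subseteq> positive_nats \<and> card J = Suc i}"
    have c: "countable \<J>"
      by (rule countable_subset[OF _ countable_Collect_finite]) (auto simp: \<J>_def)
    have "{P \<in> space partition_algebra. a < ranked_frequency P (Suc i)} =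
      (\<Union>J\<in>\<J>. {P \<in> space partition_algebra. separated J P \<and> (\<forall>j\<in>J. a < freq P j)})"
      using ranked_frequency_greater_iff[OF _ True] by (auto simp: space_partition_algebra \<J>_def)
    also have "\<dots> \<in> sets partition_algebra"
    proof (rule sets.countable_UN'[OF c], rule image_subsetI)
      fix J assume "J \<in> \<J>"
      then have [simp]: "finite J" by (auto simp: \<J>_def)
      show "{P \<in> space partition_algebra. separated J P \<and> (\<forall>j\<in>J. a < freq P j)} \<in> sets partition_algebra"
        unfolding separated_def by (intro sets.sets_Collect_conj sets.sets_Collect_finite_All) measurable
    qed
    finally show ?thesis .
  next
    case False
    then have "{P \<in> space partition_algebra. a < ranked_frequency P (Suc i)} = space partition_algebra"
      using ranked_frequency_greater_negative by (auto simp: space_partition_algebra)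
    then show ?thesis by simp
  qed
qed

context beta_fragmentation
begin

lemma measurable_W_beta: assumes "0 \<le> t" shows "W_beta \<beta> X t \<in> borel_measurable M"
proof -
  have "(\<lambda>P. exp (r * t) * (\<Sum>i. (ranked_frequency P (Suc i))\<^sup>2)) \<in> borel_measurable partition_algebra" by measurable
  from measurable_X[OF this assms] show ?thesis by (simp add: W_beta_def[abs_def])
qed

lemma AE_W_beta_eq: "0 \<le> t \<Longrightarrow> AE w in M. W_beta \<beta> X t w = martingale t w"
  using AE_regular_at[of t] by (auto elim!: eventually_mono simp: W_beta_eq_martingale)

lemma integrable_W_beta: assumes "0 \<le> t" shows "integrable M (W_beta \<beta> X t)"
  by (rule integrable_cong_AE[THEN iffD1, OF measurable_martingale[OF assms] measurable_W_beta[OF assms] _ integrable_martingale[OF assms]])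
    (use AE_W_beta_eq[OF assms] in \<open>auto elim!: eventually_mono\<close>)

lemma AE_W_beta_converges: "AE w in M. ((\<lambda>t. W_beta \<beta> X t w) \<longlongrightarrow> W_limit w) at_top"
  using AE_martingale_converges AE_regular
proof eventually_elim
  case (elim w)
  have "eventually (\<lambda>t. martingale t w = W_beta \<beta> X t w) at_top"
    using eventually_ge_at_top[of 0] by eventually_elim (use elim(2) W_beta_eq_martingale in auto)
  with elim(1) show ?case by (rule Lim_transform_eventually)
qed

lemma W_beta_L1: "((\<lambda>t. \<integral>w. \<bar>W_beta \<beta> X t w - W_limit w\<bar> \<partial>M) \<longlongrightarrow> 0) at_top"
proof (rule Lim_transform_eventually[OF martingale_L1])
  show "eventually (\<lambda>t. (\<integral>w. \<bar>martingale t w - W_limit w\<bar> \<partial>M) = (\<integral>w. \<bar>W_beta \<beta> X t w - W_limit w\<bar> \<partial>M)) at_top"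
    using eventually_ge_at_top[of 0]
  proof eventually_elim
    case (elim t)
    note [measurable] = measurable_martingale[OF elim] measurable_W_beta[OF elim]
    show ?case
      by (rule integral_cong_AE) (use AE_W_beta_eq[OF elim] in \<open>auto elim!: eventually_mono\<close>)
  qed
qed

end

section \<open>Separation of a sample\<close>

subsection \<open>Elementary inequalities\<close>

lemma ln_1_plus_bounds:
  fixes x :: real assumes "0 \<le> x"
  shows "x - x\<^sup>2 / 2 \<le> ln (1 + x)" "ln (1 + x) \<le> x - x\<^sup>2 / 2 + x ^ 3 / 3"
proof -
  have "ln (1 + 0) - (0 - 0\<^sup>2 / 2) \<le> ln (1 + x) - (x - x\<^sup>2 / 2)"
  proof (rule DERIV_nonneg_imp_nondecreasing[OF assms])
    fix y :: real assume y: "0 \<le> y" "y \<le> x"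
    have "((\<lambda>y. ln (1 + y) - (y - y\<^sup>2 / 2)) has_real_derivative (1 / (1 + y) - (1 - y))) (at y)"
      using y by (auto intro!: derivative_eq_intros)
    moreover have "0 \<le> 1 / (1 + y) - (1 - y)" using y by (simp add: field_simps)
    ultimately show "\<exists>d. ((\<lambda>y. ln (1 + y) - (y - y\<^sup>2 / 2)) has_real_derivative d) (at y) \<and> 0 \<le> d" by blast
  qed
  then show "x - x\<^sup>2 / 2 \<le> ln (1 + x)" by simp
  have "(0 - 0\<^sup>2 / 2 + 0 ^ 3 / 3) - ln (1 + 0) \<le> (x - x\<^sup>2 / 2 + x ^ 3 / 3) - ln (1 + x)"
  proof (rule DERIV_nonneg_imp_nondecreasing[OF assms])
    fix y :: real assume y: "0 \<le> y" "y \<le> x"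
    have "((\<lambda>y. (y - y\<^sup>2 / 2 + y ^ 3 / 3) - ln (1 + y)) has_real_derivative (1 - y + y\<^sup>2 - 1 / (1 + y))) (at y)"
      using y by (auto intro!: derivative_eq_intros simp: power2_eq_square)
    moreover have "1 - y + y\<^sup>2 - 1 / (1 + y) = y ^ 3 / (1 + y)"
      using y by (simp add: field_simps power2_eq_square power3_eq_cube)
    ultimately show "\<exists>d. ((\<lambda>y. (y - y\<^sup>2 / 2 + y ^ 3 / 3) - ln (1 + y)) has_real_derivative d) (at y) \<and> 0 \<le> d"
      using y by (intro exI[of _ "y ^ 3 / (1 + y)"]) simp
  qed
  then show "ln (1 + x) \<le> x - x\<^sup>2 / 2 + x ^ 3 / 3" by simp
qed

text \<open>\<open>(1 + x) * exp (- x)\<close> is the probability that a Poisson variable with mean \<open>x\<close> is at most 1. The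
  natural error is of order \<open>x ^ 3\<close>; the exponent \<open>5/2\<close> is the one whose sum over the blocks is
  \<open>power_moment (3/2)\<close> on average.\<close>

lemma poisson_factor_bounds:
  fixes x :: real assumes x: "0 \<le> x"
  shows "exp (- x\<^sup>2 / 2) \<le> (1 + x) * exp (- x)" "(1 + x) * exp (- x) \<le> 1"
    and "(1 + x) * exp (- x) - exp (- x\<^sup>2 / 2) \<le> x powr (5/2)"
proof -
  define u v where "u = (1 + x) * exp (- x)" and "v = exp (- x\<^sup>2 / 2)"
  have u: "u = exp (ln (1 + x) - x)" unfolding u_def using x by (simp add: exp_diff exp_minus field_simps)
  show 1: "exp (- x\<^sup>2 / 2) \<le> (1 + x) * exp (- x)"
    unfolding u_def[symmetric] u using ln_1_plus_bounds(1)[OF x] by simp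
  have "1 + x \<le> exp x" by (rule exp_ge_add_one_self)
  then show 2: "(1 + x) * exp (- x) \<le> 1" by (simp add: exp_minus field_simps)
  have "u - v \<le> x powr (5/2)"
  proof (cases "x \<le> 1")
    case True
    have "u * exp (- (x ^ 3) / 3) \<le> v"
      unfolding u v_def exp_add[symmetric] using ln_1_plus_bounds(2)[OF x] by simp
    then have "u - v \<le> u * (1 - exp (- (x ^ 3) / 3))" by (simp add: algebra_simps)
    also have "\<dots> \<le> 1 * (1 - exp (- (x ^ 3) / 3))" using 2 x by (intro mult_right_mono) (auto simp: u_def)
    also have "\<dots> \<le> x ^ 3"
    proof -
      define y where "y = x ^ 3"
      have "1 + - y / 3 \<le> exp (- y / 3)" by (rule exp_ge_add_one_self)
      moreover have "0 \<le> y" using x by (simp add: y_def)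
      ultimately have "1 * (1 - exp (- y / 3)) \<le> y" by simp
      then show ?thesis by (simp add: y_def)
    qed
    also have "x ^ 3 = x powr 3" using x by (cases "x = 0") (auto simp: powr_numeral)
    also have "\<dots> \<le> x powr (5/2)" using x True by (intro powr_mono') auto
    finally show ?thesis .
  next
    case False
    have "0 \<le> v" by (simp add: v_def)
    then have "u - v \<le> 1" using 2 unfolding u_def by linarith
    also have "1 \<le> x powr (5/2)" using False by (intro ge_one_powr_ge_zero) auto
    finally show ?thesis .
  qed
  then show "(1 + x) * exp (- x) - exp (- x\<^sup>2 / 2) \<le> x powr (5/2)" by (simp add: u_def v_def)
qed

text \<open>The variance of the Poisson distribution.\<close>

lemma poisson_variance_sums:
  fixes l :: real
  shows "(\<lambda>k. l ^ k / fact k * (real k - l)\<^sup>2) sums (l * exp l)"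
proof -
  have e: "(\<lambda>k. l ^ k / fact k) sums exp l"
    using exp_converges[of l] by (simp add: divide_inverse mult.commute)
  have fs: "fact (Suc k) = real (Suc k) * fact k" for k by simp
  have 1: "(\<lambda>k. l ^ k / fact k * real k) sums (l * exp l)"
  proof -
    have "(\<lambda>k. l ^ Suc k / fact (Suc k) * real (Suc k)) sums (l * exp l)"
    proof -
      have "l ^ Suc k / fact (Suc k) * real (Suc k) = l * (l ^ k / fact k)" for k
        unfolding fs by (simp del: of_nat_Suc fact_Suc)
      then show ?thesis using sums_mult[OF e, of l] by simp
    qed
    from sums_Suc[OF this] show ?thesis by simp
  qed
  have 2: "(\<lambda>k. l ^ k / fact k * (real k * (real k - 1))) sums (l\<^sup>2 * exp l)"
  proof -
    have "(\<lambda>k. l ^ Suc k / fact (Suc k) * (real (Suc k) * (real (Suc k) - 1))) sums (l * (l * exp l))"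
    proof -
      have "l ^ Suc k / fact (Suc k) * (real (Suc k) * (real (Suc k) - 1)) = l * (l ^ k / fact k * real k)" for k
      proof -
        have "real (Suc k) - 1 = real k" by simp
        then show ?thesis unfolding fs by (simp del: of_nat_Suc fact_Suc)
      qed
      then show ?thesis using sums_mult[OF 1, of l] by simp
    qed
    from sums_Suc[OF this] show ?thesis by (simp add: power2_eq_square mult.assoc)
  qed
  have "(\<lambda>k. l ^ k / fact k * (real k * (real k - 1)) + (1 - 2 * l) * (l ^ k / fact k * real k) + l\<^sup>2 * (l ^ k / fact k))
      sums (l\<^sup>2 * exp l + (1 - 2 * l) * (l * exp l) + l\<^sup>2 * exp l)"
    by (intro sums_add sums_mult 1 2 e)
  moreover have "l ^ k / fact k * (real k * (real k - 1)) + (1 - 2 * l) * (l ^ k / fact k * real k) + l\<^sup>2 * (l ^ k / fact k)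
      = l ^ k / fact k * (real k - l)\<^sup>2" for k
  proof -
    define c where "c = l ^ k / fact k"
    show ?thesis unfolding c_def[symmetric] by (simp add: power2_eq_square algebra_simps)
  qed
  moreover have "l\<^sup>2 * exp l + (1 - 2 * l) * (l * exp l) + l\<^sup>2 * exp l = l * exp l"
    by (simp add: power2_eq_square algebra_simps)
  ultimately show ?thesis by simp
qed

lemma binomial_le_power_div_fact: "real (N choose k) * (l / real N) ^ k \<le> l ^ k / fact k" if "0 \<le> l" "0 < N"
proof -
  have "real (N choose k) * fact k \<le> real N ^ k"
    using binomial_fact_pow[of N k] by (metis of_nat_fact of_nat_le_iff of_nat_mult of_nat_power)
  then have "real (N choose k) * fact k * l ^ k \<le> real N ^ k * l ^ k" using that by (intro mult_right_mono) auto
  then show ?thesis using that by (simp add: power_divide field_simps)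
qed

subsection \<open>Partial transversals\<close>

text \<open>Expanding the product means choosing at most one element of every block.\<close>

lemma prod_one_plus_card_eq_transversals:
  fixes c :: real
  assumes "finite \<eta>" "disjoint \<eta>" "\<And>B. B \<in> \<eta> \<Longrightarrow> finite B"
  shows "(\<Prod>B\<in>\<eta>. 1 + c * real (card B)) = (\<Sum>F\<in>{F. F \<subseteq> \<Union>\<eta> \<and> (\<forall>B\<in>\<eta>. card (F \<inter> B) \<le> 1)}. c ^ card F)"
  using assms
proof (induction \<eta> rule: finite_induct)
  case empty
  have "{F::'a set. F \<subseteq> \<Union>{} \<and> (\<forall>B\<in>{}. card (F \<inter> B) \<le> 1)} = {{}}" by auto
  then show ?case by simp
next
  case (insert B \<eta>)
  define T where "T = {F. F \<subseteq> \<Union>\<eta> \<and> (\<forall>B\<in>\<eta>. card (F \<inter> B) \<le> 1)}"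
  define S where "S = {G. G \<subseteq> B \<and> card G \<le> 1}"
  have finB: "finite B" and fin\<eta>: "\<And>A. A \<in> \<eta> \<Longrightarrow> finite A" using insert.prems(2) by auto
  have dj: "A \<inter> B = {}" if "A \<in> \<eta>" for A
    using insert.prems(1) insert.hyps(2) that unfolding disjoint_def by auto
  have d\<eta>: "disjoint \<eta>" using insert.prems(1) unfolding disjoint_def by auto
  have finU: "finite (\<Union>\<eta>)" using insert.hyps(1) fin\<eta> by auto
  have UB: "\<Union>\<eta> \<inter> B = {}" using dj by auto
  have S_eq: "S = insert {} ((\<lambda>x. {x}) ` B)"
  proof (intro set_eqI iffI)
    fix G assume "G \<in> S"
    then have G: "G \<subseteq> B" "card G \<le> 1" by (auto simp: S_def)
    have "finite G" using G(1) finB by (rule finite_subset)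
    then consider "G = {}" | "card G = 1" using G(2) by (cases "card G") auto
    then show "G \<in> insert {} ((\<lambda>x. {x}) ` B)"
    proof cases
      case 2
      then obtain x where "G = {x}" by (rule card_1_singletonE)
      then show ?thesis using G(1) by auto
    qed simp
  qed (auto simp: S_def)
  have Ssum: "(\<Sum>G\<in>S. c ^ card G) = 1 + c * real (card B)"
  proof -
    have "(\<Sum>G\<in>(\<lambda>x. {x}) ` B. c ^ card G) = (\<Sum>x\<in>B. c)" by (subst sum.reindex) (auto simp: inj_on_def)
    then show ?thesis unfolding S_eq using finB by (subst sum.insert) (auto simp: mult.commute)
  qed
  have "(\<Prod>A\<in>insert B \<eta>. 1 + c * real (card A)) = (1 + c * real (card B)) * (\<Sum>F\<in>T. c ^ card F)"
    using insert.IH[OF d\<eta>] fin\<eta> insert.hyps by (simp add: T_def)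
  also have "\<dots> = (\<Sum>(G, F)\<in>S \<times> T. c ^ card G * c ^ card F)"
    unfolding Ssum[symmetric] by (simp add: sum_product sum.cartesian_product)
  also have "\<dots> = (\<Sum>F\<in>{F. F \<subseteq> \<Union>(insert B \<eta>) \<and> (\<forall>A\<in>insert B \<eta>. card (F \<inter> A) \<le> 1)}. c ^ card F)"
  proof (rule sum.reindex_bij_witness[of _ "\<lambda>F. (F \<inter> B, F - B)" "\<lambda>(G, F). G \<union> F"])
    fix a assume "a \<in> S \<times> T"
    then obtain G F where a: "a = (G, F)" "G \<in> S" "F \<in> T" by auto
    then have GF: "G \<subseteq> B" "F \<subseteq> \<Union>\<eta>" "card G \<le> 1" "\<And>A. A \<in> \<eta> \<Longrightarrow> card (F \<inter> A) \<le> 1" by (auto simp: S_def T_def)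
    have e1: "(G \<union> F) \<inter> B = G" "(G \<union> F) - B = F" using GF(1,2) UB by blast+
    show "(case a of (G, F) \<Rightarrow> G \<union> F) \<in> {F. F \<subseteq> \<Union>(insert B \<eta>) \<and> (\<forall>A\<in>insert B \<eta>. card (F \<inter> A) \<le> 1)}"
    proof -
      have "(G \<union> F) \<inter> A = F \<inter> A" if "A \<in> \<eta>" for A using GF(1) dj[OF that] by blast
      then show ?thesis using GF a e1 by auto
    qed
    show "((case a of (G, F) \<Rightarrow> G \<union> F) \<inter> B, (case a of (G, F) \<Rightarrow> G \<union> F) - B) = a" using a e1 by simp
    have "G \<inter> F = {}" using GF UB by blast
    then have "card (G \<union> F) = card G + card F"
      using finite_subset[OF GF(1) finB] finite_subset[OF GF(2) finU] by (rule card_Un_disjoint[rotated 2])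
    then show "c ^ card (case a of (G, F) \<Rightarrow> G \<union> F) = (case a of (G, F) \<Rightarrow> c ^ card G * c ^ card F)"
      using a by (simp add: power_add)
  next
    fix F assume F: "F \<in> {F. F \<subseteq> \<Union>(insert B \<eta>) \<and> (\<forall>A\<in>insert B \<eta>. card (F \<inter> A) \<le> 1)}"
    have "(F - B) \<inter> A = F \<inter> A" if "A \<in> \<eta>" for A using dj[OF that] by blast
    then show "(F \<inter> B, F - B) \<in> S \<times> T" using F by (auto simp: S_def T_def)
    show "(case (F \<inter> B, F - B) of (G, F) \<Rightarrow> G \<union> F) = F" by auto
  qed
  finally show ?case .
qed

lemma prod_blocks_eq_separated:
  fixes c :: real
  assumes P: "partition_on positive_nats P"
  shows "(\<Prod>B\<in>restrict_partition P {1..N}. 1 + c * real (card B)) = (\<Sum>F\<in>Pow {1..N}. c ^ card F * (if separated F P then 1 else 0))"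
proof -
  define \<eta> where "\<eta> = restrict_partition P {1..N}"
  have p: "partition_on {1..N} \<eta>" unfolding \<eta>_def by (rule partition_on_restrict_partition[OF P]) auto
  have fin: "finite \<eta>" "\<And>B. B \<in> \<eta> \<Longrightarrow> finite B"
    using p by (auto simp: partition_on_def intro: finite_UnionD) (metis Union_upper finite_atLeastAtMost finite_subset)
  have U: "\<Union>\<eta> = {1..N}" using p by (simp add: partition_on_def)
  have "{F. F \<subseteq> \<Union>\<eta> \<and> (\<forall>B\<in>\<eta>. card (F \<inter> B) \<le> 1)} = {F\<in>Pow {1..N}. separated F P}"
  proof (intro set_eqI iffI)
    fix F assume "F \<in> {F. F \<subseteq> \<Union>\<eta> \<and> (\<forall>B\<in>\<eta>. card (F \<inter> B) \<le> 1)}"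
    then have F: "F \<subseteq> {1..N}" "\<And>B. B \<in> \<eta> \<Longrightarrow> card (F \<inter> B) \<le> 1" using U by auto
    have "\<not> same_block P i j" if ij: "i \<in> F" "j \<in> F" "i \<noteq> j" for i j
    proof
      assume "same_block P i j"
      then have "same_block \<eta> i j" unfolding \<eta>_def same_block_restrict using F(1) ij by auto
      then obtain B where B: "B \<in> \<eta>" "i \<in> B" "j \<in> B" unfolding same_block_def by auto
      have "card {i, j} \<le> card (F \<inter> B)" using ij B fin(2)[OF B(1)] by (intro card_mono) auto
      then show False using F(2)[OF B(1)] ij(3) by simp
    qed
    then show "F \<in> {F\<in>Pow {1..N}. separated F P}" using F(1) by (auto simp: separated_def)
  next
    fix F assume "F \<in> {F\<in>Pow {1..N}. separated F P}"
    then have F: "F \<subseteq> {1..N}" "separated F P" by auto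
    have "card (F \<inter> B) \<le> 1" if B: "B \<in> \<eta>" for B
    proof (rule ccontr)
      assume "\<not> card (F \<inter> B) \<le> 1"
      then obtain i j where ij: "i \<in> F \<inter> B" "j \<in> F \<inter> B" "i \<noteq> j"
        by (metis card_le_Suc0_iff_eq One_nat_def card.infinite le0)
      then have "same_block \<eta> i j" using B unfolding same_block_def by auto
      then have "same_block P i j" by (simp add: \<eta>_def same_block_restrict)
      then show False using F(2) ij by (auto simp: separated_def)
    qed
    then show "F \<in> {F. F \<subseteq> \<Union>\<eta> \<and> (\<forall>B\<in>\<eta>. card (F \<inter> B) \<le> 1)}" using F(1) U by auto
  qed
  then have "(\<Prod>B\<in>\<eta>. 1 + c * real (card B)) = (\<Sum>F\<in>{F\<in>Pow {1..N}. separated F P}. c ^ card F)"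
    using prod_one_plus_card_eq_transversals[OF fin(1) partition_onD2[OF p] fin(2)] by simp
  also have "\<dots> = (\<Sum>F\<in>Pow {1..N}. if separated F P then c ^ card F else 0)"
    by (rule sum.inter_filter) simp
  also have "\<dots> = (\<Sum>F\<in>Pow {1..N}. c ^ card F * (if separated F P then 1 else 0))"
    by (intro sum.cong) auto
  finally show ?thesis unfolding \<eta>_def .
qed

lemma sum_blocks_eq_emp_mean:
  fixes \<phi> :: "real \<Rightarrow> real"
  assumes P: "partition_on positive_nats P"
  shows "(\<Sum>B\<in>restrict_partition P {1..N}. (real (card B) / real N) * \<phi> (real (card B) / real N)) = (\<Sum>i=1..N. \<phi> (emp_freq P i N)) / real N"
proof -
  define \<eta> where "\<eta> = restrict_partition P {1..N}"
  have p: "partition_on {1..N} \<eta>" unfolding \<eta>_def by (rule partition_on_restrict_partition[OF P]) auto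
  have fin: "\<And>B. B \<in> \<eta> \<Longrightarrow> finite B"
    using p by (auto simp: partition_on_def) (metis Union_upper finite_atLeastAtMost finite_subset)
  have U: "\<Union>\<eta> = {1..N}" using p by (simp add: partition_on_def)
  have ef: "emp_freq P i N = real (card B) / real N" if B: "B \<in> \<eta>" "i \<in> B" for B i
  proof -
    have "block_of \<eta> i = B" by (rule block_of_eq[OF p B])
    moreover have "block_of \<eta> i = block_of P i \<inter> {1..N}"
      using U B by (auto simp: block_of_def \<eta>_def same_block_restrict)
    ultimately show ?thesis by (simp add: emp_freq_def block_count_def)
  qed
  have "(\<Sum>i=1..N. \<phi> (emp_freq P i N)) = (\<Sum>B\<in>\<eta>. \<Sum>i\<in>B. \<phi> (emp_freq P i N))"
    unfolding U[symmetric] using fin partition_onD2[OF p] by (subst sum.Union_disjoint) (auto simp: disjoint_def)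
  also have "\<dots> = (\<Sum>B\<in>\<eta>. real (card B) * \<phi> (real (card B) / real N))"
    using ef by (intro sum.cong refl) (simp cong: sum.cong)
  finally show ?thesis unfolding \<eta>_def by (simp add: sum_divide_distrib)
qed

text \<open>The product \<open>p\<close> is the probability that independent Poisson numbers of points in the blocks, with
  means proportional to the sizes and adding up to \<open>l\<close>, are all at most 1. Its factors are compared
  with \<open>exp (- x\<^sup>2 / 2)\<close> one by one.\<close>

lemma poissonized_block_product_bounds:
  assumes P: "partition_on positive_nats P" and l: "0 \<le> l" and N: "1 \<le> N"
  defines "p \<equiv> exp (- l) * (\<Prod>B\<in>restrict_partition P {1..N}. 1 + (l / real N) * real (card B))"
  shows "exp (- (l\<^sup>2 * emp_mean 1 P N) / 2) \<le> p"
    and "p \<le> exp (- (l\<^sup>2 * emp_mean 1 P N) / 2) + l powr (5/2) * emp_mean (3/2) P N"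
proof -
  define \<eta> where "\<eta> = restrict_partition P {1..N}"
  have part: "partition_on {1..N} \<eta>" unfolding \<eta>_def by (rule partition_on_restrict_partition[OF P]) auto
  have fin: "finite \<eta>" using part by (auto simp: partition_on_def intro: finite_UnionD)
  define x where "x = (\<lambda>B :: nat set. l * (real (card B) / real N))"
  have x0: "0 \<le> x B" for B unfolding x_def using l by simp
  have s1: "(\<Sum>B\<in>\<eta>. x B) = l"
    using sum_blocks_eq_emp_mean[OF P, of N "\<lambda>_. 1"] N unfolding \<eta>_def
    by (simp only: x_def sum_distrib_left[symmetric]) simp
  have s2: "(\<Sum>B\<in>\<eta>. (x B)\<^sup>2) = l\<^sup>2 * emp_mean 1 P N"
  proof -
    have "(\<Sum>B\<in>\<eta>. (x B)\<^sup>2) = l\<^sup>2 * (\<Sum>B\<in>\<eta>. (real (card B) / real N) * (real (card B) / real N))"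
      unfolding x_def by (simp add: power2_eq_square sum_distrib_left mult_ac)
    also have "(\<Sum>B\<in>\<eta>. (real (card B) / real N) * (real (card B) / real N)) = emp_mean 1 P N"
      using sum_blocks_eq_emp_mean[OF P, of N "\<lambda>x. x"] unfolding \<eta>_def emp_mean_def powr_one[OF emp_freq_bounds(1)] by simp
    finally show ?thesis .
  qed
  have s3: "(\<Sum>B\<in>\<eta>. x B powr (5/2)) = l powr (5/2) * emp_mean (3/2) P N"
  proof -
    have "x B powr (5/2) = l powr (5/2) * ((real (card B) / real N) * (real (card B) / real N) powr (3/2))" for B
    proof -
      define q where "q = real (card B) / real N"
      have q: "0 \<le> q" unfolding q_def by simp
      have "q powr (5/2) = q * q powr (3/2)"
        using powr_add[of q 1 "3/2"] q by (cases "q = 0") auto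
      then show ?thesis unfolding x_def q_def[symmetric] using l q by (simp add: powr_mult)
    qed
    then have "(\<Sum>B\<in>\<eta>. x B powr (5/2)) = l powr (5/2) * (\<Sum>B\<in>\<eta>. (real (card B) / real N) * (real (card B) / real N) powr (3/2))"
      by (simp add: sum_distrib_left)
    then show ?thesis using sum_blocks_eq_emp_mean[OF P, of N "\<lambda>x. x powr (3/2)"] unfolding \<eta>_def emp_mean_def by simp
  qed
  have p_eq: "p = (\<Prod>B\<in>\<eta>. (1 + x B) * exp (- x B))"
  proof -
    have "(\<Prod>B\<in>\<eta>. exp (- x B)) = exp (- l)" using s1 fin by (simp add: exp_sum[symmetric] sum_negf)
    then show ?thesis unfolding p_def \<eta>_def[symmetric] x_def by (simp add: prod.distrib mult.commute)
  qed
  have v_eq: "(\<Prod>B\<in>\<eta>. exp (- (x B)\<^sup>2 / 2)) = exp (- (l\<^sup>2 * emp_mean 1 P N) / 2)"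
    unfolding s2[symmetric] using fin by (simp add: exp_sum[symmetric] sum_negf sum_divide_distrib)
  show "exp (- (l\<^sup>2 * emp_mean 1 P N) / 2) \<le> p"
    unfolding p_eq v_eq[symmetric] using poisson_factor_bounds(1)[OF x0] by (intro prod_mono) auto
  have "\<bar>p - exp (- (l\<^sup>2 * emp_mean 1 P N) / 2)\<bar> \<le> (\<Sum>B\<in>\<eta>. \<bar>(1 + x B) * exp (- x B) - exp (- (x B)\<^sup>2 / 2)\<bar>)"
    unfolding p_eq v_eq[symmetric]
    using norm_prod_diff[of \<eta> "\<lambda>B. (1 + x B) * exp (- x B)" "\<lambda>B. exp (- (x B)\<^sup>2 / 2)"] x0 poisson_factor_bounds(2)
    by (simp add: abs_mult abs_of_nonneg add_nonneg_nonneg)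
  also have "\<dots> \<le> (\<Sum>B\<in>\<eta>. x B powr (5/2))"
    using x0 poisson_factor_bounds(1,3) by (intro sum_mono) (simp add: abs_of_nonneg)
  finally show "p \<le> exp (- (l\<^sup>2 * emp_mean 1 P N) / 2) + l powr (5/2) * emp_mean (3/2) P N"
    unfolding s3 by linarith
qed

section \<open>The limit law of the separation probability\<close>

context homogeneous_fragmentation
begin

definition separation_prob :: "nat \<Rightarrow> real \<Rightarrow> real"
  where "separation_prob n t = prob {w\<in>space M. separated {1..n} (X t w)}"

lemma pred_separated[measurable]: "finite F \<Longrightarrow> Measurable.pred partition_algebra (separated F)"
  unfolding separated_def[abs_def] by (intro pred_intros_finite) measurable

lemma sets_separated: assumes "finite F" "0 \<le> t" shows "{w\<in>space M. separated F (X t w)} \<in> sets M"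
  using measurable_sets[OF measurable_X[OF pred_separated[OF assms(1)] assms(2)], of "{True}"]
  by (simp add: vimage_def Int_def conj_commute)

lemma separation_prob_bounds: "0 \<le> separation_prob n t" "separation_prob n t \<le> 1"
  unfolding separation_prob_def by auto

lemma separation_prob_antimono:
  assumes "m \<le> n" "0 \<le> t" shows "separation_prob n t \<le> separation_prob m t"
  unfolding separation_prob_def
  by (rule finite_measure_mono) (use assms sets_separated in \<open>auto simp: separated_def\<close>)

lemma separation_prob_mono_time:
  assumes "0 \<le> s" "s \<le> t" shows "separation_prob n s \<le> separation_prob n t"
  unfolding separation_prob_def
proof (rule finite_measure_mono_AE)
  show "AE w in M. w \<in> {w\<in>space M. separated {1..n} (X s w)} \<longrightarrow> w \<in> {w\<in>space M. separated {1..n} (X t w)}"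
    using AE_refines[OF assms] by eventually_elim (auto simp: separated_def)
qed (use assms sets_separated in auto)

lemma prob_separated:
  assumes t: "0 \<le> t" and F: "finite F" "F \<subseteq> positive_nats"
  shows "prob {w\<in>space M. separated F (X t w)} = separation_prob (card F) t"
proof -
  obtain f where f: "bij_betw f {1..card F} F" using ex_bij_betw_nat_finite_1[OF F(1)] by blast
  define n where "n = Max (insert (card F) F)"
  have "\<exists>\<sigma>. \<sigma> permutes {1..n} \<and> (\<forall>k\<in>{1..card F}. \<sigma> k = f k)"
  proof (rule ex_permutes_extending)
    show "{1..card F} \<subseteq> {1..n}" unfolding n_def using F(1) by auto
    have "F \<subseteq> {1..n}" unfolding n_def using F by (auto intro: Max_ge)
    then show "f ` {1..card F} \<subseteq> {1..n}" using f by (simp add: bij_betw_def)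
  qed (use f in \<open>auto simp: bij_betw_def\<close>)
  then obtain \<sigma> where \<sigma>: "\<sigma> permutes {1..n}" "\<And>k. k \<in> {1..card F} \<Longrightarrow> \<sigma> k = f k" by auto
  have img: "\<sigma> ` {1..card F} = F" using f \<sigma>(2) by (auto simp: bij_betw_def)
  have eq: "separated F (permute_partition \<sigma> P) \<longleftrightarrow> separated {1..card F} P" for P
  proof -
    have inj: "\<sigma> i = \<sigma> j \<longleftrightarrow> i = j" for i j using permutes_inj[OF \<sigma>(1)] by (auto simp: inj_def)
    have "separated (\<sigma> ` K) (permute_partition \<sigma> P) \<longleftrightarrow> separated K P" for K
      unfolding separated_def by (simp add: inj same_block_permute[OF permutes_bij[OF \<sigma>(1)]])
    from this[of "{1..card F}"] show ?thesis unfolding img .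
  qed
  have e: "prob {w\<in>space M. separated G (X t w)} = (\<integral>w. (if separated G (X t w) then 1 else 0) \<partial>M)" for G
  proof -
    have "(\<integral>w. (if separated G (X t w) then 1 else 0) \<partial>M) = (\<integral>w. indicat_real {w\<in>space M. separated G (X t w)} w \<partial>M)"
      by (intro Bochner_Integration.integral_cong refl) (auto simp: indicator_def)
    then show ?thesis unfolding expectation_indicator by simp
  qed
  have "(\<lambda>P. if separated F P then 1 else (0::real)) \<in> borel_measurable partition_algebra"
    using pred_separated[OF F(1)] by measurable
  from exchangeable_time[OF \<sigma>(1) this t] show ?thesis
    unfolding separation_prob_def e eq by simp
qed

text \<open>The sets obtained by expanding the product are the separated samples, and by exchangeability only
  the size of a sample matters.\<close>

lemma expectation_block_product:
  assumes t: "0 \<le> t"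
  shows "(\<integral>w. (\<Prod>B\<in>restr N t w. 1 + c * real (card B)) \<partial>M) =
      (\<Sum>k\<le>N. real (N choose k) * (c ^ k * separation_prob k t))"
    and "integrable M (\<lambda>w. \<Prod>B\<in>restr N t w. 1 + c * real (card B))"
proof -
  have ind: "integrable M (\<lambda>w. if separated F (X t w) then 1 else (0::real))"
    and ex: "(\<integral>w. (if separated F (X t w) then 1 else (0::real)) \<partial>M) = separation_prob (card F) t"
    if F: "F \<in> Pow {1..N}" for F
  proof -
    have fin: "finite F" "F \<subseteq> positive_nats" using F by (auto intro: finite_subset)
    have eq: "(if separated F (X t w) then 1 else (0::real)) = indicator {w\<in>space M. separated F (X t w)} w" if "w \<in> space M" for w
      using that by (simp add: indicator_def)
    have "integrable M (indicat_real {w\<in>space M. separated F (X t w)})"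
      using sets_separated[OF fin(1) t] by (simp add: emeasure_eq_measure)
    then show "integrable M (\<lambda>w. if separated F (X t w) then 1 else (0::real))"
      by (rule Bochner_Integration.integrable_cong[THEN iffD2, rotated 2, OF _ refl eq])
    have "(\<integral>w. (if separated F (X t w) then 1 else (0::real)) \<partial>M) = (\<integral>w. indicat_real {w\<in>space M. separated F (X t w)} w \<partial>M)"
      by (intro Bochner_Integration.integral_cong refl eq)
    then show "(\<integral>w. (if separated F (X t w) then 1 else (0::real)) \<partial>M) = separation_prob (card F) t"
      unfolding expectation_indicator prob_separated[OF t fin] .
  qed
  have pe: "(\<Prod>B\<in>restr N t w. 1 + c * real (card B)) = (\<Sum>F\<in>Pow {1..N}. c ^ card F * (if separated F (X t w) then 1 else 0))"
    if "w \<in> space M" for w by (rule prod_blocks_eq_separated[OF partition_X[OF that t]])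
  have int: "integrable M (\<lambda>w. \<Sum>F\<in>Pow {1..N}. c ^ card F * (if separated F (X t w) then 1 else 0))"
    by (intro Bochner_Integration.integrable_sum integrable_mult_right ind)
  show "integrable M (\<lambda>w. \<Prod>B\<in>restr N t w. 1 + c * real (card B))"
    using int by (rule Bochner_Integration.integrable_cong[THEN iffD2, rotated 2, OF _ refl pe])
  have "(\<integral>w. (\<Prod>B\<in>restr N t w. 1 + c * real (card B)) \<partial>M) =
      (\<integral>w. (\<Sum>F\<in>Pow {1..N}. c ^ card F * (if separated F (X t w) then 1 else 0)) \<partial>M)"
    by (intro Bochner_Integration.integral_cong refl pe)
  also have "\<dots> = (\<Sum>F\<in>Pow {1..N}. \<integral>w. c ^ card F * (if separated F (X t w) then 1 else 0) \<partial>M)"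
    by (intro Bochner_Integration.integral_sum integrable_mult_right ind)
  also have "\<dots> = (\<Sum>F\<in>Pow {1..N}. c ^ card F * separation_prob (card F) t)"
    by (intro sum.cong refl) (simp add: ex del: Pow_iff)
  also have "\<dots> = (\<Sum>k\<le>N. real (N choose k) * (c ^ k * separation_prob k t))"
    using sum_Pow_by_card[of "{1..N}" "\<lambda>k. c ^ k * separation_prob k t"] by simp
  finally show "(\<integral>w. (\<Prod>B\<in>restr N t w. 1 + c * real (card B)) \<partial>M) =
      (\<Sum>k\<le>N. real (N choose k) * (c ^ k * separation_prob k t))" .
qed

end

context beta_fragmentation
begin

lemma emp_mean_power_moment:
  assumes t: "0 \<le> t" shows "(\<lambda>N. \<integral>w. emp_mean (3/2) (X t w) N \<partial>M) \<longlonglongrightarrow> power_moment (3/2) t"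
proof -
  have int: "integrable M (\<lambda>w. emp_mean (3/2) (X t w) N)" for N
    unfolding emp_mean_def by (intro integrable_divide Bochner_Integration.integrable_sum integrable_emp_powr t) simp
  note im = integrable_mass_moment[OF t, of "3/2", simplified]
  have L: "(\<lambda>N. \<integral>w. \<bar>emp_mean (3/2) (X t w) N - mass_moment (3/2) (X t w)\<bar> \<partial>M) \<longlonglongrightarrow> 0"
    by (rule emp_mean_L1[OF t]) simp
  have "norm ((\<integral>w. emp_mean (3/2) (X t w) N \<partial>M) - power_moment (3/2) t) \<le> (\<integral>w. \<bar>emp_mean (3/2) (X t w) N - mass_moment (3/2) (X t w)\<bar> \<partial>M)" for N
  proof -
    have "(\<integral>w. emp_mean (3/2) (X t w) N \<partial>M) - power_moment (3/2) t = (\<integral>w. emp_mean (3/2) (X t w) N - mass_moment (3/2) (X t w) \<partial>M)"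
      using int im expectation_mass_moment[OF t, of "3/2"] by simp
    then show ?thesis by (simp add: integral_abs_bound)
  qed
  then have "(\<lambda>N. (\<integral>w. emp_mean (3/2) (X t w) N \<partial>M) - power_moment (3/2) t) \<longlonglongrightarrow> 0"
    by (intro Lim_null_comparison[OF _ L]) auto
  then show ?thesis by (simp add: LIM_zero_iff)
qed

lemma exp_emp_mean_converges:
  assumes t: "0 \<le> t" and a: "0 \<le> a"
  shows "(\<lambda>N. \<integral>w. exp (- a * emp_mean 1 (X t w) N) \<partial>M) \<longlonglongrightarrow> (\<integral>w. exp (- a * pair_density t w) \<partial>M)"
    and "integrable M (\<lambda>w. exp (- a * emp_mean 1 (X t w) N))"
    and "integrable M (\<lambda>w. exp (- a * pair_density t w))"
proof -
  have e0: "0 \<le> emp_mean 1 P N" for P N unfolding emp_mean_def by (intro divide_nonneg_nonneg sum_nonneg) auto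
  have em[measurable]: "(\<lambda>w. emp_mean 1 (X t w) N) \<in> borel_measurable M" for N using t by measurable
  note [measurable] = measurable_pair_density[OF t]
  have int: "integrable M (\<lambda>w. emp_mean 1 (X t w) N)" for N
    unfolding emp_mean_def by (intro integrable_divide Bochner_Integration.integrable_sum integrable_emp_powr t) simp
  show i1: "integrable M (\<lambda>w. exp (- a * emp_mean 1 (X t w) N))" for N
    by (rule integrable_const_bound[where B=1]) (use a e0 in auto)
  show i2: "integrable M (\<lambda>w. exp (- a * pair_density t w))"
  proof (rule integrable_const_bound[where B=1])
    show "AE w in M. norm (exp (- a * pair_density t w)) \<le> 1"
      using AE_pair_density_bounds[OF t] by eventually_elim (use a in simp)
  qed measurable
  define R where "R = (\<lambda>N. \<integral>w. \<bar>emp_mean 1 (X t w) N - mass_moment 1 (X t w)\<bar> \<partial>M)"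
  have Rl: "R \<longlonglongrightarrow> 0" unfolding R_def by (rule emp_mean_L1[OF t]) simp
  have lip: "\<bar>exp (- x) - exp (- y)\<bar> \<le> \<bar>x - y\<bar>" if "0 \<le> x" "0 \<le> y" for x y :: real
  proof -
    have *: "exp (- u) - exp (- v) \<le> v - u" if "0 \<le> u" "u \<le> v" for u v :: real
    proof -
      have "exp (- u) - exp (- v) = exp (- u) * (1 - exp (- (v - u)))" by (simp add: algebra_simps flip: exp_add)
      also have "\<dots> \<le> 1 * (v - u)"
        using that exp_ge_add_one_self[of "- (v - u)"] by (intro mult_mono) (auto simp del: minus_diff_eq)
      finally show ?thesis by simp
    qed
    show ?thesis
    proof (cases "x \<le> y")
      case True
      then show ?thesis using *[of x y] that by simp
    next
      case False
      then show ?thesis using *[of y x] that by simp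
    qed
  qed
  have bound: "norm ((\<integral>w. exp (- a * emp_mean 1 (X t w) N) \<partial>M) - (\<integral>w. exp (- a * pair_density t w) \<partial>M)) \<le> a * R N" for N
  proof -
    have "(\<integral>w. exp (- a * emp_mean 1 (X t w) N) \<partial>M) - (\<integral>w. exp (- a * pair_density t w) \<partial>M) =
        (\<integral>w. exp (- a * emp_mean 1 (X t w) N) - exp (- a * pair_density t w) \<partial>M)"
      using i1 i2 by simp
    also have "norm \<dots> \<le> (\<integral>w. norm (exp (- a * emp_mean 1 (X t w) N) - exp (- a * pair_density t w)) \<partial>M)"
      by (rule integral_norm_bound)
    also have "\<dots> \<le> (\<integral>w. a * \<bar>emp_mean 1 (X t w) N - mass_moment 1 (X t w)\<bar> \<partial>M)"
    proof (rule integral_mono_AE)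
      show "AE w in M. norm (exp (- a * emp_mean 1 (X t w) N) - exp (- a * pair_density t w)) \<le> a * \<bar>emp_mean 1 (X t w) N - mass_moment 1 (X t w)\<bar>"
        using AE_pair_density_bounds[OF t]
      proof eventually_elim
        case (elim w)
        have "\<bar>exp (- (a * emp_mean 1 (X t w) N)) - exp (- (a * pair_density t w))\<bar> \<le> \<bar>a * emp_mean 1 (X t w) N - a * pair_density t w\<bar>"
          by (rule lip) (use a e0 elim in auto)
        also have "\<dots> = a * \<bar>emp_mean 1 (X t w) N - pair_density t w\<bar>"
          using a by (simp add: abs_mult flip: right_diff_distrib)
        finally show ?case by (simp add: pair_density_def)
      qed
    qed (use i1 i2 int integrable_mass_moment[OF t] in auto)
    also have "\<dots> = a * R N" unfolding R_def using int integrable_mass_moment[OF t] by simp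
    finally show ?thesis .
  qed
  have aR: "(\<lambda>N. a * R N) \<longlonglongrightarrow> 0" using tendsto_mult[OF tendsto_const[of a] Rl] by simp
  have "(\<lambda>N. (\<integral>w. exp (- a * emp_mean 1 (X t w) N) \<partial>M) - (\<integral>w. exp (- a * pair_density t w) \<partial>M)) \<longlonglongrightarrow> 0"
    by (rule Lim_null_comparison[OF _ aR]) (simp only: bound eventually_True)
  then show "(\<lambda>N. \<integral>w. exp (- a * emp_mean 1 (X t w) N) \<partial>M) \<longlonglongrightarrow> (\<integral>w. exp (- a * pair_density t w) \<partial>M)"
    by (simp add: LIM_zero_iff)
qed

text \<open>For \<open>N\<close> tending to infinity this becomes the separation probability of a sample whose size is
  Poisson with mean \<open>l\<close>.\<close>

definition poissonized :: "real \<Rightarrow> real \<Rightarrow> nat \<Rightarrow> real"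
  where "poissonized l t N = exp (- l) * (\<Sum>k\<le>N. real (N choose k) * ((l / real N) ^ k * separation_prob k t))"

lemma poissonized_bounds:
  assumes t: "0 \<le> t" and l: "0 \<le> l" and N: "1 \<le> N"
  shows "(\<integral>w. exp (- (l\<^sup>2 / 2) * emp_mean 1 (X t w) N) \<partial>M) \<le> poissonized l t N"
    and "poissonized l t N \<le> (\<integral>w. exp (- (l\<^sup>2 / 2) * emp_mean 1 (X t w) N) \<partial>M) + l powr (5/2) * (\<integral>w. emp_mean (3/2) (X t w) N \<partial>M)"
proof -
  define p where "p = (\<lambda>w. exp (- l) * (\<Prod>B\<in>restr N t w. 1 + (l / real N) * real (card B)))"
  have ip: "integrable M p" unfolding p_def using expectation_block_product(2)[OF t, where c="l / real N" and N=N] by simp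
  have Ep: "(\<integral>w. p w \<partial>M) = poissonized l t N"
    unfolding p_def poissonized_def using expectation_block_product[OF t, where N=N and c="l / real N"] by simp
  have l2: "0 \<le> l\<^sup>2 / 2" by simp
  note i1 = exp_emp_mean_converges(2)[OF t l2, of N]
  have i2: "integrable M (\<lambda>w. emp_mean (3/2) (X t w) N)"
    unfolding emp_mean_def by (intro integrable_divide Bochner_Integration.integrable_sum integrable_emp_powr t) simp
  show "(\<integral>w. exp (- (l\<^sup>2 / 2) * emp_mean 1 (X t w) N) \<partial>M) \<le> poissonized l t N"
    unfolding Ep[symmetric]
    by (rule integral_mono[OF i1 ip]) (use poissonized_block_product_bounds(1)[OF partition_X[OF _ t] l N] in \<open>simp add: p_def\<close>)
  have "(\<integral>w. p w \<partial>M) \<le> (\<integral>w. exp (- (l\<^sup>2 / 2) * emp_mean 1 (X t w) N) + l powr (5/2) * emp_mean (3/2) (X t w) N \<partial>M)"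
    by (rule integral_mono[OF ip])
      (use i1 i2 poissonized_block_product_bounds(2)[OF partition_X[OF _ t] l N] in \<open>auto simp: p_def\<close>)
  then show "poissonized l t N \<le> (\<integral>w. exp (- (l\<^sup>2 / 2) * emp_mean 1 (X t w) N) \<partial>M) + l powr (5/2) * (\<integral>w. emp_mean (3/2) (X t w) N \<partial>M)"
    unfolding Ep using i1 i2 by simp
qed

lemma poisson_partial_variance:
  fixes l :: real
  assumes l: "0 \<le> l" shows "exp (- l) * (\<Sum>k\<le>N. l ^ k / fact k * (real k - l)\<^sup>2) \<le> l"
proof -
  have "(\<Sum>k\<le>N. l ^ k / fact k * (real k - l)\<^sup>2) \<le> l * exp l"
    using sum_le_suminf[OF sums_summable[OF poisson_variance_sums[of l]], of "{..N}"] sums_unique[OF poisson_variance_sums[of l]] l by simp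
  then have "exp (- l) * (\<Sum>k\<le>N. l ^ k / fact k * (real k - l)\<^sup>2) \<le> exp (- l) * (l * exp l)" by (intro mult_left_mono) auto
  also have "\<dots> = l" by (simp add: exp_minus)
  finally show ?thesis .
qed

lemma poisson_partial_mass:
  fixes l :: real
  assumes l: "0 \<le> l" shows "exp (- l) * (\<Sum>k\<le>N. l ^ k / fact k) \<le> 1"
proof -
  have "(\<lambda>k. l ^ k / fact k) sums exp l"
    using exp_converges[of l] by (simp add: divide_inverse mult.commute)
  note e = this[THEN sums_summable] this[THEN sums_unique]
  have "(\<Sum>k\<le>N. l ^ k / fact k) \<le> exp l"
    using sum_le_suminf[OF e(1), of "{..N}"] e(2) l by simp
  then have "exp (- l) * (\<Sum>k\<le>N. l ^ k / fact k) \<le> exp (- l) * exp l" by (intro mult_left_mono) auto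
  then show ?thesis by (simp add: exp_minus)
qed

text \<open>Replacing the sample size \<open>n\<close> by a Poisson variable of mean \<open>l\<close> slightly above or below \<open>n\<close>: the
  separation probability is monotone in the sample size, and Chebyshev bounds the wrong side.\<close>

lemma separation_prob_lower:
  assumes t: "0 \<le> t" and l: "0 \<le> l" and d: "0 < d" "real n + d \<le> l"
  shows "(\<integral>w. exp (- (l\<^sup>2 / 2) * pair_density t w) \<partial>M) \<le> separation_prob n t + l / d\<^sup>2"
proof -
  define a where "a = separation_prob n t"
  have l2: "0 \<le> l\<^sup>2 / 2" by simp
  have ak: "separation_prob k t \<le> a + (real k - l)\<^sup>2 / d\<^sup>2" for k
  proof (cases "n \<le> k")
    case True
    have "separation_prob k t \<le> a" unfolding a_def by (rule separation_prob_antimono[OF True t])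
    moreover have "0 \<le> (real k - l)\<^sup>2 / d\<^sup>2" by simp
    ultimately show ?thesis by linarith
  next
    case False
    then have "d \<le> l - real k" using d by simp
    then have "d\<^sup>2 \<le> (l - real k)\<^sup>2" using d by (intro power_mono) auto
    then have "1 \<le> (real k - l)\<^sup>2 / d\<^sup>2" using d by (simp add: power2_commute)
    then show ?thesis using separation_prob_bounds[of k t] separation_prob_bounds[of n t] unfolding a_def by linarith
  qed
  have a0: "0 \<le> a" unfolding a_def by (rule separation_prob_bounds)
  have up: "poissonized l t N \<le> a + l / d\<^sup>2" if N: "1 \<le> N" for N
  proof -
    have "(\<Sum>k\<le>N. real (N choose k) * ((l / real N) ^ k * separation_prob k t)) \<le> (\<Sum>k\<le>N. (l ^ k / fact k) * (a + (real k - l)\<^sup>2 / d\<^sup>2))"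
    proof (rule sum_mono)
      fix k
      have "real (N choose k) * (l / real N) ^ k * separation_prob k t \<le> (l ^ k / fact k) * (a + (real k - l)\<^sup>2 / d\<^sup>2)"
        using binomial_le_power_div_fact[of l N k] ak[of k] l N separation_prob_bounds[of k t] by (intro mult_mono) auto
      then show "real (N choose k) * ((l / real N) ^ k * separation_prob k t) \<le> (l ^ k / fact k) * (a + (real k - l)\<^sup>2 / d\<^sup>2)"
        by (simp add: mult.assoc)
    qed
    also have "\<dots> = a * (\<Sum>k\<le>N. l ^ k / fact k) + (\<Sum>k\<le>N. l ^ k / fact k * (real k - l)\<^sup>2) / d\<^sup>2"
      by (simp add: distrib_left sum.distrib sum_distrib_left sum_divide_distrib mult.commute)
    finally have "poissonized l t N \<le> exp (- l) * (a * (\<Sum>k\<le>N. l ^ k / fact k) + (\<Sum>k\<le>N. l ^ k / fact k * (real k - l)\<^sup>2) / d\<^sup>2)"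
      unfolding poissonized_def by (intro mult_left_mono) auto
    also have "\<dots> = a * (exp (- l) * (\<Sum>k\<le>N. l ^ k / fact k)) + (exp (- l) * (\<Sum>k\<le>N. l ^ k / fact k * (real k - l)\<^sup>2)) / d\<^sup>2"
      by (simp add: algebra_simps)
    also have "\<dots> \<le> a * 1 + l / d\<^sup>2"
      using poisson_partial_variance[OF l, of N] poisson_partial_mass[OF l, of N] a0 by (intro add_mono mult_left_mono divide_right_mono) auto
    finally show ?thesis by simp
  qed
  show ?thesis unfolding a_def[symmetric]
  proof (rule LIMSEQ_le_const2[OF exp_emp_mean_converges(1)[OF t l2]])
    show "\<exists>N. \<forall>n\<ge>N. (\<integral>w. exp (- (l\<^sup>2 / 2) * emp_mean 1 (X t w) n) \<partial>M) \<le> a + l / d\<^sup>2"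
      using poissonized_bounds(1)[OF t l] up by (intro exI[of _ 1]) (meson order_trans)
  qed
qed

lemma separation_prob_upper:
  assumes t: "0 \<le> t" and l: "0 \<le> l" and d: "0 < d" "l + d \<le> real n"
  shows "separation_prob n t \<le> (\<integral>w. exp (- (l\<^sup>2 / 2) * pair_density t w) \<partial>M) + l powr (5/2) * power_moment (3/2) t + l / d\<^sup>2"
proof -
  define a where "a = separation_prob n t"
  have l2: "0 \<le> l\<^sup>2 / 2" by simp
  have ak: "a - (real k - l)\<^sup>2 / d\<^sup>2 \<le> separation_prob k t" for k
  proof (cases "k \<le> n")
    case True
    have "a \<le> separation_prob k t" unfolding a_def by (rule separation_prob_antimono[OF True t])
    moreover have "0 \<le> (real k - l)\<^sup>2 / d\<^sup>2" by simp
    ultimately show ?thesis by linarith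
  next
    case False
    then have "d \<le> real k - l" using d by simp
    then have "d\<^sup>2 \<le> (real k - l)\<^sup>2" using d by (intro power_mono) auto
    then have "1 \<le> (real k - l)\<^sup>2 / d\<^sup>2" using d by simp
    then show ?thesis using separation_prob_bounds[of k t] separation_prob_bounds[of n t] unfolding a_def by linarith
  qed
  have low: "a * (exp (- l) * (1 + l / real N) ^ N) - l / d\<^sup>2 \<le> poissonized l t N" if N: "1 \<le> N" for N
  proof -
    define v where "v = (\<lambda>k. real (N choose k) * (l / real N) ^ k)"
    have v0: "0 \<le> v k" for k unfolding v_def using l by simp
    have vl: "v k \<le> l ^ k / fact k" for k unfolding v_def using binomial_le_power_div_fact[of l N k] l N by auto
    have "a * (\<Sum>k\<le>N. v k) - (\<Sum>k\<le>N. l ^ k / fact k * (real k - l)\<^sup>2) / d\<^sup>2 \<le> a * (\<Sum>k\<le>N. v k) - (\<Sum>k\<le>N. v k * ((real k - l)\<^sup>2 / d\<^sup>2))"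
    proof -
      have "(\<Sum>k\<le>N. v k * ((real k - l)\<^sup>2 / d\<^sup>2)) \<le> (\<Sum>k\<le>N. l ^ k / fact k * ((real k - l)\<^sup>2 / d\<^sup>2))"
        by (intro sum_mono mult_right_mono vl) auto
      then show ?thesis by (simp add: sum_divide_distrib)
    qed
    also have "\<dots> = (\<Sum>k\<le>N. v k * (a - (real k - l)\<^sup>2 / d\<^sup>2))"
      by (simp add: right_diff_distrib sum_subtractf sum_distrib_left mult.commute)
    also have "\<dots> \<le> (\<Sum>k\<le>N. v k * separation_prob k t)" by (intro sum_mono mult_left_mono ak v0)
    also have "\<dots> = (\<Sum>k\<le>N. real (N choose k) * ((l / real N) ^ k * separation_prob k t))" by (simp add: v_def mult.assoc)
    finally have "exp (- l) * (a * (\<Sum>k\<le>N. v k) - (\<Sum>k\<le>N. l ^ k / fact k * (real k - l)\<^sup>2) / d\<^sup>2) \<le> poissonized l t N"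
      unfolding poissonized_def by (intro mult_left_mono) auto
    moreover have "(\<Sum>k\<le>N. v k) = (1 + l / real N) ^ N"
      unfolding v_def using binomial_ring[of "l / real N" 1 N] by (simp add: add.commute)
    moreover have "(exp (- l) * (\<Sum>k\<le>N. l ^ k / fact k * (real k - l)\<^sup>2)) / d\<^sup>2 \<le> l / d\<^sup>2"
      using poisson_partial_variance[OF l] by (intro divide_right_mono) auto
    ultimately show ?thesis by (simp add: algebra_simps)
  qed
  have "(\<lambda>N. exp (- l) * (1 + l / real N) ^ N) \<longlonglongrightarrow> exp (- l) * exp l"
    by (intro tendsto_mult tendsto_const tendsto_exp_limit_sequentially)
  then have e1: "(\<lambda>N. exp (- l) * (1 + l / real N) ^ N) \<longlonglongrightarrow> 1" by (simp add: exp_minus)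
  have 1: "(\<lambda>N. a * (exp (- l) * (1 + l / real N) ^ N) - l / d\<^sup>2) \<longlonglongrightarrow> a * 1 - l / d\<^sup>2"
    by (intro tendsto_intros e1)
  have 2: "(\<lambda>N. (\<integral>w. exp (- (l\<^sup>2 / 2) * emp_mean 1 (X t w) N) \<partial>M) + l powr (5/2) * (\<integral>w. emp_mean (3/2) (X t w) N \<partial>M)) \<longlonglongrightarrow>
      (\<integral>w. exp (- (l\<^sup>2 / 2) * pair_density t w) \<partial>M) + l powr (5/2) * power_moment (3/2) t"
    by (intro tendsto_add tendsto_mult tendsto_const exp_emp_mean_converges(1)[OF t l2] emp_mean_power_moment[OF t])
  have "a * 1 - l / d\<^sup>2 \<le> (\<integral>w. exp (- (l\<^sup>2 / 2) * pair_density t w) \<partial>M) + l powr (5/2) * power_moment (3/2) t"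
    by (rule LIMSEQ_le[OF 1 2]) (use low poissonized_bounds(2)[OF t l] in \<open>meson order_trans\<close>)
  then show ?thesis by (simp add: a_def)
qed

definition Laplace_W :: "real \<Rightarrow> real"
  where "Laplace_W u = (\<integral>w. exp (- u * W_limit w) \<partial>M)"

lemma Laplace_W_continuous:
  assumes "u \<longlonglongrightarrow> v" "\<And>k. 0 \<le> u k"
  shows "(\<lambda>k. Laplace_W (u k)) \<longlonglongrightarrow> Laplace_W v"
  unfolding Laplace_W_def
proof (rule integral_dominated_convergence[where w="\<lambda>_. 1"])
  show "AE w in M. (\<lambda>k. exp (- u k * W_limit w)) \<longlonglongrightarrow> exp (- v * W_limit w)"
    by (intro AE_I2 tendsto_intros assms)
  show "AE w in M. norm (exp (- u k * W_limit w)) \<le> 1" for k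
    using AE_W_limit_nonneg by eventually_elim (use assms(2) in simp)
qed auto

lemma Laplace_W_time_limit:
  assumes t: "filterlim t at_top sequentially" and u: "\<And>n. l n * exp (- r * t n) = u" and u0: "0 \<le> u"
  shows "(\<lambda>n. \<integral>w. exp (- l n * pair_density (t n) w) \<partial>M) \<longlonglongrightarrow> Laplace_W u"
proof -
  have t0: "eventually (\<lambda>n. 0 \<le> t n) sequentially" using t by (simp add: filterlim_at_top)
  have eq: "l n * pair_density (t n) w = u * martingale (t n) w" for n w
    unfolding martingale_def u[of n, symmetric] by (simp add: mult_ac flip: exp_add)
  define f where "f = (\<lambda>n w. exp (- u * martingale (max 0 (t n)) w))"
  have [measurable]: "f n \<in> borel_measurable M" for n unfolding f_def using measurable_martingale[of "max 0 (t n)"] by measurable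
  have "(\<lambda>n. \<integral>w. f n w \<partial>M) \<longlonglongrightarrow> Laplace_W u"
    unfolding Laplace_W_def
  proof (rule integral_dominated_convergence[where w="\<lambda>_. 1"])
    show "AE w in M. (\<lambda>n. f n w) \<longlonglongrightarrow> exp (- u * W_limit w)"
      using AE_martingale_converges
    proof eventually_elim
      case (elim w)
      have "filterlim (\<lambda>n. max 0 (t n)) at_top sequentially"
        using t by (rule filterlim_at_top_mono) auto
      from filterlim_compose[OF elim this] show ?case unfolding f_def by (intro tendsto_intros)
    qed
    show "AE w in M. norm (f n w) \<le> 1" for n
    proof -
      have "0 \<le> max 0 (t n)" by simp
      from AE_pair_density_bounds[OF this] show ?thesis
        by eventually_elim (use u0 in \<open>simp add: f_def martingale_def\<close>)
    qed
  qed auto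
  moreover have "eventually (\<lambda>n. (\<integral>w. f n w \<partial>M) = (\<integral>w. exp (- l n * pair_density (t n) w) \<partial>M)) sequentially"
    using t0 by eventually_elim (simp add: f_def eq)
  ultimately show ?thesis by (rule Lim_transform_eventually)
qed

definition sample_time :: "real \<Rightarrow> nat \<Rightarrow> real"
  where "sample_time x n = (2 * ln (real n) + x) / r"

lemma sample_time_at_top: "filterlim (sample_time x) at_top sequentially"
  unfolding sample_time_def using r_pos by real_asymp

lemma exp_sample_time:
  assumes "1 \<le> n" shows "exp (- r * sample_time x n) = exp (- x) / (real n)\<^sup>2"
proof -
  have "exp (- r * sample_time x n) = exp (- x) * exp (- (ln (real n) + ln (real n)))"
    unfolding sample_time_def using r_pos by (simp flip: exp_add)
  also have "exp (- (ln (real n) + ln (real n))) = 1 / (real n)\<^sup>2"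
    using assms by (simp only: exp_minus exp_add power2_eq_square inverse_eq_divide) (simp add: inverse_eq_divide)
  finally show ?thesis by simp
qed

text \<open>At time \<open>t = sample_time x n\<close> the mean number of pairs that are still together is
  \<open>n\<^sup>2 / 2 * exp (- r * t) = exp (- x) / 2\<close>, up to the factor \<open>1 - 1 / n\<close>. The error
  \<open>n powr (5/2) * exp (- \<kappa> * t)\<close> vanishes because \<open>\<kappa> > 5/4 * r\<close>.\<close>

theorem separation_prob_limit: "(\<lambda>n. separation_prob n (sample_time x n)) \<longlonglongrightarrow> Laplace_W (exp (- x) / 2)"
proof -
  define \<tau> where "\<tau> = sample_time x"
  have \<tau>top: "filterlim \<tau> at_top sequentially" unfolding \<tau>_def by (rule sample_time_at_top)
  have \<tau>0: "eventually (\<lambda>n. 0 \<le> \<tau> n) sequentially" using \<tau>top by (simp add: filterlim_at_top)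
  define u where "u = (\<lambda>\<epsilon>. (1 + \<epsilon>)\<^sup>2 * exp (- x) / 2)"
  define E where "E = (\<lambda>\<epsilon> n. \<integral>w. exp (- (((1 + \<epsilon>) * real n)\<^sup>2 / 2) * pair_density (\<tau> n) w) \<partial>M)"
  have E: "E \<epsilon> \<longlonglongrightarrow> Laplace_W (u \<epsilon>)" for \<epsilon>
  proof -
    \<comment> \<open>The value at \<open>n = 0\<close>, where \<open>exp_sample_time\<close> does not apply, is chosen such that the product
      with \<open>exp (- r * \<tau> n)\<close> is constant.\<close>
    define l where "l = (\<lambda>n. if n = 0 then u \<epsilon> * exp (r * \<tau> 0) else ((1 + \<epsilon>) * real n)\<^sup>2 / 2)"
    have "(\<lambda>n. \<integral>w. exp (- l n * pair_density (\<tau> n) w) \<partial>M) \<longlonglongrightarrow> Laplace_W (u \<epsilon>)"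
    proof (rule Laplace_W_time_limit[OF \<tau>top])
      show "l n * exp (- r * \<tau> n) = u \<epsilon>" for n
      proof (cases "n = 0")
        case False
        then show ?thesis using exp_sample_time[of n x] unfolding \<tau>_def l_def u_def
          by (simp add: power_mult_distrib)
      qed (simp add: l_def exp_minus)
    qed (simp add: u_def)
    moreover have "eventually (\<lambda>n. (\<integral>w. exp (- l n * pair_density (\<tau> n) w) \<partial>M) = E \<epsilon> n) sequentially"
      using eventually_gt_at_top[of 0] by eventually_elim (simp add: l_def E_def)
    ultimately show ?thesis by (rule Lim_transform_eventually)
  qed
  obtain \<kappa> C where \<kappa>: "5/4 * r < \<kappa>" "0 < C" "\<And>t. 0 \<le> t \<Longrightarrow> power_moment (3/2) t \<le> C * exp (- \<kappa> * t)"
    using power_moment_decay by blast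
  have g0: "(\<lambda>n. real n powr (5/2) * (C * exp (- \<kappa> * \<tau> n))) \<longlonglongrightarrow> 0"
  proof -
    define q where "q = \<kappa> / r - 5/4"
    have q: "q > 0" unfolding q_def using \<kappa>(1) r_pos by (simp add: field_simps)
    have "(\<lambda>n. C * exp (- \<kappa> * x / r) * real n powr (- 2 * q)) \<longlonglongrightarrow> 0" using q by real_asymp
    moreover have "eventually (\<lambda>n. C * exp (- \<kappa> * x / r) * real n powr (- 2 * q) = real n powr (5/2) * (C * exp (- \<kappa> * \<tau> n))) sequentially"
      using eventually_gt_at_top[of 0]
    proof eventually_elim
      case (elim n)
      have "- \<kappa> * \<tau> n = - \<kappa> * x / r + (- 2 * \<kappa> / r) * ln (real n)"
        unfolding \<tau>_def sample_time_def using r_pos by (simp add: field_simps)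
      then have "exp (- \<kappa> * \<tau> n) = exp (- \<kappa> * x / r) * real n powr (- 2 * \<kappa> / r)"
        using elim by (simp only: exp_add powr_def) simp
      then have "real n powr (5/2) * (C * exp (- \<kappa> * \<tau> n)) = C * exp (- \<kappa> * x / r) * (real n powr (5/2) * real n powr (- 2 * \<kappa> / r))"
        by (simp only: mult_ac)
      also have "real n powr (5/2) * real n powr (- 2 * \<kappa> / r) = real n powr (- 2 * q)"
      proof -
        have "5/2 + - 2 * \<kappa> / r = - 2 * q" unfolding q_def by (simp add: algebra_simps)
        then show ?thesis by (simp only: powr_add[symmetric])
      qed
      finally show ?case by (rule sym)
    qed
    ultimately show ?thesis by (rule Lim_transform_eventually)
  qed
  have lower: "eventually (\<lambda>n. E \<epsilon> n - (1 + \<epsilon>) / \<epsilon>\<^sup>2 / real n \<le> separation_prob n (\<tau> n)) sequentially" if \<epsilon>: "0 < \<epsilon>" for \<epsilon>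
    using \<tau>0 eventually_gt_at_top[of 0]
  proof eventually_elim
    case (elim n)
    have *: "E \<epsilon> n \<le> separation_prob n (\<tau> n) + ((1 + \<epsilon>) * real n) / (\<epsilon> * real n)\<^sup>2"
      unfolding E_def by (rule separation_prob_lower) (use elim \<epsilon> in \<open>auto simp: algebra_simps\<close>)
    have "((1 + \<epsilon>) * real n) / (\<epsilon> * real n)\<^sup>2 = (1 + \<epsilon>) / \<epsilon>\<^sup>2 / real n"
      using elim \<epsilon> by (simp add: power2_eq_square divide_simps)
    with * show ?case by linarith
  qed
  have upper: "eventually (\<lambda>n. separation_prob n (\<tau> n) \<le> E (- \<epsilon>) n + real n powr (5/2) * (C * exp (- \<kappa> * \<tau> n)) + (1 - \<epsilon>) / \<epsilon>\<^sup>2 / real n) sequentially"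
    if \<epsilon>: "0 < \<epsilon>" "\<epsilon> < 1" for \<epsilon>
    using \<tau>0 eventually_gt_at_top[of 0]
  proof eventually_elim
    case (elim n)
    have 1: "separation_prob n (\<tau> n) \<le> E (- \<epsilon>) n + ((1 + - \<epsilon>) * real n) powr (5/2) * power_moment (3/2) (\<tau> n) + ((1 + - \<epsilon>) * real n) / (\<epsilon> * real n)\<^sup>2"
      unfolding E_def by (rule separation_prob_upper) (use elim \<epsilon> in \<open>auto simp: algebra_simps\<close>)
    have 2: "((1 + - \<epsilon>) * real n) powr (5/2) * power_moment (3/2) (\<tau> n) \<le> real n powr (5/2) * (C * exp (- \<kappa> * \<tau> n))"
    proof (rule mult_mono)
      show "((1 + - \<epsilon>) * real n) powr (5/2) \<le> real n powr (5/2)" using \<epsilon> by (intro powr_mono2) (auto simp: mult_left_le_one_le)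
      show "power_moment (3/2) (\<tau> n) \<le> C * exp (- \<kappa> * \<tau> n)" using \<kappa>(3) elim by simp
    qed (use power_moment_bounds[of "\<tau> n" "3/2"] elim in auto)
    have "((1 + - \<epsilon>) * real n) / (\<epsilon> * real n)\<^sup>2 = (1 - \<epsilon>) / \<epsilon>\<^sup>2 / real n"
      using elim \<epsilon> by (simp add: power2_eq_square divide_simps)
    with 1 2 show ?case by linarith
  qed
  have Lc: "(\<lambda>k. Laplace_W (u (c / real (Suc (Suc k))))) \<longlonglongrightarrow> Laplace_W (exp (- x) / 2)" for c
  proof (rule Laplace_W_continuous)
    show "(\<lambda>k. u (c / real (Suc (Suc k)))) \<longlonglongrightarrow> exp (- x) / 2" unfolding u_def by real_asymp
  qed (simp add: u_def)
  show ?thesis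
    unfolding \<tau>_def[symmetric]
  proof (rule LIMSEQ_I)
    fix e :: real assume e: "e > 0"
    let ?L = "Laplace_W (exp (- x) / 2)"
    have "eventually (\<lambda>k. Laplace_W (u (1 / real (Suc (Suc k)))) > ?L - e / 2) sequentially"
      using Lc[of 1] by (rule order_tendstoD) (use e in simp)
    moreover have "eventually (\<lambda>k. Laplace_W (u (- 1 / real (Suc (Suc k)))) < ?L + e / 2) sequentially"
      using Lc[of "-1"] by (rule order_tendstoD) (use e in simp)
    ultimately have "eventually (\<lambda>k. Laplace_W (u (1 / real (Suc (Suc k)))) > ?L - e / 2 \<and> Laplace_W (u (- 1 / real (Suc (Suc k)))) < ?L + e / 2) sequentially"
      by (rule eventually_conj)
    from eventually_happens[OF this] obtain k where k: "Laplace_W (u (1 / real (Suc (Suc k)))) > ?L - e / 2" "Laplace_W (u (- 1 / real (Suc (Suc k)))) < ?L + e / 2"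
      by auto
    define \<epsilon> where "\<epsilon> = 1 / real (Suc (Suc k))"
    have \<epsilon>: "0 < \<epsilon>" "\<epsilon> < 1" unfolding \<epsilon>_def by auto
    have k': "Laplace_W (u \<epsilon>) > ?L - e / 2" "Laplace_W (u (- \<epsilon>)) < ?L + e / 2" using k unfolding \<epsilon>_def by simp_all
    have "(\<lambda>n. E \<epsilon> n - (1 + \<epsilon>) / \<epsilon>\<^sup>2 / real n) \<longlonglongrightarrow> Laplace_W (u \<epsilon>) - 0"
      by (intro tendsto_diff E) real_asymp
    then have 1: "eventually (\<lambda>n. E \<epsilon> n - (1 + \<epsilon>) / \<epsilon>\<^sup>2 / real n > ?L - e) sequentially"
      by (rule order_tendstoD) (use k' e in simp)
    have "(\<lambda>n. E (- \<epsilon>) n + real n powr (5/2) * (C * exp (- \<kappa> * \<tau> n)) + (1 - \<epsilon>) / \<epsilon>\<^sup>2 / real n) \<longlonglongrightarrow> Laplace_W (u (- \<epsilon>)) + 0 + 0"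
      by (intro tendsto_add E g0) real_asymp
    then have 2: "eventually (\<lambda>n. E (- \<epsilon>) n + real n powr (5/2) * (C * exp (- \<kappa> * \<tau> n)) + (1 - \<epsilon>) / \<epsilon>\<^sup>2 / real n < ?L + e) sequentially"
      by (rule order_tendstoD) (use k' e in simp)
    have "eventually (\<lambda>n. norm (separation_prob n (\<tau> n) - ?L) < e) sequentially"
      using 1 2 lower[OF \<epsilon>(1)] upper[OF \<epsilon>] by eventually_elim (simp add: abs_less_iff)
    then show "\<exists>no. \<forall>n\<ge>no. norm (separation_prob n (\<tau> n) - ?L) < e" by (simp add: eventually_sequentially)
  qed
qed

end

section \<open>The limit is positive\<close>

context homogeneous_fragmentation
begin

lemma sum_prob_restrict:
  assumes s: "0 \<le> s" and D: "D \<in> sets M" and E: "finite E"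
  shows "(\<Sum>\<eta>\<in>E. prob {w\<in>D. restr n s w = \<eta>}) =
    prob {w\<in>D. restr n s w \<in> E}"
proof -
  have sets: "{w\<in>D. restr n s w = \<eta>} \<in> sets M" for \<eta>
  proof -
    have "{w\<in>D. restr n s w = \<eta>} = D \<inter> {w\<in>space M. restr n s w = \<eta>}"
      using sets.sets_into_space[OF D] by auto
    then show ?thesis using D sets_restrict_X[OF s] by simp
  qed
  have "prob (\<Union>\<eta>\<in>E. {w\<in>D. restr n s w = \<eta>}) =
      (\<Sum>\<eta>\<in>E. prob {w\<in>D. restr n s w = \<eta>})"
    using E sets by (intro finite_measure_finite_Union) (auto simp: disjoint_family_on_def)
  moreover have "(\<Union>\<eta>\<in>E. {w\<in>D. restr n s w = \<eta>}) = {w\<in>D. restr n s w \<in> E}"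
    by auto
  ultimately show ?thesis by simp
qed

lemma restrict_X_partition:
  assumes "w \<in> space M" "0 \<le> s" shows "partition_on {1..n} (restr n s w)"
  using partition_on_restrict_partition[OF partition_X[OF assms], of "{1..n}"] by auto

lemma separated_iff_singletons:
  assumes "w \<in> space M" "0 \<le> t" "F \<subseteq> positive_nats"
  shows "separated F (X t w) \<longleftrightarrow> restrict_partition (X t w) F = (\<lambda>i. {i}) ` F"
  unfolding separated_def restrict_eq_singletons_iff[OF partition_X[OF assms(1,2)] assms(3)] ..

text \<open>Singletons refine every partition, and each block of \<open>\<eta>\<close> has to fall apart by itself.\<close>

lemma branching_separation:
  assumes s: "0 \<le> s" and t: "0 \<le> t" and \<eta>: "partition_on {1..n} \<eta>"
  shows "prob {w\<in>space M. restr n s w = \<eta> \<and> separated {1..n} (X (s + t) w)} =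
    prob {w\<in>space M. restr n s w = \<eta>} * (\<Prod>B\<in>\<eta>. separation_prob (card B) t)"
proof -
  define \<pi> where "\<pi> = (\<lambda>i. {i}) ` {1..n}"
  have \<pi>: "partition_on {1..n} \<pi>" unfolding \<pi>_def by (rule partition_on_singletons)
  have st: "0 \<le> s + t" using s t by simp
  have ref: "refines {1..n} \<pi> \<eta>"
    unfolding refines_def
  proof (intro conjI \<pi> \<eta> ballI)
    fix B assume "B \<in> \<pi>"
    then obtain i where i: "B = {i}" "i \<in> {1..n}" unfolding \<pi>_def by auto
    then obtain C where "C \<in> \<eta>" "i \<in> C" using \<eta> unfolding partition_on_def by blast
    then show "\<exists>Y\<in>\<eta>. B \<subseteq> Y" using i by auto
  qed
  have top: "space M \<in> sets (natural_filtration M X s)"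
    using sets.top[of "natural_filtration M X s"] by (simp add: space_natural_filtration)
  have "prob {w\<in>space M. restr n s w = \<eta> \<and> restr n (s + t) w = \<pi>} =
      prob {w\<in>space M. restr n s w = \<eta>} *
        (\<Prod>B\<in>\<eta>. prob {w\<in>space M. restrict_partition (X t w) B = restrict_partition \<pi> B})"
    using branching[OF s t top \<eta> \<pi>] ref by simp
  also have "(\<Prod>B\<in>\<eta>. prob {w\<in>space M. restrict_partition (X t w) B = restrict_partition \<pi> B}) = (\<Prod>B\<in>\<eta>. separation_prob (card B) t)"
  proof (rule prod.cong[OF refl])
    fix B assume "B \<in> \<eta>"
    then have B: "B \<subseteq> {1..n}" using \<eta> unfolding partition_on_def by auto
    then have B': "finite B" "B \<subseteq> positive_nats" by (auto intro: finite_subset)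
    have "restrict_partition \<pi> B = (\<lambda>i. {i}) ` B" using B unfolding \<pi>_def restrict_partition_def by auto
    then have "{w\<in>space M. restrict_partition (X t w) B = restrict_partition \<pi> B} = {w\<in>space M. separated B (X t w)}"
      using separated_iff_singletons[OF _ t B'(2)] by auto
    then show "prob {w\<in>space M. restrict_partition (X t w) B = restrict_partition \<pi> B} = separation_prob (card B) t"
      using prob_separated[OF t B'] by simp
  qed
  also have "{w\<in>space M. restr n s w = \<eta> \<and> restr n (s + t) w = \<pi>} =
      {w\<in>space M. restr n s w = \<eta> \<and> separated {1..n} (X (s + t) w)}"
    unfolding \<pi>_def using separated_iff_singletons[OF _ st, of _ "{1..n}"] by auto
  finally show ?thesis .
qed

lemma sets_block_count: "0 \<le> s \<Longrightarrow> {w\<in>space M. block_count (X s w) i n < m} \<in> sets M"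
proof -
  assume s: "0 \<le> s"
  note [measurable] = sets_same_block_X[OF s]
  have "{w\<in>space M. block_count (X s w) i n < m} = {w\<in>space M. (\<Sum>j=1..n. if same_block (X s w) i j then 1 else 0) < m}"
    unfolding block_count_eq_sum by simp
  also have "\<dots> \<in> sets M" by measurable
  finally show ?thesis .
qed

text \<open>If the first two labels are in different blocks at time \<open>s\<close> and both blocks contain at least
  \<open>m\<close> of the first \<open>n\<close> labels, then two independent samples of size at least \<open>m\<close> must be separated
  during the remaining time.\<close>

lemma separation_prob_split:
  assumes s: "0 \<le> s" and t: "0 \<le> t" and n: "2 \<le> n"
  shows "separation_prob n (s + t) \<le> (separation_prob m t)\<^sup>2 + prob {w\<in>space M. same_block (X s w) 1 2}
    + prob {w\<in>space M. block_count (X s w) 1 n < m} + prob {w\<in>space M. block_count (X s w) 2 n < m}"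
proof -
  define E where "E = {\<eta>. partition_on {1..n} \<eta>}"
  define G where "G = {\<eta>\<in>E. \<not> same_block \<eta> 1 2 \<and> m \<le> card (block_of \<eta> 1) \<and> m \<le> card (block_of \<eta> 2)}"
  have finE: "finite E" unfolding E_def by (rule finite_partitions) simp
  have finG: "finite G" unfolding G_def using finE by simp
  define q where "q = (\<lambda>\<eta>. prob {w\<in>space M. restr n s w = \<eta>})"
  have q0: "0 \<le> q \<eta>" for \<eta> unfolding q_def by simp
  have st: "0 \<le> s + t" using s t by simp
  note sp = separation_prob_bounds
  have good: "(\<Prod>B\<in>\<eta>. separation_prob (card B) t) \<le> (separation_prob m t)\<^sup>2" if "\<eta> \<in> G" for \<eta>
  proof -
    have part: "partition_on {1..n} \<eta>" and ns: "\<not> same_block \<eta> 1 2"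
      and m: "m \<le> card (block_of \<eta> 1)" "m \<le> card (block_of \<eta> 2)" using that unfolding G_def E_def by auto
    have fin: "finite \<eta>" using part by (auto simp: partition_on_def intro: finite_UnionD)
    have B: "block_of \<eta> 1 \<in> \<eta>" "block_of \<eta> 2 \<in> \<eta>" using n by (auto intro!: block_of_in[OF part])
    have "2 \<in> block_of \<eta> 2" unfolding block_of_def using same_block_refl[OF part, of 2] n by simp
    moreover have "2 \<notin> block_of \<eta> 1" unfolding block_of_def using ns by simp
    ultimately have ne: "block_of \<eta> 1 \<noteq> block_of \<eta> 2" by blast
    have "(\<Prod>B\<in>\<eta>. separation_prob (card B) t) = (\<Prod>B\<in>{block_of \<eta> 1, block_of \<eta> 2}. separation_prob (card B) t) * (\<Prod>B\<in>\<eta> - {block_of \<eta> 1, block_of \<eta> 2}. separation_prob (card B) t)"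
      using fin B by (intro prod.subset_diff[of "{block_of \<eta> 1, block_of \<eta> 2}" \<eta>, THEN trans] mult.commute) auto
    also have "\<dots> \<le> (\<Prod>B\<in>{block_of \<eta> 1, block_of \<eta> 2}. separation_prob (card B) t) * 1"
      using sp by (intro mult_left_mono prod_le_1 prod_nonneg) auto
    also have "\<dots> = separation_prob (card (block_of \<eta> 1)) t * separation_prob (card (block_of \<eta> 2)) t"
      using ne by simp
    also have "\<dots> \<le> separation_prob m t * separation_prob m t"
      using separation_prob_antimono[OF m(1) t] separation_prob_antimono[OF m(2) t] sp by (intro mult_mono) auto
    finally show ?thesis by (simp add: power2_eq_square)
  qed
  have "separation_prob n (s + t) = prob {w\<in>{w\<in>space M. separated {1..n} (X (s + t) w)}. restr n s w \<in> E}"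
    unfolding separation_prob_def E_def by (intro arg_cong[of _ _ prob]) (use restrict_X_partition[OF _ s] in auto)
  also have "\<dots> = (\<Sum>\<eta>\<in>E. prob {w\<in>{w\<in>space M. separated {1..n} (X (s + t) w)}. restr n s w = \<eta>})"
    by (rule sum_prob_restrict[OF s sets_separated[OF finite_atLeastAtMost st] finE, symmetric])
  also have "\<dots> = (\<Sum>\<eta>\<in>E. q \<eta> * (\<Prod>B\<in>\<eta>. separation_prob (card B) t))"
  proof (rule sum.cong[OF refl])
    fix \<eta> assume "\<eta> \<in> E"
    then have \<eta>: "partition_on {1..n} \<eta>" by (simp add: E_def)
    have "{w\<in>{w\<in>space M. separated {1..n} (X (s + t) w)}. restr n s w = \<eta>} =
        {w\<in>space M. restr n s w = \<eta> \<and> separated {1..n} (X (s + t) w)}" by auto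
    then show "prob {w\<in>{w\<in>space M. separated {1..n} (X (s + t) w)}. restr n s w = \<eta>} = q \<eta> * (\<Prod>B\<in>\<eta>. separation_prob (card B) t)"
      using branching_separation[OF s t \<eta>] by (simp add: q_def)
  qed
  also have "\<dots> = (\<Sum>\<eta>\<in>G. q \<eta> * (\<Prod>B\<in>\<eta>. separation_prob (card B) t)) + (\<Sum>\<eta>\<in>E - G. q \<eta> * (\<Prod>B\<in>\<eta>. separation_prob (card B) t))"
    using sum.subset_diff[of G E] finE by (simp add: G_def add.commute)
  also have "\<dots> \<le> (\<Sum>\<eta>\<in>G. q \<eta> * (separation_prob m t)\<^sup>2) + (\<Sum>\<eta>\<in>E - G. q \<eta> * 1)"
    using good q0 sp by (intro add_mono sum_mono mult_left_mono prod_le_1) auto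
  also have "\<dots> = (\<Sum>\<eta>\<in>G. q \<eta>) * (separation_prob m t)\<^sup>2 + (\<Sum>\<eta>\<in>E - G. q \<eta>)"
    by (simp add: sum_distrib_right)
  also have "(\<Sum>\<eta>\<in>G. q \<eta>) * (separation_prob m t)\<^sup>2 \<le> 1 * (separation_prob m t)\<^sup>2"
    unfolding q_def using sum_prob_restrict[OF s sets.top finG] by (intro mult_right_mono) auto
  also have "(\<Sum>\<eta>\<in>E - G. q \<eta>) = prob {w\<in>space M. restr n s w \<in> E - G}"
    unfolding q_def using finE by (intro sum_prob_restrict[OF s]) auto
  also have "\<dots> \<le> prob ({w\<in>space M. same_block (X s w) 1 2} \<union> {w\<in>space M. block_count (X s w) 1 n < m} \<union> {w\<in>space M. block_count (X s w) 2 n < m})"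
  proof (rule finite_measure_mono)
    show "{w\<in>space M. restr n s w \<in> E - G} \<subseteq>
      {w\<in>space M. same_block (X s w) 1 2} \<union> {w\<in>space M. block_count (X s w) 1 n < m} \<union> {w\<in>space M. block_count (X s w) 2 n < m}"
    proof
      fix w assume w: "w \<in> {w\<in>space M. restr n s w \<in> E - G}"
      have bc: "card (block_of (restr n s w) i) = block_count (X s w) i n" if "i \<in> {1..n}" for i
      proof -
        have "block_of (restr n s w) i = block_of (X s w) i \<inter> {1..n}"
          using that unfolding block_of_def by (auto simp: same_block_restrict)
        then show ?thesis by (simp add: block_count_def)
      qed
      have "1 \<in> {1..n}" "2 \<in> {1..n}" using n by auto
      with w bc[of 1] bc[of 2] show "w \<in> {w\<in>space M. same_block (X s w) 1 2} \<union> {w\<in>space M. block_count (X s w) 1 n < m} \<union> {w\<in>space M. block_count (X s w) 2 n < m}"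
        unfolding G_def by (auto simp: same_block_restrict)
    qed
  qed (intro sets.Un sets_block_count sets_same_block_X s)
  also have "\<dots> \<le> prob ({w\<in>space M. same_block (X s w) 1 2} \<union> {w\<in>space M. block_count (X s w) 1 n < m}) + prob {w\<in>space M. block_count (X s w) 2 n < m}"
    by (intro measure_Un_le sets.Un sets_block_count sets_same_block_X s)
  also have "prob ({w\<in>space M. same_block (X s w) 1 2} \<union> {w\<in>space M. block_count (X s w) 1 n < m}) \<le> prob {w\<in>space M. same_block (X s w) 1 2} + prob {w\<in>space M. block_count (X s w) 1 n < m}"
    by (intro measure_Un_le sets_block_count sets_same_block_X s)
  finally show ?thesis by simp
qed

lemma prob_block_count_2:
  assumes s: "0 \<le> s" and n: "2 \<le> n"
  shows "prob {w\<in>space M. block_count (X s w) 2 n < m} = prob {w\<in>space M. block_count (X s w) 1 n < m}"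
proof -
  define \<sigma> where "\<sigma> = Transposition.transpose (1::nat) 2"
  have \<sigma>: "\<sigma> permutes {1..2}" unfolding \<sigma>_def by (rule permutes_swap_id) auto
  have e: "prob {w\<in>space M. block_count (Y w) i n < m} = (\<integral>w. (if block_count (Y w) i n < m then 1 else 0) \<partial>M)" for i Y
  proof -
    have "(\<integral>w. (if block_count (Y w) i n < m then 1 else 0) \<partial>M) = (\<integral>w. indicat_real {w\<in>space M. block_count (Y w) i n < m} w \<partial>M)"
      by (intro Bochner_Integration.integral_cong refl) (auto simp: indicator_def)
    then show ?thesis unfolding expectation_indicator by simp
  qed
  have eq: "block_count (permute_partition \<sigma> P) 2 n = block_count P 1 n" for P
    using block_count_permute[OF \<sigma> n, of P 1] by (simp add: \<sigma>_def)
  have "(\<lambda>P. if block_count P 2 n < m then 1 else (0::real)) \<in> borel_measurable partition_algebra"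
    unfolding block_count_eq_sum by measurable
  from exchangeable_time[OF \<sigma> this s] show ?thesis unfolding e eq by simp
qed

end

context beta_fragmentation
begin

text \<open>Bounding the indicator by an exponential function of the empirical frequency gives a bound that
  passes to the limit.\<close>

lemma prob_small_block_count:
  assumes s: "0 \<le> s" and \<delta>: "0 < \<delta>" and m: "real m \<le> \<delta> * real n + 1" and n: "1 / \<delta> \<le> real n" "1 \<le> n"
  shows "prob {w\<in>space M. block_count (X s w) 1 n < m} \<le> exp 2 * (\<integral>w. exp (- emp_freq (X s w) 1 n / \<delta>) \<partial>M)"
proof -
  have [measurable]: "(\<lambda>w. emp_freq (X s w) 1 n) \<in> borel_measurable M" using s by measurable
  have e0: "0 \<le> emp_freq P 1 n" for P by (simp add: emp_freq_def)
  have int: "integrable M (\<lambda>w. exp (- emp_freq (X s w) 1 n / \<delta>))"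
    by (rule integrable_const_bound[where B=1]) (use e0 \<delta> in auto)
  have "prob {w\<in>space M. block_count (X s w) 1 n < m} = (\<integral>w. indicator {w\<in>space M. block_count (X s w) 1 n < m} w \<partial>M)"
    by (simp only: expectation_indicator)
  also have "\<dots> \<le> (\<integral>w. exp 2 * exp (- emp_freq (X s w) 1 n / \<delta>) \<partial>M)"
  proof (rule integral_mono)
    show "integrable M (indicat_real {w\<in>space M. block_count (X s w) 1 n < m})"
      using sets_block_count[OF s] by (simp add: emeasure_eq_measure)
    show "indicat_real {w\<in>space M. block_count (X s w) 1 n < m} w \<le> exp 2 * exp (- emp_freq (X s w) 1 n / \<delta>)" for w
    proof (cases "block_count (X s w) 1 n < m")
      case True
      then have "real (block_count (X s w) 1 n) \<le> \<delta> * real n + 1" using m by linarith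
      then have "emp_freq (X s w) 1 n \<le> (\<delta> * real n + 1) / real n" unfolding emp_freq_def by (intro divide_right_mono) auto
      also have "\<dots> = \<delta> + 1 / real n" using n by (simp add: field_simps)
      also have "1 / real n \<le> \<delta>" using n \<delta> by (simp add: field_simps)
      finally have "emp_freq (X s w) 1 n / \<delta> \<le> 2" using \<delta> by (simp add: field_simps)
      then have "1 \<le> exp 2 * exp (- emp_freq (X s w) 1 n / \<delta>)" by (simp flip: exp_add)
      then show ?thesis by (simp add: indicator_def)
    qed (simp add: indicator_def)
  qed (use int in auto)
  finally show ?thesis by simp
qed

lemma exp_emp_freq_converges:
  assumes s: "0 \<le> s" and \<delta>: "0 < \<delta>"
  shows "(\<lambda>n. \<integral>w. exp (- emp_freq (X s w) 1 n / \<delta>) \<partial>M) \<longlonglongrightarrow> (\<integral>w. exp (- freq (X s w) 1 / \<delta>) \<partial>M)"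
proof -
  have [measurable]: "(\<lambda>w. emp_freq (X s w) 1 n) \<in> borel_measurable M" for n using s by measurable
  note [measurable] = measurable_freq_X[OF s, of 1]
  have e0: "0 \<le> emp_freq P 1 n" for P n by (simp add: emp_freq_def)
  show ?thesis
  proof (rule integral_dominated_convergence[where w="\<lambda>_. 1"])
    show "AE w in M. (\<lambda>n. exp (- emp_freq (X s w) 1 n / \<delta>)) \<longlonglongrightarrow> exp (- freq (X s w) 1 / \<delta>)"
      using AE_regular_at[OF s]
    proof eventually_elim
      case (elim w)
      have "convergent (emp_freq (X s w) 1)" using regular_partition.reg[OF elim] unfolding regular_def by simp
      then have "emp_freq (X s w) 1 \<longlonglongrightarrow> freq (X s w) 1" unfolding freq_eq_lim by (simp add: convergent_LIMSEQ_iff)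
      then show ?case using \<delta> by (intro tendsto_intros) auto
    qed
    show "AE w in M. norm (exp (- emp_freq (X s w) 1 n / \<delta>)) \<le> 1" for n using e0 \<delta> by simp
  qed auto
qed

lemma exp_freq_vanishes:
  assumes s: "0 \<le> s"
  shows "(\<lambda>k. \<integral>w. exp (- freq (X s w) 1 / (1 / real (Suc k))) \<partial>M) \<longlonglongrightarrow> 0"
proof -
  note [measurable] = measurable_freq_X[OF s, of 1]
  have "(\<lambda>k. \<integral>w. exp (- freq (X s w) 1 / (1 / real (Suc k))) \<partial>M) \<longlonglongrightarrow> (\<integral>w. 0 \<partial>M)"
  proof (rule integral_dominated_convergence[where w="\<lambda>_. 1"])
    show "AE w in M. (\<lambda>k. exp (- freq (X s w) 1 / (1 / real (Suc k)))) \<longlonglongrightarrow> 0"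
      using AE_freq_pos[OF s]
    proof eventually_elim
      case (elim w)
      define f where "f = freq (X s w) 1"
      have "f > 0" using elim unfolding f_def .
      then show ?case unfolding f_def[symmetric] by real_asymp
    qed
    show "AE w in M. norm (exp (- freq (X s w) 1 / (1 / real (Suc k)))) \<le> 1" for k
      using AE_freq_pos[OF s] by eventually_elim simp
  qed auto
  then show ?thesis by simp
qed

text \<open>Samples of size \<open>m = \<lceil>\<delta> * n\<rceil>\<close> are observed for the time \<open>sample_time x n - s\<close>, which is at most
  \<open>sample_time\<close> of \<open>m\<close> at the shifted argument.\<close>

lemma Laplace_W_split:
  assumes s: "0 \<le> s" and \<delta>: "0 < \<delta>"
  shows "Laplace_W (exp (- x) / 2) \<le> (Laplace_W (exp (- (x - r * s - 2 * ln \<delta>)) / 2))\<^sup>2 + exp (- r * s)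
    + 2 * (exp 2 * (\<integral>w. exp (- freq (X s w) 1 / \<delta>) \<partial>M))"
proof -
  define x' where "x' = x - r * s - 2 * ln \<delta>"
  define m where "m = (\<lambda>n. nat \<lceil>\<delta> * real n\<rceil>)"
  have m_top: "filterlim m at_top sequentially" unfolding m_def using \<delta> by real_asymp
  have m_lower: "\<delta> * real n \<le> real (m n)" and m_upper: "real (m n) \<le> \<delta> * real n + 1" for n
  proof -
    have "0 \<le> \<delta> * real n" using \<delta> by simp
    then have "real (m n) = real_of_int \<lceil>\<delta> * real n\<rceil>" unfolding m_def by simp
    then show "\<delta> * real n \<le> real (m n)" "real (m n) \<le> \<delta> * real n + 1" by linarith+
  qed
  have A: "(\<lambda>n. separation_prob n (sample_time x n)) \<longlonglongrightarrow> Laplace_W (exp (- x) / 2)" by (rule separation_prob_limit)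
  have "(\<lambda>n. separation_prob (m n) (sample_time x' (m n))) \<longlonglongrightarrow> Laplace_W (exp (- x') / 2)"
    using filterlim_compose[OF separation_prob_limit m_top] .
  then have B: "(\<lambda>n. (separation_prob (m n) (sample_time x' (m n)))\<^sup>2 + exp (- r * s) + 2 * (exp 2 * (\<integral>w. exp (- emp_freq (X s w) 1 n / \<delta>) \<partial>M)))
      \<longlonglongrightarrow> (Laplace_W (exp (- x') / 2))\<^sup>2 + exp (- r * s) + 2 * (exp 2 * (\<integral>w. exp (- freq (X s w) 1 / \<delta>) \<partial>M))"
    by (intro tendsto_add tendsto_mult tendsto_power tendsto_const exp_emp_freq_converges[OF s \<delta>])
  have "eventually (\<lambda>n. separation_prob n (sample_time x n) \<le>
      (separation_prob (m n) (sample_time x' (m n)))\<^sup>2 + exp (- r * s) + 2 * (exp 2 * (\<integral>w. exp (- emp_freq (X s w) 1 n / \<delta>) \<partial>M))) sequentially"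
  proof -
    have "eventually (\<lambda>n. s \<le> sample_time x n) sequentially" using sample_time_at_top[of x] by (simp add: filterlim_at_top)
    moreover have "eventually (\<lambda>n. 1 / \<delta> \<le> real n) sequentially" by real_asymp
    ultimately show ?thesis using eventually_ge_at_top[of 2]
    proof eventually_elim
      case (elim n)
      define t where "t = sample_time x n - s"
      have t: "0 \<le> t" unfolding t_def using elim by simp
      have "ln (\<delta> * real n) \<le> ln (real (m n))" using m_lower[of n] \<delta> elim by (intro ln_mono) auto
      then have "ln \<delta> + ln (real n) \<le> ln (real (m n))" using \<delta> elim by (simp add: ln_mult)
      then have "t \<le> sample_time x' (m n)"
      proof -
        assume "ln \<delta> + ln (real n) \<le> ln (real (m n))"
        then have "(2 * ln (real n) + x) - r * s \<le> 2 * ln (real (m n)) + x'" unfolding x'_def by simp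
        then have "((2 * ln (real n) + x) - r * s) / r \<le> (2 * ln (real (m n)) + x') / r" using r_pos by (intro divide_right_mono) auto
        then show ?thesis unfolding t_def sample_time_def using r_pos by (simp add: diff_divide_distrib)
      qed
      then have "separation_prob (m n) t \<le> separation_prob (m n) (sample_time x' (m n))" by (rule separation_prob_mono_time[OF t])
      then have "(separation_prob (m n) t)\<^sup>2 \<le> (separation_prob (m n) (sample_time x' (m n)))\<^sup>2"
        by (intro power_mono separation_prob_bounds)
      moreover have "separation_prob n (sample_time x n) \<le> (separation_prob (m n) t)\<^sup>2 + prob {w\<in>space M. same_block (X s w) 1 2}
          + prob {w\<in>space M. block_count (X s w) 1 n < m n} + prob {w\<in>space M. block_count (X s w) 2 n < m n}"
        using separation_prob_split[OF s t elim(3), of "m n"] by (simp add: t_def)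
      moreover have "prob {w\<in>space M. same_block (X s w) 1 2} = exp (- r * s)" by (rule prob_same_block[OF s]) auto
      moreover have "prob {w\<in>space M. block_count (X s w) 2 n < m n} = prob {w\<in>space M. block_count (X s w) 1 n < m n}"
        by (rule prob_block_count_2[OF s elim(3)])
      moreover have "prob {w\<in>space M. block_count (X s w) 1 n < m n} \<le> exp 2 * (\<integral>w. exp (- emp_freq (X s w) 1 n / \<delta>) \<partial>M)"
        by (rule prob_small_block_count[OF s \<delta> m_upper elim(2)]) (use elim in simp)
      ultimately show ?case by linarith
    qed
  qed
  with A B show ?thesis unfolding x'_def[symmetric] by (intro tendsto_le[OF sequentially_bot]) auto
qed

lemma Laplace_W_at_infinity:
  "(\<lambda>k. Laplace_W (exp (- (c - real k)) / 2)) \<longlonglongrightarrow> prob {w\<in>space M. W_limit w \<le> 0}"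
proof -
  have "(\<lambda>k. Laplace_W (exp (- (c - real k)) / 2)) \<longlonglongrightarrow> (\<integral>w. indicator {w\<in>space M. W_limit w \<le> 0} w \<partial>M)"
    unfolding Laplace_W_def
  proof (rule integral_dominated_convergence[where w="\<lambda>_. 1"])
    show "AE w in M. (\<lambda>k. exp (- (exp (- (c - real k)) / 2) * W_limit w)) \<longlonglongrightarrow> indicator {w\<in>space M. W_limit w \<le> 0} w"
      using AE_W_limit_nonneg AE_space
    proof eventually_elim
      case (elim w)
      show ?case
      proof (cases "W_limit w = 0")
        case True
        then show ?thesis using elim by simp
      next
        case False
        define v where "v = W_limit w"
        have "v > 0" using False elim by (simp add: v_def)
        then have "(\<lambda>k. exp (- (exp (- (c - real k)) / 2) * v)) \<longlonglongrightarrow> 0" by real_asymp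
        then show ?thesis using \<open>v > 0\<close> by (simp add: v_def indicator_def)
      qed
    qed
    show "AE w in M. norm (exp (- (exp (- (c - real k)) / 2) * W_limit w)) \<le> 1" for k
      using AE_W_limit_nonneg by eventually_elim simp
  qed auto
  then show ?thesis by (simp only: expectation_indicator)
qed

text \<open>The splitting inequality says in the limit that the probability of a vanishing limit is at most
  its own square; the value 1 is excluded by the mean.\<close>

theorem AE_W_limit_pos: "AE w in M. W_limit w > 0"
proof -
  define q where "q = prob {w\<in>space M. W_limit w \<le> 0}"
  \<comment> \<open>Three limits in this order: \<open>x\<close> to minus infinity, \<open>\<delta>\<close> to 0, and \<open>s\<close> to infinity.\<close>
  have 1: "q \<le> q\<^sup>2 + exp (- r * s) + 2 * (exp 2 * (\<integral>w. exp (- freq (X s w) 1 / \<delta>) \<partial>M))" if s: "0 \<le> s" and \<delta>: "0 < \<delta>" for s \<delta>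
  proof (rule LIMSEQ_le)
    show "(\<lambda>k. Laplace_W (exp (- (0 - real k)) / 2)) \<longlonglongrightarrow> q" unfolding q_def by (rule Laplace_W_at_infinity)
    have "(\<lambda>k. Laplace_W (exp (- ((0 - r * s - 2 * ln \<delta>) - real k)) / 2)) \<longlonglongrightarrow> q" unfolding q_def by (rule Laplace_W_at_infinity)
    then show "(\<lambda>k. (Laplace_W (exp (- ((0 - r * s - 2 * ln \<delta>) - real k)) / 2))\<^sup>2 + exp (- r * s) + 2 * (exp 2 * (\<integral>w. exp (- freq (X s w) 1 / \<delta>) \<partial>M)))
        \<longlonglongrightarrow> q\<^sup>2 + exp (- r * s) + 2 * (exp 2 * (\<integral>w. exp (- freq (X s w) 1 / \<delta>) \<partial>M))"
      by (intro tendsto_add tendsto_power tendsto_const)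
    have eq: "(0 - r * s - 2 * ln \<delta>) - real k = (0 - real k) - r * s - 2 * ln \<delta>" for k by simp
    show "\<exists>N. \<forall>k\<ge>N. Laplace_W (exp (- (0 - real k)) / 2) \<le>
        (Laplace_W (exp (- ((0 - r * s - 2 * ln \<delta>) - real k)) / 2))\<^sup>2 + exp (- r * s) + 2 * (exp 2 * (\<integral>w. exp (- freq (X s w) 1 / \<delta>) \<partial>M))"
      unfolding eq using Laplace_W_split[OF s \<delta>] by blast
  qed
  have 2: "q \<le> q\<^sup>2 + exp (- r * s)" if s: "0 \<le> s" for s
  proof (rule LIMSEQ_le_const)
    have "(\<lambda>k. q\<^sup>2 + exp (- r * s) + 2 * (exp 2 * (\<integral>w. exp (- freq (X s w) 1 / (1 / real (Suc k))) \<partial>M))) \<longlonglongrightarrow> q\<^sup>2 + exp (- r * s) + 2 * (exp 2 * 0)"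
      by (intro tendsto_add tendsto_mult tendsto_const exp_freq_vanishes[OF s])
    then show "(\<lambda>k. q\<^sup>2 + exp (- r * s) + 2 * (exp 2 * (\<integral>w. exp (- freq (X s w) 1 / (1 / real (Suc k))) \<partial>M))) \<longlonglongrightarrow> q\<^sup>2 + exp (- r * s)"
      by simp
    show "\<exists>N. \<forall>k\<ge>N. q \<le> q\<^sup>2 + exp (- r * s) + 2 * (exp 2 * (\<integral>w. exp (- freq (X s w) 1 / (1 / real (Suc k))) \<partial>M))"
      using 1[OF s, of "1 / real (Suc k)" for k] by (intro exI[of _ 0]) (simp del: of_nat_Suc)
  qed
  have "q \<le> q\<^sup>2"
  proof (rule LIMSEQ_le_const)
    have "(\<lambda>k. exp (- r * real k)) \<longlonglongrightarrow> 0" using r_pos by real_asymp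
    from tendsto_add[OF tendsto_const[of "q\<^sup>2"] this] show "(\<lambda>k. q\<^sup>2 + exp (- r * real k)) \<longlonglongrightarrow> q\<^sup>2" by simp
    show "\<exists>N. \<forall>k\<ge>N. q \<le> q\<^sup>2 + exp (- r * real k)" using 2 by simp
  qed
  moreover have q01: "0 \<le> q" "q \<le> 1" unfolding q_def by auto
  moreover have "q \<noteq> 1"
  proof
    assume "q = 1"
    then have "AE w in M. W_limit w \<le> 0" unfolding q_def by (subst prob_Collect_eq_1[symmetric]) auto
    then have "AE w in M. W_limit w = 0" using AE_W_limit_nonneg by eventually_elim simp
    then have "(\<integral>w. W_limit w \<partial>M) = 0" by (rule integral_eq_zero_AE)
    then show False by (simp add: expectation_W_limit)
  qed
  ultimately have "q = 0"
  proof -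
    have "q * (1 - q) \<le> 0" using \<open>q \<le> q\<^sup>2\<close> by (simp add: power2_eq_square algebra_simps)
    moreover have "0 < 1 - q" using q01 \<open>q \<noteq> 1\<close> by simp
    ultimately show ?thesis using q01(1) by (simp add: mult_le_0_iff)
  qed
  then have "AE w in M. \<not> W_limit w \<le> 0" unfolding q_def by (subst prob_Collect_eq_0[symmetric]) auto
  then show ?thesis by eventually_elim simp
qed

end

section \<open>Heights of leaves\<close>

context homogeneous_fragmentation
begin

lemma leaf_height_eq:
  assumes "w \<in> space M" "i \<in> {1..n}"
  shows "leaf_height X n i w = Inf {t. 0 \<le> t \<and> alone n i (X t w)}"
  unfolding leaf_height_def
  using singleton_in_restrict_iff_alone[OF partition_X[OF assms(1)] assms(2)] by (intro arg_cong[of _ _ Inf]) auto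

lemma alone_right_neighbourhood:
  assumes "w \<in> space M" "0 \<le> t" "i \<in> {1..n}"
  shows "\<exists>b>t. \<forall>u. t < u \<longrightarrow> u < b \<longrightarrow> alone n i (X u w) \<longleftrightarrow> alone n i (X t w)"
proof -
  have "\<forall>\<^sub>F u in at_right t. restr n u w = restr n t w"
    by (rule right_continuous[OF assms(1,2)])
  then obtain b where b: "b > t" "\<And>u. t < u \<Longrightarrow> u < b \<Longrightarrow> restr n u w = restr n t w"
    by (auto simp: eventually_at_right[of t "t + 1"])
  have "alone n i (X u w) \<longleftrightarrow> alone n i (X t w)" if "t < u" "u < b" for u
    using b(2)[OF that] singleton_in_restrict_iff_alone[OF partition_X[OF assms(1)] assms(3)] assms(2) that
    by (metis less_imp_le order_trans)
  with b(1) show ?thesis by blast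
qed

text \<open>By right-continuity it suffices to look at rational times. This holds at every sample point, also
  where a leaf is never isolated and its height is the infimum of the empty set.\<close>

lemma measurable_leaf_height:
  assumes i: "i \<in> {1..n}" shows "leaf_height X n i \<in> borel_measurable M"
proof (rule borel_measurableI_less)
  fix a :: real
  define S where "S = (\<lambda>w. {t. 0 \<le> t \<and> alone n i (X t w)})"
  define Q where "Q = (\<lambda>q. {w\<in>space M. alone n i (X q w)})"
  have rat: "\<exists>q\<in>\<rat>. 0 \<le> q \<and> q < b \<and> w \<in> Q q" if w: "w \<in> space M" and t: "t \<in> S w" "t < b" for w t b
  proof -
    have t': "0 \<le> t" "alone n i (X t w)" using t by (auto simp: S_def)
    obtain c where c: "t < c" "\<And>u. t < u \<Longrightarrow> u < c \<Longrightarrow> alone n i (X u w)"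
      using alone_right_neighbourhood[OF w t'(1) i] t'(2) by blast
    obtain q where "q \<in> \<rat>" "t < q" "q < min b c" using Rats_dense_in_real[of t "min b c"] c(1) t by auto
    with c(2) w t' show ?thesis unfolding Q_def by (intro bexI[of _ q]) auto
  qed
  define N where "N = (\<Union>q\<in>{q\<in>\<rat>. 0 \<le> q}. Q q)"
  have N: "S w = {} \<longleftrightarrow> w \<notin> N" if "w \<in> space M" for w
  proof
    assume "w \<notin> N"
    show "S w = {}"
    proof (rule ccontr)
      assume "S w \<noteq> {}"
      then obtain t where "t \<in> S w" by auto
      from rat[OF that this, of "t + 1"] \<open>w \<notin> N\<close> show False unfolding N_def by auto
    qed
  qed (auto simp: S_def N_def Q_def)
  have cQ: "countable {q\<in>\<rat>. (0::real) \<le> q \<and> q < a}" "countable {q\<in>\<rat>. (0::real) \<le> q}"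
    using countable_rat by (auto intro: countable_subset)
  have Qs: "Q q \<in> sets M" if "0 \<le> q" for q unfolding Q_def by (rule sets_alone[OF that])
  have bdd: "bdd_below (S w)" for w by (rule bdd_belowI[of _ 0]) (auto simp: S_def)
  have "{w\<in>space M. leaf_height X n i w < a} = (\<Union>q\<in>{q\<in>\<rat>. 0 \<le> q \<and> q < a}. Q q) \<union> (if Inf {} < a then space M - N else {})"
  proof (intro set_eqI)
    fix w
    show "w \<in> {w\<in>space M. leaf_height X n i w < a} \<longleftrightarrow> w \<in> (\<Union>q\<in>{q\<in>\<rat>. 0 \<le> q \<and> q < a}. Q q) \<union> (if Inf {} < a then space M - N else {})"
    proof (cases "w \<in> space M")
      case True
      have lh: "leaf_height X n i w = Inf (S w)" unfolding S_def by (rule leaf_height_eq[OF True i])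
      show ?thesis
      proof (cases "S w = {}")
        case True
        then have "w \<notin> N" using N[OF \<open>w \<in> space M\<close>] by simp
        then have "w \<notin> (\<Union>q\<in>{q\<in>\<rat>. 0 \<le> q \<and> q < a}. Q q)" unfolding N_def by auto
        with True lh \<open>w \<in> space M\<close> \<open>w \<notin> N\<close> show ?thesis by simp
      next
        case False
        then have "w \<in> N" using N[OF True] by simp
        have "Inf (S w) < a \<longleftrightarrow> (\<exists>t\<in>S w. t < a)" by (rule cInf_less_iff[OF False bdd])
        also have "\<dots> \<longleftrightarrow> w \<in> (\<Union>q\<in>{q\<in>\<rat>. 0 \<le> q \<and> q < a}. Q q)"
        proof
          assume "\<exists>t\<in>S w. t < a"
          then obtain t where "t \<in> S w" "t < a" by blast
          from rat[OF True this] show "w \<in> (\<Union>q\<in>{q\<in>\<rat>. 0 \<le> q \<and> q < a}. Q q)" by blast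
        next
          assume "w \<in> (\<Union>q\<in>{q\<in>\<rat>. 0 \<le> q \<and> q < a}. Q q)"
          then show "\<exists>t\<in>S w. t < a" unfolding S_def Q_def by blast
        qed
        finally show ?thesis using True lh \<open>w \<in> N\<close> by simp
      qed
    next
      case False
      then show ?thesis by (simp add: Q_def)
    qed
  qed
  moreover have "(\<Union>q\<in>{q\<in>\<rat>. 0 \<le> q \<and> q < a}. Q q) \<in> sets M"
    by (rule sets.countable_UN'[OF cQ(1)]) (use Qs in auto)
  moreover have "N \<in> sets M" unfolding N_def by (rule sets.countable_UN'[OF cQ(2)]) (use Qs in auto)
  ultimately show "{w\<in>space M. leaf_height X n i w < a} \<in> sets M" by simp
qed

lemma measurable_max_height:
  assumes "1 \<le> n" shows "max_height X n \<in> borel_measurable M"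
proof -
  have "(\<lambda>w. Max ((\<lambda>i. leaf_height X n i w) ` {1..n})) \<in> borel_measurable M"
    using assms measurable_leaf_height by (intro borel_measurable_Max) auto
  then show ?thesis unfolding max_height_def[abs_def] .
qed

end

context beta_fragmentation
begin

lemma AE_pairs_separate:
  "AE w in M. \<forall>i j. 1 \<le> i \<longrightarrow> 1 \<le> j \<longrightarrow> i \<noteq> j \<longrightarrow> (\<exists>k::nat. \<not> same_block (X (real k) w) i j)"
  unfolding AE_all_countable
proof (intro allI)
  fix i j :: nat
  show "AE w in M. 1 \<le> i \<longrightarrow> 1 \<le> j \<longrightarrow> i \<noteq> j \<longrightarrow> (\<exists>k::nat. \<not> same_block (X (real k) w) i j)"
  proof (cases "1 \<le> i \<and> 1 \<le> j \<and> i \<noteq> j")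
    case True
    define D where "D = {w\<in>space M. \<forall>k::nat. same_block (X (real k) w) i j}"
    have s: "{w\<in>space M. same_block (X (real k) w) i j} \<in> sets M" for k :: nat by (rule sets_same_block_X) simp
    note [measurable] = s
    have D: "D \<in> sets M" unfolding D_def by measurable
    have "prob D \<le> exp (- r * real k)" for k :: nat
    proof -
      have "prob D \<le> prob {w\<in>space M. same_block (X (real k) w) i j}"
        unfolding D_def by (rule finite_measure_mono[OF _ s]) auto
      also have "\<dots> = exp (- r * real k)" by (rule prob_same_block) (use True in auto)
      finally show ?thesis .
    qed
    moreover have "(\<lambda>k. exp (- r * real k)) \<longlonglongrightarrow> 0" using r_pos by real_asymp
    ultimately have "prob D \<le> 0" by (intro LIMSEQ_le_const[of _ 0 "prob D"]) auto
    then have "prob D = 0" using measure_nonneg[of M D] by simp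
    then have "AE w in M. \<not> (\<forall>k::nat. same_block (X (real k) w) i j)"
      unfolding D_def by (subst prob_Collect_eq_0[symmetric]) (use D in \<open>auto simp: D_def\<close>)
    then show ?thesis by eventually_elim auto
  qed auto
qed

text \<open>Isolation of a leaf persists, and by right-continuity the infimum of the times of isolation is
  attained.\<close>

lemma AE_max_height_le_iff:
  assumes n: "1 \<le> n" and t: "0 \<le> t"
  shows "AE w in M. max_height X n w \<le> t \<longleftrightarrow> separated {1..n} (X t w)"
  using AE_monotone AE_pairs_separate AE_space
proof eventually_elim
  case (elim w)
  have up: "alone n i (X v w)" if "alone n i (X u w)" "0 \<le> u" "u \<le> v" for i u v
    using that elim(1) unfolding alone_def by blast
  have leaf: "leaf_height X n i w \<le> t \<longleftrightarrow> alone n i (X t w)" if i: "i \<in> {1..n}" for i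
  proof -
    define S where "S = {t. 0 \<le> t \<and> alone n i (X t w)}"
    have lh: "leaf_height X n i w = Inf S" unfolding S_def by (rule leaf_height_eq[OF elim(3) i])
    have bdd: "bdd_below S" by (rule bdd_belowI[of _ 0]) (auto simp: S_def)
    have "\<forall>j\<in>{1..n}. \<exists>k::nat. j \<noteq> i \<longrightarrow> \<not> same_block (X (real k) w) i j"
      using elim(2) i by auto
    from bchoice[OF this] obtain f :: "nat \<Rightarrow> nat" where f: "\<And>j. j \<in> {1..n} \<Longrightarrow> j \<noteq> i \<Longrightarrow> \<not> same_block (X (real (f j)) w) i j" by blast
    define K where "K = (\<Sum>j\<in>{1..n}. f j)"
    have "alone n i (X (real K) w)"
      unfolding alone_def
    proof (intro ballI impI)
      fix j assume j: "j \<in> {1..n}" "j \<noteq> i"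
      have "f j \<le> K" unfolding K_def using j by (intro member_le_sum) auto
      then have "real (f j) \<le> real K" "0 \<le> real (f j)" by simp_all
      then have "same_block (X (real K) w) i j \<longrightarrow> same_block (X (real (f j)) w) i j" using elim(1) by blast
      with f[OF j] show "\<not> same_block (X (real K) w) i j" by blast
    qed
    then have "real K \<in> S" by (simp add: S_def)
    then have ne: "S \<noteq> {}" by auto
    show ?thesis
    proof
      assume "alone n i (X t w)"
      then have "t \<in> S" using t by (simp add: S_def)
      then show "leaf_height X n i w \<le> t" unfolding lh by (rule cInf_lower[OF _ bdd])
    next
      assume le: "leaf_height X n i w \<le> t"
      obtain b where b: "b > t" "\<And>u. t < u \<Longrightarrow> u < b \<Longrightarrow> alone n i (X u w) \<longleftrightarrow> alone n i (X t w)"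
        using alone_right_neighbourhood[OF elim(3) t i] by blast
      have "Inf S < b" using le b(1) lh by simp
      then obtain u where u: "u \<in> S" "u < b" using cInf_less_iff[OF ne bdd] by blast
      show "alone n i (X t w)"
      proof (cases "u \<le> t")
        case True
        then show ?thesis using up[of i u t] u(1) by (simp add: S_def)
      next
        case False
        then show ?thesis using b(2)[of u] u by (simp add: S_def)
      qed
    qed
  qed
  have "max_height X n w \<le> t \<longleftrightarrow> (\<forall>i\<in>{1..n}. leaf_height X n i w \<le> t)"
    unfolding max_height_def using n by (subst Max_le_iff) auto
  then show ?case using leaf unfolding separated_iff_alone by auto
qed

lemma prob_max_height:
  assumes n: "1 \<le> n" and t: "0 \<le> sample_time x n"
  shows "prob {w\<in>space M. r * max_height X n w - 2 * ln (real n) \<le> x} = separation_prob n (sample_time x n)"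
proof -
  have "r * max_height X n w - 2 * ln (real n) \<le> x \<longleftrightarrow> max_height X n w \<le> sample_time x n" for w
    unfolding sample_time_def using r_pos by (auto simp: field_simps)
  then have "{w\<in>space M. r * max_height X n w - 2 * ln (real n) \<le> x} = {w\<in>space M. max_height X n w \<le> sample_time x n}" by simp
  moreover have "prob {w\<in>space M. max_height X n w \<le> sample_time x n} = separation_prob n (sample_time x n)"
    unfolding separation_prob_def
  proof (rule finite_measure_eq_AE)
    show "AE w in M. w \<in> {w\<in>space M. max_height X n w \<le> sample_time x n} \<longleftrightarrow> w \<in> {w\<in>space M. separated {1..n} (X (sample_time x n) w)}"
      using AE_max_height_le_iff[OF n t] by eventually_elim auto
    show "{w\<in>space M. max_height X n w \<le> sample_time x n} \<in> sets M"
      using measurable_max_height[OF n] by measurable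
  qed (rule sets_separated[OF _ t], simp)
  ultimately show ?thesis by simp
qed

lemma max_height_limit_law:
  "(\<lambda>n. prob {w\<in>space M. r * max_height X n w - 2 * ln (real n) \<le> x}) \<longlonglongrightarrow> Laplace_W (exp (- x) / 2)"
proof (rule Lim_transform_eventually[OF separation_prob_limit])
  have "eventually (\<lambda>n. 0 \<le> sample_time x n) sequentially" using sample_time_at_top[of x] by (simp add: filterlim_at_top)
  then show "eventually (\<lambda>n. separation_prob n (sample_time x n) = prob {w\<in>space M. r * max_height X n w - 2 * ln (real n) \<le> x}) sequentially"
    using eventually_ge_at_top[of 1] by eventually_elim (simp add: prob_max_height)
qed

text \<open>As \<open>W_limit\<close> is finite and positive, the limit law has no mass at infinity, so the height centred
  by \<open>2 * ln n / r\<close> is tight.\<close>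

lemma max_height_in_probability:
  assumes \<epsilon>: "0 < \<epsilon>"
  shows "(\<lambda>n. prob {w\<in>space M. \<bar>max_height X n w / ln (real n) - 2 / r\<bar> > \<epsilon>}) \<longlonglongrightarrow> 0"
proof -
  define H where "H = (\<lambda>x. Laplace_W (exp (- x) / 2))"
  define F where "F = (\<lambda>n x. prob {w\<in>space M. r * max_height X n w - 2 * ln (real n) \<le> x})"
  have F: "(\<lambda>n. F n x) \<longlonglongrightarrow> H x" for x unfolding F_def H_def by (rule max_height_limit_law)
  have "(\<lambda>k. H (real k)) \<longlonglongrightarrow> Laplace_W 0"
    unfolding H_def by (rule Laplace_W_continuous) (real_asymp, simp)
  then have H1: "(\<lambda>k. H (real k)) \<longlonglongrightarrow> 1" by (simp add: Laplace_W_def prob_space)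
  have "prob {w\<in>space M. W_limit w \<le> 0} = 0"
    by (subst prob_Collect_eq_0) (use AE_W_limit_pos in auto)
  then have H0: "(\<lambda>k. H (- real k)) \<longlonglongrightarrow> 0" using Laplace_W_at_infinity[of 0] by (simp add: H_def)
  show ?thesis
  proof (rule LIMSEQ_I)
    fix e :: real assume e: "0 < e"
    have "(\<lambda>k. 1 - H (real k) + H (- real k)) \<longlonglongrightarrow> 1 - 1 + 0" by (intro tendsto_intros H1 H0)
    then have "eventually (\<lambda>k. 1 - H (real k) + H (- real k) < e) sequentially" by (rule order_tendstoD) (use e in simp)
    from eventually_happens[OF this] obtain k where k: "1 - H (real k) + H (- real k) < e" by auto
    have "(\<lambda>n. 1 - F n (real k) + F n (- real k)) \<longlonglongrightarrow> 1 - H (real k) + H (- real k)" by (intro tendsto_intros F)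
    then have 1: "eventually (\<lambda>n. 1 - F n (real k) + F n (- real k) < e) sequentially" by (rule order_tendstoD) (use k in simp)
    have 2: "eventually (\<lambda>n. real k / (r * \<epsilon>) \<le> ln (real n)) sequentially" by real_asymp
    have "eventually (\<lambda>n. norm (prob {w\<in>space M. \<bar>max_height X n w / ln (real n) - 2 / r\<bar> > \<epsilon>} - 0) < e) sequentially"
      using 1 2 eventually_ge_at_top[of 2]
    proof eventually_elim
      case (elim n)
      have [measurable]: "max_height X n \<in> borel_measurable M" by (rule measurable_max_height) (use elim in simp)
      have ln: "0 < ln (real n)" using elim by simp
      have k_le: "real k \<le> r * \<epsilon> * ln (real n)" using elim(2) r_pos \<epsilon> by (simp add: field_simps)
      define A where "A = {w\<in>space M. r * max_height X n w - 2 * ln (real n) \<le> real k}"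
      define B where "B = {w\<in>space M. r * max_height X n w - 2 * ln (real n) \<le> - real k}"
      have [measurable]: "A \<in> sets M" "B \<in> sets M" unfolding A_def B_def by measurable
      have "{w\<in>space M. \<bar>max_height X n w / ln (real n) - 2 / r\<bar> > \<epsilon>} \<subseteq> (space M - A) \<union> B"
      proof
        fix w assume w: "w \<in> {w\<in>space M. \<bar>max_height X n w / ln (real n) - 2 / r\<bar> > \<epsilon>}"
        define y where "y = r * max_height X n w - 2 * ln (real n)"
        have "max_height X n w / ln (real n) - 2 / r = y / (r * ln (real n))"
          unfolding y_def using r_pos ln by (simp add: field_simps)
        then have "\<epsilon> < \<bar>y\<bar> / (r * ln (real n))" using w r_pos ln by (simp add: abs_mult)
        then have "r * \<epsilon> * ln (real n) < \<bar>y\<bar>" using r_pos ln by (simp add: field_simps)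
        then have "real k < \<bar>y\<bar>" using k_le by linarith
        then have "\<not> y \<le> real k \<or> y \<le> - real k" by linarith
        then show "w \<in> (space M - A) \<union> B" using w unfolding A_def B_def y_def by auto
      qed
      then have "prob {w\<in>space M. \<bar>max_height X n w / ln (real n) - 2 / r\<bar> > \<epsilon>} \<le> prob ((space M - A) \<union> B)"
        by (rule finite_measure_mono) measurable
      also have "\<dots> \<le> prob (space M - A) + prob B" by (rule measure_Un_le) measurable
      also have "prob (space M - A) = 1 - prob A" by (rule prob_compl) measurable
      finally have "prob {w\<in>space M. \<bar>max_height X n w / ln (real n) - 2 / r\<bar> > \<epsilon>} \<le> 1 - F n (real k) + F n (- real k)"
        by (simp add: F_def A_def B_def)
      then show ?case using elim(1) by simp
    qed
    then show "\<exists>no. \<forall>n\<ge>no. norm (prob {w\<in>space M. \<bar>max_height X n w / ln (real n) - 2 / r\<bar> > \<epsilon>} - 0) < e"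
      by (simp add: eventually_sequentially)
  qed
qed

end

theorem theorem2p12:
  fixes \<beta> :: real and M :: "'a measure" and X :: "real \<Rightarrow> 'a \<Rightarrow> nat set set"
  assumes "\<beta> > -2"
    and "binary_fragmentation M X (beta_dislocation \<beta>)"
  shows "\<exists>W_inf \<in> borel_measurable M.
    (AE \<omega> in M. ((\<lambda>t. W_beta \<beta> X t \<omega>) \<longlongrightarrow> W_inf \<omega>) at_top) \<and>
    (\<forall>t\<ge>0. integrable M (W_beta \<beta> X t)) \<and> integrable M W_inf \<and>
    ((\<lambda>t. \<integral>\<omega>. \<bar>W_beta \<beta> X t \<omega> - W_inf \<omega>\<bar> \<partial>M) \<longlongrightarrow> 0) at_top \<and>
    (AE \<omega> in M. W_inf \<omega> > 0) \<and>
    (\<integral>\<omega>. W_inf \<omega> \<partial>M) = 1 \<and>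
    (\<forall>n\<ge>1. max_height X n \<in> borel_measurable M) \<and>
    (\<forall>\<epsilon>>0. (\<lambda>n. measure M {\<omega> \<in> space M. \<bar>max_height X n \<omega> / ln (real n) - 2 / r_beta \<beta>\<bar> > \<epsilon>})
        \<longlonglongrightarrow> 0) \<and>
    (\<forall>x::real. (\<lambda>n. measure M {\<omega> \<in> space M. r_beta \<beta> * max_height X n \<omega> - 2 * ln (real n) \<le> x})
        \<longlonglongrightarrow> (\<integral>\<omega>. exp (- (1/2) * exp (- x) * W_inf \<omega>) \<partial>M))"
proof -
  interpret binary_fragmentation M X "beta_dislocation \<beta>" by (rule assms(2))
  interpret beta_fragmentation M X \<beta> by unfold_locales (rule assms(1))
  have "Laplace_W (exp (- x) / 2) = (\<integral>\<omega>. exp (- (1/2) * exp (- x) * W_limit \<omega>) \<partial>M)" for x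
    unfolding Laplace_W_def by simp
  then show ?thesis
    using AE_W_beta_converges integrable_W_beta integrable_W_limit W_beta_L1 AE_W_limit_pos expectation_W_limit
      measurable_max_height max_height_in_probability max_height_limit_law
    by (intro bexI[OF _ measurable_W_limit] conjI) simp_all
qed

end
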